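(* Assume that $0\le a<b<\infty$. The process $(\widetilde{\mathbf T}_{\mathrm{cross}}(n))_{n\ge1}$ satisfies the large deviation principle at speed $n^d$ with the good rate function $$I_{\mathrm{cross}}:[a,b]^d\to[0,\infty],\qquad \zeta=(\zeta_1,\dots,\zeta_d)\mapsto I^+_{[0,1]^d}(g^\zeta),$$ where $g^\zeta$ is the seminorm $g^\zeta(u)=\max_{1\le i\le d}(\zeta_i|u_i|)$ on $\mathbb R^d$. Moreover: (i) $I_{\mathrm{cross}}$ is continuous on $[a,b]^d$. (ii) $I_{\mathrm{cross}}$ is nondecreasing on $[a,b]^d$ for the componentwise order, i.e. for all $\zeta,\zeta'\in[a,b]^d$, if $\zeta_i\le\zeta'_i$ for all $i$, then $I_{\mathrm{cross}}(\zeta)\le I_{\mathrm{cross}}(\zeta')$. (iii) $I_{\mathrm{cross}}$ is separately convex on $[a,b]^d$, i.e. for all $1\le i\le d$ and $\zeta_1,\dots,\zeta_{i-1},\zeta_{i+1},\dots,\zeta_d\in[a,b]$, the function $t\mapsto I_{\mathrm{cross}}(\zeta_1,\dots,\zeta_{i-1},t,\zeta_{i+1},\dots,\zeta_d)$ is convex on $[a,b]$. (iv) $I_{\mathrm{cross}}(b,\dots,b)<\infty$ if and only if $\nu(\{b\})>0$. In particular, for all $\zeta\in[a,b)^d$, $$\lim_{n\to\infty}-\frac1{n^d}\log\mathbb P\left(\bigcap_{i=1}^d\left\{\widetilde{\mathbf T}_{n,[0,1]^d}(H_i,H_i')\ge\zeta_i\right\}\right)=I_{\mathrm{cross}}(\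zeta).$$
   Context: Let $d\ge2$ be an integer and $\mathbb E^d$ the set of non-oriented nearest-neighbour edges of $\mathbb Z^d$. Let $\nu$ be a probability distribution on $[0,\infty)$, and let $a$ and $b$ be the infimum and supremum of its support. Let $(\tau_e)_{e\in\mathbb E^d}$ be i.i.d. random variables with distribution $\nu$. Write $\|x\|=\sum_{i=1}^d|x_i|$ on $\mathbb R^d$. For $z,z'\in\mathbb R^d$, let $\tau(z,z')=\tau_{(v,v')}\|z-z'\|$ if there exist adjacent vertices $v,v'\in\mathbb Z^d$ such that $z,z'$ belong to the segment $[v,v']$, and $\tau(z,z')=b\|z-z'\|$ otherwise. For a finite sequence $\pi=(x_0,\dots,x_r)$ of points of $\mathbb R^d$, let $\tau(\pi)=\sum_{i=0}^{r-1}\tau(x_i,x_{i+1})$. For a compact convex set $X\subset\mathbb R^d$ with nonempty interior and $x,y\in X$, $\mathbf T_X(x,y)$ is the infimum of $\tau(\pi)$ over all finite sequences $\pi$ of points of $X$ with endpoints $x$ and $y$, and $\widetilde{\mathbf T}_{n,X}(x,y)=\frac1n\mathbf T_{nX}(nx,ny)$. For subsets $A,B\subseteq X$, $\widetilde{\mathbf T}_{n,X}(A,B)=\inf_{x\in A,y\in B}\widetilde{\mathbf T}_{n,X}(x,y)$. Let $H_i=\{x\in[0,1]^d: x_i=0\}$, $H_i'=\{x\in[0,1]^d:x_i=1\}$, and $$\widetilde{\mathbf T}_{\mathrm{cross}}(n)=\left(\widetilde{\mathbf T}_{n,[0,1]^d}(H_1,H_1'),\dots,\widetilde{\mathbf T}_{n,[0,1]^d}(H_d,H_d')\right).$$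 For a seminorm $g$ on $\mathbb R^d$ with $g\le b\|\cdot\|$ and $\varepsilon>0$, let $\mathrm{LD}^+_{n,[0,1]^d}(g,\varepsilon)=\{\forall x,y\in[0,1]^d,\ \widetilde{\mathbf T}_{n,[0,1]^d}(x,y)\ge g(x-y)-\varepsilon\}$ and $$I^+_{[0,1]^d}(g)=\lim_{\varepsilon\to0}\limsup_{n\to\infty}-\frac1{n^d}\log\mathbb P\left(\mathrm{LD}^+_{n,[0,1]^d}(g,\varepsilon)\right)=\lim_{\varepsilon\to0}\liminf_{n\to\infty}-\frac1{n^d}\log\mathbb P\left(\mathrm{LD}^+_{n,[0,1]^d}(g,\varepsilon)\right)$$ (the limits in $\varepsilon$ are monotone and the limsup and liminf versions give the same value). When $0<a<b<\infty$ and $g$ is a norm with $a\|\cdot\|\le g\le b\|\cdot\|$, $I^+_{[0,1]^d}(g)$ coincides with the value at (the metric induced by) $g$ of the rate function of the large deviation principle at speed $n^d$ satisfied by the random metrics $(\widetilde{\mathbf T}_{n,[0,1]^d})_{n\ge 1}$ for the uniform distance. A good rate function on a Hausdorff space $\mathcal X$ is a map $I:\mathcal X\to[0,\infty]$ with compact sublevel sets. A process $(X_n)$ with values in $\mathcal X$ satisfies the large deviation principle at speed $n^d$ with rate function $I$ if for every Borel set $A\subseteq\mathcal X$, $\inf_{\overline A}I\le\liminf_n-\frac1{n^d}\log\mathbb P(X_n\in A)\le\limsup_n-\frac1{n^d}\log\mathbb P(X_n\in A)\le\inf_{\mathring A}I$. Continuity of $[0,\infty]$-valued functions is for the usual topology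 of $[0,\infty]$. *)

theory Defs
  imports "HOL-Probability.Probability"
begin

text \<open>The dimension \<open>d\<close> is \<open>CARD('d)\<close>; points of space have type \<open>real ^ 'd\<close> and vertices of
  the lattice have type \<open>int ^ 'd\<close>.\<close>

definition l1_norm :: "real ^ 'd \<Rightarrow> real" where
  "l1_norm x = (\<Sum>i\<in>UNIV. \<bar>x $ i\<bar>)"

definition lattice_point :: "int ^ 'd \<Rightarrow> real ^ 'd" where
  "lattice_point v = (\<chi> i. real_of_int (v $ i))"

definition adjacent :: "int ^ 'd \<Rightarrow> int ^ 'd \<Rightarrow> bool" where
  "adjacent v w \<longleftrightarrow> l1_norm (lattice_point v - lattice_point w) = 1"

definition lattice_edges :: "(int ^ 'd) set set" where
  "lattice_edges = {{v, w} | v w. adjacent v w}"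

text \<open>For an edge \<open>e = {v, w}\<close> this is the segment \<open>[v, w]\<close>.\<close>

definition edge_segment :: "(int ^ 'd) set \<Rightarrow> (real ^ 'd) set" where
  "edge_segment e = convex hull (lattice_point ` e)"

definition measure_support :: "real measure \<Rightarrow> real set" where
  "measure_support \<nu> = {x. \<forall>U. open U \<longrightarrow> x \<in> U \<longrightarrow> emeasure \<nu> U > 0}"

text \<open>In the passage-time definitions, \<open>t\<close> is a deterministic configuration of edge weights.
  In \<open>point_time\<close>, the edge is unique when \<open>z \<noteq> z'\<close>; for \<open>z = z'\<close> the value is \<open>0\<close>
  whatever edge is chosen.\<close>

definition point_time ::
    "real \<Rightarrow> ((int ^ 'd) set \<Rightarrow> real) \<Rightarrow> real ^ 'd \<Rightarrow> real ^ 'd \<Rightarrow> real" where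
  "point_time b t z z' =
     (if \<exists>e\<in>lattice_edges. z \<in> edge_segment e \<and> z' \<in> edge_segment e
      then t (SOME e. e \<in> lattice_edges \<and> z \<in> edge_segment e \<and> z' \<in> edge_segment e)
             * l1_norm (z - z')
      else b * l1_norm (z - z'))"

definition path_time ::
    "real \<Rightarrow> ((int ^ 'd) set \<Rightarrow> real) \<Rightarrow> (real ^ 'd) list \<Rightarrow> real" where
  "path_time b t p = (\<Sum>i<length p - 1. point_time b t (p ! i) (p ! Suc i))"

definition passage_time ::
    "real \<Rightarrow> ((int ^ 'd) set \<Rightarrow> real) \<Rightarrow> (real ^ 'd) set \<Rightarrow> real ^ 'd \<Rightarrow> real ^ 'd \<Rightarrow> real" where
  "passage_time b t X x y =
     Inf {path_time b t p | p. p \<noteq> [] \<and> set p \<subseteq> X \<and> hd p = x \<and> last p = y}"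

definition rescaled_time ::
    "real \<Rightarrow> ((int ^ 'd) set \<Rightarrow> real) \<Rightarrow> nat \<Rightarrow> (real ^ 'd) set \<Rightarrow> real ^ 'd \<Rightarrow> real ^ 'd \<Rightarrow> real"
  where
  "rescaled_time b t n X x y =
     passage_time b t ((\<lambda>z. real n *\<^sub>R z) ` X) (real n *\<^sub>R x) (real n *\<^sub>R y) / real n"

definition rescaled_set_time ::
    "real \<Rightarrow> ((int ^ 'd) set \<Rightarrow> real) \<Rightarrow> nat \<Rightarrow> (real ^ 'd) set \<Rightarrow> (real ^ 'd) set \<Rightarrow>
       (real ^ 'd) set \<Rightarrow> real" where
  "rescaled_set_time b t n X A B = Inf {rescaled_time b t n X x y | x y. x \<in> A \<and> y \<in> B}"

definition unit_cube :: "(real ^ 'd) set" where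
  "unit_cube = {x. \<forall>i. 0 \<le> x $ i \<and> x $ i \<le> 1}"

definition face0 :: "'d \<Rightarrow> (real ^ 'd) set" where
  "face0 i = {x \<in> unit_cube. x $ i = 0}"

definition face1 :: "'d \<Rightarrow> (real ^ 'd) set" where
  "face1 i = {x \<in> unit_cube. x $ i = 1}"

definition T_cross :: "real \<Rightarrow> ((int ^ 'd) set \<Rightarrow> real) \<Rightarrow> nat \<Rightarrow> real ^ 'd" where
  "T_cross b t n = (\<chi> i. rescaled_set_time b t n unit_cube (face0 i) (face1 i))"

text \<open>\<open>- (1 / s) log P(E)\<close> as an element of \<open>[0, \<infinity>]\<close>, with \<open>- log 0 = \<infinity>\<close>.\<close>

definition decay_rate :: "'w measure \<Rightarrow> real \<Rightarrow> 'w set \<Rightarrow> ennreal" where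
  "decay_rate M s E =
     (if measure M E = 0 then \<infinity> else ennreal (- (1 / s) * ln (measure M E)))"

text \<open>The probability space \<open>M\<close> carries the random edge weights \<open>\<tau> e\<close>.\<close>

definition LD_plus ::
    "'w measure \<Rightarrow> real \<Rightarrow> ((int ^ 'd) set \<Rightarrow> 'w \<Rightarrow> real) \<Rightarrow> nat \<Rightarrow> (real ^ 'd \<Rightarrow> real) \<Rightarrow> real \<Rightarrow> 'w set"
  where
  "LD_plus M b \<tau> n g \<epsilon> =
     {\<omega> \<in> space M. \<forall>x\<in>unit_cube. \<forall>y\<in>unit_cube.
        rescaled_time b (\<lambda>e. \<tau> e \<omega>) n unit_cube x y \<ge> g (x - y) - \<epsilon>}"

text \<open>The function of \<open>\<epsilon>\<close> is monotone, so the limit exists in \<open>[0, \<infinity>]\<close>. The paper shows that replacing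
  \<open>limsup\<close> by \<open>liminf\<close> gives the same value.\<close>

definition I_plus ::
    "'w measure \<Rightarrow> real \<Rightarrow> ((int ^ 'd) set \<Rightarrow> 'w \<Rightarrow> real) \<Rightarrow> (real ^ 'd \<Rightarrow> real) \<Rightarrow> ennreal" where
  "I_plus M b \<tau> g =
     Lim (at_right 0)
       (\<lambda>\<epsilon>. limsup (\<lambda>n. decay_rate M (real n ^ CARD('d)) (LD_plus M b \<tau> n g \<epsilon>)))"

definition g_cross :: "real ^ 'd \<Rightarrow> real ^ 'd \<Rightarrow> real" where
  "g_cross \<zeta> u = (MAX i. \<zeta> $ i * \<bar>u $ i\<bar>)"

definition I_cross ::
    "'w measure \<Rightarrow> real \<Rightarrow> ((int ^ 'd) set \<Rightarrow> 'w \<Rightarrow> real) \<Rightarrow> real ^ 'd \<Rightarrow> ennreal" where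
  "I_cross M b \<tau> \<zeta> = I_plus M b \<tau> (g_cross \<zeta>)"

definition good_rate_function :: "'x topology \<Rightarrow> ('x \<Rightarrow> ennreal) \<Rightarrow> bool" where
  "good_rate_function S I \<longleftrightarrow>
     (\<forall>r::real. r \<ge> 0 \<longrightarrow> compactin S {x \<in> topspace S. I x \<le> ennreal r})"

definition borel_sets_of :: "'x topology \<Rightarrow> 'x set set" where
  "borel_sets_of S = sigma_sets (topspace S) {U. openin S U}"

text \<open>Random variables are only required to lie in the state space almost surely. Interiors and
  closures are relative to the state space.\<close>

definition satisfies_LDP ::
    "'w measure \<Rightarrow> 'x topology \<Rightarrow> (nat \<Rightarrow> real) \<Rightarrow> (nat \<Rightarrow> 'w \<Rightarrow> 'x) \<Rightarrow> ('x \<Rightarrow> ennreal) \<Rightarrow> bool"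
  where
  "satisfies_LDP M S s X I \<longleftrightarrow>
     (\<forall>n\<ge>1. (AE \<omega> in M. X n \<omega> \<in> topspace S) \<and>
        (\<forall>A\<in>borel_sets_of S. {\<omega> \<in> space M. X n \<omega> \<in> A} \<in> sets M)) \<and>
     (\<forall>A\<in>borel_sets_of S.
        (INF x\<in>S closure_of A. I x)
          \<le> liminf (\<lambda>n. decay_rate M (s n) {\<omega> \<in> space M. X n \<omega> \<in> A}) \<and>
        limsup (\<lambda>n. decay_rate M (s n) {\<omega> \<in> space M. X n \<omega> \<in> A})
          \<le> (INF x\<in>S interior_of A. I x))"

text \<open>Convexity of a \<open>[0, \<infinity>]\<close>-valued function; \<open>convex_on\<close> only covers real-valued functions.\<close>

definition ennreal_convex_on :: "real set \<Rightarrow> (real \<Rightarrow> ennreal) \<Rightarrow> bool" where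
  "ennreal_convex_on S f \<longleftrightarrow>
     convex S \<and>
     (\<forall>x\<in>S. \<forall>y\<in>S. \<forall>u\<ge>0. \<forall>v\<ge>0. u + v = 1 \<longrightarrow>
        f (u * x + v * y) \<le> ennreal u * f x + ennreal v * f y)"

text \<open>The box \<open>[a, b]\<^sup>d\<close>.\<close>

definition box_ab :: "real \<Rightarrow> real \<Rightarrow> (real ^ 'd) set" where
  "box_ab a b = {\<zeta>. \<forall>i. a \<le> \<zeta> $ i \<and> \<zeta> $ i \<le> b}"

end

theory Submission
  imports Defs
begin

text \<open>
  A passage time is at least \<open>c\<close> exactly when some potential, that is, a function that is Lipschitz with
  respect to the edge weights, increases by \<open>c\<close>. Potentials on separated tiles can be glued as soon as the
  few edges between the tiles have weights close to \<open>b\<close>.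

  Among the configurations of a box of side \<open>m\<close> with crossing speeds at least \<open>\<zeta>\<close>, the potentials that certify
  this take boundedly many shapes up to a small error. Tiling a large box with independent reflected
  copies of a most likely shape produces potentials close to \<open>\<zeta>\<^sub>i x\<^sub>i\<close>, so that the lower bound on the
  crossing speeds and the lower bound on the whole metric by \<open>g\<^sup>\<zeta>\<close> have the same rate. Two layers of tiles
  give separate convexity. Continuity follows from it, from the trivial lower semicontinuity, and from a
  Chernoff bound showing that speed \<open>b\<close> has infinite rate when \<open>\<nu>\<close> has no atom at \<open>b\<close>.

  For the lower bound of the large deviation principle the crossing speeds have to be lowered to prescribed
  values. The \<open>i\<close>-th coordinate axis lies in the starting face of every other direction, so replacing the
  weights on it one by one by small ones only affects the \<open>i\<close>-th crossing time, which moves by at most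
  \<open>b / n\<close> in each step. This costs a factor exponential in \<open>n\<close>, which is negligible at speed \<open>n\<^sup>d\<close> as \<open>d \<ge> 2\<close>.
\<close>

section \<open>Lattice edges and potentials\<close>

text \<open>The order of the choices shapes the estimates. First comes \<open>\<sigma>\<close>:
  multiplying the potentials of the tiles by 1 - \<open>\<sigma>\<close> leaves them some Lipschitz
  slack, so that corridor weights of at least (1 - \<open>\<sigma>\<close> / 2) b suffice, and these
  have positive probability even if b is not an atom. That probability, written exp (-L), fixes the
  admissible share \<open>\<kappa>\<close> of corridor edges, hence the relative corridor width
  \<open>\<eta>\<close>, hence the relative error \<open>\<delta>\<close> that such a corridor
  absorbs, hence the number C of shapes, and only then the side m. Since C does not depend on m, its
  logarithm is negligible against m^d. A single good scale m yields all large scales. Good scales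
  that occur infinitely often are thus as useful as an eventual bound, which reconciles limsup and
  liminf. The weights lie in [a, b] only almost surely. On the exceptional set passage times may be
  infima of sets unbounded below, and measurability has to be shown there too, so configurations
  with a negative weight in the box are treated separately.\<close>

lemma l1_norm_zero [simp]: "l1_norm 0 = 0"
  by (simp add: l1_norm_def)

lemma l1_norm_nonneg [simp]: "0 \<le> l1_norm x"
  by (simp add: l1_norm_def sum_nonneg)

lemma l1_norm_minus_commute: "l1_norm (x - y) = l1_norm (y - x)"
  by (simp add: l1_norm_def abs_minus_commute)

lemma l1_norm_triangle: "l1_norm (x - z) \<le> l1_norm (x - y) + l1_norm (y - z)"
  unfolding l1_norm_def sum.distrib[symmetric] by (rule sum_mono) auto

lemma component_le_l1_norm: "\<bar>x $ i - y $ i\<bar> \<le> l1_norm (x - y)" for x y :: "real ^ 'd::finite"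
  unfolding l1_norm_def using member_le_sum[of i UNIV "\<lambda>i. \<bar>(x - y) $ i\<bar>"] by simp

lemma l1_norm_scaleR: "l1_norm (c *\<^sub>R x - c *\<^sub>R y) = \<bar>c\<bar> * l1_norm (x - y)"
  by (simp add: l1_norm_def sum_distrib_left abs_mult flip: right_diff_distrib)

lemma l1_norm_single_coordinate:
  fixes x y :: "real ^ 'd::finite"
  assumes "\<And>j. j \<noteq> i \<Longrightarrow> x $ j = y $ j"
  shows "l1_norm (x - y) = \<bar>x $ i - y $ i\<bar>"
proof -
  have "l1_norm (x - y) = (\<Sum>j\<in>UNIV. if j = i then \<bar>x $ i - y $ i\<bar> else 0)"
    unfolding l1_norm_def using assms by (intro sum.cong) auto
  then show ?thesis by simp
qed

lemma l1_norm_le_norm: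
  fixes x :: "real ^ 'd::finite"
  shows "l1_norm x \<le> real CARD('d) * norm x"
proof -
  have "l1_norm x \<le> (\<Sum>i\<in>(UNIV::'d set). norm x)"
    unfolding l1_norm_def by (intro sum_mono) (simp add: component_le_norm_cart)
  then show ?thesis by simp
qed

section \<open>Integer boxes and the edges inside them\<close>

definition qbox :: "int ^ 'd \<Rightarrow> nat \<Rightarrow> (real ^ 'd) set" where
  "qbox c m = {x. \<forall>i. of_int (c $ i) \<le> x $ i \<and> x $ i \<le> of_int (c $ i) + real m}"

definition edges_in :: "(real ^ 'd) set \<Rightarrow> (int ^ 'd) set set" where
  "edges_in X = {e \<in> lattice_edges. lattice_point ` e \<subseteq> X}"

definition unit_edge :: "int ^ 'd \<Rightarrow> 'd \<Rightarrow> (int ^ 'd) set" where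
  "unit_edge v i = {v, v + axis i 1}"

lemma lattice_point_nth [simp]: "lattice_point v $ i = of_int (v $ i)"
  by (simp add: lattice_point_def)

lemma unit_edge_in_lattice_edges [simp]: "unit_edge v i \<in> lattice_edges"
  for v :: "int ^ 'd::finite"
proof -
  have "adjacent v (v + axis i 1)"
    unfolding adjacent_def
    by (subst l1_norm_single_coordinate[where i = i]) (auto simp: axis_def)
  then show ?thesis by (auto simp: lattice_edges_def unit_edge_def)
qed

text \<open>The l1 distance of two vertices is a sum of natural numbers, and a sum equal to 1 has a
  single nonzero term. An unordered edge thus gets a lower endpoint and a direction, the form in
  which segments can be computed.\<close>

lemma lattice_edge_cases:
  fixes e :: "(int ^ 'd::finite) set"
  assumes "e \<in> lattice_edges"
  obtains v i where "e = unit_edge v i"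
proof -
  obtain v w where e: "e = {v, w}" and vw: "adjacent v w"
    using assms by (auto simp: lattice_edges_def)
  have "real (\<Sum>i\<in>UNIV. nat \<bar>v $ i - w $ i\<bar>) = 1"
    using vw by (simp add: adjacent_def l1_norm_def flip: of_int_diff of_int_abs)
  then have "(\<Sum>i\<in>UNIV. nat \<bar>v $ i - w $ i\<bar>) = 1" by linarith
  then obtain i where i: "nat \<bar>v $ i - w $ i\<bar> = Suc 0"
    and j: "\<And>j. j \<noteq> i \<Longrightarrow> nat \<bar>v $ j - w $ j\<bar> = 0"
    by (auto simp: sum_eq_Suc0_iff)
  have j': "v $ j = w $ j" if "j \<noteq> i" for j using j[OF that] by simp
  from i have "w $ i = v $ i + 1 \<or> v $ i = w $ i + 1" by linarith
  then show thesis
  proof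
    assume "w $ i = v $ i + 1"
    then have "w = v + axis i 1" using j' by (auto simp: vec_eq_iff axis_def)
    then show thesis using that e by (auto simp: unit_edge_def)
  next
    assume "v $ i = w $ i + 1"
    then have "v = w + axis i 1" using j' by (auto simp: vec_eq_iff axis_def)
    then show thesis using that e by (auto simp: unit_edge_def)
  qed
qed

lemma edge_segment_unit_edge:
  fixes v :: "int ^ 'd::finite"
  shows "edge_segment (unit_edge v i) =
    {z. (\<forall>j. j \<noteq> i \<longrightarrow> z $ j = of_int (v $ j)) \<and> of_int (v $ i) \<le> z $ i \<and> z $ i \<le> of_int (v $ i) + 1}"
    (is "?L = ?R")
proof -
  have seg: "?L = closed_segment (lattice_point v) (lattice_point (v + axis i 1))"
    by (simp add: edge_segment_def unit_edge_def segment_convex_hull)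
  show ?thesis
  proof (intro equalityI subsetI)
    fix z assume "z \<in> ?L"
    then obtain u where "0 \<le> u" "u \<le> 1"
      and z: "z = (1 - u) *\<^sub>R lattice_point v + u *\<^sub>R lattice_point (v + axis i 1)"
      unfolding seg closed_segment_def by blast
    then show "z \<in> ?R" unfolding z by (auto simp: axis_def algebra_simps)
  next
    fix z assume z: "z \<in> ?R"
    let ?u = "z $ i - of_int (v $ i)"
    have "z = (1 - ?u) *\<^sub>R lattice_point v + ?u *\<^sub>R lattice_point (v + axis i 1)"
      using z by (auto simp: vec_eq_iff axis_def algebra_simps)
    moreover have "0 \<le> ?u" "?u \<le> 1" using z by auto
    ultimately show "z \<in> ?L" unfolding seg closed_segment_def by blast
  qed
qed

lemma coordinate_differs:
  fixes z z' :: "'a ^ 'd::finite"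
  assumes "z \<noteq> z'" "\<And>j. j \<noteq> i \<Longrightarrow> z $ j = z' $ j"
  shows "z $ i \<noteq> z' $ i"
  using assms by (metis vec_eq_iff)

text \<open>Two distinct common points differ in exactly one coordinate, which must be the direction
  of both edges. The interval between consecutive integers that contains both values then fixes the
  base point. This makes the choice operator in \<open>point_time\<close> harmless.\<close>

lemma edge_unique:
  fixes e e' :: "(int ^ 'd::finite) set"
  assumes "e \<in> lattice_edges" "e' \<in> lattice_edges" "z \<noteq> z'"
    and "z \<in> edge_segment e" "z' \<in> edge_segment e" "z \<in> edge_segment e'" "z' \<in> edge_segment e'"
  shows "e = e'"
proof -
  obtain v i where e: "e = unit_edge v i" using lattice_edge_cases assms(1) by blast
  obtain w k where e': "e' = unit_edge w k" using lattice_edge_cases assms(2) by blast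
  note s = assms(4-7)[unfolded e e' edge_segment_unit_edge mem_Collect_eq]
  have zi: "z $ i \<noteq> z' $ i" by (rule coordinate_differs[OF assms(3)]) (use s in auto)
  then have ik: "i = k" using s(3,4) by metis
  have j: "v $ j = w $ j" if "j \<noteq> i" for j
  proof -
    have "real_of_int (v $ j) = z $ j" "z $ j = real_of_int (w $ j)" using s(1,3) that ik by auto
    then show ?thesis by simp
  qed
  have b1: "real_of_int (v $ i) \<le> z $ i" "z $ i \<le> real_of_int (v $ i) + 1"
    "real_of_int (v $ i) \<le> z' $ i" "z' $ i \<le> real_of_int (v $ i) + 1"
    "real_of_int (w $ i) \<le> z $ i" "z $ i \<le> real_of_int (w $ i) + 1"
    "real_of_int (w $ i) \<le> z' $ i" "z' $ i \<le> real_of_int (w $ i) + 1" using s ik by auto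
  have "v $ i = w $ i" using b1 zi by linarith
  then have "v = w" using j by (metis vec_eq_iff)
  then show ?thesis using e e' ik by simp
qed

text \<open>Integrality of corner and side matters here: a box that meets a unit segment in two
  distinct points contains the whole segment. Paths inside a box therefore only see weights of edges
  of that box, so their times define local events.\<close>

lemma edge_in_qbox:
  fixes e :: "(int ^ 'd::finite) set"
  assumes "e \<in> lattice_edges" "z \<noteq> z'" "z \<in> edge_segment e" "z' \<in> edge_segment e"
    and "z \<in> qbox c m" "z' \<in> qbox c m"
  shows "e \<in> edges_in (qbox c m)"
proof -
  obtain v i where e: "e = unit_edge v i" using lattice_edge_cases assms(1) by blast
  note s = assms(3,4)[unfolded e edge_segment_unit_edge mem_Collect_eq]
  note q = assms(5,6)[unfolded qbox_def mem_Collect_eq]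
  have zi: "z $ i \<noteq> z' $ i" by (rule coordinate_differs[OF assms(2)]) (use s in auto)
  have j: "of_int (c $ j) \<le> (of_int (v $ j)::real) \<and> of_int (v $ j) \<le> (of_int (c $ j)::real) + real m"
    if "j \<noteq> i" for j
  proof -
    have "real_of_int (v $ j) = z $ j" using s(1) that by auto
    then show ?thesis using q(1)[rule_format, of j] by auto
  qed
  have b1: "real_of_int (v $ i) \<le> z $ i" "z $ i \<le> real_of_int (v $ i) + 1"
    "real_of_int (v $ i) \<le> z' $ i" "z' $ i \<le> real_of_int (v $ i) + 1" using s by auto
  have "of_int (c $ i) < (of_int (v $ i) + 1::real)" "of_int (v $ i) < (of_int (c $ i)::real) + real m"
    using b1 q(1)[rule_format, of i] q(2)[rule_format, of i] zi by linarith+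
  then have i: "c $ i \<le> v $ i" "v $ i + 1 \<le> c $ i + int m" by linarith+
  have i': "of_int (c $ i) \<le> (of_int (v $ i)::real)" "of_int (v $ i) + 1 \<le> (of_int (c $ i)::real) + real m"
    using i by linarith+
  have "of_int (c $ k) \<le> lattice_point v $ k \<and> lattice_point v $ k \<le> of_int (c $ k) + real m" for k
    using j[of k] i' by (cases "k = i") auto
  then have "lattice_point v \<in> qbox c m" by (simp add: qbox_def)
  moreover have "of_int (c $ k) \<le> lattice_point (v + axis i 1) $ k \<and>
      lattice_point (v + axis i 1) $ k \<le> of_int (c $ k) + real m" for k
    using j[of k] i' by (cases "k = i") (auto simp: axis_def)
  then have "lattice_point (v + axis i 1) \<in> qbox c m" by (simp add: qbox_def)
  ultimately show ?thesis using assms(1) e by (auto simp: edges_in_def unit_edge_def)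
qed

lemma convex_qbox: "convex (qbox c m)"
  unfolding qbox_def convex_alt
proof safe
  fix x y :: "real ^ 'a" and u :: real and i
  assume *: "\<forall>i. of_int (c $ i) \<le> x $ i \<and> x $ i \<le> of_int (c $ i) + real m"
    "\<forall>i. of_int (c $ i) \<le> y $ i \<and> y $ i \<le> of_int (c $ i) + real m" "0 \<le> u" "u \<le> 1"
  have "x $ i \<in> {of_int (c $ i) .. of_int (c $ i) + real m}" "y $ i \<in> {of_int (c $ i) .. of_int (c $ i) + real m}"
    using * by auto
  then have "(1 - u) *\<^sub>R x $ i + u *\<^sub>R y $ i \<in> {of_int (c $ i) .. of_int (c $ i) + real m}"
    using convex_real_interval(5)[unfolded convex_alt] *(3,4) by blast
  then show "of_int (c $ i) \<le> ((1 - u) *\<^sub>R x + u *\<^sub>R y) $ i"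
    "((1 - u) *\<^sub>R x + u *\<^sub>R y) $ i \<le> of_int (c $ i) + real m" by auto
qed

lemma edge_segment_subset:
  "e \<in> edges_in X \<Longrightarrow> convex X \<Longrightarrow> edge_segment e \<subseteq> X"
  by (simp add: edges_in_def edge_segment_def hull_minimal)

lemma edges_in_lattice: "e \<in> edges_in X \<Longrightarrow> e \<in> lattice_edges"
  by (simp add: edges_in_def)

section \<open>Travel times, paths and potentials\<close>

definition bounded_config :: "real \<Rightarrow> ((int ^ 'd) set \<Rightarrow> real) \<Rightarrow> bool" where
  "bounded_config b t \<longleftrightarrow> (\<forall>e\<in>lattice_edges. 0 \<le> t e \<and> t e \<le> b)"

lemma edge_segment_l1_le_1:
  fixes e :: "(int ^ 'd::finite) set"
  assumes "e \<in> lattice_edges" "z \<in> edge_segment e" "z' \<in> edge_segment e"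
  shows "l1_norm (z - z') \<le> 1"
proof -
  obtain v i where e: "e = unit_edge v i" using lattice_edge_cases assms(1) by blast
  note s = assms(2,3)[unfolded e edge_segment_unit_edge mem_Collect_eq]
  have "l1_norm (z - z') = \<bar>z $ i - z' $ i\<bar>" using s by (intro l1_norm_single_coordinate) auto
  then show ?thesis using s by linarith
qed

lemma point_time_edge:
  fixes e :: "(int ^ 'd::finite) set"
  assumes "e \<in> lattice_edges" "z \<in> edge_segment e" "z' \<in> edge_segment e"
  shows "point_time b t z z' = t e * l1_norm (z - z')"
proof (cases "z = z'")
  case True
  then show ?thesis by (simp add: point_time_def)
next
  case False
  have "(SOME e. e \<in> lattice_edges \<and> z \<in> edge_segment e \<and> z' \<in> edge_segment e) = e"
    using assms False edge_unique by (intro some_equality) blast+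
  then show ?thesis using assms by (auto simp: point_time_def)
qed

lemma point_time_same [simp]: "point_time b t z z = 0"
  by (simp add: point_time_def)

lemma point_time_non_edge:
  "\<not> (\<exists>e\<in>lattice_edges. z \<in> edge_segment e \<and> z' \<in> edge_segment e) \<Longrightarrow>
    point_time b t z z' = b * l1_norm (z - z')"
  unfolding point_time_def by (rule if_not_P)

lemma point_time_cases:
  fixes z z' :: "real ^ 'd::finite"
  obtains e where "e \<in> lattice_edges" "z \<in> edge_segment e" "z' \<in> edge_segment e"
      "point_time b t z z' = t e * l1_norm (z - z')"
  | "\<not> (\<exists>e\<in>lattice_edges. z \<in> edge_segment e \<and> z' \<in> edge_segment e)"
      "point_time b t z z' = b * l1_norm (z - z')"
  using point_time_edge point_time_non_edge by metis

lemma point_time_le: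
  fixes z z' :: "real ^ 'd::finite"
  shows "bounded_config b t \<Longrightarrow> point_time b t z z' \<le> b * l1_norm (z - z')"
  by (rule point_time_cases[of z z' b t]) (auto simp: bounded_config_def mult_right_mono)

lemma point_time_commute:
  fixes z z' :: "real ^ 'd"
  shows "point_time b t z z' = point_time b t z' z"
proof -
  have "(e \<in> lattice_edges \<and> z \<in> edge_segment e \<and> z' \<in> edge_segment e) \<longleftrightarrow>
      (e \<in> lattice_edges \<and> z' \<in> edge_segment e \<and> z \<in> edge_segment e)" for e :: "(int ^ 'd) set"
    by blast
  then show ?thesis
    unfolding point_time_def l1_norm_minus_commute[of z' z] Bex_def by presburger
qed

text \<open>Potentials are the dual certificates of passage times: a lower bound for a passage time is
  the increment of a potential, and conversely.\<close>

definition potential ::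
    "real \<Rightarrow> ((int ^ 'd) set \<Rightarrow> real) \<Rightarrow> (real ^ 'd) set \<Rightarrow> (real ^ 'd \<Rightarrow> real) \<Rightarrow> bool" where
  "potential b t X f \<longleftrightarrow>
     (\<forall>z\<in>X. \<forall>z'\<in>X. \<bar>f z - f z'\<bar> \<le> b * l1_norm (z - z')) \<and>
     (\<forall>e\<in>edges_in X. \<forall>z\<in>edge_segment e. \<forall>z'\<in>edge_segment e. \<bar>f z - f z'\<bar> \<le> t e * l1_norm (z - z'))"

definition path_in :: "(real ^ 'd) set \<Rightarrow> (real ^ 'd) list \<Rightarrow> bool" where
  "path_in X p \<longleftrightarrow> p \<noteq> [] \<and> set p \<subseteq> X"

lemma potential_point_time:
  fixes z z' :: "real ^ 'd::finite"
  assumes "potential b t (qbox c m) f" "z \<in> qbox c m" "z' \<in> qbox c m"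
  shows "\<bar>f z - f z'\<bar> \<le> point_time b t z z'"
\<comment> \<open>For \<open>z = z'\<close> the edge picked by \<open>point_time\<close> may stick
  out of the box, where the potential promises nothing; both sides vanish instead.\<close>
proof (cases "z = z'")
  case False
  show ?thesis
  proof (rule point_time_cases[of z z' b t])
    fix e assume e: "e \<in> lattice_edges" "z \<in> edge_segment e" "z' \<in> edge_segment e"
      "point_time b t z z' = t e * l1_norm (z - z')"
    have "e \<in> edges_in (qbox c m)" by (rule edge_in_qbox[of e z z']) (use e assms False in auto)
    then have "\<bar>f z - f z'\<bar> \<le> t e * l1_norm (z - z')" using assms(1) e(2,3) by (simp add: potential_def)
    then show ?thesis using e(4) by simp
  next
    assume "point_time b t z z' = b * l1_norm (z - z')"
    then show ?thesis using assms by (auto simp: potential_def)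
  qed
qed simp

lemma path_time_single [simp]: "path_time b t [x] = 0"
  by (simp add: path_time_def)

lemma path_time_Cons2 [simp]:
  "path_time b t (x # y # p) = point_time b t x y + path_time b t (y # p)"
  by (simp add: path_time_def sum.lessThan_Suc_shift del: sum.lessThan_Suc)

lemma path_time_append:
  assumes "p \<noteq> []" "q \<noteq> []"
  shows "path_time b t (p @ q) = path_time b t p + point_time b t (last p) (hd q) + path_time b t q"
  using assms
proof (induction p rule: list_nonempty_induct)
  case (single x)
  then show ?case by (cases q) auto
next
  case (cons x xs)
  then show ?case by (cases xs) auto
qed

lemma potential_path_time:
  fixes p :: "(real ^ 'd::finite) list"
  assumes "potential b t (qbox c m) f" "path_in (qbox c m) p"
  shows "\<bar>f (last p) - f (hd p)\<bar> \<le> path_time b t p"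
  using assms(2)
proof (induction p rule: induct_list012)
  case (3 x y zs)
  then have "\<bar>f (last (y # zs)) - f y\<bar> \<le> path_time b t (y # zs)" by (auto simp: path_in_def)
  moreover have "\<bar>f x - f y\<bar> \<le> point_time b t x y"
    using 3 by (intro potential_point_time[OF assms(1)]) (auto simp: path_in_def)
  ultimately show ?case by auto
qed (auto simp: path_in_def)

text \<open>Comparison with the zero potential. The assumption concerns the weights inside the box
  alone, so the bound is available for configurations outside \<open>bounded_config\<close> as
  well.\<close>

lemma path_time_nonneg:
  fixes p :: "(real ^ 'd::finite) list"
  assumes "\<forall>e\<in>edges_in (qbox c m). 0 \<le> t e" "0 \<le> b" "path_in (qbox c m) p"
  shows "0 \<le> path_time b t p"
proof -
  have "potential b t (qbox c m) (\<lambda>_. 0)"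
    using assms by (auto simp: potential_def edges_in_def)
  from potential_path_time[OF this assms(3)] show ?thesis by simp
qed

definition paths_between :: "(real ^ 'd) set \<Rightarrow> real ^ 'd \<Rightarrow> real ^ 'd \<Rightarrow> (real ^ 'd) list set" where
  "paths_between X x y = {p. path_in X p \<and> hd p = x \<and> last p = y}"

lemma passage_time_alt: "passage_time b t X x y = (INF p\<in>paths_between X x y. path_time b t p)"
  unfolding passage_time_def paths_between_def path_in_def
  by (rule arg_cong[where f = Inf]) auto

lemma direct_path: "x \<in> X \<Longrightarrow> y \<in> X \<Longrightarrow> [x, y] \<in> paths_between X x y"
  by (auto simp: paths_between_def path_in_def)

text \<open>The McShane-type formula \<open>f y = inf (\<beta> x + T x y)\<close> turns passage times into potentials.\<close>

lemma potential_from_times: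
  fixes X :: "(real ^ 'd::finite) set"
  assumes X: "X = qbox c m" and t: "bounded_config b t" "0 \<le> b"
    and S: "S \<subseteq> X" "S \<noteq> {}" and bd: "\<And>x. x \<in> S \<Longrightarrow> l \<le> \<beta> x"
  obtains f where "potential b t X f" "\<And>x. x \<in> S \<Longrightarrow> f x \<le> \<beta> x"
    "\<And>y C. y \<in> X \<Longrightarrow> (\<And>p. path_in X p \<Longrightarrow> hd p \<in> S \<Longrightarrow> last p = y \<Longrightarrow> C \<le> \<beta> (hd p) + path_time b t p)
       \<Longrightarrow> C \<le> f y"
proof -
  define P where "P y = {p. path_in X p \<and> hd p \<in> S \<and> last p = y}" for y
  define F where "F p = \<beta> (hd p) + path_time b t p" for p
  define f where "f y = (INF p\<in>P y. F p)" for y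
  have ne: "P y \<noteq> {}" if "y \<in> X" for y
  proof -
    obtain x where "x \<in> S" using S by blast
    then have "[x, y] \<in> P y" using S that by (auto simp: P_def path_in_def)
    then show ?thesis by blast
  qed
  have nn: "0 \<le> path_time b t p" if "path_in X p" for p
    using that t unfolding X by (intro path_time_nonneg) (auto simp: bounded_config_def edges_in_def)
  have lb: "l \<le> F p" if "p \<in> P y" for p y
    using that bd[of "hd p"] nn[of p] by (auto simp: P_def F_def)
  have bdd: "bdd_below (F ` P y)" for y
    using lb by (intro bdd_belowI[of _ l]) auto
  have step: "f y \<le> f z + point_time b t z y" if "y \<in> X" "z \<in> X" for y z
  proof -
    have "f y - point_time b t z y \<le> f z"
      unfolding f_def[of z]
    proof (rule cINF_greatest[OF ne[OF \<open>z \<in> X\<close>]])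
      fix p assume p: "p \<in> P z"
      then have "p @ [y] \<in> P y" using \<open>y \<in> X\<close> by (auto simp: P_def path_in_def)
      moreover have "F (p @ [y]) = F p + point_time b t z y"
        using p by (auto simp: F_def P_def path_in_def path_time_append)
      ultimately show "f y - point_time b t z y \<le> F p"
        using cINF_lower[OF bdd, of "p @ [y]" y] by (simp add: f_def)
    qed
    then show ?thesis by simp
  qed
  have abs: "\<bar>f z - f z'\<bar> \<le> point_time b t z z'" if "z \<in> X" "z' \<in> X" for z z'
    using step[OF that] step[OF that(2,1)] by (simp add: point_time_commute[of b t z' z])
  have "potential b t X f"
    unfolding potential_def
  proof (intro conjI ballI)
    fix z z' assume "z \<in> X" "z' \<in> X"
    then show "\<bar>f z - f z'\<bar> \<le> b * l1_norm (z - z')"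
      using abs point_time_le[OF t(1)] order_trans by blast
  next
    fix e z z' assume e: "e \<in> edges_in X" "z \<in> edge_segment e" "z' \<in> edge_segment e"
    have "edge_segment e \<subseteq> X" using e(1) X convex_qbox edge_segment_subset by blast
    then have "z \<in> X" "z' \<in> X" using e by auto
    then show "\<bar>f z - f z'\<bar> \<le> t e * l1_norm (z - z')"
      using abs[of z z'] point_time_edge[OF edges_in_lattice[OF e(1)] e(2,3)] by simp
  qed
  moreover have "f x \<le> \<beta> x" if "x \<in> S" for x
  proof -
    have "[x] \<in> P x" using that S by (auto simp: P_def path_in_def)
    from cINF_lower[OF bdd this] show ?thesis by (simp add: f_def F_def)
  qed
  moreover have "C \<le> f y" if "y \<in> X" "\<And>p. path_in X p \<Longrightarrow> hd p \<in> S \<Longrightarrow> last p = y \<Longrightarrow> C \<le> \<beta> (hd p) + path_time b t p"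
    for y C
    unfolding f_def using ne[OF that(1)] that(2) by (intro cINF_greatest) (auto simp: P_def F_def)
  ultimately show thesis using that by blast
qed

text \<open>Only increments of a potential are constrained, so its values may be passed through any
  1-Lipschitz map. This is how potentials are scaled, truncated and collapsed later.\<close>

lemma potential_transform:
  assumes "potential b t X f" and "\<And>r s. \<bar>g r - g s\<bar> \<le> \<bar>r - s\<bar>"
  shows "potential b t X (\<lambda>x. g (f x))"
  using assms(1) unfolding potential_def by (auto intro: order_trans[OF assms(2)])

text \<open>The metric of the box dominates the increments of all functions \<open>h j\<close> up to
  an additive error. Linear \<open>h\<close> give the event defining the rate function; crossing
  shapes give the event that is copied into every tile.\<close>

definition profile_event ::
    "real \<Rightarrow> (real ^ 'd) set \<Rightarrow> ('d \<Rightarrow> real ^ 'd \<Rightarrow> real) \<Rightarrow> real \<Rightarrow> ((int ^ 'd) set \<Rightarrow> real) set" where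
  "profile_event b X h \<epsilon> =
     {t. \<forall>j p. path_in X p \<longrightarrow> \<bar>h j (last p) - h j (hd p)\<bar> - \<epsilon> \<le> path_time b t p}"

text \<open>The infimum formula is applied with every point of the box as a source and
  \<open>g\<close> as initial value. Then f lies below g by construction, and the event keeps it
  above g - \<open>\<epsilon>\<close>. Allowing any \<open>g\<close> whose increments are dominated
  by those of \<open>h j\<close> covers the shape itself, its negative and their translates by
  constants.\<close>

lemma profile_event_potential:
  fixes X :: "(real ^ 'd::finite) set"
  assumes X: "X = qbox c m" and t: "bounded_config b t" "0 \<le> b" "t \<in> profile_event b X h \<epsilon>"
    and h: "\<And>x. x \<in> X \<Longrightarrow> l \<le> g x" "\<And>x y. x \<in> X \<Longrightarrow> y \<in> X \<Longrightarrow> \<bar>g x - g y\<bar> \<le> \<bar>h j x - h j y\<bar>"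
    and ne: "X \<noteq> {}" and "0 \<le> \<epsilon>"
  obtains f where "potential b t X f" "\<And>x. x \<in> X \<Longrightarrow> \<bar>f x - g x\<bar> \<le> \<epsilon>"
proof -
  obtain f where f: "potential b t X f" "\<And>x. x \<in> X \<Longrightarrow> f x \<le> g x"
    "\<And>y C. y \<in> X \<Longrightarrow> (\<And>p. path_in X p \<Longrightarrow> hd p \<in> X \<Longrightarrow> last p = y \<Longrightarrow> C \<le> g (hd p) + path_time b t p)
       \<Longrightarrow> C \<le> f y"
    by (rule potential_from_times[OF X t(1,2) subset_refl ne, of l g]) (use h(1) in blast)+
  have "g y - \<epsilon> \<le> f y" if "y \<in> X" for y
  proof (rule f(3)[OF that])
    fix p assume p: "path_in X p" "hd p \<in> X" "last p = y"
    then have "\<bar>h j y - h j (hd p)\<bar> - \<epsilon> \<le> path_time b t p"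
      using t(3) by (auto simp: profile_event_def)
    then show "g y - \<epsilon> \<le> g (hd p) + path_time b t p"
      using h(2)[OF that p(2)] by linarith
  qed
  then have "\<bar>f y - g y\<bar> \<le> \<epsilon>" if "y \<in> X" for y
    using f(2)[OF that] that[THEN \<open>\<And>y. y \<in> X \<Longrightarrow> g y - \<epsilon> \<le> f y\<close>] \<open>0 \<le> \<epsilon>\<close> by linarith
  then show thesis by (rule that[OF f(1)])
qed

section \<open>Gluing potentials on tiles\<close>

text \<open>The data are indexed by \<open>P\<close> rather than by points, so that pairs of a tile
  and a point can be fed in. Consistency at coinciding points is part of the Lipschitz
  assumption.\<close>

lemma mcshane_extension:
  fixes pt :: "'i \<Rightarrow> real ^ 'd" and val :: "'i \<Rightarrow> real"
  assumes "P \<noteq> {}" "0 \<le> L"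
    and lip: "\<And>i j. i \<in> P \<Longrightarrow> j \<in> P \<Longrightarrow> \<bar>val i - val j\<bar> \<le> L * l1_norm (pt i - pt j)"
  obtains F where "\<And>x y. \<bar>F x - F y\<bar> \<le> L * l1_norm (x - y)" "\<And>i. i \<in> P \<Longrightarrow> F (pt i) = val i"
proof -
  define F where "F x = (INF i\<in>P. val i + L * l1_norm (x - pt i))" for x
  obtain k where k: "k \<in> P" using assms(1) by blast
  have tri: "L * l1_norm (x - z) \<le> L * l1_norm (x - y) + L * l1_norm (y - z)" for x y z :: "real ^ 'd"
    using mult_left_mono[OF l1_norm_triangle assms(2)] by (simp add: distrib_left)
  have bdd: "bdd_below ((\<lambda>i. val i + L * l1_norm (x - pt i)) ` P)" for x
  proof (rule bdd_belowI2)
    fix i assume "i \<in> P"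
    then show "val k - L * l1_norm (pt k - x) \<le> val i + L * l1_norm (x - pt i)"
      using lip[OF k] tri[of "pt k" "pt i" x] by fastforce
  qed
  have le: "F x \<le> F y + L * l1_norm (x - y)" for x y
  proof -
    have "F x - L * l1_norm (x - y) \<le> F y"
      unfolding F_def[of y]
    proof (rule cINF_greatest[OF assms(1)])
      fix i assume "i \<in> P"
      then have "F x \<le> val i + L * l1_norm (x - pt i)"
        unfolding F_def by (rule cINF_lower[OF bdd])
      then show "F x - L * l1_norm (x - y) \<le> val i + L * l1_norm (y - pt i)"
        using tri[of x "pt i" y] by linarith
    qed
    then show ?thesis by simp
  qed
  have "\<bar>F x - F y\<bar> \<le> L * l1_norm (x - y)" for x y
    using le[of x y] le[of y x] by (simp add: l1_norm_minus_commute[of y x] abs_le_iff)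
  moreover have "F (pt i) = val i" if i: "i \<in> P" for i
  proof (rule antisym)
    have "F (pt i) \<le> val i + L * l1_norm (pt i - pt i)"
      unfolding F_def by (rule cINF_lower[OF bdd i])
    then show "F (pt i) \<le> val i" by simp
    show "val i \<le> F (pt i)"
      unfolding F_def
    proof (rule cINF_greatest[OF assms(1)])
      fix j assume "j \<in> P"
      then show "val i \<le> val j + L * l1_norm (pt i - pt j)" using lip[OF i] by fastforce
    qed
  qed
  ultimately show thesis using that by blast
qed

text \<open>Edges inside a piece are controlled by the potential of that piece, since the extension
  agrees with it there. For every other edge the global Lipschitz constant \<open>L\<close> has to
  do, hence the demand that such edges have weight at least \<open>L\<close>.\<close>

lemma potential_patch:
  fixes B :: "'k \<Rightarrow> (real ^ 'd::finite) set"
  assumes "I \<noteq> {}" "\<And>k. k \<in> I \<Longrightarrow> B k \<noteq> {}" "0 \<le> L" "L \<le> b"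
    and pot: "\<And>k. k \<in> I \<Longrightarrow> potential b t (B k) (f k)" and cB: "\<And>k. k \<in> I \<Longrightarrow> convex (B k)"
    and lip: "\<And>k k' x y. k \<in> I \<Longrightarrow> k' \<in> I \<Longrightarrow> x \<in> B k \<Longrightarrow> y \<in> B k' \<Longrightarrow>
      \<bar>f k x - f k' y\<bar> \<le> L * l1_norm (x - y)"
    and slow: "\<And>e. e \<in> edges_in X \<Longrightarrow> (\<And>k. k \<in> I \<Longrightarrow> e \<notin> edges_in (B k)) \<Longrightarrow> L \<le> t e"
  obtains F where "potential b t X F" "\<And>k x. k \<in> I \<Longrightarrow> x \<in> B k \<Longrightarrow> F x = f k x"
proof -
  define P where "P = Sigma I B"
  have "P \<noteq> {}" using assms(1,2) by (auto simp: P_def)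
  then obtain F where F: "\<And>x y. \<bar>F x - F y\<bar> \<le> L * l1_norm (x - y)"
    "\<And>q. q \<in> P \<Longrightarrow> F (snd q) = (\<lambda>(k, x). f k x) q"
    by (rule mcshane_extension[where L = L and pt = snd and val = "\<lambda>(k, x). f k x"])
       (use lip assms(3) in \<open>auto simp: P_def\<close>)
  have eq: "F x = f k x" if "k \<in> I" "x \<in> B k" for k x using F(2)[of "(k, x)"] that by (simp add: P_def)
  have "potential b t X F"
    unfolding potential_def
  proof (intro conjI ballI)
    fix z z' show "\<bar>F z - F z'\<bar> \<le> b * l1_norm (z - z')"
      using F(1)[of z z'] mult_right_mono[OF assms(4) l1_norm_nonneg, of "z - z'"] by linarith
  next
    fix e z z' assume e: "e \<in> edges_in X" "z \<in> edge_segment e" "z' \<in> edge_segment e"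
    show "\<bar>F z - F z'\<bar> \<le> t e * l1_norm (z - z')"
    proof (cases "\<exists>k\<in>I. e \<in> edges_in (B k)")
      case True
      then obtain k where k: "k \<in> I" "e \<in> edges_in (B k)" by blast
      then have "edge_segment e \<subseteq> B k" using edge_segment_subset cB by blast
      then have "F z = f k z" "F z' = f k z'" using eq[OF k(1)] e(2,3) by blast+
      then show ?thesis using pot[OF k(1)] k(2) e(2,3) by (simp add: potential_def)
    next
      case False
      then have "L \<le> t e" using slow e by blast
      then show ?thesis
        using F(1)[of z z'] mult_right_mono[OF _ l1_norm_nonneg, of L "t e" "z - z'"] by linarith
    qed
  qed
  then show thesis using that eq by blast
qed

text \<open>Moves the box of side m at the origin to the corner c, after reflecting it in the
  coordinates selected by r. It is polymorphic because real points and integer vertices are moved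
  alike.\<close>

definition place :: "('d \<Rightarrow> bool) \<Rightarrow> int ^ 'd \<Rightarrow> nat \<Rightarrow> 'a::ring_1 ^ 'd \<Rightarrow> 'a ^ 'd" where
  "place r c m y = (\<chi> i. of_int (c $ i) + (if r i then of_nat m - y $ i else y $ i))"

definition unplace :: "('d \<Rightarrow> bool) \<Rightarrow> int ^ 'd \<Rightarrow> nat \<Rightarrow> 'a::ring_1 ^ 'd \<Rightarrow> 'a ^ 'd" where
  "unplace r c m x = (\<chi> i. if r i then of_nat m - (x $ i - of_int (c $ i)) else x $ i - of_int (c $ i))"

lemma place_unplace [simp]: "place r c m (unplace r c m x) = x"
  by (simp add: place_def unplace_def vec_eq_iff)

lemma unplace_place [simp]: "unplace r c m (place r c m x) = x"
  by (simp add: place_def unplace_def vec_eq_iff)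

lemma inj_place: "inj (place r c m)"
  by (metis injI unplace_place)

lemma lattice_point_place: "lattice_point (place r c m v) = place r c m (lattice_point v)"
  by (simp add: lattice_point_def place_def vec_eq_iff)

lemma lattice_point_unplace: "lattice_point (unplace r c m v) = unplace r c m (lattice_point v)"
  by (simp add: lattice_point_def unplace_def vec_eq_iff)

lemma l1_norm_place: "l1_norm (place r c m x - place r c m y) = l1_norm (x - y)"
  by (auto simp: l1_norm_def place_def intro!: sum.cong)

lemma l1_norm_unplace: "l1_norm (unplace r c m x - unplace r c m y) = l1_norm (x - y)"
  by (auto simp: l1_norm_def unplace_def intro!: sum.cong)

lemma place_in_qbox: "x \<in> qbox 0 m \<Longrightarrow> place r c m x \<in> qbox c m"
  by (auto simp: qbox_def place_def)

lemma unplace_in_qbox: "x \<in> qbox c m \<Longrightarrow> unplace r c m x \<in> qbox 0 m"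
  by (auto simp: qbox_def unplace_def algebra_simps)

lemma place_edges_in: "e \<in> edges_in (qbox 0 m) \<Longrightarrow> place r c m ` e \<in> edges_in (qbox c m)"
  unfolding edges_in_def lattice_edges_def adjacent_def
  by (auto simp: lattice_point_place l1_norm_place intro!: place_in_qbox)
     (metis l1_norm_place lattice_point_place)

lemma unplace_edges_in: "e \<in> edges_in (qbox c m) \<Longrightarrow> unplace r c m ` e \<in> edges_in (qbox 0 m)"
  unfolding edges_in_def lattice_edges_def adjacent_def
  by (auto simp: lattice_point_unplace l1_norm_unplace intro!: unplace_in_qbox)
     (metis l1_norm_unplace lattice_point_unplace)

lemma place_lattice_edges: "e \<in> lattice_edges \<Longrightarrow> place r c m ` e \<in> lattice_edges"
  unfolding lattice_edges_def adjacent_def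
  by clarsimp (metis l1_norm_place lattice_point_place)

lemma place_edge_segment:
  assumes "e \<in> lattice_edges" "z \<in> edge_segment e"
  shows "unplace r c m z \<in> edge_segment (unplace r c m ` e)"
proof -
  obtain v w where e: "e = {v, w}" using assms(1) by (auto simp: lattice_edges_def)
  have seg: "edge_segment {v, w} = closed_segment (lattice_point v) (lattice_point w)" for v w :: "int ^ 'a"
    by (simp add: edge_segment_def segment_convex_hull)
  obtain u where u: "0 \<le> u" "u \<le> 1" and z: "z = (1 - u) *\<^sub>R lattice_point v + u *\<^sub>R lattice_point w"
    using assms(2) unfolding e seg closed_segment_def by blast
  have "unplace r c m z = (1 - u) *\<^sub>R lattice_point (unplace r c m v) + u *\<^sub>R lattice_point (unplace r c m w)"
    unfolding z by (simp add: vec_eq_iff unplace_def algebra_simps)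
  then show ?thesis unfolding e image_insert image_empty seg closed_segment_def using u by blast
qed

lemma potential_place:
  assumes "potential b (\<lambda>e. t (place r c m ` e)) (qbox 0 m) f"
  shows "potential b t (qbox c m) (\<lambda>x. f (unplace r c m x))"
  unfolding potential_def
proof (intro conjI ballI)
  fix z z' assume "z \<in> qbox c m" "z' \<in> qbox c m"
  then show "\<bar>f (unplace r c m z) - f (unplace r c m z')\<bar> \<le> b * l1_norm (z - z')"
    using assms unplace_in_qbox l1_norm_unplace unfolding potential_def by metis
next
  fix e z z' assume e: "e \<in> edges_in (qbox c m)" "z \<in> edge_segment e" "z' \<in> edge_segment e"
  define e' where "e' = unplace r c m ` e"
  have "place r c m ` e' = e" by (simp add: e'_def image_image)
  moreover have "e' \<in> edges_in (qbox 0 m)" using unplace_edges_in[OF e(1)] by (simp add: e'_def)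
  moreover have "unplace r c m z \<in> edge_segment e'" "unplace r c m z' \<in> edge_segment e'"
    using place_edge_segment[OF edges_in_lattice[OF e(1)]] e by (auto simp: e'_def)
  ultimately have "\<bar>f (unplace r c m z) - f (unplace r c m z')\<bar>
      \<le> t e * l1_norm (unplace r c m z - unplace r c m z')"
    using assms unfolding potential_def by (metis (no_types, lifting))
  then show "\<bar>f (unplace r c m z) - f (unplace r c m z')\<bar> \<le> t e * l1_norm (z - z')"
    by (simp add: l1_norm_unplace)
qed

section \<open>Tiles separated by corridors\<close>

lemma l1_norm_le_coordinates:
  fixes x :: "real ^ 'd::finite"
  assumes "\<And>i. \<bar>x $ i\<bar> \<le> C" shows "l1_norm x \<le> real CARD('d) * C"
  unfolding l1_norm_def using sum_bounded_above[of UNIV "\<lambda>i. \<bar>x $ i\<bar>" C] assms by simp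

lemma zero_in_qbox [simp]: "0 \<in> qbox 0 m"
  by (simp add: qbox_def)

lemma l1_norm_qbox_le:
  fixes x y :: "real ^ 'd::finite"
  assumes "x \<in> qbox c m" "y \<in> qbox c m"
  shows "l1_norm (x - y) \<le> real CARD('d) * real m"
proof (rule l1_norm_le_coordinates)
  fix i
  have "of_int (c $ i) \<le> x $ i" "x $ i \<le> of_int (c $ i) + real m"
    "of_int (c $ i) \<le> y $ i" "y $ i \<le> of_int (c $ i) + real m"
    using assms by (auto simp: qbox_def)
  then show "\<bar>(x - y) $ i\<bar> \<le> real m" by simp
qed

text \<open>Here p is the period of the tiling: a tile has side m, and the remaining p - m is the
  width of the corridor up to the next tile.\<close>

definition tile_corner :: "nat \<Rightarrow> int ^ 'd \<Rightarrow> int ^ 'd" where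
  "tile_corner p k = (\<chi> i. int p * k $ i)"

abbreviation tile :: "nat \<Rightarrow> nat \<Rightarrow> int ^ 'd \<Rightarrow> (real ^ 'd) set" where
  "tile p m k \<equiv> qbox (tile_corner p k) m"

definition tile_indices :: "nat \<Rightarrow> (int ^ 'd) set" where
  "tile_indices K = {k. \<forall>i. 0 \<le> k $ i \<and> k $ i < int K}"

lemma tile_coordinate:
  assumes "x \<in> tile p m k"
  shows "real p * of_int (k $ i) \<le> x $ i" "x $ i \<le> real p * of_int (k $ i) + real m"
  using assms by (auto simp: qbox_def tile_corner_def)

lemma tile_separation:
  fixes x y :: "real ^ 'd::finite"
  assumes "k \<noteq> k'" "x \<in> tile (m + w) m k" "y \<in> tile (m + w) m k'"
  shows "real w \<le> l1_norm (x - y)"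
proof -
  have *: "real w \<le> y $ i - x $ i" if "k $ i < k' $ i" "x \<in> tile (m + w) m k" "y \<in> tile (m + w) m k'"
    for k k' i and x y :: "real ^ 'd"
  proof -
    have "real (m + w) * (of_int (k $ i) + 1) \<le> real (m + w) * of_int (k' $ i)"
      using that(1) by (intro mult_left_mono) auto
    then show ?thesis
      using tile_coordinate(2)[OF that(2), of i] tile_coordinate(1)[OF that(3), of i]
      by (simp add: algebra_simps)
  qed
  obtain i where "k $ i \<noteq> k' $ i" using assms(1) by (auto simp: vec_eq_iff)
  then have "k $ i < k' $ i \<or> k' $ i < k $ i" by linarith
  then have "real w \<le> \<bar>x $ i - y $ i\<bar>"
    using *[of k i k' x y] *[of k' i k y x] assms by fastforce
  then show ?thesis using component_le_l1_norm order_trans by blast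
qed

lemma tile_covering:
  fixes x :: "real ^ 'd::finite"
  assumes x: "x \<in> qbox 0 N" and "0 < K" "N < (K + 1) * p" "m \<le> p"
  obtains k y where "k \<in> tile_indices K" "y \<in> tile p m k" "l1_norm (x - y) \<le> real CARD('d) * (2 * real p)"
proof -
  have p: "0 < p" using assms(3) by (cases p) auto
  have x0: "0 \<le> x $ i" "x $ i \<le> real N" for i using x by (auto simp: qbox_def)
  \<comment> \<open>Past the last full period the index is cut off at K - 1. Such a coordinate may
    lie almost 2 p beyond the corner of its tile, whence the 2 p in the conclusion.\<close>
  define k :: "int ^ 'd" where "k = (\<chi> i. min \<lfloor>x $ i / real p\<rfloor> (int K - 1))"
  define y :: "real ^ 'd" where "y = (\<chi> i. min (x $ i) (real p * of_int (k $ i) + real m))"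
  have fl: "real p * of_int \<lfloor>x $ i / real p\<rfloor> \<le> x $ i" "x $ i < real p * of_int \<lfloor>x $ i / real p\<rfloor> + real p" for i
  proof -
    have eq: "real p * (x $ i / real p) = x $ i" using p by simp
    have "real p * of_int \<lfloor>x $ i / real p\<rfloor> \<le> real p * (x $ i / real p)"
      by (intro mult_left_mono of_int_floor_le) simp
    then show "real p * of_int \<lfloor>x $ i / real p\<rfloor> \<le> x $ i" unfolding eq .
    have "real p * (x $ i / real p) < real p * (of_int \<lfloor>x $ i / real p\<rfloor> + 1)"
      using p by (intro mult_strict_left_mono) (linarith, simp)
    then show "x $ i < real p * of_int \<lfloor>x $ i / real p\<rfloor> + real p" unfolding eq by (simp add: algebra_simps)
  qed
  have N: "real N < real K * real p + real p"
    using assms(3) by (metis distrib_right lambda_one of_nat_1 of_nat_add of_nat_less_iff of_nat_mult)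
  have k1: "real p * of_int (k $ i) \<le> x $ i" for i
  proof -
    have "real p * of_int (k $ i) \<le> real p * of_int \<lfloor>x $ i / real p\<rfloor>"
      by (intro mult_left_mono) (auto simp: k_def)
    then show ?thesis using fl(1)[of i] by linarith
  qed
  have k2: "x $ i \<le> real p * of_int (k $ i) + 2 * real p" for i
  proof (cases "\<lfloor>x $ i / real p\<rfloor> \<le> int K - 1")
    case True
    then show ?thesis using fl(2)[of i] by (simp add: k_def)
  next
    case False
    then have ki: "real_of_int (k $ i) = real K - 1" by (simp add: k_def)
    have "real p * of_int (k $ i) = real K * real p - real p" unfolding ki by (simp add: algebra_simps)
    then show ?thesis using x0(2)[of i] N by linarith
  qed
  have "k \<in> tile_indices K"
    using assms(2) x0(1) by (auto simp: tile_indices_def k_def)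
  moreover have "y \<in> tile p m k"
    using k1 by (auto simp: qbox_def y_def tile_corner_def)
  moreover have "l1_norm (x - y) \<le> real CARD('d) * (2 * real p)"
  proof (rule l1_norm_le_coordinates)
    fix i
    have "y $ i = min (x $ i) (real p * of_int (k $ i) + real m)" by (simp add: y_def)
    then show "\<bar>(x - y) $ i\<bar> \<le> 2 * real p"
      using k2[of i] by (simp add: min_def)
  qed
  ultimately show thesis using that by blast
qed

text \<open>Each tile carries a potential within \<open>\<epsilon>\<close> of \<open>H\<close>, so
  values in different tiles may differ by 2 \<open>\<epsilon>\<close> more than b times the
  distance. Scaling by 1 - \<open>\<sigma>\<close> gains \<open>\<sigma>\<close> b times the
  distance, which is at least w. Half of this gain absorbs 2 \<open>\<epsilon>\<close>; the other
  half leaves the Lipschitz constant (1 - \<open>\<sigma>\<close> / 2) b, which the corridor weights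
  can support.\<close>

lemma tile_potential:
  fixes t :: "(int ^ 'd::finite) set \<Rightarrow> real" and H :: "real ^ 'd \<Rightarrow> real"
  assumes t: "bounded_config b t" and b: "0 < b" and \<sigma>: "0 < \<sigma>" "\<sigma> < 1" and "0 < K"
    and ev: "\<And>k. k \<in> tile_indices K \<Longrightarrow>
      (\<lambda>e. t (place (r k) (tile_corner (m + w) k) m ` e)) \<in> profile_event b (qbox 0 m) (h k) \<epsilon>"
    and slow: "\<And>e. e \<in> edges_in (qbox 0 N) \<Longrightarrow>
      (\<And>k. k \<in> tile_indices K \<Longrightarrow> e \<notin> edges_in (tile (m + w) m k)) \<Longrightarrow> (1 - \<sigma> / 2) * b \<le> t e"
    and H: "\<And>k k' x y. k \<in> tile_indices K \<Longrightarrow> k' \<in> tile_indices K \<Longrightarrow> x \<in> tile (m + w) m k \<Longrightarrow>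
      y \<in> tile (m + w) m k' \<Longrightarrow> \<bar>H x - H y\<bar> \<le> b * l1_norm (x - y)"
    and h: "\<And>k x y. k \<in> tile_indices K \<Longrightarrow> x \<in> qbox 0 m \<Longrightarrow> y \<in> qbox 0 m \<Longrightarrow>
      \<bar>H (place (r k) (tile_corner (m + w) k) m x) - H (place (r k) (tile_corner (m + w) k) m y)\<bar>
        \<le> \<bar>h k j x - h k j y\<bar>"
    and \<epsilon>: "0 \<le> \<epsilon>" "2 * \<epsilon> \<le> \<sigma> / 2 * b * real w"
  obtains F where "potential b t (qbox 0 N) F"
    "\<And>k x. k \<in> tile_indices K \<Longrightarrow> x \<in> tile (m + w) m k \<Longrightarrow> \<bar>F x - (1 - \<sigma>) * H x\<bar> \<le> \<epsilon>"
proof -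
  let ?P = "\<lambda>k. place (r k) (tile_corner (m + w) k) m"
  let ?U = "\<lambda>k. unplace (r k) (tile_corner (m + w) k) m"
  have "\<exists>f. potential b t (tile (m + w) m k) f \<and> (\<forall>x\<in>tile (m + w) m k. \<bar>f x - H x\<bar> \<le> \<epsilon>)"
    if k: "k \<in> tile_indices K" for k
  proof -
    define t' where "t' = (\<lambda>e. t (?P k ` e))"
    have t': "bounded_config b t'"
      using t place_lattice_edges unfolding bounded_config_def t'_def by blast
    \<comment> \<open>A lower bound for the initial values, so that the infimum defining the
      potential is finite.\<close>
    have low: "H (?P k 0) - b * (real CARD('d) * real m) \<le> H (?P k x)" if "x \<in> qbox 0 m" for x
    proof -
      have "\<bar>H (?P k x) - H (?P k 0)\<bar> \<le> b * l1_norm (?P k x - ?P k 0)"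
        by (rule H[OF k k]) (auto intro!: place_in_qbox that)
      also have "\<dots> \<le> b * (real CARD('d) * real m)"
        using b that unfolding l1_norm_place by (intro mult_left_mono l1_norm_qbox_le[of _ 0]) auto
      finally show ?thesis by linarith
    qed
    obtain f where f: "potential b t' (qbox 0 m) f" "\<And>x. x \<in> qbox 0 m \<Longrightarrow> \<bar>f x - H (?P k x)\<bar> \<le> \<epsilon>"
    proof (rule profile_event_potential[OF refl t' less_imp_le[OF b]])
      show "t' \<in> profile_event b (qbox 0 m) (h k) \<epsilon>" using ev[OF k] by (simp add: t'_def)
      show "(qbox 0 m :: (real ^ 'd) set) \<noteq> {}" using zero_in_qbox by blast
      show "\<And>x. x \<in> qbox 0 m \<Longrightarrow> H (?P k 0) - b * (real CARD('d) * real m) \<le> H (?P k x)" by (rule low)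
      show "\<And>x y. x \<in> qbox 0 m \<Longrightarrow> y \<in> qbox 0 m \<Longrightarrow> \<bar>H (?P k x) - H (?P k y)\<bar> \<le> \<bar>h k j x - h k j y\<bar>"
        by (rule h[OF k])
    qed (use \<epsilon> in auto)
    have "potential b t (tile (m + w) m k) (\<lambda>x. f (?U k x))"
      using f(1) unfolding t'_def by (rule potential_place)
    moreover have "\<bar>f (?U k x) - H x\<bar> \<le> \<epsilon>" if "x \<in> tile (m + w) m k" for x
      using f(2)[OF unplace_in_qbox[OF that, of "r k"]] by (simp only: place_unplace)
    ultimately show ?thesis by blast
  qed
  then obtain f where f: "\<And>k. k \<in> tile_indices K \<Longrightarrow> potential b t (tile (m + w) m k) (f k)"
    "\<And>k x. k \<in> tile_indices K \<Longrightarrow> x \<in> tile (m + w) m k \<Longrightarrow> \<bar>f k x - H x\<bar> \<le> \<epsilon>" by metis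
  define g where "g k x = (1 - \<sigma>) * f k x" for k x
  have g: "potential b t (tile (m + w) m k) (g k)" if "k \<in> tile_indices K" for k
    unfolding g_def
  proof (rule potential_transform[OF f(1)[OF that]])
    fix r s :: real
    have "\<bar>1 - \<sigma>\<bar> * \<bar>r - s\<bar> \<le> 1 * \<bar>r - s\<bar>" using \<sigma> by (intro mult_right_mono) auto
    then show "\<bar>(1 - \<sigma>) * r - (1 - \<sigma>) * s\<bar> \<le> \<bar>r - s\<bar>"
      by (simp add: abs_mult flip: right_diff_distrib)
  qed
  have scale: "\<bar>(1 - \<sigma>) * r - (1 - \<sigma>) * s\<bar> = (1 - \<sigma>) * \<bar>r - s\<bar>" for r s
    using \<sigma> by (simp add: abs_mult flip: right_diff_distrib)
  let ?L = "(1 - \<sigma> / 2) * b"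
  have L: "0 \<le> ?L" "?L \<le> b" using \<sigma> b by (auto simp: mult_le_cancel_right1)
  have lip: "\<bar>g k x - g k' y\<bar> \<le> ?L * l1_norm (x - y)"
    if "k \<in> tile_indices K" "k' \<in> tile_indices K" "x \<in> tile (m + w) m k" "y \<in> tile (m + w) m k'" for k k' x y
  proof (cases "k = k'")
    case True
    have "\<bar>g k x - g k' y\<bar> \<le> (1 - \<sigma>) * (b * l1_norm (x - y))"
      unfolding g_def scale True using f(1)[OF that(2)] that \<sigma> True
      by (intro mult_left_mono) (auto simp: potential_def)
    also have "\<dots> \<le> (1 - \<sigma> / 2) * (b * l1_norm (x - y))"
      using \<sigma> b by (intro mult_right_mono) auto
    finally show ?thesis by (simp add: mult.assoc)
  next
    case False
    have sep: "real w \<le> l1_norm (x - y)" using tile_separation[OF False that(3,4)] .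
    have "\<bar>f k x - f k' y\<bar> \<le> 2 * \<epsilon> + b * l1_norm (x - y)"
      using f(2)[OF that(1,3)] f(2)[OF that(2,4)] H[OF that] by linarith
    then have "\<bar>g k x - g k' y\<bar> \<le> (1 - \<sigma>) * (2 * \<epsilon> + b * l1_norm (x - y))"
      unfolding g_def scale using \<sigma> by (intro mult_left_mono) auto
    also have "\<dots> \<le> 1 * (2 * \<epsilon>) + (1 - \<sigma>) * (b * l1_norm (x - y))"
      unfolding distrib_left using \<sigma> \<epsilon>(1) by (intro add_mono mult_right_mono order_refl) auto
    also have "2 * \<epsilon> \<le> \<sigma> / 2 * b * l1_norm (x - y)"
      using \<epsilon>(2) sep \<sigma> b by (meson half_gt_zero less_imp_le mult_left_mono mult_pos_pos order_trans)
    finally show ?thesis by (simp add: algebra_simps)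
  qed
  obtain F where F: "potential b t (qbox 0 N) F"
    "\<And>k x. k \<in> tile_indices K \<Longrightarrow> x \<in> tile (m + w) m k \<Longrightarrow> F x = g k x"
  proof (rule potential_patch[of "tile_indices K" "tile (m + w) m" ?L b t g "qbox 0 N"])
    have "0 \<in> tile_indices K" using \<open>0 < K\<close> by (simp add: tile_indices_def)
    then show "tile_indices K \<noteq> {}" by blast
    show "tile (m + w) m k \<noteq> {}" for k :: "int ^ 'd" using place_in_qbox[OF zero_in_qbox] by blast
  qed (use L g lip slow convex_qbox in blast)+
  have "\<bar>F x - (1 - \<sigma>) * H x\<bar> \<le> \<epsilon>" if "k \<in> tile_indices K" "x \<in> tile (m + w) m k" for k x
  proof -
    have "\<bar>F x - (1 - \<sigma>) * H x\<bar> = (1 - \<sigma>) * \<bar>f k x - H x\<bar>"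
      unfolding F(2)[OF that] g_def by (rule scale)
    also have "\<dots> \<le> 1 * \<epsilon>" using \<sigma> f(2)[OF that] by (intro mult_mono) auto
    finally show ?thesis by simp
  qed
  then show thesis using that F(1) by blast
qed

section \<open>Crossing times\<close>

lemma scaled_unit_cube: "(\<lambda>z. real n *\<^sub>R z) ` unit_cube = (qbox 0 n :: (real ^ 'd::finite) set)"
proof (intro equalityI subsetI)
  fix x :: "real ^ 'd" assume "x \<in> (\<lambda>z. real n *\<^sub>R z) ` unit_cube"
  then show "x \<in> qbox 0 n" by (auto simp: unit_cube_def qbox_def mult_left_le)
next
  fix x :: "real ^ 'd" assume x: "x \<in> qbox 0 n"
  show "x \<in> (\<lambda>z. real n *\<^sub>R z) ` unit_cube"
  proof (cases "n = 0")
    case True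
    then have "x = real n *\<^sub>R 0" using x by (auto simp: qbox_def vec_eq_iff intro: antisym)
    then show ?thesis by (rule image_eqI) (simp add: unit_cube_def)
  next
    case False
    then have "x = real n *\<^sub>R ((1 / real n) *\<^sub>R x)" by simp
    then show ?thesis
      by (rule image_eqI) (use x False in \<open>auto simp: unit_cube_def qbox_def\<close>)
  qed
qed

lemma path_time_cong:
  fixes p :: "(real ^ 'd::finite) list"
  assumes "path_in (qbox c m) p" and eq: "\<And>e. e \<in> edges_in (qbox c m) \<Longrightarrow> t e = t' e"
  shows "path_time b t p = path_time b t' p"
  using assms(1)
proof (induction p rule: induct_list012)
  case (3 x y zs)
  have "point_time b t x y = point_time b t' x y"
  proof (cases "x = y")
    case False
    show ?thesis
    proof (rule point_time_cases[of x y b t])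
      fix e assume e: "e \<in> lattice_edges" "x \<in> edge_segment e" "y \<in> edge_segment e"
      have "e \<in> edges_in (qbox c m)"
        using 3(3) by (intro edge_in_qbox[OF e(1) False e(2,3)]) (auto simp: path_in_def)
      then show ?thesis using eq by (simp add: point_time_edge[OF e])
    qed (simp add: point_time_non_edge)
  qed simp
  then show ?case using 3 by (auto simp: path_in_def)
qed (auto simp: path_in_def)

text \<open>Junk values: the infimum of a set of reals that is unbounded below is the same for all such sets.\<close>

lemma Inf_unbounded_below:
  fixes S :: "real set"
  assumes "\<not> bdd_below S"
  shows "Inf S = Inf UNIV"
proof -
  have *: "(\<forall>x\<in>uminus ` S. x \<le> z) \<longleftrightarrow> False" if "\<not> bdd_below S" for S :: "real set" and z
  proof
    assume "\<forall>x\<in>uminus ` S. x \<le> z"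
    then have "bdd_below S" by (intro bdd_belowI[of _ "- z"]) force
    with that show False by simp
  qed auto
  have unb: "\<not> bdd_below (UNIV :: real set)"
    by (meson UNIV_I bdd_below.E gt_ex leD minus_less_iff lt_ex)
  show ?thesis unfolding Inf_real_def Sup_real_def *[OF assms] *[OF unb] by (rule refl)
qed

lemma edge_loop_time:
  assumes "e \<in> lattice_edges" "e = {v, w}"
  shows "path_time b t (lattice_point v # concat (replicate k [lattice_point w, lattice_point v])) =
    2 * real k * (t e * l1_norm (lattice_point v - lattice_point w))"
proof (induction k)
  case (Suc k)
  have "lattice_point v \<in> edge_segment e" "lattice_point w \<in> edge_segment e"
    using assms(2) by (auto simp: edge_segment_def hull_inc)
  then have "point_time b t (lattice_point v) (lattice_point w) = t e * l1_norm (lattice_point v - lattice_point w)"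
    using point_time_edge[OF assms(1)] by blast
  then show ?case using Suc by (simp add: point_time_commute[of b t "lattice_point w"] algebra_simps)
qed simp

text \<open>Walk from x to an endpoint of e, run back and forth along e, then go on to y. The detour
  has a fixed cost, while each round trip adds 2 \<open>t e\<close> < 0. All infima over such paths
  then take one and the same default value.\<close>

lemma negative_edge_unbounded:
  fixes X :: "(real ^ 'd::finite) set"
  assumes e: "e \<in> edges_in X" "t e < 0" and xy: "x \<in> X" "y \<in> X"
  shows "\<not> bdd_below (path_time b t ` paths_between X x y)"
proof
  assume "bdd_below (path_time b t ` paths_between X x y)"
  then obtain l where l: "\<And>p. p \<in> paths_between X x y \<Longrightarrow> l \<le> path_time b t p"
    by (auto simp: bdd_below_def)
  obtain v w where vw: "e = {v, w}" "adjacent v w" using edges_in_lattice[OF e(1)] by (auto simp: lattice_edges_def)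
  let ?v = "lattice_point v" and ?w = "lattice_point w"
  have X: "?v \<in> X" "?w \<in> X" using e(1) vw(1) by (auto simp: edges_in_def)
  define q where "q k = ?v # concat (replicate k [?w, ?v])" for k
  have q: "q k \<noteq> []" "set (q k) \<subseteq> X" "hd (q k) = ?v" "last (q k) = ?v" for k
    using X by (auto simp: q_def) (induction k, auto)
  define C where "C = point_time b t x ?v + point_time b t ?v y"
  have "l \<le> C + 2 * real k * t e" for k
  proof -
    have "[x] @ q k @ [y] \<in> paths_between X x y"
      using q xy by (auto simp: paths_between_def path_in_def)
    moreover have "path_time b t ([x] @ q k @ [y]) = C + path_time b t (q k)"
      using q by (simp add: path_time_append C_def del: append_Cons)
    moreover have "path_time b t (q k) = 2 * real k * t e"
      using edge_loop_time[OF edges_in_lattice[OF e(1)] vw(1)] vw(2) by (simp add: q_def adjacent_def)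
    ultimately show ?thesis using l by force
  qed
  moreover obtain k :: nat where "(C - l) / (- t e) < real k" using reals_Archimedean2 by blast
  then have "C + real k * t e < l" using e(2) by (simp add: field_simps)
  moreover have "real k * t e \<le> 0" using e(2) by (simp add: mult_nonneg_nonpos)
  ultimately show False by (smt (verit) distrib_right mult_2)
qed

definition crossing_paths :: "nat \<Rightarrow> 'd \<Rightarrow> (real ^ 'd) list set" where
  "crossing_paths n i = {p. path_in (qbox 0 n) p \<and> hd p $ i = 0 \<and> last p $ i = real n}"

text \<open>Merges the infimum over the endpoints on two opposite faces with the infimum over paths,
  without rescaling, so that a lower bound is a condition on a single set of paths.\<close>

definition crossing_time :: "real \<Rightarrow> ((int ^ 'd) set \<Rightarrow> real) \<Rightarrow> nat \<Rightarrow> 'd \<Rightarrow> real" where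
  "crossing_time b t n i = (INF p\<in>crossing_paths n i. path_time b t p)"

lemma opposite_corner: "axis i (real n) \<in> qbox 0 n"
  by (auto simp: qbox_def axis_def)

lemma direct_crossing: "[0, axis i (real n)] \<in> crossing_paths n i"
  using zero_in_qbox opposite_corner by (auto simp: crossing_paths_def path_in_def axis_def)

lemma bdd_below_path_times:
  fixes c :: "int ^ 'd::finite"
  assumes "\<forall>e\<in>edges_in (qbox c m). 0 \<le> t e" "0 \<le> b" "\<And>p. p \<in> P \<Longrightarrow> path_in (qbox c m) p"
  shows "bdd_below (path_time b t ` P)"
proof (rule bdd_belowI2)
  fix p assume "p \<in> P"
  then show "0 \<le> path_time b t p"
    by (intro path_time_nonneg[where t = t, OF assms(1,2) assms(3)])
qed

lemma real_eq_by_lower_bounds: "(\<And>c. c \<le> x \<longleftrightarrow> c \<le> y) \<Longrightarrow> x = y" for x y :: real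
  by (meson antisym order_refl)

lemma qbox_rescale:
  "x \<in> qbox 0 n \<Longrightarrow> 1 \<le> n \<Longrightarrow> (1 / real n) *\<^sub>R x \<in> unit_cube"
  by (auto simp: qbox_def unit_cube_def)

lemma unit_cube_scale: "x \<in> unit_cube \<Longrightarrow> real n *\<^sub>R x \<in> qbox 0 n"
  by (auto simp: qbox_def unit_cube_def mult_left_le)

lemma rescaled_time_eq:
  "rescaled_time b t n unit_cube x y =
    (INF p\<in>paths_between (qbox 0 n) (real n *\<^sub>R x) (real n *\<^sub>R y). path_time b t p) / real n"
  for x y :: "real ^ 'd::finite"
  by (simp add: rescaled_time_def scaled_unit_cube passage_time_alt)

lemma rescaled_time_ge_iff:
  fixes x y :: "real ^ 'd::finite"
  assumes nn: "\<forall>e\<in>edges_in (qbox 0 n :: (real ^ 'd) set). 0 \<le> t e" "0 \<le> b" and n: "1 \<le> n"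
    and "x \<in> unit_cube" "y \<in> unit_cube"
  shows "c \<le> rescaled_time b t n unit_cube x y \<longleftrightarrow>
    (\<forall>p\<in>paths_between (qbox 0 n) (real n *\<^sub>R x) (real n *\<^sub>R y). c * real n \<le> path_time b t p)"
proof -
  have "c \<le> rescaled_time b t n unit_cube x y \<longleftrightarrow>
      c * real n \<le> (INF p\<in>paths_between (qbox 0 n) (real n *\<^sub>R x) (real n *\<^sub>R y). path_time b t p)"
    using n by (simp add: rescaled_time_eq pos_le_divide_eq)
  also have "\<dots> \<longleftrightarrow> (\<forall>p\<in>paths_between (qbox 0 n) (real n *\<^sub>R x) (real n *\<^sub>R y). c * real n \<le> path_time b t p)"
  proof (rule le_cINF_iff)
    show "paths_between (qbox 0 n) (real n *\<^sub>R x) (real n *\<^sub>R y) \<noteq> {}"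
      using direct_path unit_cube_scale assms(4,5) by blast
    show "bdd_below (path_time b t ` paths_between (qbox 0 n) (real n *\<^sub>R x) (real n *\<^sub>R y))"
      by (rule bdd_below_path_times[where t = t, OF nn]) (auto simp: paths_between_def)
  qed
  finally show ?thesis .
qed

lemma rescaled_time_negative:
  fixes x y :: "real ^ 'd::finite"
  assumes "e \<in> edges_in (qbox 0 n)" "t e < 0" "x \<in> unit_cube" "y \<in> unit_cube"
  shows "rescaled_time b t n unit_cube x y = Inf UNIV / real n"
  unfolding rescaled_time_eq
  by (subst Inf_unbounded_below, rule negative_edge_unbounded[where t = t and e = e, OF assms(1,2)])
     (simp_all add: unit_cube_scale assms(3,4))

lemma crossing_time_ge_iff:
  fixes t :: "(int ^ 'd::finite) set \<Rightarrow> real"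
  assumes "\<forall>e\<in>edges_in (qbox 0 n :: (real ^ 'd) set). 0 \<le> t e" "0 \<le> b"
  shows "c \<le> crossing_time b t n i \<longleftrightarrow> (\<forall>p\<in>crossing_paths n i. c \<le> path_time b t p)"
  unfolding crossing_time_def
proof (rule le_cINF_iff)
  show "crossing_paths n i \<noteq> {}" using direct_crossing by blast
  show "bdd_below (path_time b t ` crossing_paths n i)"
    by (rule bdd_below_path_times[where t = t, OF assms]) (auto simp: crossing_paths_def)
qed

lemma crossing_time_negative:
  fixes t :: "(int ^ 'd::finite) set \<Rightarrow> real"
  assumes "e \<in> edges_in (qbox 0 n)" "t e < 0"
  shows "crossing_time b t n i = Inf UNIV"
  unfolding crossing_time_def
proof (rule Inf_unbounded_below)
  have "path_time b t ` paths_between (qbox 0 n) 0 (axis i (real n)) \<subseteq> path_time b t ` crossing_paths n i"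
    by (auto simp: paths_between_def crossing_paths_def axis_def)
  then show "\<not> bdd_below (path_time b t ` crossing_paths n i)"
    using negative_edge_unbounded[where t = t and e = e, OF assms zero_in_qbox opposite_corner, of b i]
      bdd_below_mono by (metis (no_types))
qed

text \<open>With nonnegative weights in the box both sides have the same lower bounds. With a
  negative weight every inner infimum is the default value, so the outer infimum runs over a
  singleton, and the right-hand side degenerates to the same number.\<close>

lemma rescaled_set_time_eq:
  fixes t :: "(int ^ 'd::finite) set \<Rightarrow> real"
  assumes n: "1 \<le> n" and b: "0 \<le> b"
  shows "rescaled_set_time b t n unit_cube (face0 i) (face1 i) = crossing_time b t n i / real n"
proof -
  let ?A = "{rescaled_time b t n unit_cube x y | x y. x \<in> face0 i \<and> y \<in> face1 i}"
  have f: "(0::real ^ 'd) \<in> face0 i" "axis i 1 \<in> face1 i"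
    by (auto simp: face0_def face1_def unit_cube_def axis_def)
  have sub: "x \<in> unit_cube" if "x \<in> face0 i \<or> x \<in> face1 i" for x :: "real ^ 'd"
    using that by (auto simp: face0_def face1_def)
  show ?thesis
  proof (cases "\<exists>e\<in>edges_in (qbox 0 n). t e < 0")
    case True
    then obtain e where e: "e \<in> edges_in (qbox 0 n)" "t e < 0" by blast
    have "?A = {Inf UNIV / real n}"
    proof (intro equalityI subsetI)
      fix r assume "r \<in> ?A"
      then show "r \<in> {Inf UNIV / real n}"
        using rescaled_time_negative[where t = t and e = e, OF e] sub by auto
    next
      fix r assume "r \<in> {Inf UNIV / real n}"
      then have "r = rescaled_time b t n unit_cube 0 (axis i 1)"
        using rescaled_time_negative[where t = t and e = e, OF e] sub f by auto
      then show "r \<in> ?A" using f by blast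
    qed
    then show ?thesis by (simp add: rescaled_set_time_def crossing_time_negative[where t = t and e = e, OF e])
  next
    case False
    then have nn: "\<forall>e\<in>edges_in (qbox 0 n). 0 \<le> t e" by fastforce
    note iff = rescaled_time_ge_iff[where t = t, OF nn b n]
    have bdd: "bdd_below ?A"
    proof (rule bdd_belowI[of _ 0])
      fix r assume "r \<in> ?A"
      then obtain x y where r: "r = rescaled_time b t n unit_cube x y" "x \<in> face0 i" "y \<in> face1 i" by blast
      show "0 \<le> r" unfolding r(1) using r sub
        by (subst iff) (auto simp: paths_between_def intro: path_time_nonneg[where t = t, OF nn b])
    qed
    show ?thesis
    proof (rule real_eq_by_lower_bounds)
      fix c
      have "c \<le> rescaled_set_time b t n unit_cube (face0 i) (face1 i) \<longleftrightarrow>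
          (\<forall>x\<in>face0 i. \<forall>y\<in>face1 i. c \<le> rescaled_time b t n unit_cube x y)"
        unfolding rescaled_set_time_def using f by (subst le_cInf_iff[OF _ bdd]) blast+
      also have "\<dots> \<longleftrightarrow> (\<forall>x\<in>face0 i. \<forall>y\<in>face1 i.
          \<forall>p\<in>paths_between (qbox 0 n) (real n *\<^sub>R x) (real n *\<^sub>R y). c * real n \<le> path_time b t p)"
        by (intro ball_cong refl iff) (simp_all add: sub)
      also have "\<dots> \<longleftrightarrow> (\<forall>p\<in>crossing_paths n i. c * real n \<le> path_time b t p)"
      proof (intro iffI ballI)
        fix p assume *: "\<forall>x\<in>face0 i. \<forall>y\<in>face1 i.
          \<forall>p\<in>paths_between (qbox 0 n) (real n *\<^sub>R x) (real n *\<^sub>R y). c * real n \<le> path_time b t p"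
          and p: "p \<in> crossing_paths n i"
        have X: "hd p \<in> qbox 0 n" "last p \<in> qbox 0 n" using p by (auto simp: crossing_paths_def path_in_def)
        have "(1 / real n) *\<^sub>R hd p \<in> face0 i" "(1 / real n) *\<^sub>R last p \<in> face1 i"
          using p n qbox_rescale[OF X(1) n] qbox_rescale[OF X(2) n]
          by (auto simp: face0_def face1_def crossing_paths_def)
        moreover have "p \<in> paths_between (qbox 0 n) (real n *\<^sub>R ((1 / real n) *\<^sub>R hd p)) (real n *\<^sub>R ((1 / real n) *\<^sub>R last p))"
          using p n by (auto simp: paths_between_def crossing_paths_def)
        ultimately show "c * real n \<le> path_time b t p" using * by blast
      next
        fix x y p assume "\<forall>p\<in>crossing_paths n i. c * real n \<le> path_time b t p"
          "x \<in> face0 i" "y \<in> face1 i" "p \<in> paths_between (qbox 0 n) (real n *\<^sub>R x) (real n *\<^sub>R y)"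
        then show "c * real n \<le> path_time b t p"
          by (auto simp: paths_between_def crossing_paths_def face0_def face1_def)
      qed
      also have "\<dots> \<longleftrightarrow> c \<le> crossing_time b t n i / real n"
        using n by (simp add: crossing_time_ge_iff[where t = t, OF nn b] pos_le_divide_eq)
      finally show "c \<le> rescaled_set_time b t n unit_cube (face0 i) (face1 i) \<longleftrightarrow> c \<le> crossing_time b t n i / real n" .
    qed
  qed
qed

lemma T_cross_nth:
  fixes t :: "(int ^ 'd::finite) set \<Rightarrow> real"
  shows "1 \<le> n \<Longrightarrow> 0 \<le> b \<Longrightarrow> T_cross b t n $ i = crossing_time b t n i / real n"
  by (simp add: T_cross_def rescaled_set_time_eq)

definition linear_profile :: "real ^ 'd \<Rightarrow> 'd \<Rightarrow> real ^ 'd \<Rightarrow> real" where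
  "linear_profile \<zeta> j x = \<zeta> $ j * x $ j"

text \<open>Since \<open>g_cross\<close> is a maximum of seminorms that depend on one coordinate
  each, domination by it splits into one scalar condition per direction. Each of them compares the
  metric with increments of a single linear function, the kind of bound a potential
  certifies.\<close>

lemma rescaled_time_g_cross_iff:
  fixes t :: "(int ^ 'd::finite) set \<Rightarrow> real"
  assumes nn: "\<forall>e\<in>edges_in (qbox 0 n :: (real ^ 'd) set). 0 \<le> t e" "0 \<le> b" and n: "1 \<le> n"
    and \<zeta>: "\<And>i. 0 \<le> \<zeta> $ i"
  shows "(\<forall>x\<in>unit_cube. \<forall>y\<in>unit_cube. g_cross \<zeta> (x - y) - \<epsilon> \<le> rescaled_time b t n unit_cube x y) \<longleftrightarrow>
    t \<in> profile_event b (qbox 0 n) (linear_profile \<zeta>) (\<epsilon> * real n)"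
proof -
  have g: "(g_cross \<zeta> (x - y) - \<epsilon>) * real n \<le> c \<longleftrightarrow>
      (\<forall>j. \<bar>linear_profile \<zeta> j (real n *\<^sub>R y) - linear_profile \<zeta> j (real n *\<^sub>R x)\<bar> - \<epsilon> * real n \<le> c)" for x y c
  proof -
    have "(g_cross \<zeta> (x - y) - \<epsilon>) * real n \<le> c \<longleftrightarrow> g_cross \<zeta> (x - y) \<le> c / real n + \<epsilon>"
      using n by (simp add: field_simps)
    also have "\<dots> \<longleftrightarrow> (\<forall>j. \<zeta> $ j * \<bar>x $ j - y $ j\<bar> \<le> c / real n + \<epsilon>)"
      unfolding g_cross_def by (subst Max_le_iff) auto
    also have "\<dots> \<longleftrightarrow> (\<forall>j. real n * (\<zeta> $ j * \<bar>x $ j - y $ j\<bar>) - \<epsilon> * real n \<le> c)"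
      using n by (simp add: field_simps)
    also have "\<dots> \<longleftrightarrow> (\<forall>j. \<bar>linear_profile \<zeta> j (real n *\<^sub>R y) - linear_profile \<zeta> j (real n *\<^sub>R x)\<bar> - \<epsilon> * real n \<le> c)"
    proof -
      have "\<bar>linear_profile \<zeta> j (real n *\<^sub>R y) - linear_profile \<zeta> j (real n *\<^sub>R x)\<bar> = real n * (\<zeta> $ j * \<bar>x $ j - y $ j\<bar>)" for j
      proof -
        have "linear_profile \<zeta> j (real n *\<^sub>R y) - linear_profile \<zeta> j (real n *\<^sub>R x) = (real n * \<zeta> $ j) * (y $ j - x $ j)"
          by (simp add: linear_profile_def algebra_simps)
        then show ?thesis using \<zeta>[of j] by (simp add: abs_mult abs_minus_commute)
      qed
      then show ?thesis by simp
    qed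
    finally show ?thesis .
  qed
  have "(\<forall>x\<in>unit_cube. \<forall>y\<in>unit_cube. g_cross \<zeta> (x - y) - \<epsilon> \<le> rescaled_time b t n unit_cube x y) \<longleftrightarrow>
    (\<forall>x\<in>unit_cube. \<forall>y\<in>unit_cube. \<forall>p\<in>paths_between (qbox 0 n) (real n *\<^sub>R x) (real n *\<^sub>R y).
       \<forall>j. \<bar>linear_profile \<zeta> j (real n *\<^sub>R y) - linear_profile \<zeta> j (real n *\<^sub>R x)\<bar> - \<epsilon> * real n \<le> path_time b t p)"
    by (intro ball_cong refl) (simp add: rescaled_time_ge_iff[where t = t, OF nn n] g)
  also have "\<dots> \<longleftrightarrow> t \<in> profile_event b (qbox 0 n) (linear_profile \<zeta>) (\<epsilon> * real n)"
    unfolding profile_event_def mem_Collect_eq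
  proof (intro iffI allI impI ballI)
    fix j and p :: "(real ^ 'd) list" assume *: "\<forall>x\<in>unit_cube. \<forall>y\<in>unit_cube. \<forall>p\<in>paths_between (qbox 0 n) (real n *\<^sub>R x) (real n *\<^sub>R y).
       \<forall>j. \<bar>linear_profile \<zeta> j (real n *\<^sub>R y) - linear_profile \<zeta> j (real n *\<^sub>R x)\<bar> - \<epsilon> * real n \<le> path_time b t p"
      and p: "path_in (qbox 0 n) p"
    have X: "hd p \<in> qbox 0 n" "last p \<in> qbox 0 n" using p by (auto simp: path_in_def)
    have eq: "real n *\<^sub>R ((1 / real n) *\<^sub>R z) = z" for z :: "real ^ 'd" using n by simp
    have "p \<in> paths_between (qbox 0 n) (real n *\<^sub>R ((1 / real n) *\<^sub>R hd p)) (real n *\<^sub>R ((1 / real n) *\<^sub>R last p))"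
      using p n by (auto simp: paths_between_def)
    from *[THEN bspec, OF qbox_rescale[OF X(1) n], THEN bspec, OF qbox_rescale[OF X(2) n], THEN bspec, OF this, THEN spec, of j]
    show "\<bar>linear_profile \<zeta> j (last p) - linear_profile \<zeta> j (hd p)\<bar> - \<epsilon> * real n \<le> path_time b t p"
      unfolding eq .
  next
    fix x y :: "real ^ 'd" and p j
    assume *: "\<forall>j p. path_in (qbox 0 n) p \<longrightarrow>
        \<bar>linear_profile \<zeta> j (last p) - linear_profile \<zeta> j (hd p)\<bar> - \<epsilon> * real n \<le> path_time b t p"
      and "p \<in> paths_between (qbox 0 n) (real n *\<^sub>R x) (real n *\<^sub>R y)"
    then have p: "path_in (qbox 0 n) p" "hd p = real n *\<^sub>R x" "last p = real n *\<^sub>R y"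
      by (auto simp: paths_between_def)
    show "\<bar>linear_profile \<zeta> j (real n *\<^sub>R y) - linear_profile \<zeta> j (real n *\<^sub>R x)\<bar> - \<epsilon> * real n \<le> path_time b t p"
      using *[rule_format, OF p(1), of j] unfolding p(2,3) .
  qed
  finally show ?thesis .
qed

text \<open>The travel time from the starting face: the infimum formula with that face as source and
  initial value 0. Conversely, \<open>crossing_time_ge_potential\<close> reads a crossing time off a
  potential.\<close>

lemma crossing_potential:
  fixes t :: "(int ^ 'd::finite) set \<Rightarrow> real"
  assumes t: "bounded_config b t" "0 \<le> b"
  obtains f where "potential b t (qbox 0 n) f" "\<And>x. x \<in> qbox 0 n \<Longrightarrow> 0 \<le> f x"
    "\<And>x. x \<in> qbox 0 n \<Longrightarrow> x $ i = 0 \<Longrightarrow> f x = 0"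
    "\<And>x. x \<in> qbox 0 n \<Longrightarrow> x $ i = real n \<Longrightarrow> crossing_time b t n i \<le> f x"
proof -
  have nn: "\<forall>e\<in>edges_in (qbox 0 n). 0 \<le> t e" using t by (auto simp: bounded_config_def edges_in_def)
  let ?S = "{x \<in> qbox 0 n. x $ i = 0}"
  have S: "?S \<noteq> {}" using zero_in_qbox zero_index by blast
  obtain f where f: "potential b t (qbox 0 n) f" "\<And>x. x \<in> ?S \<Longrightarrow> f x \<le> 0"
    "\<And>y C. y \<in> qbox 0 n \<Longrightarrow> (\<And>p. path_in (qbox 0 n) p \<Longrightarrow> hd p \<in> ?S \<Longrightarrow> last p = y \<Longrightarrow> C \<le> 0 + path_time b t p)
       \<Longrightarrow> C \<le> f y"
    by (rule potential_from_times[OF refl t, of ?S 0 n 0 "\<lambda>_. 0"]) (use S in auto)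
  have f0: "0 \<le> f x" if "x \<in> qbox 0 n" for x
    using f(3)[OF that, of 0] path_time_nonneg[where t = t, OF nn t(2)] by auto
  have "crossing_time b t n i \<le> f x" if "x \<in> qbox 0 n" "x $ i = real n" for x
  proof (rule f(3)[OF that(1)])
    fix p assume "path_in (qbox 0 n) p" "hd p \<in> ?S" "last p = x"
    then have "p \<in> crossing_paths n i" using that by (auto simp: crossing_paths_def)
    then show "crossing_time b t n i \<le> 0 + path_time b t p"
      using crossing_time_ge_iff[where t = t, OF nn t(2), where c = "crossing_time b t n i"] by auto
  qed
  moreover have "f x = 0" if "x \<in> qbox 0 n" "x $ i = 0" for x using f(2)[of x] f0[of x] that by auto
  ultimately show thesis using that f(1) f0 by blast
qed

lemma crossing_time_ge_potential:
  fixes t :: "(int ^ 'd::finite) set \<Rightarrow> real"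
  assumes nn: "\<forall>e\<in>edges_in (qbox 0 n :: (real ^ 'd) set). 0 \<le> t e" "0 \<le> b"
    and f: "potential b t (qbox 0 n) f"
    and C: "\<And>x y. x \<in> qbox 0 n \<Longrightarrow> y \<in> qbox 0 n \<Longrightarrow> x $ i = 0 \<Longrightarrow> y $ i = real n \<Longrightarrow> C \<le> f y - f x"
  shows "C \<le> crossing_time b t n i"
  unfolding crossing_time_ge_iff[where t = t, OF nn]
proof
  fix p assume "p \<in> crossing_paths n i"
  then have p: "path_in (qbox 0 n) p" "hd p $ i = 0" "last p $ i = real n" by (auto simp: crossing_paths_def)
  then have "hd p \<in> qbox 0 n" "last p \<in> qbox 0 n" by (auto simp: path_in_def)
  then show "C \<le> path_time b t p" using C p potential_path_time[OF f p(1)] by fastforce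
qed

text \<open>Collapse the range of the potential along the edge \<open>e0\<close>.\<close>

lemma crossing_time_single_edge:
  fixes t t' :: "(int ^ 'd::finite) set \<Rightarrow> real"
  assumes t: "bounded_config b t" "bounded_config b t'" "0 \<le> b"
    and e0: "e0 \<in> lattice_edges" and eq: "\<And>e. e \<in> lattice_edges \<Longrightarrow> e \<noteq> e0 \<Longrightarrow> t' e = t e"
  shows "crossing_time b t n i - b \<le> crossing_time b t' n i"
proof (cases "e0 \<in> edges_in (qbox 0 n)")
  case False
  have "path_time b t p = path_time b t' p" if "p \<in> crossing_paths n i" for p
  proof (rule path_time_cong)
    show "path_in (qbox 0 n) p" using that by (simp add: crossing_paths_def)
    fix e :: "(int ^ 'd) set" assume "e \<in> edges_in (qbox 0 n)"
    then show "t e = t' e" using False eq[of e] edges_in_lattice[of e] by metis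
  qed
  then have "crossing_time b t n i = crossing_time b t' n i" unfolding crossing_time_def by simp
  then show ?thesis using t(3) by simp
next
  case True
  have nn: "\<forall>e\<in>edges_in (qbox 0 n). 0 \<le> t' e" using t by (auto simp: bounded_config_def edges_in_def)
  have sub: "edge_segment e0 \<subseteq> qbox 0 n" using edge_segment_subset[OF True convex_qbox] .
  obtain f where f: "potential b t (qbox 0 n) f" "\<And>x. x \<in> qbox 0 n \<Longrightarrow> 0 \<le> f x"
    "\<And>x. x \<in> qbox 0 n \<Longrightarrow> x $ i = 0 \<Longrightarrow> f x = 0"
    "\<And>x. x \<in> qbox 0 n \<Longrightarrow> x $ i = real n \<Longrightarrow> crossing_time b t n i \<le> f x"
    by (rule crossing_potential[OF t(1,3)]) blast
  let ?R = "f ` edge_segment e0"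
  have near: "\<bar>f z - f z'\<bar> \<le> b" if "z \<in> edge_segment e0" "z' \<in> edge_segment e0" for z z'
  proof -
    have "\<bar>f z - f z'\<bar> \<le> b * l1_norm (z - z')" using f(1) that sub unfolding potential_def by blast
    also have "\<dots> \<le> b * 1" using edge_segment_l1_le_1[OF e0 that] t(3) by (intro mult_left_mono)
    finally show ?thesis by simp
  qed
  obtain z0 where z0: "z0 \<in> edge_segment e0"
    using e0 by (auto simp: lattice_edges_def edge_segment_def intro: hull_inc)
  have bdd: "bdd_below ?R" "bdd_above ?R"
    using near[OF _ z0] by (auto intro!: bdd_belowI[of _ "f z0 - b"] bdd_aboveI[of _ "f z0 + b"]) fastforce+
  define lo where "lo = Inf ?R"
  define hi where "hi = Sup ?R"
  have range: "lo \<le> f z" "f z \<le> hi" if "z \<in> edge_segment e0" for z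
    using that bdd by (auto simp: lo_def hi_def intro: cINF_lower cSUP_upper)
  have "hi \<le> lo + b"
    unfolding hi_def
  proof (rule cSUP_least)
    fix z assume z: "z \<in> edge_segment e0"
    have "f z - b \<le> lo" unfolding lo_def using z0 near[OF z] by (intro cINF_greatest) (auto, fastforce)
    then show "f z \<le> lo + b" by simp
  qed (use z0 in blast)
  \<comment> \<open>\<open>g\<close> has slope 1 except on [\<open>lo\<close>, \<open>hi\<close>],
    where it is constant. It makes the potential constant on \<open>e0\<close>, so any weight of
    \<open>e0\<close> is admissible, and it lowers values by at most \<open>hi\<close> -
    \<open>lo\<close>, which is at most b. As \<open>lo\<close> is nonnegative, the value 0 on the
    starting face survives.\<close>
  define g where "g r = min r lo + max (r - hi) 0" for r
  have lohi: "lo \<le> hi" using range[OF z0] by simp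
  have lo0: "0 \<le> lo" unfolding lo_def using z0 sub f(2) by (intro cINF_greatest) auto
  have g1: "\<bar>g r - g s\<bar> \<le> \<bar>r - s\<bar>" for r s using lohi by (auto simp: g_def min_def max_def)
  have pot: "potential b t (qbox 0 n) (\<lambda>x. g (f x))" by (rule potential_transform[OF f(1) g1])
  have "potential b t' (qbox 0 n) (\<lambda>x. g (f x))"
    unfolding potential_def
  proof (intro conjI ballI)
    fix e :: "(int ^ 'd) set" and z z' :: "real ^ 'd" assume e: "e \<in> edges_in (qbox 0 n)" "z \<in> edge_segment e" "z' \<in> edge_segment e"
    show "\<bar>g (f z) - g (f z')\<bar> \<le> t' e * l1_norm (z - z')"
    proof (cases "e = e0")
      case True
      then have "g (f z) = lo" "g (f z') = lo" using range e by (auto simp: g_def)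
      then show ?thesis using bspec[OF nn e(1)] by simp
    next
      case False
      then show ?thesis using pot e eq[OF edges_in_lattice[OF e(1)]] by (auto simp: potential_def)
    qed
  qed (use pot in \<open>auto simp: potential_def\<close>)
  then show ?thesis
  proof (rule crossing_time_ge_potential[where t = t', OF nn t(3)])
    fix x y :: "real ^ 'd" assume xy: "x \<in> qbox 0 n" "y \<in> qbox 0 n" "x $ i = 0" "y $ i = real n"
    have "g (f x) = 0" using f(3)[OF xy(1,3)] lo0 lohi by (simp add: g_def)
    moreover have "f y - b \<le> g (f y)" using lohi \<open>hi \<le> lo + b\<close> by (auto simp: g_def min_def max_def)
    ultimately show "crossing_time b t n i - b \<le> g (f y) - g (f x)" using f(4)[OF xy(2,4)] by simp
  qed
qed

text \<open>A potential that vanishes on the starting face stays a potential whatever the weights inside that face.\<close>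

lemma crossing_time_face_edges:
  fixes t t' :: "(int ^ 'd::finite) set \<Rightarrow> real"
  assumes t: "bounded_config b t" "bounded_config b t'" "0 \<le> b"
    and eq: "\<And>e. e \<in> edges_in (qbox 0 n) \<Longrightarrow> \<not> (\<forall>v\<in>e. v $ i = 0) \<Longrightarrow> t' e = t e"
  shows "crossing_time b t n i \<le> crossing_time b t' n i"
proof -
  have nn: "\<forall>e\<in>edges_in (qbox 0 n). 0 \<le> t' e" using t by (auto simp: bounded_config_def edges_in_def)
  obtain f where f: "potential b t (qbox 0 n) f"
    "\<And>x. x \<in> qbox 0 n \<Longrightarrow> x $ i = 0 \<Longrightarrow> f x = 0"
    "\<And>x. x \<in> qbox 0 n \<Longrightarrow> x $ i = real n \<Longrightarrow> crossing_time b t n i \<le> f x"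
    by (rule crossing_potential[OF t(1,3)]) blast
  have "potential b t' (qbox 0 n) f"
    unfolding potential_def
  proof (intro conjI ballI)
    fix e :: "(int ^ 'd) set" and z z' :: "real ^ 'd" assume e: "e \<in> edges_in (qbox 0 n)" "z \<in> edge_segment e" "z' \<in> edge_segment e"
    show "\<bar>f z - f z'\<bar> \<le> t' e * l1_norm (z - z')"
    proof (cases "\<forall>v\<in>e. v $ i = 0")
      case True
      have "convex {x :: real ^ 'd. x $ i = 0}" by (auto simp: convex_alt)
      then have "edge_segment e \<subseteq> {x. x $ i = 0}"
        unfolding edge_segment_def using True by (intro hull_minimal) auto
      moreover have "edge_segment e \<subseteq> qbox 0 n" using edge_segment_subset[OF e(1) convex_qbox] .
      ultimately have "f z = 0" "f z' = 0" using e f(2) by auto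
      then show ?thesis using bspec[OF nn e(1)] by simp
    next
      case False
      then show ?thesis using f(1) e eq by (auto simp: potential_def)
    qed
  qed (use f(1) in \<open>auto simp: potential_def\<close>)
  then show ?thesis
    by (rule crossing_time_ge_potential[where t = t', OF nn t(3)]) (use f(2,3) in auto)
qed

lemma crossing_time_le:
  fixes t :: "(int ^ 'd::finite) set \<Rightarrow> real"
  assumes t: "bounded_config b t" "0 \<le> b" and p: "p \<in> crossing_paths n i"
  shows "crossing_time b t n i \<le> path_time b t p"
proof -
  have nn: "\<forall>e\<in>edges_in (qbox 0 n). 0 \<le> t e" using t by (auto simp: bounded_config_def edges_in_def)
  show ?thesis using crossing_time_ge_iff[where t = t, OF nn t(2), where c = "crossing_time b t n i"] p by blast
qed

lemma crossing_time_bounds: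
  fixes t :: "(int ^ 'd::finite) set \<Rightarrow> real"
  assumes t: "bounded_config b t" and ab: "0 \<le> a" "a \<le> b" and a: "\<And>e. e \<in> lattice_edges \<Longrightarrow> a \<le> t e"
  shows "a * real n \<le> crossing_time b t n i" "crossing_time b t n i \<le> b * real n"
proof -
  have b: "0 \<le> b" using ab by simp
  have nn: "\<forall>e\<in>edges_in (qbox 0 n). 0 \<le> t e" using t by (auto simp: bounded_config_def edges_in_def)
  have *: "\<bar>a * z $ i - a * z' $ i\<bar> \<le> s * l1_norm (z - z')" if "a \<le> s" for s and z z' :: "real ^ 'd"
  proof -
    have "\<bar>a * z $ i - a * z' $ i\<bar> = a * \<bar>z $ i - z' $ i\<bar>"
      using ab by (simp add: abs_mult flip: right_diff_distrib)
    also have "\<dots> \<le> s * l1_norm (z - z')"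
      using that ab component_le_l1_norm by (intro mult_mono) auto
    finally show ?thesis .
  qed
  have "potential b t (qbox 0 n) (\<lambda>x. a * x $ i)"
    unfolding potential_def using * a ab(2) by (auto simp: edges_in_def)
  then show "a * real n \<le> crossing_time b t n i"
    by (rule crossing_time_ge_potential[where t = t, OF nn b]) auto
  have "crossing_time b t n i \<le> point_time b t 0 (axis i (real n))"
    using crossing_time_le[OF t b direct_crossing[of i n]] by simp
  also have "\<dots> \<le> b * l1_norm (0 - axis i (real n) :: real ^ 'd)" by (rule point_time_le[OF t])
  also have "l1_norm (0 - axis i (real n) :: real ^ 'd) = real n"
    by (subst l1_norm_single_coordinate[where i = i]) (auto simp: axis_def)
  finally show "crossing_time b t n i \<le> b * real n" .
qed

text \<open>Used for all lattice lines of a direction in the Chernoff bound, and for the coordinate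
  axis alone when its weights are replaced by small ones.\<close>

lemma crossing_time_le_line:
  fixes t :: "(int ^ 'd::finite) set \<Rightarrow> real"
  assumes t: "bounded_config b t" "0 \<le> b" and v: "\<And>j. 0 \<le> v $ j \<and> v $ j \<le> int n" "v $ i = 0"
  shows "crossing_time b t n i \<le> (\<Sum>k<n. t (unit_edge (v + axis i (int k)) i))"
proof -
  define q where "q k = lattice_point (v + axis i (int k))" for k
  define p where "p k = map q [0..<Suc k]" for k
  have pt: "point_time b t (q k) (q (Suc k)) = t (unit_edge (v + axis i (int k)) i)" for k
  proof -
    have "q k \<in> edge_segment (unit_edge (v + axis i (int k)) i)"
      "q (Suc k) \<in> edge_segment (unit_edge (v + axis i (int k)) i)"
      by (auto simp: edge_segment_unit_edge q_def axis_def)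
    moreover have "l1_norm (q k - q (Suc k)) = 1"
      by (subst l1_norm_single_coordinate[where i = i]) (auto simp: q_def axis_def)
    ultimately show ?thesis by (subst point_time_edge) auto
  qed
  have "path_time b t (p m) = (\<Sum>k<m. t (unit_edge (v + axis i (int k)) i))" for m
  proof (induction m)
    case (Suc m)
    have "path_time b t (p (Suc m)) = path_time b t (p m @ [q (Suc m)])" by (simp add: p_def)
    also have "\<dots> = path_time b t (p m) + point_time b t (q m) (q (Suc m))"
      by (subst path_time_append) (auto simp: p_def)
    finally show ?case using Suc pt by simp
  qed (simp add: p_def)
  moreover have "p n \<in> crossing_paths n i"
  proof -
    have "q k \<in> qbox 0 n" if "k \<le> n" for k
    proof -
      have "0 \<le> q k $ j \<and> q k $ j \<le> real n" for j
      proof (cases "j = i")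
        case True
        then show ?thesis using v(2) that by (simp add: q_def axis_def)
      next
        case False
        then have "q k $ j = of_int (v $ j)" by (simp add: q_def axis_def)
        moreover have "(0::real) \<le> of_int (v $ j)" "of_int (v $ j) \<le> real n" using v(1)[of j] by linarith+
        ultimately show ?thesis by simp
      qed
      then show ?thesis by (simp add: qbox_def)
    qed
    moreover have "hd (p n) = q 0" "last (p n) = q n" by (simp_all add: p_def hd_append hd_map)
    moreover have "q 0 $ i = 0" "q n $ i = real n" using v(2) by (auto simp: q_def axis_def)
    ultimately show ?thesis by (auto simp: crossing_paths_def path_in_def p_def)
  qed
  ultimately show ?thesis using crossing_time_le[OF t] by metis
qed

section \<open>Local events and independence\<close>

text \<open>Events are sets of total configurations, whereas the product
  \<open>\<sigma>\<close>-algebra lives on functions that are extensional on S. Hence the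
  intersection with its space; the first conjunct makes the values outside S irrelevant.\<close>

definition local_event :: "'e set \<Rightarrow> ('e \<Rightarrow> real) set \<Rightarrow> bool" where
  "local_event S C \<longleftrightarrow>
     (\<forall>t t'. (\<forall>e\<in>S. t e = t' e) \<longrightarrow> t \<in> C \<longrightarrow> t' \<in> C) \<and>
     C \<inter> space (\<Pi>\<^sub>M e\<in>S. borel) \<in> sets (\<Pi>\<^sub>M e\<in>S. borel)"

lemma local_event_cong:
  assumes "local_event S C" "\<And>e. e \<in> S \<Longrightarrow> t e = t' e"
  shows "t \<in> C \<longleftrightarrow> t' \<in> C"
proof -
  have "\<forall>t t'. (\<forall>e\<in>S. t e = t' e) \<longrightarrow> t \<in> C \<longrightarrow> t' \<in> C" using assms(1) by (simp add: local_event_def)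
  from this[rule_format, of t t'] this[rule_format, of t' t] show ?thesis using assms(2) by auto
qed

lemma local_event_Compl:
  assumes "local_event S C" shows "local_event S (- C)"
proof -
  let ?P = "\<Pi>\<^sub>M e\<in>S. (borel :: real measure)"
  have "(- C) \<inter> space ?P = space ?P - C \<inter> space ?P" by blast
  then show ?thesis using assms local_event_cong[OF assms] unfolding local_event_def
    by (metis Compl_iff sets.compl_sets)
qed

lemma local_event_Int:
  assumes "local_event S C" "local_event S D" shows "local_event S (C \<inter> D)"
proof -
  let ?P = "\<Pi>\<^sub>M e\<in>S. (borel :: real measure)"
  have eq: "C \<inter> D \<inter> space ?P = (C \<inter> space ?P) \<inter> (D \<inter> space ?P)" by blast
  have "C \<inter> D \<inter> space ?P \<in> sets ?P"
    unfolding eq by (rule sets.Int) (use assms in \<open>simp_all only: local_event_def\<close>)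
  moreover have "t' \<in> C \<inter> D" if "\<forall>e\<in>S. t e = t' e" "t \<in> C \<inter> D" for t t'
    using that local_event_cong[OF assms(1), of t t'] local_event_cong[OF assms(2), of t t'] by auto
  ultimately show ?thesis unfolding local_event_def by blast
qed

lemma local_event_Un:
  assumes "local_event S C" "local_event S D" shows "local_event S (C \<union> D)"
  using local_event_Compl[OF local_event_Int[OF local_event_Compl[OF assms(1)] local_event_Compl[OF assms(2)]]]
  by simp

lemma local_event_const: "local_event S {t. Q}"
  by (cases Q) (auto simp: local_event_def)

lemma continuous_point_time:
  "continuous_on UNIV (\<lambda>y :: nat \<Rightarrow> real. point_time b (\<lambda>e. y (g e)) z z')"
proof -
  have "continuous_on UNIV (\<lambda>y :: nat \<Rightarrow> real. if Q then y i * c else d)" for Q i c d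
    by (cases Q) (auto intro!: continuous_on_mult continuous_on_product_coordinates)
  then show ?thesis unfolding point_time_def .
qed

lemma continuous_path_time:
  "continuous_on UNIV (\<lambda>y :: nat \<Rightarrow> real. path_time b (\<lambda>e. y (g e)) p)"
  unfolding path_time_def by (intro continuous_on_sum continuous_point_time)

text \<open>Lower bounds on uncountably many path times define a closed set, hence a measurable one.\<close>

lemma local_event_path_times:
  fixes Q :: "(real ^ 'd::finite) list set"
  assumes Q: "\<And>p. p \<in> Q \<Longrightarrow> path_in (qbox c m) p" and fin: "finite (edges_in (qbox c m :: (real ^ 'd) set))"
  shows "local_event (edges_in (qbox c m)) {t. \<forall>p\<in>Q. r p \<le> path_time b t p}"
proof -
  let ?E = "edges_in (qbox c m) :: (int ^ 'd) set set"
  let ?C = "{t. \<forall>p\<in>Q. r p \<le> path_time b t p}"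
  let ?P = "\<Pi>\<^sub>M e\<in>?E. (borel :: real measure)"
  \<comment> \<open>The edges are numbered to move to functions on the naturals, where a map into
    the product topology is Borel measurable as soon as its coordinates are. Closed sets of weights
    then become available.\<close>
  define g where "g = to_nat_on ?E"
  define h where "h = from_nat_into ?E"
  have hg: "h (g e) = e" if "e \<in> ?E" for e
    using that fin by (simp add: g_def h_def countable_finite)
  define \<Phi> :: "((int ^ 'd) set \<Rightarrow> real) \<Rightarrow> nat \<Rightarrow> real" where "\<Phi> x = (\<lambda>n. if h n \<in> ?E then x (h n) else 0)" for x
  have \<Phi>: "\<Phi> \<in> borel_measurable ?P"
  proof (rule measurable_coordinatewise_then_product)
    show "(\<lambda>x. \<Phi> x n) \<in> borel_measurable ?P" for n
      unfolding \<Phi>_def by (cases "h n \<in> ?E") (auto intro: measurable_component_singleton)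
  qed
  have cl: "closed {y. \<forall>p\<in>Q. r p \<le> path_time b (\<lambda>e. y (g e)) p}"
  proof -
    have "closed {y :: nat \<Rightarrow> real. r p \<le> path_time b (\<lambda>e. y (g e)) p}" for p
      by (intro closed_Collect_le continuous_path_time continuous_on_const)
    then have "closed (\<Inter>p\<in>Q. {y :: nat \<Rightarrow> real. r p \<le> path_time b (\<lambda>e. y (g e)) p})" by (intro closed_INT) auto
    then show ?thesis by (simp add: Collect_ball_eq)
  qed
  have "\<Phi> -` {y. \<forall>p\<in>Q. r p \<le> path_time b (\<lambda>e. y (g e)) p} \<inter> space ?P \<in> sets ?P"
    by (rule measurable_sets[OF \<Phi> borel_closed[OF cl]])
  also have "\<Phi> -` {y. \<forall>p\<in>Q. r p \<le> path_time b (\<lambda>e. y (g e)) p} \<inter> space ?P = ?C \<inter> space ?P"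
  proof -
    have "path_time b (\<lambda>e. \<Phi> x (g e)) p = path_time b x p" if "p \<in> Q" for p x
      by (rule path_time_cong[OF Q[OF that]]) (simp add: \<Phi>_def hg)
    then show ?thesis by auto
  qed
  finally have "?C \<inter> space ?P \<in> sets ?P" .
  moreover have "t' \<in> ?C" if "\<forall>e\<in>?E. t e = t' e" "t \<in> ?C" for t t'
  proof -
    have "path_time b t p = path_time b t' p" if "p \<in> Q" for p
      by (rule path_time_cong[OF Q[OF that]]) (use \<open>\<forall>e\<in>?E. t e = t' e\<close> in auto)
    then show ?thesis using that by auto
  qed
  ultimately show ?thesis unfolding local_event_def by blast
qed

section \<open>Locality of the events used below\<close>

lemma finite_int_box: "finite {v :: int ^ 'd::finite. \<forall>i. v $ i \<in> A i}" if "\<And>i. finite (A i)"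
proof -
  have "{v :: int ^ 'd. \<forall>i. v $ i \<in> A i} \<subseteq> vec_lambda ` (\<Pi>\<^sub>E i\<in>UNIV. A i)"
    by (auto intro!: image_eqI[where x = "vec_nth _"])
  then show ?thesis by (rule finite_subset) (intro finite_imageI finite_PiE finite that)
qed

lemma lattice_point_qbox_iff:
  "lattice_point v \<in> qbox c m \<longleftrightarrow> (\<forall>i. v $ i \<in> {c $ i..c $ i + int m})"
proof -
  have "of_int (c $ i) \<le> (of_int (v $ i) :: real) \<and> of_int (v $ i) \<le> of_int (c $ i) + real m \<longleftrightarrow>
      v $ i \<in> {c $ i..c $ i + int m}" for i by (auto; linarith)
  then show ?thesis by (simp add: qbox_def)
qed

lemma finite_edges_in_qbox: "finite (edges_in (qbox c m :: (real ^ 'd::finite) set))"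
proof -
  let ?V = "{v :: int ^ 'd. \<forall>i. v $ i \<in> {c $ i..c $ i + int m}}"
  have "edges_in (qbox c m) \<subseteq> Pow ?V"
    by (auto simp: edges_in_def image_subset_iff lattice_point_qbox_iff)
  moreover have "finite ?V" by (rule finite_int_box) simp
  ultimately show ?thesis by (meson finite_Pow_iff finite_subset)
qed

lemma local_profile_event: "local_event (edges_in (qbox c m)) (profile_event b (qbox c m) h \<epsilon>)"
proof -
  have "profile_event b (qbox c m) h \<epsilon> =
    {t. \<forall>p\<in>{p. path_in (qbox c m) p}. (MAX j. \<bar>h j (last p) - h j (hd p)\<bar> - \<epsilon>) \<le> path_time b t p}"
    by (subst Max_le_iff) (auto simp: profile_event_def)
  then show ?thesis by (simp only:) (intro local_event_path_times finite_edges_in_qbox, simp)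
qed

definition crossing_event :: "real \<Rightarrow> nat \<Rightarrow> real ^ 'd \<Rightarrow> ((int ^ 'd) set \<Rightarrow> real) set" where
  "crossing_event b n \<zeta> = {t. \<forall>i. \<forall>p\<in>crossing_paths n i. \<zeta> $ i * real n \<le> path_time b t p}"

lemma local_crossing_bound:
  "local_event (edges_in (qbox 0 n)) {t. \<forall>p\<in>crossing_paths n i. c \<le> path_time b t p}"
  by (intro local_event_path_times finite_edges_in_qbox) (simp add: crossing_paths_def)

lemma local_event_INT:
  assumes "\<And>i. i \<in> I \<Longrightarrow> local_event S (C i)" "finite I" shows "local_event S (\<Inter>i\<in>I. C i)"
  using assms(2,1)
proof (induction I rule: finite_induct)
  case empty
  then show ?case using local_event_const[of S True] by simp
next
  case (insert x F)
  then show ?case using local_event_Int[of S "C x" "\<Inter>i\<in>F. C i"] by simp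
qed

lemma local_crossing_event: "local_event (edges_in (qbox 0 n)) (crossing_event b n \<zeta>)"
proof -
  have eq: "crossing_event b n \<zeta> = (\<Inter>i\<in>UNIV. {t. \<forall>p\<in>crossing_paths n i. \<zeta> $ i * real n \<le> path_time b t p})"
    by (auto simp: crossing_event_def)
  show ?thesis unfolding eq by (rule local_event_INT[OF local_crossing_bound finite])
qed

lemma local_nonneg:
  "local_event (edges_in (qbox c m :: (real ^ 'd::finite) set)) {t. \<forall>e\<in>edges_in (qbox c m :: (real ^ 'd) set). 0 \<le> t e}"
proof -
  let ?E = "edges_in (qbox c m) :: (int ^ 'd) set set"
  let ?P = "\<Pi>\<^sub>M e\<in>?E. (borel :: real measure)"
  have "{x \<in> space ?P. \<forall>e\<in>?E. 0 \<le> x e} \<in> sets ?P"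
    using finite_edges_in_qbox by measurable
  moreover have "{t. \<forall>e\<in>?E. 0 \<le> t e} \<inter> space ?P = {x \<in> space ?P. \<forall>e\<in>?E. 0 \<le> x e}" by blast
  ultimately show ?thesis unfolding local_event_def by auto
qed

lemma countable_lattice_edges: "countable (lattice_edges :: (int ^ 'd::finite) set set)"
proof -
  have "lattice_edges \<subseteq> (\<lambda>(v, i). unit_edge v i) ` (UNIV :: ((int ^ 'd) \<times> 'd) set)"
  proof
    fix e :: "(int ^ 'd) set" assume "e \<in> lattice_edges"
    then obtain v i where "e = unit_edge v i" by (rule lattice_edge_cases)
    then show "e \<in> (\<lambda>(v, i). unit_edge v i) ` (UNIV :: ((int ^ 'd) \<times> 'd) set)" by auto
  qed
  moreover have "countable (vec_lambda ` (\<Pi>\<^sub>E i\<in>(UNIV :: 'd set). (UNIV :: int set)))"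
    by (intro countable_image countable_PiE) auto
  then have "countable (UNIV :: (int ^ 'd) set)"
    by (rule countable_subset[rotated]) (auto intro!: image_eqI[where x = "vec_nth _"])
  then have "countable ((\<lambda>(v, i). unit_edge v i) ` ((UNIV :: (int ^ 'd) set) \<times> (UNIV :: 'd set)))"
    by (intro countable_image countable_SIGMA) (auto simp: countable_finite)
  ultimately show ?thesis by (auto intro: countable_subset)
qed

section \<open>The probability space with independent weights\<close>

locale passage_percolation = prob_space M
  for M :: "'w measure" +
  fixes \<nu> :: "real measure" and a b :: real and \<tau> :: "(int ^ 'd::finite) set \<Rightarrow> 'w \<Rightarrow> real"
  assumes d_ge_2: "CARD('d) \<ge> 2"
    and nu_prob: "prob_space \<nu>"
    and nu_sets: "sets \<nu> = sets borel"
    and nu_nonneg: "emeasure \<nu> {..<0} = 0"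
    and a_def: "ereal a = Inf (ereal ` measure_support \<nu>)"
    and b_def: "ereal b = Sup (ereal ` measure_support \<nu>)"
    and a_nonneg: "0 \<le> a"
    and a_less_b: "a < b"
    and tau_indep: "indep_vars (\<lambda>_. borel) \<tau> lattice_edges"
    and tau_distr: "\<And>e. e \<in> lattice_edges \<Longrightarrow> distr M borel (\<tau> e) = \<nu>"
begin

lemma b_pos: "0 < b" using a_nonneg a_less_b by simp

lemma tau_measurable: "e \<in> lattice_edges \<Longrightarrow> random_variable borel (\<tau> e)"
  using tau_indep by (simp add: indep_vars_def)

lemma tau_event:
  assumes "e \<in> lattice_edges" "B \<in> sets borel"
  shows "{\<omega> \<in> space M. \<tau> e \<omega> \<in> B} \<in> events"
proof -
  have "{\<omega> \<in> space M. \<tau> e \<omega> \<in> B} = \<tau> e -` B \<inter> space M" by auto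
  then show ?thesis using measurable_sets[OF tau_measurable[OF assms(1)] assms(2)] by simp
qed

lemma tau_prob:
  assumes "e \<in> lattice_edges" "B \<in> sets borel"
  shows "prob {\<omega> \<in> space M. \<tau> e \<omega> \<in> B} = measure \<nu> B"
proof -
  have "measure (distr M borel (\<tau> e)) B = prob (\<tau> e -` B \<inter> space M)"
    using assms tau_measurable by (intro measure_distr)
  then show ?thesis using tau_distr[OF assms(1)] by (simp add: vimage_def Int_def conj_commute)
qed

abbreviation cprob :: "((int ^ 'd) set \<Rightarrow> real) set \<Rightarrow> real" where
  "cprob C \<equiv> prob {\<omega> \<in> space M. (\<lambda>e. \<tau> e \<omega>) \<in> C}"

lemma reindexed_weights_measurable:
  assumes "\<sigma> ` E \<subseteq> lattice_edges"
  shows "(\<lambda>\<omega>. \<lambda>e\<in>E. \<tau> (\<sigma> e) \<omega>) \<in> measurable M (\<Pi>\<^sub>M e\<in>E. borel)"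
  using assms by (intro measurable_restrict tau_measurable) auto

text \<open>Along an injective map of edges the weights are again independent with law
  \<open>\<nu>\<close>. This contains the invariance under the translations and reflections of
  tiles, and the invariance under exchanging axis weights for fresh ones.\<close>

lemma reindexed_law:
  assumes "inj_on \<sigma> E" "\<sigma> ` E \<subseteq> lattice_edges"
  shows "distr M (\<Pi>\<^sub>M e\<in>E. borel) (\<lambda>\<omega>. \<lambda>e\<in>E. \<tau> (\<sigma> e) \<omega>) = (\<Pi>\<^sub>M e\<in>E. \<nu>)"
proof -
  let ?L = "lattice_edges :: (int ^ 'd) set set"
  let ?X = "\<lambda>\<omega>. \<lambda>e\<in>?L. \<tau> e \<omega>"
  have ne: "?L \<noteq> {}" using unit_edge_in_lattice_edges by blast
  have "distr M (\<Pi>\<^sub>M e\<in>?L. borel) ?X = (\<Pi>\<^sub>M e\<in>?L. distr M borel (\<tau> e))"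
    by (rule indep_vars_iff_distr_eq_PiM'[OF ne tau_measurable, THEN iffD1, OF _ tau_indep])
  also have "\<dots> = (\<Pi>\<^sub>M e\<in>?L. \<nu>)" by (intro PiM_cong) (auto simp: tau_distr)
  finally have law: "distr M (\<Pi>\<^sub>M e\<in>?L. borel) ?X = (\<Pi>\<^sub>M e\<in>?L. \<nu>)" .
  have sets: "sets (\<Pi>\<^sub>M e\<in>E. borel) = sets (\<Pi>\<^sub>M e\<in>E. \<nu>)" by (intro sets_PiM_cong) (auto simp: nu_sets)
  have r: "(\<lambda>x. \<lambda>e\<in>E. x (\<sigma> e)) \<in> measurable (\<Pi>\<^sub>M e\<in>?L. borel) (\<Pi>\<^sub>M e\<in>E. (borel :: real measure))"
    using assms(2) by (intro measurable_restrict measurable_component_singleton) auto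
  have "distr M (\<Pi>\<^sub>M e\<in>E. borel) (\<lambda>\<omega>. \<lambda>e\<in>E. \<tau> (\<sigma> e) \<omega>) =
      distr M (\<Pi>\<^sub>M e\<in>E. borel) ((\<lambda>x. \<lambda>e\<in>E. x (\<sigma> e)) \<circ> ?X)"
    using assms(2) by (intro distr_cong) (auto simp: restrict_def fun_eq_iff image_subset_iff)
  also have "\<dots> = distr (distr M (\<Pi>\<^sub>M e\<in>?L. borel) ?X) (\<Pi>\<^sub>M e\<in>E. borel) (\<lambda>x. \<lambda>e\<in>E. x (\<sigma> e))"
    using reindexed_weights_measurable[of "\<lambda>e. e" ?L] by (intro distr_distr[OF r, symmetric]) simp
  also have "\<dots> = distr (\<Pi>\<^sub>M e\<in>?L. \<nu>) (\<Pi>\<^sub>M e\<in>E. \<nu>) (\<lambda>x. \<lambda>e\<in>E. x (\<sigma> e))"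
    unfolding law using sets by (intro distr_cong) auto
  also have "\<dots> = (\<Pi>\<^sub>M e\<in>E. \<nu>)"
    using distr_PiM_reindex[of ?L "\<lambda>_. \<nu>" \<sigma> E] assms nu_prob by auto
  finally show ?thesis .
qed

lemma reindexed_event:
  assumes "local_event E C"
  shows "{\<omega> \<in> space M. (\<lambda>e. \<tau> (\<sigma> e) \<omega>) \<in> C} =
    (\<lambda>\<omega>. \<lambda>e\<in>E. \<tau> (\<sigma> e) \<omega>) -` (C \<inter> space (\<Pi>\<^sub>M e\<in>E. borel)) \<inter> space M"
proof -
  have "(\<lambda>e. \<tau> (\<sigma> e) \<omega>) \<in> C \<longleftrightarrow> (\<lambda>e\<in>E. \<tau> (\<sigma> e) \<omega>) \<in> C" for \<omega>
    by (rule local_event_cong[OF assms]) simp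
  then show ?thesis by (auto simp: space_PiM)
qed

lemma reindexed_event_measurable:
  assumes "local_event E C" "\<sigma> ` E \<subseteq> lattice_edges"
  shows "{\<omega> \<in> space M. (\<lambda>e. \<tau> (\<sigma> e) \<omega>) \<in> C} \<in> events"
  unfolding reindexed_event[OF assms(1)]
  using assms by (intro measurable_sets[OF reindexed_weights_measurable]) (auto simp: local_event_def)

lemma local_event_measurable:
  assumes "local_event E C" "E \<subseteq> lattice_edges"
  shows "{\<omega> \<in> space M. (\<lambda>e. \<tau> e \<omega>) \<in> C} \<in> events"
  using reindexed_event_measurable[of E C "\<lambda>e. e"] assms by simp

lemma reindexed_prob:
  assumes "local_event E C" "inj_on \<sigma> E" "\<sigma> ` E \<subseteq> lattice_edges" "E \<subseteq> lattice_edges"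
  shows "prob {\<omega> \<in> space M. (\<lambda>e. \<tau> (\<sigma> e) \<omega>) \<in> C} = cprob C"
proof -
  have C: "C \<inter> space (\<Pi>\<^sub>M e\<in>E. borel) \<in> sets (\<Pi>\<^sub>M e\<in>E. borel)" using assms(1) by (simp add: local_event_def)
  have "prob {\<omega> \<in> space M. (\<lambda>e. \<tau> (\<sigma> e) \<omega>) \<in> C} = measure (\<Pi>\<^sub>M e\<in>E. \<nu>) (C \<inter> space (\<Pi>\<^sub>M e\<in>E. borel))"
    if "inj_on \<sigma> E" "\<sigma> ` E \<subseteq> lattice_edges" for \<sigma>
    unfolding reindexed_event[OF assms(1)] reindexed_law[OF that, symmetric]
    by (rule measure_distr[OF reindexed_weights_measurable[OF that(2)] C, symmetric])
  from this[OF assms(2,3)] this[of "\<lambda>e. e"] show ?thesis using assms(4) by simp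
qed

text \<open>The blocks and the edges of \<open>R\<close> are pairwise disjoint groups of independent
  weights. One formula serves tiles together with corridors, the case without blocks (all weights
  large) and the case of a single block (a box with its fresh weights).\<close>

lemma block_prob:
  assumes "finite I" and C: "\<And>k. k \<in> I \<Longrightarrow> local_event E (C k)"
    and E: "E \<subseteq> lattice_edges" and inj: "\<And>k. k \<in> I \<Longrightarrow> inj_on (\<sigma> k) E"
    and \<sigma>: "\<And>k. k \<in> I \<Longrightarrow> \<sigma> k ` E \<subseteq> lattice_edges"
    and disj: "\<And>k k'. k \<in> I \<Longrightarrow> k' \<in> I \<Longrightarrow> k \<noteq> k' \<Longrightarrow> \<sigma> k ` E \<inter> \<sigma> k' ` E = {}"
    and R: "finite R" "R \<subseteq> lattice_edges" "\<And>k. k \<in> I \<Longrightarrow> R \<inter> \<sigma> k ` E = {}" and B: "B \<in> sets borel"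
  shows "prob {\<omega> \<in> space M. (\<forall>k\<in>I. (\<lambda>e. \<tau> (\<sigma> k e) \<omega>) \<in> C k) \<and> (\<forall>e\<in>R. \<tau> e \<omega> \<in> B)} =
    (\<Prod>k\<in>I. cprob (C k)) * measure \<nu> B ^ card R"
\<comment> \<open>The product formula for independent variables is stated for nonempty index
  sets.\<close>
proof (cases "I = {} \<and> R = {}")
  case True
  then show ?thesis by (simp add: prob_space)
next
  case False
  \<comment> \<open>Groups of edges are indexed by a disjoint sum: a block for each element of
    \<open>I\<close>, and a singleton for each edge of \<open>R\<close>.\<close>
  define J where "J = I <+> R"
  define K where "K = case_sum (\<lambda>k. \<sigma> k ` E) (\<lambda>e. {e})"
  define A where "A = case_sum (\<lambda>k. {x \<in> space (\<Pi>\<^sub>M e\<in>\<sigma> k ` E. borel). (\<lambda>e. x (\<sigma> k e)) \<in> C k})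
      (\<lambda>e. {x \<in> space (\<Pi>\<^sub>M e\<in>{e}. borel). x e \<in> B})"
  let ?X = "\<lambda>j \<omega>. \<lambda>e\<in>K j. \<tau> e \<omega>"
  have indep: "indep_vars (\<lambda>j. \<Pi>\<^sub>M e\<in>K j. borel) ?X J"
  proof (rule indep_vars_restrict[OF tau_indep])
    show "K j \<subseteq> lattice_edges" if "j \<in> J" for j
    proof (cases j)
      case (Inl k)
      then have "k \<in> I" using that by (auto simp: J_def)
      from \<sigma>[OF this] show ?thesis by (simp add: K_def Inl)
    next
      case (Inr e)
      then show ?thesis using that R(2) by (auto simp: J_def K_def)
    qed
    show "disjoint_family_on K J"
      unfolding disjoint_family_on_def
    proof (intro ballI impI)
      fix j j' assume "j \<in> J" "j' \<in> J" "j \<noteq> j'"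
      then show "K j \<inter> K j' = {}"
        using disj R(3) by (auto simp: J_def K_def) (metis IntI empty_iff image_eqI)+
    qed
  qed
  have A: "A j \<in> sets (\<Pi>\<^sub>M e\<in>K j. borel)" if j: "j \<in> J" for j
  proof (cases j)
    case (Inl k)
    then have k: "k \<in> I" using j by (auto simp: J_def)
    let ?S = "\<Pi>\<^sub>M e\<in>\<sigma> k ` E. (borel :: real measure)"
    have "(\<lambda>x. \<lambda>e\<in>E. x (\<sigma> k e)) \<in> measurable ?S (\<Pi>\<^sub>M e\<in>E. borel)"
      by (intro measurable_restrict measurable_component_singleton) auto
    then have "(\<lambda>x. \<lambda>e\<in>E. x (\<sigma> k e)) -` (C k \<inter> space (\<Pi>\<^sub>M e\<in>E. borel)) \<inter> space ?S \<in> sets ?S"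
      by (rule measurable_sets) (use C[OF k] in \<open>simp add: local_event_def\<close>)
    also have "(\<lambda>x. \<lambda>e\<in>E. x (\<sigma> k e)) -` (C k \<inter> space (\<Pi>\<^sub>M e\<in>E. borel)) \<inter> space ?S = A j"
    proof -
      have "(\<lambda>e\<in>E. x (\<sigma> k e)) \<in> C k \<longleftrightarrow> (\<lambda>e. x (\<sigma> k e)) \<in> C k" for x
        by (rule local_event_cong[OF C[OF k]]) simp
      then show ?thesis by (auto simp: A_def Inl space_PiM)
    qed
    finally show ?thesis by (simp add: Inl K_def)
  next
    case (Inr e)
    have "{x \<in> space (\<Pi>\<^sub>M e\<in>{e}. borel). x e \<in> B} \<in> sets (\<Pi>\<^sub>M e\<in>{e}. borel)" using B by measurable
    then show ?thesis by (simp add: Inr K_def A_def)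
  qed
  have fin: "finite J" "J \<noteq> {}" using assms(1) R(1) False by (auto simp: J_def)
  have ev: "?X (Inl k) -` A (Inl k) \<inter> space M = {\<omega> \<in> space M. (\<lambda>e. \<tau> (\<sigma> k e) \<omega>) \<in> C k}" if "k \<in> I" for k
  proof -
    have "(\<lambda>e. (\<lambda>e\<in>\<sigma> k ` E. \<tau> e \<omega>) (\<sigma> k e)) \<in> C k \<longleftrightarrow> (\<lambda>e. \<tau> (\<sigma> k e) \<omega>) \<in> C k" for \<omega>
      by (rule local_event_cong[OF C[OF that]]) simp
    then show ?thesis by (auto simp: A_def K_def space_PiM)
  qed
  have ev': "?X (Inr e) -` A (Inr e) \<inter> space M = {\<omega> \<in> space M. \<tau> e \<omega> \<in> B}" for e
    by (auto simp: A_def K_def space_PiM)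
  have "{\<omega> \<in> space M. (\<forall>k\<in>I. (\<lambda>e. \<tau> (\<sigma> k e) \<omega>) \<in> C k) \<and> (\<forall>e\<in>R. \<tau> e \<omega> \<in> B)} = (\<Inter>j\<in>J. ?X j -` A j \<inter> space M)"
    (is "?L = ?R")
  proof (intro equalityI subsetI)
    fix \<omega> assume \<omega>: "\<omega> \<in> ?L"
    show "\<omega> \<in> ?R"
    proof
      fix j assume j: "j \<in> J"
      show "\<omega> \<in> ?X j -` A j \<inter> space M"
      proof (cases j)
        case (Inl k)
        then have "k \<in> I" using j by (auto simp: J_def)
        then show ?thesis unfolding Inl ev[OF \<open>k \<in> I\<close>] using \<omega> by blast
      next
        case (Inr e)
        then have "e \<in> R" using j by (auto simp: J_def)
        then show ?thesis unfolding Inr ev' using \<omega> by blast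
      qed
    qed
  next
    fix \<omega> assume \<omega>: "\<omega> \<in> ?R"
    have 1: "\<omega> \<in> {\<omega> \<in> space M. (\<lambda>e. \<tau> (\<sigma> k e) \<omega>) \<in> C k}" if "k \<in> I" for k
      unfolding ev[OF that, symmetric] using INT_D[OF \<omega>, of "Inl k"] that by (simp add: J_def InlI)
    have 2: "\<omega> \<in> {\<omega> \<in> space M. \<tau> e \<omega> \<in> B}" if "e \<in> R" for e
      unfolding ev'[symmetric] using INT_D[OF \<omega>, of "Inr e"] that by (simp add: J_def InrI)
    have "\<omega> \<in> space M" using \<omega> fin(2) by auto
    then show "\<omega> \<in> ?L" using 1 2 by blast
  qed
  then have "prob {\<omega> \<in> space M. (\<forall>k\<in>I. (\<lambda>e. \<tau> (\<sigma> k e) \<omega>) \<in> C k) \<and> (\<forall>e\<in>R. \<tau> e \<omega> \<in> B)} =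
      (\<Prod>j\<in>J. prob (?X j -` A j \<inter> space M))"
    using indep_varsD_finite[OF indep fin(2,1) A] by simp
  also have "\<dots> = (\<Prod>k\<in>I. prob (?X (Inl k) -` A (Inl k) \<inter> space M)) * (\<Prod>e\<in>R. prob (?X (Inr e) -` A (Inr e) \<inter> space M))"
    unfolding J_def Plus_def
    by (subst prod.union_disjoint) (use assms(1) R(1) in \<open>auto simp: prod.reindex simp del: vimage_eq Int_iff\<close>)
  also have "(\<Prod>k\<in>I. prob (?X (Inl k) -` A (Inl k) \<inter> space M)) = (\<Prod>k\<in>I. cprob (C k))"
    by (rule prod.cong[OF refl], subst ev, assumption) (use reindexed_prob C inj \<sigma> E in blast)
  also have "(\<Prod>e\<in>R. prob (?X (Inr e) -` A (Inr e) \<inter> space M)) = (\<Prod>e\<in>R. measure \<nu> B)"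
    by (rule prod.cong[OF refl], subst ev', rule tau_prob) (use R B in auto)
  finally show ?thesis by simp
qed

lemma support_in: "x \<in> measure_support \<nu> \<Longrightarrow> a \<le> x \<and> x \<le> b"
  using Inf_lower[of "ereal x" "ereal ` measure_support \<nu>"] Sup_upper[of "ereal x" "ereal ` measure_support \<nu>"]
  by (simp add: a_def[symmetric] b_def[symmetric])

text \<open>Every point off the support has an open null neighbourhood, and by the Lindelof property
  countably many of these cover the complement of [a, b].\<close>

lemma nu_outside: "emeasure \<nu> (- {a..b}) = 0"
proof -
  define F where "F = {U :: real set. open U \<and> emeasure \<nu> U = 0}"
  obtain F' where F': "F' \<subseteq> F" "countable F'" "\<Union>F' = \<Union>F"
    using Lindelof[of F] by (auto simp: F_def)
  have "- {a..b} \<subseteq> \<Union>F"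
  proof
    fix x assume "x \<in> - {a..b}"
    then have "x \<notin> measure_support \<nu>" using support_in by auto
    then show "x \<in> \<Union>F" by (auto simp: measure_support_def F_def not_gr_zero)
  qed
  then have "- {a..b} \<subseteq> \<Union>F'" using F' by simp
  moreover have "\<Union>F' \<in> null_sets \<nu>"
    using F' nu_sets by (intro null_sets_UN'[of F' "\<lambda>x. x", simplified]) (auto simp: F_def null_sets_def)
  ultimately have "- {a..b} \<in> null_sets \<nu>"
    by (rule null_sets_subset[rotated 2]) (simp add: nu_sets)
  then show ?thesis by auto
qed

lemma nu_upper_pos: assumes "r < b" shows "0 < measure \<nu> {r..}"
proof -
  interpret nu: prob_space \<nu> by (rule nu_prob)
  have "ereal r < Sup (ereal ` measure_support \<nu>)" using assms by (simp add: b_def[symmetric])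
  then obtain x where "x \<in> measure_support \<nu>" "r < x" by (auto simp: less_Sup_iff)
  then have "0 < emeasure \<nu> {r<..}" by (auto simp: measure_support_def)
  also have "\<dots> \<le> emeasure \<nu> {r..}" using nu_sets by (intro emeasure_mono) auto
  finally show ?thesis by (simp add: nu.emeasure_eq_measure)
qed

lemma nu_lower_pos: assumes "a < r" shows "0 < measure \<nu> {..r}"
proof -
  interpret nu: prob_space \<nu> by (rule nu_prob)
  have "Inf (ereal ` measure_support \<nu>) < ereal r" using assms by (simp add: a_def[symmetric])
  then obtain x where "x \<in> measure_support \<nu>" "x < r" by (auto simp: Inf_less_iff)
  then have "0 < emeasure \<nu> {..<r}" by (auto simp: measure_support_def)
  also have "\<dots> \<le> emeasure \<nu> {..r}" using nu_sets by (intro emeasure_mono) auto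
  finally show ?thesis by (simp add: nu.emeasure_eq_measure)
qed

definition weights_in_range :: "'w \<Rightarrow> bool" where
  "weights_in_range \<omega> \<longleftrightarrow> (\<forall>e\<in>lattice_edges. a \<le> \<tau> e \<omega> \<and> \<tau> e \<omega> \<le> b)"

lemma AE_weights_in_range: "AE \<omega> in M. weights_in_range \<omega>"
  unfolding weights_in_range_def AE_ball_countable[OF countable_lattice_edges]
proof
  fix e :: "(int ^ 'd) set" assume e: "e \<in> lattice_edges"
  have "AE x in distr M borel (\<tau> e). x \<in> {a..b}"
    unfolding tau_distr[OF e]
    by (rule AE_I[where N = "- {a..b}"]) (auto simp: nu_outside nu_sets)
  then have "AE \<omega> in M. \<tau> e \<omega> \<in> {a..b}"
    using AE_distrD[OF tau_measurable[OF e]] by blast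
  then show "AE \<omega> in M. a \<le> \<tau> e \<omega> \<and> \<tau> e \<omega> \<le> b" by simp
qed

lemma bounded_config_weights: "weights_in_range \<omega> \<Longrightarrow> bounded_config b (\<lambda>e. \<tau> e \<omega>)"
  using a_nonneg by (auto simp: weights_in_range_def bounded_config_def)

text \<open>The bridge from deterministic statements to probabilities: an inclusion of events only
  has to be checked for configurations with all weights in [a, b].\<close>

lemma prob_mono_in_range:
  assumes "A \<in> events" "B \<in> events"
    and "\<And>\<omega>. \<omega> \<in> space M \<Longrightarrow> weights_in_range \<omega> \<Longrightarrow> \<omega> \<in> A \<Longrightarrow> \<omega> \<in> B"
  shows "prob A \<le> prob B"
proof (rule finite_measure_mono_AE[OF _ assms(2)])
  show "AE \<omega> in M. \<omega> \<in> A \<longrightarrow> \<omega> \<in> B"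
    using AE_weights_in_range AE_space by eventually_elim (use assms(3) in blast)
qed

end

section \<open>Probability of a tiling\<close>

lemma card_int_box_prod:
  assumes "\<And>i. finite (A i)"
  shows "card {v :: int ^ 'd::finite. \<forall>i. v $ i \<in> A i} = (\<Prod>i\<in>UNIV. card (A i))"
proof -
  have "bij_betw vec_lambda (\<Pi>\<^sub>E i\<in>(UNIV::'d set). A i) {v :: int ^ 'd. \<forall>i. v $ i \<in> A i}"
    by (rule bij_betwI[where g = vec_nth]) (auto simp: PiE_def)
  then have "card {v :: int ^ 'd. \<forall>i. v $ i \<in> A i} = card (\<Pi>\<^sub>E i\<in>(UNIV::'d set). A i)"
    by (rule bij_betw_same_card[symmetric])
  then show ?thesis by (simp add: card_PiE)
qed

lemma card_int_box: "finite A \<Longrightarrow> card {v :: int ^ 'd::finite. \<forall>i. v $ i \<in> A} = card A ^ CARD('d)"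
  by (simp add: card_int_box_prod)

lemma tile_indices_alt: "tile_indices K = {k. \<forall>i. k $ i \<in> {0..<int K}}"
  by (simp add: tile_indices_def)

lemma finite_tile_indices: "finite (tile_indices K :: (int ^ 'd::finite) set)"
  unfolding tile_indices_alt by (intro finite_int_box) simp

lemma card_tile_indices: "card (tile_indices K :: (int ^ 'd::finite) set) = K ^ CARD('d)"
  unfolding tile_indices_alt by (subst card_int_box) simp_all

lemma edge_tiles_disjoint:
  fixes k k' :: "int ^ 'd::finite"
  assumes "0 < w" "k \<noteq> k'"
  shows "edges_in (tile (m + w) m k) \<inter> edges_in (tile (m + w) m k') = {}"
proof (rule ccontr)
  assume "\<not> ?thesis"
  then obtain e where e: "e \<in> edges_in (tile (m + w) m k)" "e \<in> edges_in (tile (m + w) m k')" by blast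
  then obtain v where "v \<in> e" by (auto simp: edges_in_def lattice_edges_def)
  then have "lattice_point v \<in> tile (m + w) m k" "lattice_point v \<in> tile (m + w) m k'"
    using e by (auto simp: edges_in_def)
  then show False using tile_separation[OF assms(2)] assms(1) by fastforce
qed

lemma tile_subset_qbox:
  fixes k :: "int ^ 'd::finite"
  assumes "k \<in> tile_indices K" "K * p \<le> N" "m \<le> p"
  shows "tile p m k \<subseteq> qbox 0 N"
proof
  fix x assume x: "x \<in> tile p m k"
  have "0 \<le> x $ i \<and> x $ i \<le> real N" for i
  proof -
    have "0 \<le> k $ i \<and> k $ i < int K" using assms(1) unfolding tile_indices_def by blast
    then have k: "0 \<le> k $ i" "k $ i + 1 \<le> int K" by linarith+
    have "real p * (of_int (k $ i) + 1) \<le> real p * real K" using k(2) by (intro mult_left_mono) linarith+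
    also have "\<dots> \<le> real N" using assms(2) by (metis mult.commute of_nat_le_iff of_nat_mult)
    finally have "real p * of_int (k $ i) + real p \<le> real N" by (simp add: algebra_simps)
    moreover have "0 \<le> real p * of_int (k $ i)" using k(1) by simp
    moreover have "real m \<le> real p" using assms(3) by simp
    ultimately show ?thesis using tile_coordinate[OF x, of i] by linarith
  qed
  then show "x \<in> qbox 0 N" by (simp add: qbox_def)
qed

text \<open>An edge is charged to its lower endpoint v. If all coordinates of v lie in the half-open
  intervals that make up \<open>A\<close>, then the upper endpoint still lies in the closed tile, so
  the edge belongs to a tile. Corridor edges therefore have v outside this grid of (K m)^d points,
  and there are d directions for each v.\<close>

lemma card_corridor_edges:
  assumes "K * p \<le> N" "m \<le> p"
  shows "card (edges_in (qbox 0 N :: (real ^ 'd::finite) set) - (\<Union>k\<in>tile_indices K. edges_in (tile p m k)))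
    \<le> CARD('d) * ((N + 1) ^ CARD('d) - (K * m) ^ CARD('d))"
proof -
  let ?R = "edges_in (qbox 0 N :: (real ^ 'd) set) - (\<Union>k\<in>tile_indices K. edges_in (tile p m k))"
  define A where "A = (\<Union>k<K. {int p * int k..<int p * int k + int m})"
  define V where "V = {v :: int ^ 'd. \<forall>i. v $ i \<in> {0..int N}}"
  define W where "W = {v :: int ^ 'd. \<forall>i. v $ i \<in> A}"
  have fA: "finite A" by (simp add: A_def)
  have up: "int p * int k + int m \<le> int N" if "k < K" for k
  proof -
    have "p * (k + 1) \<le> p * K" using that by (intro mult_le_mono2) simp
    then have "p * k + m \<le> N" using assms by (simp add: algebra_simps)
    then show ?thesis by (metis of_nat_add of_nat_le_iff of_nat_mult)
  qed
  have AN: "A \<subseteq> {0..int N}"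
  proof
    fix x assume "x \<in> A"
    then obtain k where k: "k < K" "int p * int k \<le> x" "x < int p * int k + int m" by (auto simp: A_def)
    moreover have "0 \<le> int p * int k" by simp
    ultimately show "x \<in> {0..int N}" using up[OF k(1)] unfolding atLeastAtMost_iff by linarith
  qed
  have cA: "card A = K * m"
  proof -
    have "card A = (\<Sum>k<K. card {int p * int k..<int p * int k + int m})"
      unfolding A_def
    proof (rule card_UN_disjoint)
      have *: "{int p * int k..<int p * int k + int m} \<inter> {int p * int k'..<int p * int k' + int m} = {}"
        if "k < k'" for k k'
      proof -
        have "p * (k + 1) \<le> p * k'" using that by (intro mult_le_mono2) simp
        then have "p * k + m \<le> p * k'" using assms(2) by (simp add: algebra_simps)
        then have "int p * int k + int m \<le> int p * int k'" by (metis of_nat_add of_nat_le_iff of_nat_mult)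
        then show ?thesis by auto
      qed
      show "\<forall>k\<in>{..<K}. \<forall>k'\<in>{..<K}. k \<noteq> k' \<longrightarrow>
        {int p * int k..<int p * int k + int m} \<inter> {int p * int k'..<int p * int k' + int m} = {}"
        using * by (metis inf_commute nat_neq_iff)
    qed auto
    then show ?thesis by simp
  qed
  have fV: "finite V" unfolding V_def by (rule finite_int_box) simp
  have WV: "W \<subseteq> V" using AN by (auto simp: W_def V_def)
  have cV: "card (V - W) = (N + 1) ^ CARD('d) - (K * m) ^ CARD('d)"
  proof -
    have "card V = (N + 1) ^ CARD('d)" unfolding V_def by (subst card_int_box) (simp_all add: nat_add_distrib)
    moreover have "card W = (K * m) ^ CARD('d)" unfolding W_def by (simp add: card_int_box fA cA)
    ultimately show ?thesis using card_Diff_subset[OF finite_subset[OF WV fV] WV] by simp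
  qed
  have "?R \<subseteq> (\<lambda>(v, i). unit_edge v i) ` ((V - W) \<times> UNIV)"
  proof
    fix e assume e: "e \<in> ?R"
    then obtain v i where vi: "e = unit_edge v i" using edges_in_lattice lattice_edge_cases by (metis DiffD1)
    have "lattice_point v \<in> qbox 0 N" using e vi by (auto simp: edges_in_def unit_edge_def)
    then have "v \<in> V" by (auto simp: V_def lattice_point_qbox_iff)
    moreover have "v \<notin> W"
    proof
      assume "v \<in> W"
      then have "\<exists>k<K. v $ j \<in> {int p * int k..<int p * int k + int m}" for j by (auto simp: W_def A_def)
      then obtain \<kappa> where \<kappa>: "\<And>j. \<kappa> j < K" "\<And>j. v $ j \<in> {int p * int (\<kappa> j)..<int p * int (\<kappa> j) + int m}" by metis
      define k :: "int ^ 'd" where "k = (\<chi> j. int (\<kappa> j))"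
      have "k \<in> tile_indices K" using \<kappa>(1) by (simp add: k_def tile_indices_def)
      moreover have "lattice_point v \<in> tile p m k"
        unfolding lattice_point_qbox_iff using \<kappa>(2) by (fastforce simp: k_def tile_corner_def)
      moreover have "lattice_point (v + axis i 1) \<in> tile p m k"
        unfolding lattice_point_qbox_iff
      proof
        fix j
        have "v $ j \<in> {int p * int (\<kappa> j)..<int p * int (\<kappa> j) + int m}" by (rule \<kappa>(2))
        then show "(v + axis i 1) $ j \<in> {tile_corner p k $ j..tile_corner p k $ j + int m}"
          by (auto simp: k_def tile_corner_def axis_def)
      qed
      ultimately have "e \<in> (\<Union>k\<in>tile_indices K. edges_in (tile p m k))"
        using vi by (auto simp: edges_in_def unit_edge_def intro!: bexI[of _ k])
           (metis insert_commute unit_edge_def unit_edge_in_lattice_edges)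
      then show False using e by blast
    qed
    ultimately show "e \<in> (\<lambda>(v, i). unit_edge v i) ` ((V - W) \<times> UNIV)" using vi by auto
  qed
  then have "card ?R \<le> card ((\<lambda>(v, i). unit_edge v i) ` ((V - W) \<times> (UNIV :: 'd set)))"
    using fV by (intro card_mono) auto
  also have "\<dots> \<le> card ((V - W) \<times> (UNIV :: 'd set))" using fV by (intro card_image_le) auto
  also have "\<dots> = CARD('d) * ((N + 1) ^ CARD('d) - (K * m) ^ CARD('d))"
    by (simp add: card_cartesian_product cV)
  finally show ?thesis .
qed

text \<open>With K = \<open>N div p\<close> the product K m exceeds (m / p) N - m, so the share of
  the points outside the tiles is asymptotically at most 1 - (m / p)^d, which lies strictly below
  \<open>\<kappa>\<close>.\<close>

lemma corridor_fraction:
  assumes "1 \<le> m" "m \<le> p" "1 - (real m / real p) ^ d < \<kappa>"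
  shows "eventually (\<lambda>N. real ((N + 1) ^ d - ((N div p) * m) ^ d) \<le> \<kappa> * real N ^ d) sequentially"
proof -
  have p: "0 < p" using assms by simp
  have "(\<lambda>N. (1 + 1 / real N) ^ d - (real m / real p - real m / real N) ^ d) \<longlonglongrightarrow>
      (1 + 0) ^ d - (real m / real p - 0) ^ d"
    by (intro tendsto_intros lim_const_over_n)
  then have "eventually (\<lambda>N. (1 + 1 / real N) ^ d - (real m / real p - real m / real N) ^ d < \<kappa>) sequentially"
    using assms(3) by (intro order_tendstoD(2)) auto
  then show ?thesis
    using eventually_ge_at_top[of p]
  proof eventually_elim
    case (elim N)
    let ?K = "N div p"
    have N: "0 < real N" using elim(2) p by linarith
    have "N < p * ?K + p" using p by (metis add_less_cancel_left mod_less_divisor mult_div_mod_eq)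
    then have "real N < real p * real ?K + real p" by (metis of_nat_add of_nat_less_iff of_nat_mult)
    then have "real m / real p * real N \<le> real m / real p * (real p * real ?K + real p)"
      by (intro mult_left_mono) auto
    then have low: "real m / real p * real N - real m \<le> real (?K * m)" using p by (simp add: field_simps)
    have nonneg: "0 \<le> real m / real p - real m / real N"
    proof -
      have "real m / real N \<le> real m / real p" using elim(2) p by (intro divide_left_mono) auto
      then show ?thesis by simp
    qed
    have KN: "?K * m \<le> N + 1"
    proof -
      have "?K * m \<le> ?K * p" using assms(2) by simp
      then show ?thesis using div_times_less_eq_dividend[of N p] by linarith
    qed
    have "real ((N + 1) ^ d - (?K * m) ^ d) = real (N + 1) ^ d - real (?K * m) ^ d"
      using KN by (subst of_nat_diff) (simp_all add: power_mono del: of_nat_mult of_nat_Suc)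
    also have "\<dots> \<le> real (N + 1) ^ d - (real m / real p * real N - real m) ^ d"
    proof -
      have "0 \<le> real m / real p * real N - real m"
        using nonneg N by (simp add: field_simps)
      then show ?thesis using low by (intro diff_left_mono power_mono)
    qed
    also have "real (N + 1) = (1 + 1 / real N) * real N" using N by (simp add: field_simps)
    also have "real m / real p * real N - real m = (real m / real p - real m / real N) * real N"
      unfolding left_diff_distrib using N by simp
    also have "((1 + 1 / real N) * real N) ^ d - ((real m / real p - real m / real N) * real N) ^ d =
        ((1 + 1 / real N) ^ d - (real m / real p - real m / real N) ^ d) * real N ^ d"
      unfolding power_mult_distrib left_diff_distrib[symmetric] ..
    also have "\<dots> \<le> \<kappa> * real N ^ d" using elim(1) by (intro mult_right_mono) auto
    finally show ?case .
  qed
qed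

context passage_percolation
begin

text \<open>The gluing lemma combined with independence. The target \<open>D\<close> only has to
  follow from the existence of potentials close to the prescribed functions \<open>H j\<close>. This
  covers both applications: reflected crossing shapes, and two layers of linear profiles.\<close>

lemma tile_prob:
  assumes \<sigma>: "0 < \<sigma>" "\<sigma> < 1" and "0 < K" "0 < w" "K * (m + w) \<le> N"
    and H: "\<And>j k k' x y. k \<in> tile_indices K \<Longrightarrow> k' \<in> tile_indices K \<Longrightarrow> x \<in> tile (m + w) m k \<Longrightarrow>
      y \<in> tile (m + w) m k' \<Longrightarrow> \<bar>H j x - H j y\<bar> \<le> b * l1_norm (x - y)"
    and h: "\<And>j k x y. k \<in> tile_indices K \<Longrightarrow> x \<in> qbox 0 m \<Longrightarrow> y \<in> qbox 0 m \<Longrightarrow>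
      \<bar>H j (place (r k) (tile_corner (m + w) k) m x) - H j (place (r k) (tile_corner (m + w) k) m y)\<bar>
        \<le> \<bar>h k j x - h k j y\<bar>"
    and \<epsilon>: "0 \<le> \<epsilon>" "2 * \<epsilon> \<le> \<sigma> / 2 * b * real w"
    and D: "local_event (edges_in (qbox 0 N)) D"
      "\<And>t. bounded_config b t \<Longrightarrow> (\<And>j. \<exists>F. potential b t (qbox 0 N) F \<and>
        (\<forall>k\<in>tile_indices K. \<forall>x\<in>tile (m + w) m k. \<bar>F x - (1 - \<sigma>) * H j x\<bar> \<le> \<epsilon>)) \<Longrightarrow> t \<in> D"
  shows "(\<Prod>k\<in>tile_indices K. cprob (profile_event b (qbox 0 m) (h k) \<epsilon>)) *
      measure \<nu> {(1 - \<sigma> / 2) * b..} ^ (CARD('d) * ((N + 1) ^ CARD('d) - (K * m) ^ CARD('d)))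
    \<le> cprob D"
proof -
  let ?I = "tile_indices K :: (int ^ 'd) set"
  let ?E = "edges_in (qbox 0 m) :: (int ^ 'd) set set"
  let ?B = "{(1 - \<sigma> / 2) * b..}"
  let ?C = "\<lambda>k. profile_event b (qbox 0 m) (h k) \<epsilon>"
  define \<rho> where "\<rho> k e = place (r k) (tile_corner (m + w) k) m ` e" for k and e :: "(int ^ 'd) set"
  define R where "R = edges_in (qbox 0 N :: (real ^ 'd) set) - (\<Union>k\<in>?I. edges_in (tile (m + w) m k))"
  interpret nu: prob_space \<nu> by (rule nu_prob)
  have \<rho>: "\<rho> k ` ?E \<subseteq> edges_in (tile (m + w) m k)" for k
    unfolding \<rho>_def using place_edges_in by blast
  have \<rho>L: "\<rho> k ` ?E \<subseteq> lattice_edges" for k using \<rho> edges_in_lattice by blast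
  have EL: "?E \<subseteq> lattice_edges" using edges_in_lattice by blast
  have inj: "inj_on (\<rho> k) ?E" for k
    unfolding \<rho>_def by (rule inj_onI) (simp add: inj_image_eq_iff[OF inj_place])
  have RL: "R \<subseteq> lattice_edges" unfolding R_def using edges_in_lattice by blast
  have fR: "finite R" unfolding R_def using finite_edges_in_qbox by blast
  let ?A = "{\<omega> \<in> space M. (\<forall>k\<in>?I. (\<lambda>e. \<tau> (\<rho> k e) \<omega>) \<in> ?C k) \<and> (\<forall>e\<in>R. \<tau> e \<omega> \<in> ?B)}"
  have "prob ?A = (\<Prod>k\<in>?I. cprob (?C k)) * measure \<nu> ?B ^ card R"
  proof (rule block_prob[OF finite_tile_indices _ EL inj \<rho>L _ fR RL])
    show "local_event ?E (?C k)" for k by (rule local_profile_event)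
    show "\<rho> k ` ?E \<inter> \<rho> k' ` ?E = {}" if "k \<noteq> k'" for k k'
      using edge_tiles_disjoint[OF \<open>0 < w\<close> that, of m] \<rho> by blast
    show "R \<inter> \<rho> k ` ?E = {}" if "k \<in> ?I" for k using \<rho>[of k] that by (auto simp: R_def)
  qed auto
  moreover have "measure \<nu> ?B ^ (CARD('d) * ((N + 1) ^ CARD('d) - (K * m) ^ CARD('d))) \<le> measure \<nu> ?B ^ card R"
    unfolding R_def by (intro power_decreasing card_corridor_edges) (use \<open>K * (m + w) \<le> N\<close> in auto)
  ultimately have "(\<Prod>k\<in>?I. cprob (?C k)) * measure \<nu> ?B ^ (CARD('d) * ((N + 1) ^ CARD('d) - (K * m) ^ CARD('d)))
      \<le> prob ?A"
    by (simp add: mult_left_mono prod_nonneg)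
  also have "prob ?A \<le> cprob D"
  proof (rule prob_mono_in_range)
    have ev1: "{\<omega> \<in> space M. (\<lambda>e. \<tau> (\<rho> k e) \<omega>) \<in> ?C k} \<in> events" for k
      by (rule reindexed_event_measurable[OF local_profile_event \<rho>L])
    have ev2: "{\<omega> \<in> space M. \<tau> e \<omega> \<in> ?B} \<in> events" if "e \<in> R" for e
      by (rule tau_event) (use RL that in auto)
    have "{\<omega> \<in> space M. \<forall>k\<in>?I. (\<lambda>e. \<tau> (\<rho> k e) \<omega>) \<in> ?C k} \<in> events"
      by (rule sets.sets_Collect_finite_All) (use ev1 finite_tile_indices in auto)
    moreover have "{\<omega> \<in> space M. \<forall>e\<in>R. \<tau> e \<omega> \<in> ?B} \<in> events"
      by (rule sets.sets_Collect_finite_All) (use ev2 fR in auto)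
    ultimately show "?A \<in> events" by (rule sets.sets_Collect_conj[rotated])
    show "{\<omega> \<in> space M. (\<lambda>e. \<tau> e \<omega>) \<in> D} \<in> events"
      using D(1) by (rule local_event_measurable) (use edges_in_lattice in blast)
    fix \<omega> assume \<omega>: "\<omega> \<in> space M" "weights_in_range \<omega>" "\<omega> \<in> ?A"
    have "(\<lambda>e. \<tau> e \<omega>) \<in> D"
    proof (rule D(2))
      show bc: "bounded_config b (\<lambda>e. \<tau> e \<omega>)" by (rule bounded_config_weights[OF \<omega>(2)])
      fix j
      obtain F where "potential b (\<lambda>e. \<tau> e \<omega>) (qbox 0 N) F"
        "\<And>k x. k \<in> tile_indices K \<Longrightarrow> x \<in> tile (m + w) m k \<Longrightarrow> \<bar>F x - (1 - \<sigma>) * H j x\<bar> \<le> \<epsilon>"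
      proof (rule tile_potential[OF bc b_pos \<sigma> \<open>0 < K\<close>, where r = r and h = h and H = "H j" and j = j and \<epsilon> = \<epsilon> and m = m and w = w and N = N])
        show "(\<lambda>e. \<tau> (place (r k) (tile_corner (m + w) k) m ` e) \<omega>) \<in> ?C k" if "k \<in> ?I" for k
          using \<omega>(3) that by (simp add: \<rho>_def)
        show "(1 - \<sigma> / 2) * b \<le> \<tau> e \<omega>" if "e \<in> edges_in (qbox 0 N)"
          "\<And>k. k \<in> ?I \<Longrightarrow> e \<notin> edges_in (tile (m + w) m k)" for e
          using \<omega>(3) that by (auto simp: R_def)
      qed (use H h \<epsilon> in blast)+
      then show "\<exists>F. potential b (\<lambda>e. \<tau> e \<omega>) (qbox 0 N) F \<and>
        (\<forall>k\<in>tile_indices K. \<forall>x\<in>tile (m + w) m k. \<bar>F x - (1 - \<sigma>) * H j x\<bar> \<le> \<epsilon>)" by blast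
    qed
    then show "\<omega> \<in> {\<omega> \<in> space M. (\<lambda>e. \<tau> e \<omega>) \<in> D}" using \<omega>(1) by simp
  qed
  finally show ?thesis .
qed

end

section \<open>Crossing shapes\<close>

lemma unit_cube_eq_cbox: "unit_cube = cbox 0 (1 :: real ^ 'd::finite)"
  by (auto simp: unit_cube_def mem_box_cart)

lemma compact_unit_cube: "compact (unit_cube :: (real ^ 'd::finite) set)"
  unfolding unit_cube_eq_cbox by (rule compact_cbox)

lemma finite_l1_net:
  assumes "0 < \<rho>"
  obtains \<Gamma> :: "(real ^ 'd::finite) set" where "finite \<Gamma>" "\<Gamma> \<subseteq> unit_cube"
    "\<And>x. x \<in> unit_cube \<Longrightarrow> \<exists>y\<in>\<Gamma>. l1_norm (x - y) \<le> \<rho>"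
proof -
  let ?e = "\<rho> / real CARD('d)"
  have e: "0 < ?e" using assms by simp
  obtain \<Gamma> :: "(real ^ 'd) set" where \<Gamma>: "finite \<Gamma>" "\<Gamma> \<subseteq> unit_cube" "unit_cube \<subseteq> (\<Union>x\<in>\<Gamma>. ball x ?e)"
  proof (rule compactE_image[OF compact_unit_cube])
    show "open (ball x ?e)" for x :: "real ^ 'd" by simp
    show "unit_cube \<subseteq> (\<Union>x\<in>unit_cube. ball x ?e)" for x :: "real ^ 'd" using e by auto
  qed blast
  have "\<exists>y\<in>\<Gamma>. l1_norm (x - y) \<le> \<rho>" if "x \<in> unit_cube" for x
  proof -
    have "x \<in> (\<Union>x\<in>\<Gamma>. ball x ?e)" using \<Gamma>(3) that by (rule subsetD)
    then obtain y where y: "y \<in> \<Gamma>" "dist y x < ?e" unfolding UN_iff mem_ball by blast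
    have "l1_norm (x - y) \<le> real CARD('d) * norm (x - y)" by (rule l1_norm_le_norm)
    also have "\<dots> \<le> real CARD('d) * ?e"
      using y(2) by (intro mult_left_mono) (auto simp: dist_norm norm_minus_commute)
    finally show ?thesis using y(1) by auto
  qed
  then show thesis using that \<Gamma>(1,2) by blast
qed

text \<open>Round the values on a finite net of points.\<close>

lemma lipschitz_net:
  fixes G :: "(real ^ 'd::finite \<Rightarrow> real) set"
  assumes L: "0 \<le> L" and \<delta>: "0 < \<delta>"
    and lip: "\<And>f x y. f \<in> G \<Longrightarrow> x \<in> unit_cube \<Longrightarrow> y \<in> unit_cube \<Longrightarrow> \<bar>f x - f y\<bar> \<le> L * l1_norm (x - y)"
    and bnd: "\<And>f x. f \<in> G \<Longrightarrow> x \<in> unit_cube \<Longrightarrow> \<bar>f x\<bar> \<le> B"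
  obtains G' where "finite G'" "G' \<subseteq> G" "\<And>f. f \<in> G \<Longrightarrow> \<exists>g\<in>G'. \<forall>x\<in>unit_cube. \<bar>f x - g x\<bar> \<le> \<delta>"
proof -
  \<comment> \<open>Half of \<open>\<delta>\<close> pays for rounding, the other half for moving
    both functions to a net point. Using L + 1 avoids a division by zero.\<close>
  define \<rho> where "\<rho> = \<delta> / (4 * (L + 1))"
  have \<rho>: "0 < \<rho>" "2 * (L * \<rho>) \<le> \<delta> / 2"
    using L \<delta> by (auto simp: \<rho>_def field_simps)
  obtain \<Gamma> :: "(real ^ 'd) set" where \<Gamma>: "finite \<Gamma>" "\<Gamma> \<subseteq> unit_cube"
    "\<And>x. x \<in> unit_cube \<Longrightarrow> \<exists>y\<in>\<Gamma>. l1_norm (x - y) \<le> \<rho>"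
    by (rule finite_l1_net[OF \<rho>(1)]) blast
  define R where "R f = (\<lambda>x\<in>\<Gamma>. \<lfloor>f x * (2 / \<delta>)\<rfloor>)" for f :: "real ^ 'd \<Rightarrow> real"
  define Z where "Z = {\<lfloor>- B * (2 / \<delta>)\<rfloor>..\<lfloor>B * (2 / \<delta>)\<rfloor>}"
  have "R ` G \<subseteq> (\<Pi>\<^sub>E x\<in>\<Gamma>. Z)"
  proof
    fix r assume "r \<in> R ` G"
    then obtain f where f: "f \<in> G" "r = R f" by blast
    have "\<lfloor>f x * (2 / \<delta>)\<rfloor> \<in> Z" if "x \<in> \<Gamma>" for x
    proof -
      have "- B \<le> f x" "f x \<le> B" using bnd[OF f(1), of x] that \<Gamma>(2) by (auto simp: abs_le_iff)
      then have "- B * (2 / \<delta>) \<le> f x * (2 / \<delta>)" "f x * (2 / \<delta>) \<le> B * (2 / \<delta>)"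
        using \<delta> by (intro mult_right_mono; simp)+
      then show ?thesis unfolding Z_def by (simp only: atLeastAtMost_iff floor_mono)
    qed
    then show "r \<in> (\<Pi>\<^sub>E x\<in>\<Gamma>. Z)" unfolding f(2) R_def by auto
  qed
  then have fin: "finite (R ` G)" by (rule finite_subset) (intro finite_PiE \<Gamma>(1), simp add: Z_def)
  \<comment> \<open>One representative per rounding pattern, chosen from \<open>G\<close> itself:
    the approximating functions have to be crossing shapes again, with exact boundary
    values.\<close>
  define G' where "G' = inv_into G R ` (R ` G)"
  have "\<exists>g\<in>G'. \<forall>x\<in>unit_cube. \<bar>f x - g x\<bar> \<le> \<delta>" if f: "f \<in> G" for f
  proof (intro bexI ballI)
    let ?g = "inv_into G R (R f)"
    show "?g \<in> G'" using f by (simp add: G'_def)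
    have g: "?g \<in> G" "R ?g = R f"
      using inv_into_into[of "R f" R G] f_inv_into_f[of "R f" R G] f by auto
    fix x :: "real ^ 'd" assume x: "x \<in> unit_cube"
    obtain y where y: "y \<in> \<Gamma>" "l1_norm (x - y) \<le> \<rho>" using \<Gamma>(3)[OF x] by blast
    have "\<lfloor>?g y * (2 / \<delta>)\<rfloor> = \<lfloor>f y * (2 / \<delta>)\<rfloor>" using fun_cong[OF g(2), of y] y(1) by (simp add: R_def)
    then have "\<bar>?g y * (2 / \<delta>) - f y * (2 / \<delta>)\<bar> \<le> 1" by linarith
    then have "\<bar>?g y - f y\<bar> * \<bar>2 / \<delta>\<bar> \<le> 1" unfolding left_diff_distrib[symmetric] abs_mult .
    then have 1: "\<bar>?g y - f y\<bar> \<le> \<delta> / 2" using \<delta> by (simp add: field_simps)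
    have yc: "y \<in> unit_cube" using y \<Gamma>(2) by blast
    have L\<rho>: "L * l1_norm (x - y) \<le> L * \<rho>" using y(2) L by (rule mult_left_mono)
    show "\<bar>f x - ?g x\<bar> \<le> \<delta>"
      using 1 lip[OF f x yc] lip[OF g(1) x yc] L\<rho> \<rho>(2) by linarith
  qed
  moreover have "finite G'" using fin by (simp add: G'_def)
  moreover have "G' \<subseteq> G" by (auto simp: G'_def intro: inv_into_into)
  ultimately show thesis using that by blast
qed

text \<open>Possible shapes, on a box of side \<open>m\<close>, of a potential in direction \<open>j\<close> that certifies a crossing
  time of at least \<open>s m\<close>.\<close>

definition crossing_shape :: "real \<Rightarrow> nat \<Rightarrow> 'd \<Rightarrow> real \<Rightarrow> (real ^ 'd \<Rightarrow> real) set" where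
  "crossing_shape b m j s = {f.
     (\<forall>x\<in>qbox 0 m. \<forall>y\<in>qbox 0 m. \<bar>f x - f y\<bar> \<le> b * l1_norm (x - y)) \<and>
     (\<forall>x\<in>qbox 0 m. x $ j = 0 \<longrightarrow> f x = 0) \<and> (\<forall>x\<in>qbox 0 m. x $ j = real m \<longrightarrow> f x = s * real m)}"

lemma crossing_shape_near_start:
  fixes f :: "real ^ 'd::finite \<Rightarrow> real"
  assumes "f \<in> crossing_shape b m j s" "x \<in> qbox 0 m"
  shows "\<bar>f x\<bar> \<le> b * x $ j"
proof -
  define y where "y = (\<chi> i. if i = j then 0 else x $ i)"
  have y: "y \<in> qbox 0 m" "y $ j = 0" using assms(2) by (auto simp: y_def qbox_def)
  have "l1_norm (x - y) = \<bar>x $ j - y $ j\<bar>" by (rule l1_norm_single_coordinate) (simp add: y_def)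
  moreover have "0 \<le> x $ j" using assms(2) by (auto simp: qbox_def)
  moreover have "\<bar>f x - f y\<bar> \<le> b * l1_norm (x - y)" "f y = 0"
    using assms y unfolding crossing_shape_def by blast+
  ultimately show ?thesis using y(2) by simp
qed

lemma crossing_shape_near_end:
  fixes f :: "real ^ 'd::finite \<Rightarrow> real"
  assumes "f \<in> crossing_shape b m j s" "x \<in> qbox 0 m"
  shows "\<bar>f x - s * real m\<bar> \<le> b * (real m - x $ j)"
proof -
  define y where "y = (\<chi> i. if i = j then real m else x $ i)"
  have y: "y \<in> qbox 0 m" "y $ j = real m" using assms(2) by (auto simp: y_def qbox_def)
  have "l1_norm (x - y) = \<bar>x $ j - y $ j\<bar>" by (rule l1_norm_single_coordinate) (simp add: y_def)
  moreover have "x $ j \<le> real m" using assms(2) by (auto simp: qbox_def)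
  moreover have "\<bar>f x - f y\<bar> \<le> b * l1_norm (x - y)" "f y = s * real m"
    using assms y unfolding crossing_shape_def by blast+
  ultimately show ?thesis using y(2) by simp
qed

lemma crossing_shape_nonempty:
  assumes "0 \<le> s" "s \<le> b"
  shows "(\<lambda>x. s * x $ j) \<in> crossing_shape b m j s"
proof -
  have "\<bar>s * x $ j - s * y $ j\<bar> \<le> b * l1_norm (x - y)" for x y :: "real ^ 'a"
  proof -
    have "\<bar>s * x $ j - s * y $ j\<bar> = s * \<bar>x $ j - y $ j\<bar>"
      using assms(1) by (simp add: abs_mult flip: right_diff_distrib)
    also have "\<dots> \<le> b * l1_norm (x - y)"
      using assms component_le_l1_norm by (intro mult_mono) auto
    finally show ?thesis .
  qed
  then show ?thesis by (auto simp: crossing_shape_def)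
qed

lemma rescale_crossing_shape:
  assumes f: "f \<in> crossing_shape b m j s" and m: "1 \<le> m" and n: "1 \<le> n"
  shows "(\<lambda>x. real n / real m * f ((real m / real n) *\<^sub>R x)) \<in> crossing_shape b n j s"
proof -
  let ?c = "real m / real n"
  have c: "0 < ?c" "real n / real m = 1 / ?c" using m n by auto
  have q: "?c *\<^sub>R x \<in> qbox 0 m" if x: "x \<in> qbox 0 n" for x
  proof -
    have "0 \<le> ?c * x $ i \<and> ?c * x $ i \<le> real m" for i
    proof -
      have "0 \<le> x $ i" "x $ i \<le> real n" using x by (auto simp: qbox_def)
      then have "?c * x $ i \<le> ?c * real n" using c by (intro mult_left_mono) auto
      then show ?thesis using \<open>0 \<le> x $ i\<close> n by simp
    qed
    then show ?thesis by (simp add: qbox_def)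
  qed
  have 1: "\<bar>1 / ?c * f (?c *\<^sub>R x) - 1 / ?c * f (?c *\<^sub>R y)\<bar> \<le> b * l1_norm (x - y)"
    if "x \<in> qbox 0 n" "y \<in> qbox 0 n" for x y
  proof -
    have "\<bar>f (?c *\<^sub>R x) - f (?c *\<^sub>R y)\<bar> \<le> b * l1_norm (?c *\<^sub>R x - ?c *\<^sub>R y)"
      using f q[OF that(1)] q[OF that(2)] unfolding crossing_shape_def by blast
    also have "\<dots> = ?c * (b * l1_norm (x - y))" unfolding l1_norm_scaleR using c by simp
    finally have "1 / ?c * \<bar>f (?c *\<^sub>R x) - f (?c *\<^sub>R y)\<bar> \<le> 1 / ?c * (?c * (b * l1_norm (x - y)))"
      using c by (intro mult_left_mono) auto
    moreover have "1 / ?c * (?c * r) = r" for r using m n by simp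
    moreover have "\<bar>1 / ?c * r - 1 / ?c * s\<bar> = 1 / ?c * \<bar>r - s\<bar>" for r s
      unfolding right_diff_distrib[symmetric] abs_mult using c by simp
    ultimately show ?thesis by metis
  qed
  have 2: "1 / ?c * f (?c *\<^sub>R x) = 0" if "x \<in> qbox 0 n" "x $ j = 0" for x
    using f q[OF that(1)] that(2) by (simp add: crossing_shape_def)
  have 3: "1 / ?c * f (?c *\<^sub>R x) = s * real n" if "x \<in> qbox 0 n" "x $ j = real n" for x
  proof -
    have "f (?c *\<^sub>R x) = s * real m" using f q[OF that(1)] that(2) n by (simp add: crossing_shape_def)
    then show ?thesis using m n by (simp add: field_simps)
  qed
  show ?thesis unfolding c(2) crossing_shape_def using 1 2 3 by blast
qed

text \<open>Truncating the travel time from the starting face at \<open>\<zeta> $ j * real m\<close>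
  makes it constant on the opposite face. Exact constants on both faces are what lets reflected
  copies match from one layer of tiles to the next.\<close>

lemma crossing_event_shape:
  fixes t :: "(int ^ 'd::finite) set \<Rightarrow> real"
  assumes t: "bounded_config b t" "0 \<le> b" "t \<in> crossing_event b m \<zeta>" and \<zeta>: "0 \<le> \<zeta> $ j"
  obtains f where "potential b t (qbox 0 m) f" "f \<in> crossing_shape b m j (\<zeta> $ j)"
proof -
  have nn: "\<forall>e\<in>edges_in (qbox 0 m). 0 \<le> t e" using t by (auto simp: bounded_config_def edges_in_def)
  obtain f where f: "potential b t (qbox 0 m) f" "\<And>x. x \<in> qbox 0 m \<Longrightarrow> 0 \<le> f x"
    "\<And>x. x \<in> qbox 0 m \<Longrightarrow> x $ j = 0 \<Longrightarrow> f x = 0"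
    "\<And>x. x \<in> qbox 0 m \<Longrightarrow> x $ j = real m \<Longrightarrow> crossing_time b t m j \<le> f x"
    by (rule crossing_potential[OF t(1,2)]) blast
  have "\<zeta> $ j * real m \<le> crossing_time b t m j"
    unfolding crossing_time_ge_iff[where t = t, OF nn t(2)] using t(3) by (auto simp: crossing_event_def)
  then have f4: "\<zeta> $ j * real m \<le> f x" if "x \<in> qbox 0 m" "x $ j = real m" for x
    using f(4)[OF that] by linarith
  let ?g = "\<lambda>x. min (f x) (\<zeta> $ j * real m)"
  have pot: "potential b t (qbox 0 m) ?g"
    by (rule potential_transform[OF f(1), of "\<lambda>r. min r (\<zeta> $ j * real m)"]) (auto simp: min_def)
  moreover have "?g \<in> crossing_shape b m j (\<zeta> $ j)"
    unfolding crossing_shape_def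
  proof (intro CollectI conjI ballI impI)
    show "\<bar>?g x - ?g y\<bar> \<le> b * l1_norm (x - y)" if "x \<in> qbox 0 m" "y \<in> qbox 0 m" for x y
      using pot that unfolding potential_def by blast
    show "?g x = 0" if "x \<in> qbox 0 m" "x $ j = 0" for x using f(3)[OF that] \<zeta> by simp
    show "?g x = \<zeta> $ j * real m" if "x \<in> qbox 0 m" "x $ j = real m" for x using f4[OF that] by simp
  qed
  ultimately show thesis by (rule that)
qed

context passage_percolation
begin

lemma edges_in_subset_lattice: "edges_in X \<subseteq> lattice_edges"
  using edges_in_lattice by blast

text \<open>Pigeonhole over the finitely many shapes, whose number does not depend on \<open>m\<close>.\<close>

lemma crossing_shape_pigeonhole:
  assumes \<zeta>: "\<And>i. 0 \<le> \<zeta> $ i" "\<And>i. \<zeta> $ i \<le> b" and \<delta>: "0 < \<delta>"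
  obtains C :: nat where "1 \<le> C" "\<And>m. 1 \<le> m \<Longrightarrow> \<exists>f. (\<forall>j. f j \<in> crossing_shape b m j (\<zeta> $ j)) \<and>
    cprob (crossing_event b m \<zeta>) \<le> real C * cprob (profile_event b (qbox 0 m) f (\<delta> * real m))"
proof -
  have cube: "(qbox 0 1 :: (real ^ 'd) set) = unit_cube" by (auto simp: qbox_def unit_cube_def)
  have "\<exists>G'. finite G' \<and> G' \<subseteq> crossing_shape b 1 j (\<zeta> $ j) \<and>
      (\<forall>f\<in>crossing_shape b 1 j (\<zeta> $ j). \<exists>g\<in>G'. \<forall>x\<in>unit_cube. \<bar>f x - g x\<bar> \<le> \<delta> / 2)" for j
  proof -
    have 1: "\<bar>f x\<bar> \<le> b" if "f \<in> crossing_shape b 1 j (\<zeta> $ j)" "x \<in> unit_cube" for f x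
    proof -
      have "\<bar>f x\<bar> \<le> b * x $ j" using crossing_shape_near_start that cube by metis
      also have "\<dots> \<le> b" using that(2) b_pos by (simp add: unit_cube_def mult_left_le)
      finally show ?thesis .
    qed
    have 2: "\<bar>f x - f y\<bar> \<le> b * l1_norm (x - y)"
      if "f \<in> crossing_shape b 1 j (\<zeta> $ j)" "x \<in> unit_cube" "y \<in> unit_cube" for f x y
      using that unfolding crossing_shape_def cube by blast
    show ?thesis
      by (rule lipschitz_net[of b "\<delta> / 2" "crossing_shape b 1 j (\<zeta> $ j)" b])
         (use 1 2 b_pos \<delta> in \<open>simp_all only: half_gt_zero less_imp_le, blast\<close>)
  qed
  then obtain G where G: "\<And>j. finite (G j)" "\<And>j. G j \<subseteq> crossing_shape b 1 j (\<zeta> $ j)"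
    "\<And>j f. f \<in> crossing_shape b 1 j (\<zeta> $ j) \<Longrightarrow> \<exists>g\<in>G j. \<forall>x\<in>unit_cube. \<bar>f x - g x\<bar> \<le> \<delta> / 2" by metis
  define P where "P = (\<Pi>\<^sub>E j\<in>UNIV. G j)"
  have fP: "finite P" unfolding P_def by (intro finite_PiE) (auto simp: G)
  have Gne: "\<exists>g. g \<in> G j" for j
    using G(3)[OF crossing_shape_nonempty[OF \<zeta>]] by blast
  then have Pne: "P \<noteq> {}" unfolding P_def by (auto simp: PiE_eq_empty_iff)
  show thesis
  proof (rule that[of "card P"])
    show "1 \<le> card P" using fP Pne by (simp add: Suc_le_eq card_gt_0_iff)
    fix m :: nat assume m: "1 \<le> m"
    \<comment> \<open>All shapes at side m are dilations of one net at side 1, so their number does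
      not depend on m. The factor \<open>real m / 1\<close> is the form produced by the rescaling
      lemma.\<close>
    define \<phi> where "\<phi> g j x = real m / 1 * g j ((1 / real m) *\<^sub>R x)" for g :: "'d \<Rightarrow> real ^ 'd \<Rightarrow> real" and j x
    let ?Q = "\<lambda>g. profile_event b (qbox 0 m) (\<phi> g) (\<delta> * real m)"
    have sh: "\<phi> g j \<in> crossing_shape b m j (\<zeta> $ j)" if "g \<in> P" for g j
    proof -
      have "g j \<in> crossing_shape b 1 j (\<zeta> $ j)" using that G(2) by (auto simp: P_def PiE_def Pi_def)
      from rescale_crossing_shape[OF this _ m] show ?thesis by (simp add: \<phi>_def[abs_def])
    qed
    have meas: "{\<omega> \<in> space M. (\<lambda>e. \<tau> e \<omega>) \<in> ?Q g} \<in> events" for g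
      by (rule local_event_measurable[OF local_profile_event edges_in_subset_lattice])
    have "cprob (crossing_event b m \<zeta>) \<le> prob (\<Union>g\<in>P. {\<omega> \<in> space M. (\<lambda>e. \<tau> e \<omega>) \<in> ?Q g})"
    proof (rule prob_mono_in_range)
      show "{\<omega> \<in> space M. (\<lambda>e. \<tau> e \<omega>) \<in> crossing_event b m \<zeta>} \<in> events"
        by (rule local_event_measurable[OF local_crossing_event edges_in_subset_lattice])
      show "(\<Union>g\<in>P. {\<omega> \<in> space M. (\<lambda>e. \<tau> e \<omega>) \<in> ?Q g}) \<in> events" using fP meas by blast
      fix \<omega> assume \<omega>: "\<omega> \<in> space M" "weights_in_range \<omega>"
        "\<omega> \<in> {\<omega> \<in> space M. (\<lambda>e. \<tau> e \<omega>) \<in> crossing_event b m \<zeta>}"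
      let ?t = "\<lambda>e. \<tau> e \<omega>"
      have "\<exists>f g. potential b ?t (qbox 0 m) f \<and> g \<in> G j \<and>
        (\<forall>x\<in>qbox 0 m. \<bar>f x - real m * g ((1 / real m) *\<^sub>R x)\<bar> \<le> \<delta> / 2 * real m)" for j
      proof -
        obtain f where f: "potential b ?t (qbox 0 m) f" "f \<in> crossing_shape b m j (\<zeta> $ j)"
          using crossing_event_shape[OF bounded_config_weights[OF \<omega>(2)] less_imp_le[OF b_pos], of m \<zeta> j] \<omega>(3) \<zeta>(1)
          by blast
        obtain g where g: "g \<in> G j" "\<And>x. x \<in> unit_cube \<Longrightarrow> \<bar>1 / real m * f (real m *\<^sub>R x) - g x\<bar> \<le> \<delta> / 2"
          using G(3)[OF rescale_crossing_shape[OF f(2) m, of 1]] by auto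
        have "\<bar>f x - real m * g ((1 / real m) *\<^sub>R x)\<bar> \<le> \<delta> / 2 * real m" if x: "x \<in> qbox 0 m" for x
        proof -
          have "\<bar>1 / real m * f x - g ((1 / real m) *\<^sub>R x)\<bar> \<le> \<delta> / 2"
            using g(2)[OF qbox_rescale[OF x m]] m by simp
          then have "real m * \<bar>1 / real m * f x - g ((1 / real m) *\<^sub>R x)\<bar> \<le> real m * (\<delta> / 2)"
            by (intro mult_left_mono) auto
          moreover have "f x - real m * g ((1 / real m) *\<^sub>R x) = real m * (1 / real m * f x - g ((1 / real m) *\<^sub>R x))"
            using m by (simp add: right_diff_distrib)
          ultimately show ?thesis by (simp add: abs_mult mult.commute)
        qed
        then show ?thesis using f(1) g(1) by blast
      qed
      then obtain f g where fg: "\<And>j. potential b ?t (qbox 0 m) (f j)" "\<And>j. g j \<in> G j"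
        "\<And>j x. x \<in> qbox 0 m \<Longrightarrow> \<bar>f j x - real m * g j ((1 / real m) *\<^sub>R x)\<bar> \<le> \<delta> / 2 * real m" by metis
      \<comment> \<open>The approximation error of \<open>\<delta> / 2\<close> times m occurs at
        both ends of a path.\<close>
      have "?t \<in> ?Q g"
        unfolding profile_event_def
      proof (intro CollectI allI impI)
        fix j and p :: "(real ^ 'd) list" assume p: "path_in (qbox 0 m) p"
        then have "hd p \<in> qbox 0 m" "last p \<in> qbox 0 m" by (auto simp: path_in_def)
        then show "\<bar>\<phi> g j (last p) - \<phi> g j (hd p)\<bar> - \<delta> * real m \<le> path_time b ?t p"
          using potential_path_time[OF fg(1) p, of j] fg(3)[of "hd p" j] fg(3)[of "last p" j]
          unfolding \<phi>_def div_by_1 abs_le_iff by linarith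
      qed
      moreover have "g \<in> P" using fg(2) by (auto simp: P_def)
      ultimately show "\<omega> \<in> (\<Union>g\<in>P. {\<omega> \<in> space M. (\<lambda>e. \<tau> e \<omega>) \<in> ?Q g})" using \<omega>(1) by blast
    qed
    also have "\<dots> \<le> (\<Sum>g\<in>P. cprob (?Q g))"
      using meas by (intro finite_measure_subadditive_finite fP) auto
    finally have le: "cprob (crossing_event b m \<zeta>) \<le> (\<Sum>g\<in>P. cprob (?Q g))" .
    have "\<exists>g\<in>P. cprob (crossing_event b m \<zeta>) \<le> real (card P) * cprob (?Q g)"
    proof (rule ccontr)
      assume *: "\<not> ?thesis"
      have "(\<Sum>g\<in>P. real (card P) * cprob (?Q g)) < (\<Sum>g\<in>P. cprob (crossing_event b m \<zeta>))"
        using * fP Pne by (intro sum_strict_mono) auto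
      then have "real (card P) * (\<Sum>g\<in>P. cprob (?Q g)) < real (card P) * cprob (crossing_event b m \<zeta>)"
        by (simp add: sum_distrib_left)
      then show False using le mult_left_mono[OF le, of "real (card P)"] by simp
    qed
    then show "\<exists>f. (\<forall>j. f j \<in> crossing_shape b m j (\<zeta> $ j)) \<and>
        cprob (crossing_event b m \<zeta>) \<le> real (card P) * cprob (profile_event b (qbox 0 m) f (\<delta> * real m))"
      using sh by blast
  qed
qed

end

section \<open>From crossings to norms\<close>

lemma tile_floor:
  assumes "x \<in> tile (m + w) m k" "0 < w"
  shows "\<lfloor>x $ i / real (m + w)\<rfloor> = k $ i"
proof (rule floor_unique)
  have p: "0 < real (m + w)" using assms(2) by simp
  have c: "real (m + w) * of_int (k $ i) \<le> x $ i" "x $ i \<le> real (m + w) * of_int (k $ i) + real m"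
    by (rule tile_coordinate[OF assms(1)])+
  show "of_int (k $ i) \<le> x $ i / real (m + w)" using c(1) p by (simp add: pos_le_divide_eq mult.commute)
  have "x $ i < real (m + w) * of_int (k $ i) + real (m + w)" using c(2) assms(2) by simp
  then show "x $ i / real (m + w) < of_int (k $ i) + 1" using p by (simp add: pos_divide_less_eq algebra_simps)
qed

text \<open>The folding map: reflections of the tiles make it one-Lipschitz in each coordinate.\<close>

definition parity :: "int ^ 'd \<Rightarrow> 'd \<Rightarrow> bool" where
  "parity k i \<longleftrightarrow> odd (k $ i)"

abbreviation fold_tile :: "nat \<Rightarrow> nat \<Rightarrow> int ^ 'd \<Rightarrow> real ^ 'd \<Rightarrow> real ^ 'd" where
  "fold_tile m w k \<equiv> unplace (parity k) (tile_corner (m + w) k) m"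

lemma fold_coordinate:
  "fold_tile m w k x $ i =
    (if odd (k $ i) then real m - (x $ i - real (m + w) * of_int (k $ i)) else x $ i - real (m + w) * of_int (k $ i))"
  by (simp add: unplace_def parity_def tile_corner_def)

text \<open>In one coordinate the map is a zigzag onto [0, m], with corridors inserted at the
  turning points. Adjacent layers have opposite orientation and agree at the turning point. Layers
  at least two apart are at distance at least m, which is the whole range of the fold.\<close>

lemma fold_coordinate_lipschitz:
  assumes x: "x \<in> tile (m + w) m k" and y: "y \<in> tile (m + w) m k'"
  shows "\<bar>fold_tile m w k x $ i - fold_tile m w k' y $ i\<bar> \<le> \<bar>x $ i - y $ i\<bar>"
proof -
  have main: "\<bar>fold_tile m w k x $ i - fold_tile m w k' y $ i\<bar> \<le> \<bar>x $ i - y $ i\<bar>"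
    if le: "k $ i \<le> k' $ i" and that: "x \<in> tile (m + w) m k" "y \<in> tile (m + w) m k'" for k k' and x y :: "real ^ 'a"
  proof -
    define \<alpha> where "\<alpha> = x $ i - real (m + w) * of_int (k $ i)"
    define \<beta> where "\<beta> = y $ i - real (m + w) * of_int (k' $ i)"
    have \<alpha>: "0 \<le> \<alpha>" "\<alpha> \<le> real m" using tile_coordinate[OF that(1), of i] by (simp_all add: \<alpha>_def)
    have \<beta>: "0 \<le> \<beta>" "\<beta> \<le> real m" using tile_coordinate[OF that(2), of i] by (simp_all add: \<beta>_def)
    have diff: "y $ i - x $ i = real (m + w) * of_int (k' $ i - k $ i) + \<beta> - \<alpha>"
      by (simp add: \<alpha>_def \<beta>_def algebra_simps)
    have fx: "fold_tile m w k x $ i = (if odd (k $ i) then real m - \<alpha> else \<alpha>)"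
      unfolding fold_coordinate \<alpha>_def ..
    have fy: "fold_tile m w k' y $ i = (if odd (k' $ i) then real m - \<beta> else \<beta>)"
      unfolding fold_coordinate \<beta>_def ..
    consider "k' $ i = k $ i" | "k' $ i = k $ i + 1" | "k $ i + 2 \<le> k' $ i" using le by linarith
    then show ?thesis
    proof cases
      case 1
      then show ?thesis using diff unfolding fx fy by (auto simp: abs_if)
    next
      case 2
      have "y $ i - x $ i = real (m + w) + \<beta> - \<alpha>" using diff 2 by simp
      then have "real m + \<beta> - \<alpha> \<le> \<bar>x $ i - y $ i\<bar>" by simp
      then show ?thesis using \<alpha> \<beta> 2 unfolding fx fy by (auto simp: abs_le_iff)
    next
      case 3
      have "real (m + w) * 2 \<le> real (m + w) * of_int (k' $ i - k $ i)"
        using 3 by (intro mult_left_mono) auto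
      then have "real m \<le> y $ i - x $ i" using diff \<alpha> \<beta> by simp
      moreover have "0 \<le> fold_tile m w k x $ i" "fold_tile m w k x $ i \<le> real m"
        "0 \<le> fold_tile m w k' y $ i" "fold_tile m w k' y $ i \<le> real m" using \<alpha> \<beta> by (auto simp: fx fy)
      ultimately show ?thesis by linarith
    qed
  qed
  show ?thesis
  proof (cases "k $ i \<le> k' $ i")
    case True
    then show ?thesis by (rule main[OF _ x y])
  next
    case False
    then show ?thesis using main[OF _ y x] by (simp add: abs_minus_commute)
  qed
qed

lemma fold_lipschitz:
  fixes x y :: "real ^ 'd::finite"
  assumes "x \<in> tile (m + w) m k" "y \<in> tile (m + w) m k'"
  shows "l1_norm (fold_tile m w k x - fold_tile m w k' y) \<le> l1_norm (x - y)"
  unfolding l1_norm_def using fold_coordinate_lipschitz[OF assms] by (intro sum_mono) simp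

text \<open>The shape \<open>f\<close> unfolded from one tile to all tiles: it increases by \<open>s m\<close> through each layer of
  tiles in direction \<open>j\<close>.\<close>

definition unfolded :: "nat \<Rightarrow> nat \<Rightarrow> 'd \<Rightarrow> real \<Rightarrow> (real ^ 'd \<Rightarrow> real) \<Rightarrow> real ^ 'd \<Rightarrow> real" where
  "unfolded m w j s f x =
    (let k = (\<chi> i. \<lfloor>x $ i / real (m + w)\<rfloor>); y = fold_tile m w k x
     in if odd (k $ j) then (of_int (k $ j) + 1) * (s * real m) - f y else of_int (k $ j) * (s * real m) + f y)"

lemma unfolded_tile:
  assumes "x \<in> tile (m + w) m k" "0 < w"
  shows "unfolded m w j s f x =
    (if odd (k $ j) then (of_int (k $ j) + 1) * (s * real m) - f (fold_tile m w k x)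
     else of_int (k $ j) * (s * real m) + f (fold_tile m w k x))"
proof -
  have "(\<chi> i. \<lfloor>x $ i / real (m + w)\<rfloor>) = k" using tile_floor[OF assms] by (simp add: vec_eq_iff)
  then show ?thesis by (simp add: unfolded_def Let_def)
qed

text \<open>In direction j a tile is entered at height \<open>k $ j\<close> and left at height
  \<open>k $ j + 1\<close>, in units of s m. Reflection swaps the two ends and the sign, so the
  bounds near the two faces of a shape give both estimates for either parity.\<close>

lemma unfolded_layer_bounds:
  fixes f :: "real ^ 'd::finite \<Rightarrow> real"
  assumes f: "f \<in> crossing_shape b m j s" and x: "x \<in> tile (m + w) m k" and w: "0 < w"
  shows "\<bar>unfolded m w j s f x - of_int (k $ j) * (s * real m)\<bar> \<le> b * (x $ j - real (m + w) * of_int (k $ j))"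
    "\<bar>unfolded m w j s f x - (of_int (k $ j) + 1) * (s * real m)\<bar>
      \<le> b * (real m - (x $ j - real (m + w) * of_int (k $ j)))"
proof -
  let ?y = "fold_tile m w k x"
  have y: "?y \<in> qbox 0 m" using unplace_in_qbox[OF x] .
  have 1: "\<bar>f ?y\<bar> \<le> b * ?y $ j" by (rule crossing_shape_near_start[OF f y])
  have 2: "\<bar>f ?y - s * real m\<bar> \<le> b * (real m - ?y $ j)" by (rule crossing_shape_near_end[OF f y])
  have e: "(of_int (k $ j) + 1) * (s * real m) = of_int (k $ j) * (s * real m) + s * real m"
    by (simp add: algebra_simps)
  have A: "\<bar>unfolded m w j s f x - of_int (k $ j) * (s * real m)\<bar> \<le> b * (x $ j - real (m + w) * of_int (k $ j)) \<and>
    \<bar>unfolded m w j s f x - (of_int (k $ j) + 1) * (s * real m)\<bar>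
      \<le> b * (real m - (x $ j - real (m + w) * of_int (k $ j)))"
  proof (cases "odd (k $ j)")
    case True
    then have yj: "?y $ j = real m - (x $ j - real (m + w) * of_int (k $ j))" unfolding fold_coordinate by simp
    then have "real m - ?y $ j = x $ j - real (m + w) * of_int (k $ j)" by simp
    then show ?thesis using 1 2 True yj unfolding unfolded_tile[OF x w] e
      by (simp add: abs_minus_commute del: of_nat_add)
  next
    case False
    then have yj: "?y $ j = x $ j - real (m + w) * of_int (k $ j)" unfolding fold_coordinate by simp
    then show ?thesis using 1 2 False unfolding unfolded_tile[OF x w] e
      by (simp add: abs_minus_commute del: of_nat_add)
  qed
  then show "\<bar>unfolded m w j s f x - of_int (k $ j) * (s * real m)\<bar> \<le> b * (x $ j - real (m + w) * of_int (k $ j))"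
    "\<bar>unfolded m w j s f x - (of_int (k $ j) + 1) * (s * real m)\<bar>
      \<le> b * (real m - (x $ j - real (m + w) * of_int (k $ j)))" by blast+
qed

text \<open>Within one layer of direction j only the fold and possibly a sign intervene. Between
  layers the increment is split into leaving the lower layer, crossing the full layers in between
  and entering the upper one. A full layer adds s m, at most b times its period because s is at most
  b.\<close>

lemma unfolded_lipschitz:
  fixes f :: "real ^ 'd::finite \<Rightarrow> real"
  assumes f: "f \<in> crossing_shape b m j s" and s: "0 \<le> s" "s \<le> b" and w: "0 < w"
    and x: "x \<in> tile (m + w) m k" and y: "y \<in> tile (m + w) m k'"
  shows "\<bar>unfolded m w j s f x - unfolded m w j s f y\<bar> \<le> b * l1_norm (x - y)"
proof -
  have b: "0 \<le> b" using s by simp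
  have main: "\<bar>unfolded m w j s f x - unfolded m w j s f y\<bar> \<le> b * l1_norm (x - y)"
    if x: "x \<in> tile (m + w) m k" and y: "y \<in> tile (m + w) m k'" and lt: "k $ j < k' $ j"
    for k k' and x y :: "real ^ 'd"
  proof -
    define K where "K = real_of_int (k' $ j) - real_of_int (k $ j)"
    have K: "1 \<le> K" using lt unfolding K_def by linarith
    let ?A = "b * (real m - (x $ j - real (m + w) * of_int (k $ j)))"
    let ?B = "b * (y $ j - real (m + w) * of_int (k' $ j))"
    have "of_int (k' $ j) * (s * real m) - (of_int (k $ j) + 1) * (s * real m) = (K - 1) * (s * real m)"
      by (simp add: K_def algebra_simps)
    moreover have "0 \<le> (K - 1) * (s * real m)" using K s by simp
    ultimately have "\<bar>unfolded m w j s f x - unfolded m w j s f y\<bar> \<le> ?A + ?B + (K - 1) * (s * real m)"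
      using unfolded_layer_bounds(2)[OF f x w] unfolded_layer_bounds(1)[OF f y w] by linarith
    also have "(K - 1) * (s * real m) \<le> b * ((K - 1) * real (m + w))"
    proof -
      have "s * real m \<le> b * real (m + w)" using s by (intro mult_mono) auto
      then have "(K - 1) * (s * real m) \<le> (K - 1) * (b * real (m + w))" using K by (intro mult_left_mono) auto
      then show ?thesis by (simp only: mult.left_commute)
    qed
    also have "?A + ?B + b * ((K - 1) * real (m + w)) = b * (y $ j - x $ j) - b * real w"
      by (simp add: K_def algebra_simps)
    also have "\<dots> \<le> b * l1_norm (x - y)"
    proof -
      have "y $ j - x $ j \<le> l1_norm (x - y)" using component_le_l1_norm[of x j y] by linarith
      then have "b * (y $ j - x $ j) \<le> b * l1_norm (x - y)" using b by (rule mult_left_mono)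
      moreover have "0 \<le> b * real w" using b by simp
      ultimately show ?thesis by linarith
    qed
    finally show ?thesis by simp
  qed
  consider "k $ j < k' $ j" | "k' $ j < k $ j" | "k $ j = k' $ j" by linarith
  then show ?thesis
  proof cases
    case 1
    then show ?thesis by (rule main[OF x y])
  next
    case 2
    then show ?thesis using main[OF y x] by (simp add: abs_minus_commute l1_norm_minus_commute)
  next
    case 3
    have "\<bar>unfolded m w j s f x - unfolded m w j s f y\<bar> = \<bar>f (fold_tile m w k x) - f (fold_tile m w k' y)\<bar>"
      unfolding unfolded_tile[OF x w] unfolded_tile[OF y w] 3 by (simp add: abs_minus_commute)
    also have "\<dots> \<le> b * l1_norm (fold_tile m w k x - fold_tile m w k' y)"
      using f unplace_in_qbox[OF x, of "parity k"] unplace_in_qbox[OF y, of "parity k'"]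
      unfolding crossing_shape_def by blast
    also have "\<dots> \<le> b * l1_norm (x - y)" by (rule mult_left_mono[OF fold_lipschitz[OF x y] b])
    finally show ?thesis .
  qed
qed

text \<open>The growth is s m per period m + w instead of s (m + w). This relative loss of w / (m +
  w) over a length of at most N is the first error term; the deviation inside a single tile gives
  the second.\<close>

lemma unfolded_almost_linear:
  fixes f :: "real ^ 'd::finite \<Rightarrow> real"
  assumes f: "f \<in> crossing_shape b m j s" and s: "0 \<le> s" "s \<le> b" and w: "0 < w"
    and x: "x \<in> tile (m + w) m k" and k: "k \<in> tile_indices K" "K * (m + w) \<le> N"
  shows "\<bar>unfolded m w j s f x - s * x $ j\<bar> \<le> b * real N * real w / real (m + w) + 2 * b * real m"
proof -
  define p where "p = real (m + w)"
  have p: "0 < p" using w by (simp add: p_def)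
  have b: "0 \<le> b" using s by simp
  have c: "p * of_int (k $ j) \<le> x $ j" "x $ j \<le> p * of_int (k $ j) + real m"
    using tile_coordinate[OF x, of j] by (simp_all only: p_def)
  have k0: "0 \<le> (of_int (k $ j) :: real)" using k(1) by (simp add: tile_indices_def)
  have "x \<in> qbox 0 N" using tile_subset_qbox[OF k le_add1] x by blast
  then have "x $ j \<le> real N" by (simp add: qbox_def)
  then have "p * of_int (k $ j) \<le> real N" using c(1) by linarith
  then have kp: "of_int (k $ j) \<le> real N / p" using p by (simp add: pos_le_divide_eq mult.commute)
  have 1: "\<bar>unfolded m w j s f x - of_int (k $ j) * (s * real m)\<bar> \<le> b * (x $ j - p * of_int (k $ j))"
    using unfolded_layer_bounds(1)[OF f x w] by (simp only: p_def)
  have "b * (x $ j - p * of_int (k $ j)) \<le> b * real m" using c b by (intro mult_left_mono) auto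
  moreover have "s * x $ j - of_int (k $ j) * (s * real m) = s * (x $ j - of_int (k $ j) * real m)"
    by (simp add: algebra_simps)
  moreover have "0 \<le> s * (x $ j - of_int (k $ j) * real m)"
  proof -
    have "real m * of_int (k $ j) \<le> p * of_int (k $ j)" using k0 by (intro mult_right_mono) (simp_all add: p_def)
    then show ?thesis using c s by (simp add: mult.commute)
  qed
  moreover have "s * (x $ j - of_int (k $ j) * real m) \<le> b * (real N / p * real w + real m)"
  proof (rule mult_mono)
    have "x $ j - of_int (k $ j) * real m \<le> of_int (k $ j) * real w + real m"
      using c(2) by (simp add: p_def algebra_simps)
    also have "\<dots> \<le> real N / p * real w + real m" using kp by (intro add_right_mono mult_right_mono) auto
    finally show "x $ j - of_int (k $ j) * real m \<le> real N / p * real w + real m" .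
    have "real m * of_int (k $ j) \<le> p * of_int (k $ j)" using k0 by (intro mult_right_mono) (simp_all add: p_def)
    then show "0 \<le> x $ j - of_int (k $ j) * real m" using c by (simp add: mult.commute)
  qed (use s b in auto)
  moreover have "b * (real N / p * real w + real m) = b * real N * real w / p + b * real m"
    by (simp add: algebra_simps)
  ultimately show ?thesis using 1 unfolding p_def[symmetric] by linarith
qed

lemma inverse_power_bernoulli:
  assumes "0 \<le> \<eta>" "2 * \<eta> \<le> 1" "1 \<le> m" "real w \<le> 2 * \<eta> * real m"
  shows "1 - 2 * real d * \<eta> \<le> (real m / real (m + w)) ^ d"
proof -
  have "real (m + w) \<le> (1 + 2 * \<eta>) * real m" using assms(4) by (simp add: algebra_simps)
  then have "(1 - 2 * \<eta>) * real (m + w) \<le> (1 - 2 * \<eta>) * ((1 + 2 * \<eta>) * real m)"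
    using assms(2) by (intro mult_left_mono) auto
  also have "\<dots> = real m - (2 * \<eta>)^2 * real m" by (simp add: power2_eq_square algebra_simps)
  also have "\<dots> \<le> real m" by simp
  finally have le: "1 - 2 * \<eta> \<le> real m / real (m + w)"
    using assms(3) by (subst pos_le_divide_eq) auto
  have "1 + real d * (- (2 * \<eta>)) \<le> (1 + - (2 * \<eta>)) ^ d"
    using assms(2) by (intro Bernoulli_inequality) simp
  also have "\<dots> \<le> (real m / real (m + w)) ^ d"
    using le assms(2) by (intro power_mono) auto
  finally show ?thesis by simp
qed

text \<open>The width is \<open>\<eta>\<close> m rounded up. As \<open>\<eta>\<close> m is at least
  1, rounding costs no more than a factor 2.\<close>

lemma tile_gap:
  assumes \<eta>: "0 < \<eta>" "2 * \<eta> \<le> 1" "2 * real d * \<eta> < \<kappa>" and m: "1 \<le> m" "1 / \<eta> \<le> real m"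
  obtains w where "\<eta> * real m \<le> real w" "real w \<le> 2 * \<eta> * real m" "0 < w"
    "1 - (real m / real (m + w)) ^ d < \<kappa>"
proof -
  define w where "w = nat \<lceil>\<eta> * real m\<rceil>"
  have "1 \<le> \<eta> * real m" using m(2) \<eta>(1) by (simp add: field_simps)
  then have w: "\<eta> * real m \<le> real w" "real w \<le> 2 * \<eta> * real m" "0 < w"
    unfolding w_def by linarith+
  have "1 - (real m / real (m + w)) ^ d < \<kappa>"
    using inverse_power_bernoulli[OF less_imp_le[OF \<eta>(1)] \<eta>(2) m(1) w(2), of d] \<eta>(3) by linarith
  then show thesis using that w by blast
qed

context passage_percolation
begin

text \<open>Tiles scaled down by \<open>1 - \<sigma>\<close> and separated by corridors of relative width \<open>\<eta>\<close>, whose edges have weights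
  at least \<open>(1 - \<sigma> / 2) b\<close>; such weights cost at most \<open>\<beta> / 2\<close>.\<close>

lemma tile_parameters:
  assumes \<epsilon>: "0 < \<epsilon>" and \<beta>: "0 < \<beta>"
  obtains \<sigma> L \<kappa> \<eta> where "0 < \<sigma>" "\<sigma> < 1" "\<sigma> * b \<le> \<epsilon> / 8"
    "0 \<le> L" "measure \<nu> {(1 - \<sigma> / 2) * b..} = exp (- L)"
    "0 < \<kappa>" "real CARD('d) * L * \<kappa> \<le> \<beta> / 2"
    "0 < \<eta>" "2 * \<eta> \<le> 1" "2 * real CARD('d) * \<eta> < \<kappa>" "2 * b * \<eta> \<le> \<epsilon> / 8"
proof -
  let ?d = "CARD('d)"
  interpret nu: prob_space \<nu> by (rule nu_prob)
  define \<sigma> where "\<sigma> = min (1 / 2) (\<epsilon> / (8 * b))"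
  have \<sigma>: "0 < \<sigma>" "\<sigma> < 1" using \<epsilon> b_pos by (auto simp: \<sigma>_def)
  have \<sigma>b: "\<sigma> * b \<le> \<epsilon> / 8"
  proof -
    have "\<sigma> * b \<le> \<epsilon> / (8 * b) * b" using b_pos by (intro mult_right_mono) (auto simp: \<sigma>_def)
    then show ?thesis using b_pos by simp
  qed
  define c where "c = measure \<nu> {(1 - \<sigma> / 2) * b..}"
  have c: "0 < c" "c \<le> 1"
    unfolding c_def using \<sigma> b_pos by (auto intro!: nu_upper_pos)
  define L where "L = - ln c"
  have L: "0 \<le> L" "c = exp (- L)" using c by (auto simp: L_def)
  \<comment> \<open>The corridors get half of the budget \<open>\<beta>\<close>; the other half is
    left for the number of shapes, or for a rounded layer. The summand 1 keeps the quotient defined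
    when L = 0.\<close>
  define \<kappa> where "\<kappa> = \<beta> / (2 * (real ?d * L + 1))"
  have dL: "0 \<le> real ?d * L" using L by simp
  have \<kappa>: "0 < \<kappa>" "real ?d * L * \<kappa> \<le> \<beta> / 2"
  proof -
    show "0 < \<kappa>" using dL \<beta> by (simp add: \<kappa>_def)
    have "real ?d * L * \<kappa> \<le> (real ?d * L + 1) * \<kappa>" using \<open>0 < \<kappa>\<close> by (intro mult_right_mono) auto
    also have "\<dots> = \<beta> / 2" using dL by (simp add: \<kappa>_def field_simps)
    finally show "real ?d * L * \<kappa> \<le> \<beta> / 2" .
  qed
  \<comment> \<open>The three bounds serve, in this order, the Bernoulli estimate, the share
    \<open>\<kappa>\<close> of corridor edges and the slope lost in the corridors.\<close>
  define \<eta> where "\<eta> = min (1 / 2) (min (\<kappa> / (4 * real ?d)) (\<epsilon> / (16 * b)))"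
  have \<eta>: "0 < \<eta>" "2 * \<eta> \<le> 1" "2 * real ?d * \<eta> < \<kappa>" "2 * b * \<eta> \<le> \<epsilon> / 8"
  proof -
    show "0 < \<eta>" "2 * \<eta> \<le> 1" using \<kappa> \<epsilon> b_pos by (auto simp: \<eta>_def)
    have "2 * real ?d * \<eta> \<le> 2 * real ?d * (\<kappa> / (4 * real ?d))" by (intro mult_left_mono) (auto simp: \<eta>_def)
    also have "\<dots> = \<kappa> / 2" by simp
    finally show "2 * real ?d * \<eta> < \<kappa>" using \<kappa>(1) by simp
    have "2 * b * \<eta> \<le> 2 * b * (\<epsilon> / (16 * b))" using b_pos by (intro mult_left_mono) (auto simp: \<eta>_def)
    then show "2 * b * \<eta> \<le> \<epsilon> / 8" using b_pos by simp
  qed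
  show thesis
    by (rule that[OF \<sigma> \<sigma>b L(1) L(2)[unfolded c_def] \<kappa> \<eta>])
qed

lemma tile_count_le:
  assumes "1 \<le> m" shows "real (N div (m + w)) ^ d * real m ^ d \<le> real N ^ d"
proof -
  have "N div (m + w) * m \<le> N div (m + w) * (m + w)" by simp
  also have "\<dots> \<le> N" by (rule div_times_less_eq_dividend)
  finally have "real (N div (m + w) * m) \<le> real N" by (simp only: of_nat_le_iff)
  then show ?thesis by (simp only: power_mult_distrib[symmetric] of_nat_mult[symmetric]) (intro power_mono, auto)
qed

text \<open>Tile space with reflected independent copies of a most likely crossing shape.\<close>

lemma crossing_to_profile:
  assumes \<zeta>: "\<And>i. 0 \<le> \<zeta> $ i" "\<And>i. \<zeta> $ i \<le> b" and \<epsilon>: "0 < \<epsilon>" and \<beta>: "0 < \<beta>" and x: "0 \<le> x"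
    and freq: "\<exists>\<^sub>F m in sequentially. exp (- x * real m ^ CARD('d)) \<le> cprob (crossing_event b m \<zeta>)"
  shows "\<forall>\<^sub>F N in sequentially. exp (- (x + \<beta>) * real N ^ CARD('d))
    \<le> cprob (profile_event b (qbox 0 N) (linear_profile \<zeta>) (\<epsilon> * real N))"
proof -
  let ?d = "CARD('d)"
  obtain \<sigma> L \<kappa> \<eta> where \<sigma>: "0 < \<sigma>" "\<sigma> < 1" and \<sigma>b: "\<sigma> * b \<le> \<epsilon> / 8"
    and L: "0 \<le> L" "measure \<nu> {(1 - \<sigma> / 2) * b..} = exp (- L)"
    and \<kappa>: "0 < \<kappa>" "real ?d * L * \<kappa> \<le> \<beta> / 2"
    and \<eta>: "0 < \<eta>" "2 * \<eta> \<le> 1" "2 * real ?d * \<eta> < \<kappa>" "2 * b * \<eta> \<le> \<epsilon> / 8"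
    by (rule tile_parameters[OF \<epsilon> \<beta>]) blast
  define c where "c = measure \<nu> {(1 - \<sigma> / 2) * b..}"
  have c: "0 < c" "c = exp (- L)" using L(2) by (simp_all add: c_def)
  have dL: "0 \<le> real ?d * L" using L(1) by simp
  \<comment> \<open>Makes 2 \<open>\<delta>\<close> m equal to \<open>\<sigma> / 2 * b\<close> times
    \<open>\<eta>\<close> m, hence at most what a corridor of width w \<ge> \<open>\<eta>\<close> m
    absorbs.\<close>
  define \<delta> where "\<delta> = \<sigma> * b * \<eta> / 4"
  have \<delta>: "0 < \<delta>" using \<sigma> b_pos \<eta> by (simp add: \<delta>_def)
  obtain C :: nat where C: "1 \<le> C" "\<And>m. 1 \<le> m \<Longrightarrow> \<exists>f. (\<forall>j. f j \<in> crossing_shape b m j (\<zeta> $ j)) \<and>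
    cprob (crossing_event b m \<zeta>) \<le> real C * cprob (profile_event b (qbox 0 m) f (\<delta> * real m))"
    by (rule crossing_shape_pigeonhole[OF \<zeta> \<delta>]) blast
  have "\<forall>\<^sub>F m in sequentially. ln (real C) / (\<beta> / 2) \<le> real m \<and> 1 / \<eta> \<le> real m"
    by (intro eventually_conj eventually_at_top_linorderI[of "nat \<lceil>ln (real C) / (\<beta> / 2)\<rceil>"]
        eventually_at_top_linorderI[of "nat \<lceil>1 / \<eta>\<rceil>"]) linarith+
  \<comment> \<open>One scale suffices from here on. Besides being good it has to be large, so that
    the logarithm of C costs at most \<open>\<beta> / 2\<close> per unit volume of a tile and
    \<open>\<eta>\<close> m is at least 1.\<close>
  then obtain m where m: "exp (- x * real m ^ ?d) \<le> cprob (crossing_event b m \<zeta>)"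
    "ln (real C) / (\<beta> / 2) \<le> real m" "1 / \<eta> \<le> real m"
    using frequently_ex[OF frequently_eventually_conj[OF freq]] by blast
  have m1: "1 \<le> m"
  proof -
    have "0 < 1 / \<eta>" using \<eta>(1) by simp
    then show ?thesis using m(3) by linarith
  qed
  obtain f where f: "\<And>j. f j \<in> crossing_shape b m j (\<zeta> $ j)"
    "cprob (crossing_event b m \<zeta>) \<le> real C * cprob (profile_event b (qbox 0 m) f (\<delta> * real m))"
    using C(2)[OF m1] by blast
  obtain w where w: "\<eta> * real m \<le> real w" "real w \<le> 2 * \<eta> * real m" "0 < w"
    and frac: "1 - (real m / real (m + w)) ^ ?d < \<kappa>"
    by (rule tile_gap[OF \<eta>(1-3) m1 m(3)]) blast
  define p where "p = m + w"
  have mp: "m \<le> p" "1 \<le> p" using m1 by (auto simp: p_def)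
  note corr = corridor_fraction[OF m1 mp(1) frac[folded p_def]]
  \<comment> \<open>Errors at a point that do not grow with N: the passage to a nearby tile, the
    error of the potential in the tile and the deviation of the unfolded shape from linearity. The
    corridors and the factor 1 - \<open>\<sigma>\<close> add at most \<open>\<epsilon> / 8\<close>
    times N each. Both ends of a path together stay below \<open>\<epsilon>\<close> N once 2 Q is at
    most \<open>\<epsilon> / 4\<close> times N.\<close>
  define Q where "Q = 4 * b * (real ?d * (2 * real p)) + \<delta> * real m + 2 * b * real m"
  have "\<forall>\<^sub>F N in sequentially. 2 * Q / (\<epsilon> / 4) \<le> real N"
    by (intro eventually_at_top_linorderI[of "nat \<lceil>2 * Q / (\<epsilon> / 4)\<rceil>"]) linarith
  then show ?thesis
    using corr eventually_ge_at_top[of p]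
  proof eventually_elim
    case (elim N)
    define K where "K = N div p"
    have K: "0 < K" "K * p \<le> N" "N < (K + 1) * p"
    proof -
      show "0 < K" using elim(3) mp(2) by (simp add: K_def div_greater_zero_iff)
      show "K * p \<le> N" unfolding K_def by (rule div_times_less_eq_dividend)
      have "N < p + N div p * p" using mp(2) by (intro dividend_less_div_times) simp
      then show "N < (K + 1) * p" by (simp add: K_def)
    qed
    have QN: "2 * Q \<le> \<epsilon> / 4 * real N" using elim(1) \<epsilon> by (simp add: field_simps)
    have quarter: "\<epsilon> / 4 * real N = \<epsilon> * real N / 4" "\<epsilon> / 8 * real N = \<epsilon> * real N / 8" by simp_all
    let ?H = "\<lambda>j. unfolded m w j (\<zeta> $ j) (f j)"
    let ?D = "profile_event b (qbox 0 N) (linear_profile \<zeta>) (\<epsilon> * real N)"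
    let ?P = "cprob (profile_event b (qbox 0 m) f (\<delta> * real m))"
    have "(\<Prod>k\<in>(tile_indices K :: (int ^ 'd) set). ?P) * c ^ (?d * ((N + 1) ^ ?d - (K * m) ^ ?d)) \<le> cprob ?D"
      unfolding c_def
    proof (rule tile_prob[OF \<sigma> K(1) w(3), where H = ?H and r = parity and h = "\<lambda>_. f" and \<epsilon> = "\<delta> * real m" and N = N])
      show "K * (m + w) \<le> N" using K(2) by (simp add: p_def)
      show "\<bar>?H j y - ?H j y'\<bar> \<le> b * l1_norm (y - y')"
        if "y \<in> tile (m + w) m k" "y' \<in> tile (m + w) m k'" for j k k' y y'
        by (rule unfolded_lipschitz[OF f(1) \<zeta> w(3) that])
      show "\<bar>?H j (place (parity k) (tile_corner (m + w) k) m y) - ?H j (place (parity k) (tile_corner (m + w) k) m y')\<bar>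
          \<le> \<bar>f j y - f j y'\<bar>" if "y \<in> qbox 0 m" "y' \<in> qbox 0 m" for j k y y'
        using place_in_qbox[OF that(1), of "parity k" "tile_corner (m + w) k"]
          place_in_qbox[OF that(2), of "parity k" "tile_corner (m + w) k"]
        by (simp add: unfolded_tile[OF _ w(3)] abs_minus_commute)
      show "0 \<le> \<delta> * real m" using \<delta> by simp
      show "2 * (\<delta> * real m) \<le> \<sigma> / 2 * b * real w"
      proof -
        have "2 * (\<delta> * real m) = \<sigma> / 2 * b * (\<eta> * real m)" by (simp add: \<delta>_def)
        also have "\<dots> \<le> \<sigma> / 2 * b * real w" using w(1) \<sigma> b_pos by (intro mult_left_mono) auto
        finally show ?thesis .
      qed
      show "local_event (edges_in (qbox 0 N)) ?D" by (rule local_profile_event)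
      fix t assume t: "bounded_config b t"
        and F: "\<And>j. \<exists>F. potential b t (qbox 0 N) F \<and>
          (\<forall>k\<in>tile_indices K. \<forall>y\<in>tile (m + w) m k. \<bar>F y - (1 - \<sigma>) * ?H j y\<bar> \<le> \<delta> * real m)"
      show "t \<in> ?D"
        unfolding profile_event_def
      proof (intro CollectI allI impI)
        fix j and q :: "(real ^ 'd) list" assume q: "path_in (qbox 0 N) q"
        obtain F where F: "potential b t (qbox 0 N) F"
          "\<And>k y. k \<in> tile_indices K \<Longrightarrow> y \<in> tile (m + w) m k \<Longrightarrow> \<bar>F y - (1 - \<sigma>) * ?H j y\<bar> \<le> \<delta> * real m"
          using F[of j] by blast
        have near: "\<bar>F z - \<zeta> $ j * z $ j\<bar> \<le> Q + \<epsilon> / 4 * real N" if z: "z \<in> qbox 0 N" for z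
        proof -
          obtain k y where y: "k \<in> tile_indices K" "y \<in> tile p m k" "l1_norm (z - y) \<le> real ?d * (2 * real p)"
            by (rule tile_covering[OF z K(1,3) mp(1)])
          have yX: "y \<in> qbox 0 N" using tile_subset_qbox[OF y(1) K(2) mp(1)] y(2) by blast
          have r: "b * l1_norm (z - y) \<le> b * (real ?d * (2 * real p))" using y(3) b_pos by (intro mult_left_mono) auto
          have 1: "\<bar>F z - F y\<bar> \<le> b * l1_norm (z - y)" using F(1) z yX unfolding potential_def by blast
          have 2: "\<bar>F y - (1 - \<sigma>) * ?H j y\<bar> \<le> \<delta> * real m" using F(2) y by (simp add: p_def)
          have 3: "\<bar>?H j y - \<zeta> $ j * y $ j\<bar> \<le> b * real N * real w / real (m + w) + 2 * b * real m"
            by (rule unfolded_almost_linear[OF f(1) \<zeta> w(3)]) (use y K in \<open>auto simp: p_def\<close>)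
          have 4: "b * real N * real w / real (m + w) \<le> \<epsilon> / 8 * real N"
          proof -
            have "real w / real (m + w) \<le> 2 * \<eta>"
            proof -
              have "2 * \<eta> * real m \<le> 2 * \<eta> * real (m + w)" using \<eta>(1) by (intro mult_left_mono) auto
              then have "real w \<le> 2 * \<eta> * real (m + w)" using w(2) by linarith
              then show ?thesis using w(3) by (simp add: pos_divide_le_eq)
            qed
            then have "b * real N * (real w / real (m + w)) \<le> b * real N * (2 * \<eta>)"
              using b_pos by (intro mult_left_mono) auto
            also have "\<dots> = 2 * b * \<eta> * real N" by simp
            also have "\<dots> \<le> \<epsilon> / 8 * real N" using \<eta>(4) by (intro mult_right_mono) auto
            finally show ?thesis by simp
          qed
          have yj: "0 \<le> y $ j" "y $ j \<le> real N" using yX by (auto simp: qbox_def)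
          have 5: "\<bar>(1 - \<sigma>) * ?H j y - \<zeta> $ j * y $ j\<bar> \<le> \<bar>?H j y - \<zeta> $ j * y $ j\<bar> + \<epsilon> / 8 * real N"
          proof -
            have tri: "\<bar>A - B\<bar> \<le> \<bar>V\<bar> + E" if "\<bar>A\<bar> \<le> 1 * \<bar>V\<bar>" "B \<le> C" "C \<le> E" "0 \<le> B" for A B C V E :: real
              using that by linarith
            have eq: "(1 - \<sigma>) * ?H j y - \<zeta> $ j * y $ j = (1 - \<sigma>) * (?H j y - \<zeta> $ j * y $ j) - \<sigma> * (\<zeta> $ j * y $ j)"
              by (simp add: algebra_simps)
            have "\<bar>(1 - \<sigma>) * (?H j y - \<zeta> $ j * y $ j)\<bar> \<le> 1 * \<bar>?H j y - \<zeta> $ j * y $ j\<bar>"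
              unfolding abs_mult using \<sigma> by (intro mult_right_mono) auto
            moreover have "\<sigma> * (\<zeta> $ j * y $ j) \<le> \<sigma> * (b * real N)"
              using \<sigma> \<zeta> yj b_pos by (intro mult_left_mono mult_mono) auto
            moreover have "\<sigma> * (b * real N) \<le> \<epsilon> / 8 * real N"
              using mult_right_mono[OF \<sigma>b, of "real N"] by (simp add: mult.assoc)
            moreover have "0 \<le> \<sigma> * (\<zeta> $ j * y $ j)" using \<sigma> \<zeta> yj by simp
            ultimately show ?thesis unfolding eq by (rule tri)
          qed
          have 6: "\<bar>\<zeta> $ j * y $ j - \<zeta> $ j * z $ j\<bar> \<le> b * l1_norm (z - y)"
          proof -
            have "\<bar>\<zeta> $ j * y $ j - \<zeta> $ j * z $ j\<bar> = \<zeta> $ j * \<bar>z $ j - y $ j\<bar>"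
              unfolding right_diff_distrib[symmetric] abs_mult using \<zeta>(1)[of j] by (simp add: abs_minus_commute)
            also have "\<dots> \<le> b * l1_norm (z - y)" using \<zeta> component_le_l1_norm b_pos by (intro mult_mono) auto
            finally show ?thesis .
          qed
          have "0 \<le> b * (real ?d * (2 * real p))" using b_pos by simp
          then show ?thesis using 1 2 3 4 5 6 r quarter unfolding Q_def by linarith
        qed
        have "hd q \<in> qbox 0 N" "last q \<in> qbox 0 N" using q by (auto simp: path_in_def)
        note near[OF this(1)] near[OF this(2)]
        moreover have "\<bar>F (last q) - F (hd q)\<bar> \<le> path_time b t q" by (rule potential_path_time[OF F(1) q])
        moreover have "2 * Q + 2 * (\<epsilon> / 4 * real N) \<le> \<epsilon> * real N"
        proof -
          have "0 \<le> \<epsilon> * real N" using \<epsilon> by simp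
          then show ?thesis using QN quarter by linarith
        qed
        ultimately show "\<bar>linear_profile \<zeta> j (last q) - linear_profile \<zeta> j (hd q)\<bar> - \<epsilon> * real N \<le> path_time b t q"
          unfolding linear_profile_def by linarith
      qed
    qed
    \<comment> \<open>Cost accounting: each of the K^d tiles costs x m^d plus the logarithm of C, in
      total at most (x + \<open>\<beta>\<close> / 2) N^d because K m is at most N. The corridors use
      the remaining \<open>\<beta>\<close> / 2.\<close>
    moreover have "exp (- (x + \<beta>) * real N ^ ?d)
        \<le> (\<Prod>k\<in>(tile_indices K :: (int ^ 'd) set). ?P) * c ^ (?d * ((N + 1) ^ ?d - (K * m) ^ ?d))"
    proof -
      have P: "exp (- (x * real m ^ ?d + ln (real C))) \<le> ?P"
      proof -
        have "exp (- x * real m ^ ?d) \<le> real C * ?P" using m(1) f(2) by linarith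
        then have "exp (- x * real m ^ ?d) / real C \<le> ?P" using C(1) by (simp add: pos_divide_le_eq mult.commute)
        moreover have "exp (- (x * real m ^ ?d + ln (real C))) = exp (- x * real m ^ ?d) / real C"
          using C(1) by (simp add: exp_diff diff_conv_add_uminus[symmetric])
        ultimately show ?thesis by simp
      qed
      have lnC: "ln (real C) \<le> \<beta> / 2 * real m ^ ?d"
      proof -
        have "ln (real C) \<le> \<beta> / 2 * real m" using m(2) \<beta> by (simp add: field_simps)
        also have "real m \<le> real m ^ ?d" using m1 by (intro self_le_power) auto
        finally show ?thesis using \<beta> by simp
      qed
      have "real (K ^ ?d) * (x * real m ^ ?d + ln (real C)) \<le> real (K ^ ?d) * ((x + \<beta> / 2) * real m ^ ?d)"
        using lnC by (intro mult_left_mono) (auto simp: distrib_right)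
      also have "\<dots> = (x + \<beta> / 2) * (real K ^ ?d * real m ^ ?d)" by (simp add: mult_ac)
      also have "\<dots> \<le> (x + \<beta> / 2) * real N ^ ?d"
        using tile_count_le[OF m1, of N w ?d] x \<beta> by (intro mult_left_mono) (auto simp: K_def p_def)
      finally have e1: "real (K ^ ?d) * (x * real m ^ ?d + ln (real C)) \<le> (x + \<beta> / 2) * real N ^ ?d" .
      have "real (?d * ((N + 1) ^ ?d - (K * m) ^ ?d)) * L = real ?d * L * real ((N + 1) ^ ?d - (K * m) ^ ?d)"
        by (simp only: of_nat_mult mult_ac)
      also have "\<dots> \<le> real ?d * L * (\<kappa> * real N ^ ?d)"
        using elim(2) dL unfolding K_def by (intro mult_left_mono) auto
      also have "\<dots> \<le> \<beta> / 2 * real N ^ ?d"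
        using mult_right_mono[OF \<kappa>(2), of "real N ^ ?d"] by (simp add: mult.assoc)
      finally have e2: "real (?d * ((N + 1) ^ ?d - (K * m) ^ ?d)) * L \<le> \<beta> / 2 * real N ^ ?d" .
      have "exp (- (x + \<beta>) * real N ^ ?d)
          \<le> exp (- (real (K ^ ?d) * (x * real m ^ ?d + ln (real C))) - real (?d * ((N + 1) ^ ?d - (K * m) ^ ?d)) * L)"
      proof -
        have "(x + \<beta>) * real N ^ ?d = (x + \<beta> / 2) * real N ^ ?d + \<beta> / 2 * real N ^ ?d" by (simp add: algebra_simps)
        then show ?thesis using e1 e2 unfolding exp_le_cancel_iff mult_minus_left by linarith
      qed
      also have "\<dots> = exp (- (x * real m ^ ?d + ln (real C))) ^ (K ^ ?d) * c ^ (?d * ((N + 1) ^ ?d - (K * m) ^ ?d))"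
      proof -
        have "exp (- r - real i * L) = exp (- s) ^ k * exp (- L) ^ i" if "r = real k * s" for r s :: real and i k :: nat
          unfolding that exp_of_nat_mult[symmetric] exp_add[symmetric] by simp
        then show ?thesis unfolding c(2) by blast
      qed
      also have "\<dots> \<le> ?P ^ (K ^ ?d) * c ^ (?d * ((N + 1) ^ ?d - (K * m) ^ ?d))"
        using P c(1) by (intro mult_right_mono power_mono) auto
      finally show ?thesis by (simp add: card_tile_indices)
    qed
    ultimately show ?case by linarith
  qed
qed

end

section \<open>Layered tilings\<close>

lemma card_tile_layers:
  assumes "K1 \<le> K"
  shows "card {k \<in> tile_indices K :: (int ^ 'd::finite) set. k $ i < int K1} = K1 * K ^ (CARD('d) - 1)"
proof -
  have "{k \<in> tile_indices K. k $ i < int K1} = {k. \<forall>j. k $ j \<in> (if j = i then {0..<int K1} else {0..<int K})}"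
    (is "_ = ?S")
  proof (intro equalityI subsetI)
    fix k assume "k \<in> ?S"
    then have *: "k $ j \<in> (if j = i then {0..<int K1} else {0..<int K})" for j by blast
    have "0 \<le> k $ j \<and> k $ j < int K" for j using *[of j] assms by (cases "j = i") auto
    then show "k \<in> {k \<in> tile_indices K. k $ i < int K1}" using *[of i] by (simp add: tile_indices_def)
  qed (simp add: tile_indices_def)
  moreover have "card ?S = (\<Prod>j\<in>UNIV. card (if j = i then {0..<int K1} else {0..<int K}))"
    by (rule card_int_box_prod) auto
  moreover have "\<dots> = card (if i = i then {0..<int K1} else {0..<int K}) *
      (\<Prod>j\<in>UNIV - {i}. card (if j = i then {0..<int K1} else {0..<int K}))"
    by (rule prod.remove) auto
  moreover have "(\<Prod>j\<in>UNIV - {i}. card (if j = i then {0..<int K1} else {0..<int K})) = (\<Prod>j\<in>UNIV - {i}. K)"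
    by (rule prod.cong) auto
  moreover have "(\<Prod>j\<in>UNIV - {i}. K) = K ^ (CARD('d) - 1)"
    by (simp add: card_Diff_singleton)
  ultimately show ?thesis by simp
qed

lemma sum_tile_layers:
  fixes x1 x2 :: real and i :: "'d::finite"
  assumes "K1 \<le> K"
  shows "(\<Sum>k\<in>(tile_indices K :: (int ^ 'd) set). if k $ i < int K1 then x1 else x2) =
    real K ^ (CARD('d) - 1) * (real K1 * x1 + (real K - real K1) * x2)"
proof -
  let ?I = "tile_indices K :: (int ^ 'd) set"
  let ?A = "{k \<in> ?I. k $ i < int K1}"
  have f: "finite ?I" by (rule finite_tile_indices)
  have "(\<Sum>k\<in>?I. if k $ i < int K1 then x1 else x2) = real (card ?A) * x1 + real (card (?I - ?A)) * x2"
  proof -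
    have "(\<Sum>k\<in>?I. if k $ i < int K1 then x1 else x2) =
        (\<Sum>k\<in>?A. if k $ i < int K1 then x1 else x2) + (\<Sum>k\<in>?I - ?A. if k $ i < int K1 then x1 else x2)"
      using f by (subst sum.subset_diff[of ?A ?I]) auto
    also have "(\<Sum>k\<in>?A. if k $ i < int K1 then x1 else x2) = (\<Sum>k\<in>?A. x1)" by (rule sum.cong) auto
    also have "(\<Sum>k\<in>?I - ?A. if k $ i < int K1 then x1 else x2) = (\<Sum>k\<in>?I - ?A. x2)" by (rule sum.cong) auto
    finally show ?thesis by simp
  qed
  moreover have "card ?A = K1 * K ^ (CARD('d) - 1)" by (rule card_tile_layers[OF assms])
  moreover have "card (?I - ?A) = K ^ CARD('d) - K1 * K ^ (CARD('d) - 1)"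
    using f calculation(2) by (subst card_Diff_subset) (auto simp: card_tile_indices intro: finite_subset)
  moreover have Kd: "K ^ CARD('d) = K * K ^ (CARD('d) - 1)"
    by (metis power_eq_if zero_less_card_finite less_numeral_extra(3))
  moreover have "real (K * K ^ (CARD('d) - 1) - K1 * K ^ (CARD('d) - 1)) =
      real (K * K ^ (CARD('d) - 1)) - real (K1 * K ^ (CARD('d) - 1))"
    using assms by (intro of_nat_diff mult_right_mono) auto
  ultimately show ?thesis by (simp only:) (simp add: algebra_simps)
qed

context passage_percolation
begin

text \<open>The easy converse of \<open>crossing_to_profile\<close>: along a crossing path the
  coordinate increases by exactly n, so the additive error becomes a loss of
  \<open>\<epsilon>\<close> in speed.\<close>

lemma profile_le_crossing:
  assumes "\<And>i. 0 \<le> \<zeta> $ i" "\<And>i. \<zeta>' $ i \<le> \<zeta> $ i - \<epsilon>"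
  shows "cprob (profile_event b (qbox 0 n) (linear_profile \<zeta>) (\<epsilon> * real n)) \<le> cprob (crossing_event b n \<zeta>')"
proof (rule finite_measure_mono)
  show "{\<omega> \<in> space M. (\<lambda>e. \<tau> e \<omega>) \<in> crossing_event b n \<zeta>'} \<in> events"
    by (rule local_event_measurable[OF local_crossing_event edges_in_subset_lattice])
  have "t \<in> crossing_event b n \<zeta>'" if t: "t \<in> profile_event b (qbox 0 n) (linear_profile \<zeta>) (\<epsilon> * real n)" for t
    unfolding crossing_event_def
  proof (intro CollectI allI ballI)
    fix i and p :: "(real ^ 'd) list" assume "p \<in> crossing_paths n i"
    then have p: "path_in (qbox 0 n) p" "hd p $ i = 0" "last p $ i = real n" by (auto simp: crossing_paths_def)
    have "\<bar>linear_profile \<zeta> i (last p) - linear_profile \<zeta> i (hd p)\<bar> - \<epsilon> * real n \<le> path_time b t p"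
      using t p(1) unfolding profile_event_def by blast
    then have "\<zeta> $ i * real n - \<epsilon> * real n \<le> path_time b t p"
      using assms(1) by (simp add: linear_profile_def p(2,3))
    moreover have "\<zeta>' $ i * real n \<le> (\<zeta> $ i - \<epsilon>) * real n" using assms(2) by (intro mult_right_mono) auto
    ultimately show "\<zeta>' $ i * real n \<le> path_time b t p" by (simp add: left_diff_distrib)
  qed
  then show "{\<omega> \<in> space M. (\<lambda>e. \<tau> e \<omega>) \<in> profile_event b (qbox 0 n) (linear_profile \<zeta>) (\<epsilon> * real n)}
      \<subseteq> {\<omega> \<in> space M. (\<lambda>e. \<tau> e \<omega>) \<in> crossing_event b n \<zeta>'}" by blast
qed

text \<open>Two layers of tiles, of relative thickness \<open>u\<close> and \<open>1 - u\<close> in direction \<open>i\<close>, produce the convex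
  combination of two crossing speeds in that direction.\<close>

lemma layered_crossing:
  assumes \<zeta>: "\<And>j. 0 \<le> \<zeta> $ j" "\<And>j. \<zeta> $ j \<le> b" "\<And>j. 0 \<le> \<zeta>' $ j" "\<And>j. \<zeta>' $ j \<le> b"
    and eq: "\<And>j. j \<noteq> i \<Longrightarrow> \<zeta>' $ j = \<zeta> $ j" and u: "0 \<le> u" "u \<le> 1"
    and \<xi>: "\<And>j. \<xi> $ j \<le> u * \<zeta> $ j + (1 - u) * \<zeta>' $ j - \<epsilon>"
    and \<epsilon>: "0 < \<epsilon>" and \<beta>: "0 < \<beta>" and x: "0 \<le> x1" "0 \<le> x2"
    and ev: "\<And>\<delta>. 0 < \<delta> \<Longrightarrow> \<forall>\<^sub>F m in sequentially.
      exp (- x1 * real m ^ CARD('d)) \<le> cprob (profile_event b (qbox 0 m) (linear_profile \<zeta>) (\<delta> * real m))"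
      "\<And>\<delta>. 0 < \<delta> \<Longrightarrow> \<forall>\<^sub>F m in sequentially.
      exp (- x2 * real m ^ CARD('d)) \<le> cprob (profile_event b (qbox 0 m) (linear_profile \<zeta>') (\<delta> * real m))"
  shows "\<forall>\<^sub>F N in sequentially. exp (- (u * x1 + (1 - u) * x2 + \<beta>) * real N ^ CARD('d))
    \<le> cprob (crossing_event b N \<xi>)"
proof -
  let ?d = "CARD('d)"
  obtain \<sigma> L \<kappa> \<eta> where \<sigma>: "0 < \<sigma>" "\<sigma> < 1" and \<sigma>b: "\<sigma> * b \<le> \<epsilon> / 8"
    and L: "0 \<le> L" "measure \<nu> {(1 - \<sigma> / 2) * b..} = exp (- L)"
    and \<kappa>: "0 < \<kappa>" "real ?d * L * \<kappa> \<le> \<beta> / 2"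
    and \<eta>: "0 < \<eta>" "2 * \<eta> \<le> 1" "2 * real ?d * \<eta> < \<kappa>" "2 * b * \<eta> \<le> \<epsilon> / 8"
    by (rule tile_parameters[OF \<epsilon> \<beta>]) blast
  define c where "c = measure \<nu> {(1 - \<sigma> / 2) * b..}"
  have c: "0 < c" "c = exp (- L)" using L(2) by (simp_all add: c_def)
  have dL: "0 \<le> real ?d * L" using L(1) by simp
  define \<delta> where "\<delta> = \<sigma> * b * \<eta> / 4"
  have \<delta>: "0 < \<delta>" using \<sigma> b_pos \<eta> by (simp add: \<delta>_def)
  have "\<forall>\<^sub>F m in sequentially. 1 / \<eta> \<le> real m"
    by (intro eventually_at_top_linorderI[of "nat \<lceil>1 / \<eta>\<rceil>"]) linarith
  then have "\<forall>\<^sub>F m in sequentially.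
      exp (- x1 * real m ^ ?d) \<le> cprob (profile_event b (qbox 0 m) (linear_profile \<zeta>) (\<delta> * real m)) \<and>
      exp (- x2 * real m ^ ?d) \<le> cprob (profile_event b (qbox 0 m) (linear_profile \<zeta>') (\<delta> * real m)) \<and>
      1 / \<eta> \<le> real m"
    using ev[OF \<delta>] by eventually_elim blast
  then obtain m where m:
    "exp (- x1 * real m ^ ?d) \<le> cprob (profile_event b (qbox 0 m) (linear_profile \<zeta>) (\<delta> * real m))"
    "exp (- x2 * real m ^ ?d) \<le> cprob (profile_event b (qbox 0 m) (linear_profile \<zeta>') (\<delta> * real m))"
    "1 / \<eta> \<le> real m"
    using eventually_happens'[OF sequentially_bot] by blast
  have m1: "1 \<le> m"
  proof -
    have "0 < 1 / \<eta>" using \<eta>(1) by simp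
    then show ?thesis using m(3) by linarith
  qed
  obtain w where w: "\<eta> * real m \<le> real w" "real w \<le> 2 * \<eta> * real m" "0 < w"
    and frac: "1 - (real m / real (m + w)) ^ ?d < \<kappa>"
    by (rule tile_gap[OF \<eta>(1-3) m1 m(3)]) blast
  define p where "p = m + w"
  have mp: "m \<le> p" "1 \<le> p" using m1 by (auto simp: p_def)
  note corr = corridor_fraction[OF m1 mp(1) frac[folded p_def]]
  \<comment> \<open>Bounded errors, for both ends of the path together. The last term pays for
    moving the interface from u N to a tile boundary: it moves by at most 2 p, and the two slopes
    differ by at most b.\<close>
  define Q where "Q = 4 * b * (real ?d * (2 * real p)) + 2 * (\<delta> * real m) + 2 * b * real p"
  have Q0: "0 \<le> Q" using b_pos \<delta> by (simp add: Q_def)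
  have "\<forall>\<^sub>F N in sequentially. 2 * Q / (\<epsilon> / 4) \<le> real N \<and> real m * x2 / (\<beta> / 2) \<le> real N"
    by (intro eventually_conj eventually_at_top_linorderI[of "nat \<lceil>2 * Q / (\<epsilon> / 4)\<rceil>"]
        eventually_at_top_linorderI[of "nat \<lceil>real m * x2 / (\<beta> / 2)\<rceil>"]) linarith+
  then show ?thesis
    using corr eventually_ge_at_top[of p]
  proof eventually_elim
    case (elim N)
    define K where "K = N div p"
    have K: "0 < K" "K * p \<le> N" "N < (K + 1) * p"
    proof -
      show "0 < K" using elim(3) mp(2) by (simp add: K_def div_greater_zero_iff)
      show "K * p \<le> N" unfolding K_def by (rule div_times_less_eq_dividend)
      have "N < p + N div p * p" using mp(2) by (intro dividend_less_div_times) simp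
      then show "N < (K + 1) * p" by (simp add: K_def)
    qed
    \<comment> \<open>Number of layers of the first kind. Rounding down leaves up to one additional
      layer of the second kind, whose cost \<open>real m * x2\<close> times N^(d-1) is below
      \<open>\<beta> / 2\<close> times N^d by the choice of N.\<close>
    define K1 where "K1 = nat \<lfloor>u * real K\<rfloor>"
    have K1: "real K1 \<le> u * real K" "u * real K < real K1 + 1"
      using u by (simp_all add: K1_def)
    have K1K: "K1 \<le> K"
    proof -
      have "u * real K \<le> 1 * real K" using u by (intro mult_right_mono) auto
      then show ?thesis using K1(1) by linarith
    qed
    define s where "s = real p * real K1"
    have QN: "2 * Q \<le> \<epsilon> / 4 * real N" using elim(1) \<epsilon> by (simp add: field_simps)
    have quarter: "\<epsilon> / 4 * real N = \<epsilon> * real N / 4" "\<epsilon> / 8 * real N = \<epsilon> * real N / 8" by simp_all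
    \<comment> \<open>In direction i the slope changes from \<open>\<zeta> $ i\<close> to
      \<open>\<zeta>' $ i\<close> at \<open>s\<close>, the lower face of the tiles of layer
      \<open>K1\<close>. No tile contains the kink in its interior, so inside each tile
      \<open>H\<close> is linear up to a constant and tiles are copied without reflection.\<close>
    define H where "H j z = (if j = i then \<zeta> $ i * min (z $ i) s + \<zeta>' $ i * max (z $ i - s) 0 else \<zeta> $ j * z $ j)"
      for j and z :: "real ^ 'd"
    define h where "h k = linear_profile (if k $ i < int K1 then \<zeta> else \<zeta>')" for k :: "int ^ 'd"
    let ?P = "\<lambda>k. cprob (profile_event b (qbox 0 m) (h k) (\<delta> * real m))"
    have Hlip: "\<bar>H j y - H j y'\<bar> \<le> b * l1_norm (y - y')" for j y y'
    proof -
      have scale: "\<bar>z * r - z * r'\<bar> \<le> b * \<bar>r - r'\<bar>" if "0 \<le> z" "z \<le> b" for z r r' :: real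
      proof -
        have "\<bar>z * r - z * r'\<bar> = z * \<bar>r - r'\<bar>" unfolding right_diff_distrib[symmetric] abs_mult using that by simp
        then show ?thesis using that by (simp add: mult_right_mono)
      qed
      have "\<bar>H j y - H j y'\<bar> \<le> b * \<bar>y $ j - y' $ j\<bar>"
      proof (cases "j = i")
        case False
        then show ?thesis using scale[OF \<zeta>(1,2)] by (simp add: H_def)
      next
        case True
        have "\<bar>H i y - H i y'\<bar> \<le> \<bar>\<zeta> $ i * min (y $ i) s - \<zeta> $ i * min (y' $ i) s\<bar>
            + \<bar>\<zeta>' $ i * max (y $ i - s) 0 - \<zeta>' $ i * max (y' $ i - s) 0\<bar>"
        proof -
          have "\<bar>r + r' - (q + q')\<bar> \<le> \<bar>r - q\<bar> + \<bar>r' - q'\<bar>" for r r' q q' :: real by linarith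
          then show ?thesis unfolding H_def by (simp only: refl if_True)
        qed
        also have "\<dots> \<le> b * \<bar>min (y $ i) s - min (y' $ i) s\<bar> + b * \<bar>max (y $ i - s) 0 - max (y' $ i - s) 0\<bar>"
          by (intro add_mono scale \<zeta>)
        also have "\<dots> = b * (\<bar>min (y $ i) s - min (y' $ i) s\<bar> + \<bar>max (y $ i - s) 0 - max (y' $ i - s) 0\<bar>)"
          by (rule distrib_left[symmetric])
        also have "\<bar>min (y $ i) s - min (y' $ i) s\<bar> + \<bar>max (y $ i - s) 0 - max (y' $ i - s) 0\<bar> = \<bar>y $ i - y' $ i\<bar>"
          by (auto simp: min_def max_def)
        finally show ?thesis using True by simp
      qed
      also have "\<dots> \<le> b * l1_norm (y - y')" using component_le_l1_norm b_pos by (intro mult_left_mono) auto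
      finally show ?thesis .
    qed
    have "(\<Prod>k\<in>(tile_indices K :: (int ^ 'd) set). ?P k) * c ^ (?d * ((N + 1) ^ ?d - (K * m) ^ ?d))
        \<le> cprob (crossing_event b N \<xi>)"
      unfolding c_def
    proof (rule tile_prob[OF \<sigma> K(1) w(3), where H = H and r = "\<lambda>_ _. False" and h = h and \<epsilon> = "\<delta> * real m" and N = N])
      show "K * (m + w) \<le> N" using K(2) by (simp add: p_def)
      show "\<bar>H j y - H j y'\<bar> \<le> b * l1_norm (y - y')" for j y y' by (rule Hlip)
      show "\<bar>H j (place (\<lambda>_. False) (tile_corner (m + w) k) m y) - H j (place (\<lambda>_. False) (tile_corner (m + w) k) m y')\<bar>
          \<le> \<bar>h k j y - h k j y'\<bar>"
        if y: "y \<in> qbox 0 m" and y': "y' \<in> qbox 0 m" for j k y y'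
      proof -
        have pl: "place (\<lambda>_. False) (tile_corner (m + w) k) m y $ j = real p * of_int (k $ j) + y $ j" for j and y :: "real ^ 'd"
          by (simp add: place_def tile_corner_def p_def)
        show ?thesis
        proof (cases "j = i")
          case False
          then show ?thesis by (simp add: H_def h_def pl linear_profile_def eq distrib_left)
        next
          case True
          have yi: "0 \<le> y $ i" "y $ i \<le> real m" "0 \<le> y' $ i" "y' $ i \<le> real m" using y y' by (auto simp: qbox_def)
          show ?thesis
          proof (cases "k $ i < int K1")
            case lt: True
            have "real p * (of_int (k $ i) + 1) \<le> real p * real K1" using lt by (intro mult_left_mono) linarith+
            then have "real p * of_int (k $ i) + real m \<le> s" using mp(1) by (simp add: s_def algebra_simps)
            then have "H i (place (\<lambda>_. False) (tile_corner (m + w) k) m z) = \<zeta> $ i * (real p * of_int (k $ i) + z $ i)"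
              if "z $ i \<le> real m" for z using that by (simp add: H_def pl)
            then show ?thesis using lt True yi by (simp add: h_def linear_profile_def distrib_left)
          next
            case ge: False
            have "real p * real K1 \<le> real p * of_int (k $ i)" using ge by (intro mult_left_mono) linarith+
            then have "s \<le> real p * of_int (k $ i)" by (simp add: s_def)
            then have Hv: "H i (place (\<lambda>_. False) (tile_corner (m + w) k) m z) = \<zeta> $ i * s + \<zeta>' $ i * (real p * of_int (k $ i) + z $ i - s)"
              if "0 \<le> z $ i" for z using that by (simp add: H_def pl)
            have "H i (place (\<lambda>_. False) (tile_corner (m + w) k) m y) - H i (place (\<lambda>_. False) (tile_corner (m + w) k) m y')
                = \<zeta>' $ i * y $ i - \<zeta>' $ i * y' $ i"
              unfolding Hv[OF yi(1)] Hv[OF yi(3)] by (simp add: algebra_simps)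
            then show ?thesis using ge True by (simp add: h_def linear_profile_def)
          qed
        qed
      qed
      show "0 \<le> \<delta> * real m" using \<delta> by simp
      show "2 * (\<delta> * real m) \<le> \<sigma> / 2 * b * real w"
      proof -
        have "2 * (\<delta> * real m) = \<sigma> / 2 * b * (\<eta> * real m)" by (simp add: \<delta>_def)
        also have "\<dots> \<le> \<sigma> / 2 * b * real w" using w(1) \<sigma> b_pos by (intro mult_left_mono) auto
        finally show ?thesis .
      qed
      show "local_event (edges_in (qbox 0 N)) (crossing_event b N \<xi>)" by (rule local_crossing_event)
      fix t assume t: "bounded_config b t"
        and F: "\<And>j. \<exists>F. potential b t (qbox 0 N) F \<and>
          (\<forall>k\<in>tile_indices K. \<forall>y\<in>tile (m + w) m k. \<bar>F y - (1 - \<sigma>) * H j y\<bar> \<le> \<delta> * real m)"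
      show "t \<in> crossing_event b N \<xi>"
        unfolding crossing_event_def
      proof (intro CollectI allI ballI)
        fix j and q :: "(real ^ 'd) list" assume "q \<in> crossing_paths N j"
        then have q: "path_in (qbox 0 N) q" "hd q $ j = 0" "last q $ j = real N" by (auto simp: crossing_paths_def)
        obtain F where F: "potential b t (qbox 0 N) F"
          "\<And>k y. k \<in> tile_indices K \<Longrightarrow> y \<in> tile (m + w) m k \<Longrightarrow> \<bar>F y - (1 - \<sigma>) * H j y\<bar> \<le> \<delta> * real m"
          using F[of j] by blast
        have near: "\<bar>F z - (1 - \<sigma>) * H j z\<bar> \<le> \<delta> * real m + 2 * b * (real ?d * (2 * real p))"
          if z: "z \<in> qbox 0 N" for z
        proof -
          obtain k y where y: "k \<in> tile_indices K" "y \<in> tile p m k" "l1_norm (z - y) \<le> real ?d * (2 * real p)"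
            by (rule tile_covering[OF z K(1,3) mp(1)])
          have yX: "y \<in> qbox 0 N" using tile_subset_qbox[OF y(1) K(2) mp(1)] y(2) by blast
          have r: "b * l1_norm (z - y) \<le> b * (real ?d * (2 * real p))" using y(3) b_pos by (intro mult_left_mono) auto
          have 1: "\<bar>F z - F y\<bar> \<le> b * l1_norm (z - y)" using F(1) z yX unfolding potential_def by blast
          have 2: "\<bar>F y - (1 - \<sigma>) * H j y\<bar> \<le> \<delta> * real m" using F(2) y by (simp add: p_def)
          have "(1 - \<sigma>) * \<bar>H j y - H j z\<bar> \<le> 1 * (b * l1_norm (y - z))" using \<sigma> Hlip by (intro mult_mono) auto
          then have 3: "\<bar>(1 - \<sigma>) * H j y - (1 - \<sigma>) * H j z\<bar> \<le> b * l1_norm (z - y)"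
            unfolding right_diff_distrib[symmetric] abs_mult using \<sigma> by (simp add: l1_norm_minus_commute)
          show ?thesis using 1 2 3 r by linarith
        qed
        have X: "hd q \<in> qbox 0 N" "last q \<in> qbox 0 N" using q(1) by (auto simp: path_in_def)
        have pt: "\<bar>F (last q) - F (hd q)\<bar> \<le> path_time b t q" by (rule potential_path_time[OF F(1) q(1)])
        have sN: "0 \<le> s" "s \<le> real N" "\<bar>s - u * real N\<bar> \<le> 2 * real p"
        proof -
          show "0 \<le> s" by (simp add: s_def)
          have "p * K1 \<le> N" using K1K K(2) by (metis mult.commute mult_le_mono1 order_trans)
          then show "s \<le> real N" unfolding s_def by (metis of_nat_le_iff of_nat_mult)
          have KN: "real K * real p \<le> real N" "real N < real K * real p + real p"
          proof -
            show "real K * real p \<le> real N" using K(2) by (metis of_nat_le_iff of_nat_mult)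
            have "N < K * p + p" using K(3) by simp
            then show "real N < real K * real p + real p" by (metis of_nat_add of_nat_less_iff of_nat_mult)
          qed
          have "s \<le> real p * (u * real K)" using K1(1) unfolding s_def by (intro mult_left_mono) auto
          also have "\<dots> = u * (real K * real p)" by simp
          also have "\<dots> \<le> u * real N" using KN(1) u by (intro mult_left_mono) auto
          finally have 1: "s \<le> u * real N" .
          have "u * real N \<le> u * (real K * real p + real p)" using KN(2) u by (intro mult_left_mono) auto
          also have "\<dots> = real p * (u * real K) + u * real p" by (simp add: algebra_simps)
          also have "\<dots> \<le> real p * (real K1 + 1) + 1 * real p"
            using K1(2) u by (intro add_mono mult_left_mono mult_right_mono) auto
          finally have "u * real N \<le> s + 2 * real p" by (simp add: s_def algebra_simps)
          then show "\<bar>s - u * real N\<bar> \<le> 2 * real p" using 1 by simp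
        qed
        have Hd: "(u * \<zeta> $ j + (1 - u) * \<zeta>' $ j) * real N - 2 * b * real p \<le> H j (last q) - H j (hd q)"
        proof (cases "j = i")
          case False
          then have "(u * \<zeta> $ j + (1 - u) * \<zeta>' $ j) * real N = H j (last q) - H j (hd q)"
            by (simp add: eq H_def q algebra_simps)
          moreover have "0 \<le> 2 * b * real p" using b_pos by simp
          ultimately show ?thesis by linarith
        next
          case True
          have "H j (last q) - H j (hd q) = \<zeta> $ i * s + \<zeta>' $ i * (real N - s)"
            using sN(1,2) True q by (simp add: H_def)
          moreover have "\<zeta> $ i * s + \<zeta>' $ i * (real N - s) - (u * \<zeta> $ i + (1 - u) * \<zeta>' $ i) * real N
              = (\<zeta> $ i - \<zeta>' $ i) * (s - u * real N)" by (simp add: algebra_simps)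
          moreover have "\<bar>(\<zeta> $ i - \<zeta>' $ i) * (s - u * real N)\<bar> \<le> b * (2 * real p)"
          proof -
            have "\<bar>\<zeta> $ i - \<zeta>' $ i\<bar> \<le> b" using \<zeta>(1-4)[of i] by (simp add: abs_le_iff)
            then show ?thesis unfolding abs_mult using sN(3) by (intro mult_mono) auto
          qed
          ultimately show ?thesis unfolding True by linarith
        qed
        have Hu: "\<bar>H j (last q) - H j (hd q)\<bar> \<le> b * real N"
        proof (cases "j = i")
          case False
          then show ?thesis using \<zeta>(1,2)[of j] by (simp add: H_def q mult_right_mono)
        next
          case True
          have "\<zeta> $ i * s \<le> b * s" "\<zeta>' $ i * (real N - s) \<le> b * (real N - s)"
            using \<zeta> sN by (intro mult_right_mono; simp)+
          moreover have "0 \<le> \<zeta> $ i * s" "0 \<le> \<zeta>' $ i * (real N - s)" using \<zeta> sN by simp_all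
          moreover have "H j (last q) - H j (hd q) = \<zeta> $ i * s + \<zeta>' $ i * (real N - s)"
            using sN(1,2) True q by (simp add: H_def)
          moreover have "b * s + b * (real N - s) = b * real N" by (simp add: algebra_simps)
          ultimately show ?thesis by linarith
        qed
        have "\<sigma> * (H j (last q) - H j (hd q)) \<le> \<sigma> * (b * real N)" using Hu \<sigma> by (intro mult_left_mono) auto
        also have "\<dots> = \<sigma> * b * real N" by simp
        also have "\<dots> \<le> \<epsilon> / 4 * real N" using \<sigma>b \<epsilon> by (intro mult_right_mono) auto
        finally have Hs: "\<sigma> * (H j (last q) - H j (hd q)) \<le> \<epsilon> / 4 * real N" .
        have e: "(1 - \<sigma>) * H j (last q) - (1 - \<sigma>) * H j (hd q) =
            (H j (last q) - H j (hd q)) - \<sigma> * (H j (last q) - H j (hd q))" by (simp add: algebra_simps)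
        have "\<xi> $ j * real N \<le> (u * \<zeta> $ j + (1 - u) * \<zeta>' $ j - \<epsilon>) * real N" using \<xi> by (intro mult_right_mono) auto
        then have "\<xi> $ j * real N \<le> (u * \<zeta> $ j + (1 - u) * \<zeta>' $ j) * real N - \<epsilon> * real N"
          by (simp only: left_diff_distrib)
        moreover have "0 \<le> \<epsilon> * real N" using \<epsilon> by simp
        ultimately show "\<xi> $ j * real N \<le> path_time b t q"
          using near[OF X(1)] near[OF X(2)] pt Hd Hs e QN Q0 quarter Q_def by linarith
      qed
    qed
    moreover have "exp (- (u * x1 + (1 - u) * x2 + \<beta>) * real N ^ ?d)
        \<le> (\<Prod>k\<in>(tile_indices K :: (int ^ 'd) set). ?P k) * c ^ (?d * ((N + 1) ^ ?d - (K * m) ^ ?d))"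
    proof -
      let ?x = "\<lambda>k :: int ^ 'd. if k $ i < int K1 then x1 else x2"
      have P: "exp (- ?x k * real m ^ ?d) \<le> ?P k" for k using m(1,2) by (simp add: h_def)
      have dd: "real r ^ ?d = real r * real r ^ (?d - 1)" for r :: nat
        by (metis power_eq_if zero_less_card_finite less_numeral_extra(3))
      have Km: "real K ^ ?d * real m ^ ?d \<le> real N ^ ?d"
        using tile_count_le[OF m1, of N w ?d] by (simp add: K_def p_def)
      have Km': "real K ^ (?d - 1) * real m ^ (?d - 1) \<le> real N ^ (?d - 1)"
        using tile_count_le[OF m1, of N w "?d - 1"] by (simp add: K_def p_def)
      have "real K1 * x1 + (real K - real K1) * x2 \<le> (u * real K) * x1 + ((1 - u) * real K + 1) * x2"
        using K1 x by (intro add_mono mult_right_mono) (auto simp: algebra_simps)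
      then have "(\<Sum>k\<in>(tile_indices K :: (int ^ 'd) set). ?x k) * real m ^ ?d \<le>
          real K ^ (?d - 1) * ((u * real K) * x1 + ((1 - u) * real K + 1) * x2) * real m ^ ?d"
        unfolding sum_tile_layers[OF K1K] by (intro mult_right_mono mult_left_mono) auto
      also have "\<dots> = (u * x1 + (1 - u) * x2) * (real K ^ ?d * real m ^ ?d)
          + real m * x2 * (real K ^ (?d - 1) * real m ^ (?d - 1))"
        unfolding dd[of K] dd[of m] by (simp add: algebra_simps)
      also have "\<dots> \<le> (u * x1 + (1 - u) * x2) * real N ^ ?d + real m * x2 * real N ^ (?d - 1)"
        using Km Km' u x by (intro add_mono mult_left_mono) auto
      also have "real m * x2 * real N ^ (?d - 1) \<le> (\<beta> / 2 * real N) * real N ^ (?d - 1)"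
        using elim(1) \<beta> by (intro mult_right_mono) (auto simp: field_simps)
      also have "(\<beta> / 2 * real N) * real N ^ (?d - 1) = \<beta> / 2 * real N ^ ?d" unfolding dd[of N] by simp
      finally have e1: "(\<Sum>k\<in>(tile_indices K :: (int ^ 'd) set). ?x k) * real m ^ ?d
          \<le> (u * x1 + (1 - u) * x2) * real N ^ ?d + \<beta> / 2 * real N ^ ?d" by simp
      have "real (?d * ((N + 1) ^ ?d - (K * m) ^ ?d)) * L = real ?d * L * real ((N + 1) ^ ?d - (K * m) ^ ?d)"
        by (simp only: of_nat_mult mult_ac)
      also have "\<dots> \<le> real ?d * L * (\<kappa> * real N ^ ?d)"
        using elim(2) dL unfolding K_def by (intro mult_left_mono) auto
      also have "\<dots> \<le> \<beta> / 2 * real N ^ ?d"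
        using mult_right_mono[OF \<kappa>(2), of "real N ^ ?d"] by (simp add: mult.assoc)
      finally have e2: "real (?d * ((N + 1) ^ ?d - (K * m) ^ ?d)) * L \<le> \<beta> / 2 * real N ^ ?d" .
      have "exp (- (u * x1 + (1 - u) * x2 + \<beta>) * real N ^ ?d)
          \<le> exp ((\<Sum>k\<in>(tile_indices K :: (int ^ 'd) set). - ?x k * real m ^ ?d)
              - real (?d * ((N + 1) ^ ?d - (K * m) ^ ?d)) * L)"
      proof -
        have "(u * x1 + (1 - u) * x2 + \<beta>) * real N ^ ?d =
            (u * x1 + (1 - u) * x2) * real N ^ ?d + \<beta> / 2 * real N ^ ?d + \<beta> / 2 * real N ^ ?d"
          by (simp add: algebra_simps)
        moreover have "(\<Sum>k\<in>(tile_indices K :: (int ^ 'd) set). - ?x k * real m ^ ?d) =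
            - ((\<Sum>k\<in>(tile_indices K :: (int ^ 'd) set). ?x k) * real m ^ ?d)"
          by (simp only: sum_distrib_right mult_minus_left sum_negf)
        ultimately show ?thesis using e1 e2 unfolding exp_le_cancel_iff mult_minus_left by linarith
      qed
      also have "\<dots> = (\<Prod>k\<in>(tile_indices K :: (int ^ 'd) set). exp (- ?x k * real m ^ ?d)) *
          c ^ (?d * ((N + 1) ^ ?d - (K * m) ^ ?d))"
      proof -
        have "exp (r - real i * L) = exp r * exp (- L) ^ i" for r and i :: nat
          unfolding exp_of_nat_mult[symmetric] exp_add[symmetric] by simp
        then show ?thesis unfolding c(2) exp_sum[OF finite_tile_indices, symmetric] .
      qed
      also have "\<dots> \<le> (\<Prod>k\<in>(tile_indices K :: (int ^ 'd) set). ?P k) * c ^ (?d * ((N + 1) ^ ?d - (K * m) ^ ?d))"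
        using P c(1) by (intro mult_right_mono prod_mono) auto
      finally show ?thesis .
    qed
    ultimately show ?case by linarith
  qed
qed

lemma card_edges_in_qbox:
  "card (edges_in (qbox 0 n :: (real ^ 'd) set)) \<le> CARD('d) * (n + 1) ^ CARD('d)"
proof -
  have "tile_indices 0 = ({} :: (int ^ 'd) set)" by (auto simp: tile_indices_def)
  then show ?thesis using card_corridor_edges[of 0 1 n 0, where 'd = 'd] by (simp add: power_0_left)
qed

text \<open>If all weights in the box are at least c, the linear functions with slopes up to c are
  potentials. This costs one factor \<open>measure \<nu> {c..}\<close> per edge, and the box has at
  most d (2 n)^d edges.\<close>

lemma heavy_weights_bound:
  assumes \<zeta>: "\<And>i. 0 \<le> \<zeta> $ i" "\<And>i. \<zeta> $ i \<le> c" and c: "c \<le> b" "0 < measure \<nu> {c..}" and \<epsilon>: "0 \<le> \<epsilon>"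
  obtains A where "0 \<le> A" "\<And>n. 1 \<le> n \<Longrightarrow>
    exp (- A * real n ^ CARD('d)) \<le> cprob (profile_event b (qbox 0 n) (linear_profile \<zeta>) (\<epsilon> * real n))"
proof
  let ?d = "CARD('d)"
  interpret nu: prob_space \<nu> by (rule nu_prob)
  let ?r = "measure \<nu> {c..}"
  define A where "A = real ?d * 2 ^ ?d * (- ln ?r)"
  have ln: "0 \<le> - ln ?r" using c by simp
  show "0 \<le> A" unfolding A_def using ln by (intro mult_nonneg_nonneg) auto
  fix n :: nat assume n: "1 \<le> n"
  let ?E = "edges_in (qbox 0 n) :: (int ^ 'd) set set"
  let ?D = "profile_event b (qbox 0 n) (linear_profile \<zeta>) (\<epsilon> * real n)"
  have "prob {\<omega> \<in> space M. (\<forall>k\<in>({} :: unit set). (\<lambda>e. \<tau> e \<omega>) \<in> ?D) \<and> (\<forall>e\<in>?E. \<tau> e \<omega> \<in> {c..})} =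
      (\<Prod>k\<in>({} :: unit set). cprob ?D) * ?r ^ card ?E"
    by (rule block_prob[where E = "{}" and \<sigma> = "\<lambda>_ e. e" and C = "\<lambda>_. ?D"])
       (use finite_edges_in_qbox edges_in_subset_lattice in auto)
  then have "?r ^ card ?E = prob {\<omega> \<in> space M. \<forall>e\<in>?E. \<tau> e \<omega> \<in> {c..}}" by simp
  also have "\<dots> \<le> cprob ?D"
  proof (rule prob_mono_in_range)
    show "{\<omega> \<in> space M. \<forall>e\<in>?E. \<tau> e \<omega> \<in> {c..}} \<in> events"
      by (rule sets.sets_Collect_finite_All)
        (simp_all add: tau_event edges_in_lattice finite_edges_in_qbox del: atLeast_iff)
    show "{\<omega> \<in> space M. (\<lambda>e. \<tau> e \<omega>) \<in> ?D} \<in> events"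
      by (rule local_event_measurable[OF local_profile_event edges_in_subset_lattice])
    fix \<omega> assume \<omega>: "\<omega> \<in> space M" "\<omega> \<in> {\<omega> \<in> space M. \<forall>e\<in>?E. \<tau> e \<omega> \<in> {c..}}"
    have "(\<lambda>e. \<tau> e \<omega>) \<in> ?D"
      unfolding profile_event_def
    proof (intro CollectI allI impI)
      fix j and p :: "(real ^ 'd) list" assume p: "path_in (qbox 0 n) p"
      have lin: "\<bar>\<zeta> $ j * z $ j - \<zeta> $ j * z' $ j\<bar> \<le> r * l1_norm (z - z')" if "c \<le> r" for r and z z' :: "real ^ 'd"
      proof -
        have "\<bar>\<zeta> $ j * z $ j - \<zeta> $ j * z' $ j\<bar> = \<zeta> $ j * \<bar>z $ j - z' $ j\<bar>"
          unfolding right_diff_distrib[symmetric] abs_mult using \<zeta>(1)[of j] by simp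
        also have "\<dots> \<le> r * l1_norm (z - z')"
          using order_trans[OF \<zeta>(2)[of j] that] \<zeta>(1)[of j] component_le_l1_norm by (intro mult_mono) auto
        finally show ?thesis .
      qed
      have "potential b (\<lambda>e. \<tau> e \<omega>) (qbox 0 n) (\<lambda>z. \<zeta> $ j * z $ j)"
        unfolding potential_def using lin c(1) \<omega>(2) by auto
      from potential_path_time[OF this p]
      have "\<bar>linear_profile \<zeta> j (last p) - linear_profile \<zeta> j (hd p)\<bar> \<le> path_time b (\<lambda>e. \<tau> e \<omega>) p"
        by (simp add: linear_profile_def)
      moreover have "0 \<le> \<epsilon> * real n" using \<epsilon> by simp
      ultimately show "\<bar>linear_profile \<zeta> j (last p) - linear_profile \<zeta> j (hd p)\<bar> - \<epsilon> * real n
          \<le> path_time b (\<lambda>e. \<tau> e \<omega>) p" by linarith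
    qed
    then show "\<omega> \<in> {\<omega> \<in> space M. (\<lambda>e. \<tau> e \<omega>) \<in> ?D}" using \<omega>(1) by simp
  qed
  finally have le: "?r ^ card ?E \<le> cprob ?D" .
  have "real (card ?E) \<le> real (?d * (n + 1) ^ ?d)" using card_edges_in_qbox of_nat_le_iff by blast
  also have "\<dots> \<le> real (?d * (2 * n) ^ ?d)" using n by (intro of_nat_mono mult_left_mono power_mono) auto
  also have "\<dots> = real ?d * 2 ^ ?d * real n ^ ?d" by (simp add: power_mult_distrib)
  finally have "real (card ?E) * (- ln ?r) \<le> real ?d * 2 ^ ?d * real n ^ ?d * (- ln ?r)"
    using ln by (rule mult_right_mono)
  then have "exp (- A * real n ^ ?d) \<le> exp (real (card ?E) * ln ?r)" by (simp add: A_def mult_ac)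
  also have "\<dots> = ?r ^ card ?E" using c(2) by (simp add: exp_of_nat_mult)
  finally show "exp (- A * real n ^ ?d) \<le> cprob ?D" using le by linarith
qed

end

section \<open>Maximal crossing speeds\<close>

lemma unit_edge_inj_point: "unit_edge u i = unit_edge v i \<Longrightarrow> u = v"
  for u v :: "int ^ 'd::finite"
proof -
  assume eq: "unit_edge u i = unit_edge v i"
  show "u = v"
  proof (rule ccontr)
    assume ne: "u \<noteq> v"
    have "u \<in> unit_edge v i" "v \<in> unit_edge u i" using eq by (auto simp: unit_edge_def)
    then have "u = v + axis i 1" "v = u + axis i 1" using ne by (auto simp: unit_edge_def)
    then have "u $ i = v $ i + 1" "v $ i = u $ i + 1" by (metis axis_nth vector_add_component)+
    then show False by simp
  qed
qed

lemma line_sum: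
  fixes g :: "int ^ 'd::finite \<Rightarrow> real"
  shows "(\<Sum>u | \<forall>j. u $ j \<in> {0..<int n}. g u) =
    (\<Sum>v | \<forall>j. v $ j \<in> (if j = i then {0} else {0..<int n}). \<Sum>k<n. g (v + axis i (int k)))"
    (is "sum g ?U = sum _ ?V")
proof -
  have "sum g ?U = (\<Sum>(v, k)\<in>?V \<times> {..<n}. g (v + axis i (int k)))"
  proof (rule sum.reindex_bij_witness[where j = "\<lambda>u. (\<chi> j. if j = i then 0 else u $ j, nat (u $ i))"
        and i = "\<lambda>(v, k). v + axis i (int k)"])
    fix u assume u: "u \<in> ?U"
    then have ui: "0 \<le> u $ i" "u $ i < int n" by auto
    show eq: "(case (\<chi> j. if j = i then 0 else u $ j, nat (u $ i)) of (v, k) \<Rightarrow> v + axis i (int k)) = u"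
      using ui by (auto simp: vec_eq_iff axis_def)
    have "nat (u $ i) < n" using ui by linarith
    then show "(\<chi> j. if j = i then 0 else u $ j, nat (u $ i)) \<in> ?V \<times> {..<n}" using u by auto
    show "(case (\<chi> j. if j = i then 0 else u $ j, nat (u $ i)) of (v, k) \<Rightarrow> g (v + axis i (int k))) = g u"
      using eq by simp
  next
    fix vk assume "vk \<in> ?V \<times> {..<n}"
    then obtain v k where vk: "vk = (v, k)" "k < n" and v: "\<And>j. v $ j \<in> (if j = i then {0} else {0..<int n})" by auto
    have vi: "v $ i = 0" using v[of i] by simp
    show "(case vk of (v, k) \<Rightarrow> v + axis i (int k)) \<in> ?U"
    proof -
      have "(v + axis i (int k)) $ j \<in> {0..<int n}" for j
        using v[of j] vk(2) by (cases "j = i") (auto simp: axis_def)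
      then show ?thesis by (simp add: vk)
    qed
    show "(\<chi> j. if j = i then 0 else (case vk of (v, k) \<Rightarrow> v + axis i (int k)) $ j,
        nat ((case vk of (v, k) \<Rightarrow> v + axis i (int k)) $ i)) = vk"
      using vi by (auto simp: vk axis_def vec_eq_iff)
  qed
  also have "\<dots> = (\<Sum>v\<in>?V. \<Sum>k<n. g (v + axis i (int k)))" by (rule sum.cartesian_product[symmetric])
  finally show ?thesis .
qed

context passage_percolation
begin

text \<open>Without an atom at b, the integrand tends to 0 almost everywhere as k grows and is
  bounded by 1, so dominated convergence applies.\<close>

lemma exponential_moment_small:
  assumes "measure \<nu> {b} = 0" and r: "0 < r"
  obtains k :: nat where "1 \<le> k" "(\<integral>\<^sup>+x. ennreal (exp (real k * (x - b))) \<partial>\<nu>) \<le> ennreal r"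
proof -
  interpret nu: prob_space \<nu> by (rule nu_prob)
  have [measurable_cong]: "sets \<nu> = sets borel" by (rule nu_sets)
  have le: "AE x in \<nu>. x \<le> b"
    by (rule AE_I[where N = "- {a..b}"]) (auto simp: nu_outside nu_sets)
  have nb: "AE x in \<nu>. x \<noteq> b"
    by (rule AE_I[where N = "{b}"]) (use assms(1) in \<open>auto simp: nu_sets nu.emeasure_eq_measure\<close>)
  have lim: "(\<lambda>k. \<integral>x. exp (real k * (x - b)) \<partial>\<nu>) \<longlonglongrightarrow> (\<integral>x. 0 \<partial>\<nu>)"
  proof (rule integral_dominated_convergence[where w = "\<lambda>_. 1"])
    show "AE x in \<nu>. (\<lambda>k. exp (real k * (x - b))) \<longlonglongrightarrow> 0"
      using le nb
    proof eventually_elim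
      case (elim x)
      then have x: "exp (x - b) < 1" by simp
      have "(\<lambda>k. exp (x - b) ^ k) \<longlonglongrightarrow> 0" using x by (intro LIMSEQ_realpow_zero) auto
      then show ?case by (simp add: exp_of_nat_mult)
    qed
    show "AE x in \<nu>. norm (exp (real k * (x - b))) \<le> 1" for k
      using le by eventually_elim (simp add: mult_nonneg_nonpos)
  qed (auto intro: nu.integrable_const)
  have int: "integrable \<nu> (\<lambda>x. exp (real k * (x - b)))" for k
  proof (rule nu.integrable_const_bound[where B = 1])
    show "AE x in \<nu>. norm (exp (real k * (x - b))) \<le> 1"
      using le by eventually_elim (simp add: mult_nonneg_nonpos)
  qed measurable
  have "\<forall>\<^sub>F k in sequentially. (\<integral>x. exp (real k * (x - b)) \<partial>\<nu>) < r"
    using order_tendstoD(2)[OF lim] r by simp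
  then have "\<forall>\<^sub>F k in sequentially. (\<integral>x. exp (real k * (x - b)) \<partial>\<nu>) < r \<and> 1 \<le> k"
    using eventually_ge_at_top[of 1] by eventually_elim simp
  then obtain k where k: "(\<integral>x. exp (real k * (x - b)) \<partial>\<nu>) < r" "1 \<le> k"
    using eventually_happens'[OF sequentially_bot] by blast
  have "(\<integral>\<^sup>+x. ennreal (exp (real k * (x - b))) \<partial>\<nu>) = ennreal (\<integral>x. exp (real k * (x - b)) \<partial>\<nu>)"
    by (rule nn_integral_eq_integral[OF int]) simp
  then show thesis using that[of k] k by (simp add: ennreal_leI)
qed

text \<open>Chernoff bound over all edges of direction \<open>i\<close>.\<close>

lemma near_maximal_crossing:
  assumes nb: "measure \<nu> {b} = 0" and L: "0 \<le> L"
  obtains \<epsilon> where "0 < \<epsilon>" "\<And>n \<zeta> i. b - \<epsilon> \<le> \<zeta> $ i \<Longrightarrow>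
    cprob (crossing_event b n \<zeta>) \<le> exp (- L * real n ^ CARD('d))"
proof -
  obtain k :: nat where k: "1 \<le> k" "(\<integral>\<^sup>+x. ennreal (exp (real k * (x - b))) \<partial>\<nu>) \<le> ennreal (exp (- L - 1))"
    by (rule exponential_moment_small[OF nb, of "exp (- L - 1)"]) auto
  show thesis
  \<comment> \<open>With this margin the exponential weight of each edge grows by the factor exp (k
    / k) = e, which the extra -1 in the moment bound compensates.\<close>
  proof (rule that[of "1 / real k"])
    show "0 < 1 / real k" using k(1) by simp
    fix n and \<zeta> :: "real ^ 'd" and i assume \<zeta>: "b - 1 / real k \<le> \<zeta> $ i"
    define U where "U = {u :: int ^ 'd. \<forall>j. u $ j \<in> {0..<int n}}"
    define V where "V = {v :: int ^ 'd. \<forall>j. v $ j \<in> (if j = i then {0} else {0..<int n})}"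
    define S where "S = (\<lambda>u. unit_edge u i) ` U"
    define X where "X e \<omega> = ennreal (exp (real k * (\<tau> e \<omega> - b + 1 / real k)))" for e \<omega>
    have inj: "inj_on (\<lambda>u. unit_edge u i) U" by (rule inj_onI) (rule unit_edge_inj_point)
    have fU: "finite U" unfolding U_def by (rule finite_int_box) simp
    have cU: "card U = n ^ CARD('d)" unfolding U_def by (subst card_int_box) simp_all
    have fS: "finite S" and cS: "card S = n ^ CARD('d)"
      using fU cU card_image[OF inj] by (auto simp: S_def)
    have indep: "indep_vars (\<lambda>_. borel) X S"
    proof -
      have "indep_vars (\<lambda>_. borel) \<tau> S"
        by (rule indep_vars_subset[OF tau_indep]) (auto simp: S_def)
      then show ?thesis unfolding X_def by (rule indep_vars_compose2) measurable
    qed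
    have "emeasure M {\<omega> \<in> space M. (\<lambda>e. \<tau> e \<omega>) \<in> crossing_event b n \<zeta>} =
        (\<integral>\<^sup>+\<omega>. indicator {\<omega> \<in> space M. (\<lambda>e. \<tau> e \<omega>) \<in> crossing_event b n \<zeta>} \<omega> \<partial>M)"
      by (rule nn_integral_indicator[symmetric], rule local_event_measurable[OF local_crossing_event edges_in_subset_lattice])
    also have "\<dots> \<le> (\<integral>\<^sup>+\<omega>. (\<Prod>e\<in>S. X e \<omega>) \<partial>M)"
    proof (rule nn_integral_mono_AE)
      show "AE \<omega> in M. indicator {\<omega> \<in> space M. (\<lambda>e. \<tau> e \<omega>) \<in> crossing_event b n \<zeta>} \<omega> \<le> (\<Prod>e\<in>S. X e \<omega>)"
        using AE_weights_in_range
      proof eventually_elim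
        case (elim \<omega>)
        show ?case
        proof (cases "(\<lambda>e. \<tau> e \<omega>) \<in> crossing_event b n \<zeta>")
          case False
          then show ?thesis by (simp add: indicator_def)
        next
          case True
          let ?t = "\<lambda>e. \<tau> e \<omega>"
          have t: "bounded_config b ?t" by (rule bounded_config_weights[OF elim])
          have nn: "\<forall>e\<in>edges_in (qbox 0 n). 0 \<le> ?t e" using t by (auto simp: bounded_config_def edges_in_def)
          have "\<zeta> $ i * real n \<le> crossing_time b ?t n i"
            unfolding crossing_time_ge_iff[where t = ?t, OF nn less_imp_le[OF b_pos]]
            using True by (auto simp: crossing_event_def)
          moreover have "(b - 1 / real k) * real n \<le> \<zeta> $ i * real n" using \<zeta> by (intro mult_right_mono) auto
          ultimately have ct: "(b - 1 / real k) * real n \<le> crossing_time b ?t n i" by linarith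
          \<comment> \<open>Each lattice line of direction i is a crossing path, so its mean weight
            is at least b - 1 / k. Summing over all lines turns the crossing event into a condition
            on n^d independent weights.\<close>
          have "0 \<le> (\<Sum>v\<in>V. \<Sum>l<n. ?t (unit_edge (v + axis i (int l)) i) - b + 1 / real k)"
          proof (rule sum_nonneg)
            fix v assume "v \<in> V"
            then have v: "\<And>j. v $ j \<in> (if j = i then {0} else {0..<int n})" by (auto simp: V_def)
            have "crossing_time b ?t n i \<le> (\<Sum>l<n. ?t (unit_edge (v + axis i (int l)) i))"
            proof (rule crossing_time_le_line[OF t less_imp_le[OF b_pos]])
              show "0 \<le> v $ j \<and> v $ j \<le> int n" for j using v[of j] by (cases "j = i") auto
              show "v $ i = 0" using v[of i] by simp
            qed
            moreover have "(\<Sum>l<n. ?t (unit_edge (v + axis i (int l)) i) - b + 1 / real k) =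
              (\<Sum>l<n. ?t (unit_edge (v + axis i (int l)) i)) - (b - 1 / real k) * real n"
              by (simp add: sum.distrib sum_subtractf algebra_simps)
            ultimately show "0 \<le> (\<Sum>l<n. ?t (unit_edge (v + axis i (int l)) i) - b + 1 / real k)"
              using ct by linarith
          qed
          then have s0: "0 \<le> (\<Sum>u\<in>U. ?t (unit_edge u i) - b + 1 / real k)"
            unfolding U_def V_def line_sum[where i = i] .
          have "(\<Prod>e\<in>S. X e \<omega>) = ennreal (\<Prod>u\<in>U. exp (real k * (?t (unit_edge u i) - b + 1 / real k)))"
            unfolding X_def S_def prod.reindex[OF inj] o_def by (rule prod_ennreal) simp
          also have "(\<Prod>u\<in>U. exp (real k * (?t (unit_edge u i) - b + 1 / real k))) =
              exp (real k * (\<Sum>u\<in>U. ?t (unit_edge u i) - b + 1 / real k))"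
            by (simp only: exp_sum[OF fU, symmetric] sum_distrib_left)
          finally have "(\<Prod>e\<in>S. X e \<omega>) = ennreal (exp (real k * (\<Sum>u\<in>U. ?t (unit_edge u i) - b + 1 / real k)))" .
          moreover have "1 \<le> exp (real k * (\<Sum>u\<in>U. ?t (unit_edge u i) - b + 1 / real k))" using s0 by simp
          ultimately have "1 \<le> (\<Prod>e\<in>S. X e \<omega>)" by (simp only: ennreal_ge_1)
          then show ?thesis by (simp add: indicator_def)
        qed
      qed
    qed
    also have "\<dots> = (\<Prod>e\<in>S. \<integral>\<^sup>+\<omega>. X e \<omega> \<partial>M)"
      by (rule indep_vars_nn_integral[OF fS indep]) simp
    also have "\<dots> \<le> (\<Prod>e\<in>S. ennreal (exp (- L)))"
    proof (rule prod_mono_ennreal)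
      fix e assume "e \<in> S"
      then have e: "e \<in> lattice_edges" by (auto simp: S_def)
      have "(\<integral>\<^sup>+\<omega>. X e \<omega> \<partial>M) = (\<integral>\<^sup>+x. ennreal (exp (real k * (x - b + 1 / real k))) \<partial>distr M borel (\<tau> e))"
        unfolding X_def by (rule nn_integral_distr[symmetric]) (use tau_measurable[OF e] in auto)
      also have "\<dots> = (\<integral>\<^sup>+x. ennreal (exp 1) * ennreal (exp (real k * (x - b))) \<partial>\<nu>)"
        unfolding tau_distr[OF e] using k(1)
        by (intro nn_integral_cong) (simp add: ennreal_mult'[symmetric] exp_add[symmetric] distrib_left)
      also have "\<dots> = ennreal (exp 1) * (\<integral>\<^sup>+x. ennreal (exp (real k * (x - b))) \<partial>\<nu>)"
        by (rule nn_integral_cmult) (simp add: measurable_cong_sets[OF nu_sets refl])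
      also have "\<dots> \<le> ennreal (exp 1) * ennreal (exp (- L - 1))" by (rule mult_left_mono[OF k(2)]) simp
      also have "\<dots> = ennreal (exp (- L))" by (simp add: ennreal_mult'[symmetric] exp_add[symmetric])
      finally show "(\<integral>\<^sup>+\<omega>. X e \<omega> \<partial>M) \<le> ennreal (exp (- L))" .
    qed
    also have "\<dots> = ennreal (exp (- L * real n ^ CARD('d)))"
      by (simp add: cS ennreal_power exp_of_nat_mult[symmetric] mult.commute)
    finally show "cprob (crossing_event b n \<zeta>) \<le> exp (- L * real n ^ CARD('d))"
      by (simp add: emeasure_eq_measure)
  qed
qed

end

section \<open>Refreshing the coordinate axes\<close>

definition axis_edge :: "'d \<Rightarrow> nat \<Rightarrow> (int ^ 'd) set" where
  "axis_edge i k = unit_edge (axis i (int k)) i"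

lemma axis_edge_in_qbox: "k < n \<Longrightarrow> axis_edge i k \<in> edges_in (qbox 0 n)"
  unfolding edges_in_def axis_edge_def
  by (auto simp: lattice_point_qbox_iff unit_edge_def axis_def)
     (metis unit_edge_def unit_edge_in_lattice_edges axis_def)

lemma axis_edge_face: "v \<in> axis_edge j k \<Longrightarrow> j \<noteq> i \<Longrightarrow> v $ i = 0"
  by (auto simp: axis_edge_def unit_edge_def axis_def)

text \<open>Source of fresh weights, outside the box of side \<open>n\<close>.\<close>

definition far_copy :: "nat \<Rightarrow> (int ^ 'd) set \<Rightarrow> (int ^ 'd) set" where
  "far_copy n e = place (\<lambda>_. False) (\<chi> i. int n + 1) 0 ` e"

lemma far_copy_lattice: "e \<in> lattice_edges \<Longrightarrow> far_copy n e \<in> lattice_edges"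
  unfolding far_copy_def by (rule place_lattice_edges)

lemma far_copy_inj: "far_copy n e = far_copy n e' \<Longrightarrow> e = e'"
  unfolding far_copy_def using inj_image_eq_iff[OF inj_place] by blast

lemma far_copy_outside:
  assumes "e \<in> edges_in (qbox 0 n :: (real ^ 'd::finite) set)"
  shows "far_copy n e \<notin> edges_in (qbox 0 n)"
proof
  assume far: "far_copy n e \<in> edges_in (qbox 0 n)"
  obtain v where v: "v \<in> e" using assms by (auto simp: edges_in_def lattice_edges_def)
  let ?w = "place (\<lambda>_. False) (\<chi> i. int n + 1) 0 v :: int ^ 'd"
  obtain i :: 'd where True by simp
  have "lattice_point v \<in> qbox 0 n" using assms v by (auto simp: edges_in_def)
  then have "0 \<le> v $ i" by (auto simp: lattice_point_qbox_iff)
  moreover have "lattice_point ?w \<in> qbox 0 n" using far v by (auto simp: edges_in_def far_copy_def)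
  then have "?w $ i \<le> int n" by (auto simp: lattice_point_qbox_iff)
  ultimately show False by (simp add: place_def)
qed

text \<open>\<open>\<kappa> i\<close> counts the replaced edges of the i-th axis, starting from the
  origin. The replacement is expressed as a map of edges, injective on the box, so that the new
  configuration has the same law as the old one.\<close>

definition refresh :: "nat \<Rightarrow> ('d \<Rightarrow> nat) \<Rightarrow> (int ^ 'd) set \<Rightarrow> (int ^ 'd) set" where
  "refresh n \<kappa> e = (if \<exists>i k. k < \<kappa> i \<and> e = axis_edge i k then far_copy n e else e)"

lemma refresh_lattice: "e \<in> lattice_edges \<Longrightarrow> refresh n \<kappa> e \<in> lattice_edges"
  by (simp add: refresh_def far_copy_lattice)

lemma refresh_inj:
  "inj_on (refresh n \<kappa>) (edges_in (qbox 0 n :: (real ^ 'd::finite) set))"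
proof (rule inj_onI)
  fix e e' assume "e \<in> edges_in (qbox 0 n :: (real ^ 'd) set)" "e' \<in> edges_in (qbox 0 n :: (real ^ 'd) set)"
    "refresh n \<kappa> e = refresh n \<kappa> e'"
  then show "e = e'" using far_copy_outside far_copy_inj unfolding refresh_def by (metis (full_types))
qed

text \<open>Expressed through lower bounds on path times, whose locality is known; the upper bound
  is the complement of such a condition. Nonnegativity is included so that the infima are
  genuine.\<close>

definition near_event :: "real \<Rightarrow> nat \<Rightarrow> real ^ 'd \<Rightarrow> real \<Rightarrow> ((int ^ 'd) set \<Rightarrow> real) set" where
  "near_event b n \<zeta> \<epsilon> = {t. \<forall>e\<in>edges_in (qbox 0 n :: (real ^ 'd) set). 0 \<le> t e} \<inter>
    (\<Inter>i. {t. \<forall>p\<in>crossing_paths n i. (\<zeta> $ i - \<epsilon>) * real n \<le> path_time b t p} -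
         {t. \<forall>p\<in>crossing_paths n i. (\<zeta> $ i + \<epsilon>) * real n \<le> path_time b t p})"

lemma local_near_event:
  "local_event (edges_in (qbox 0 n)) (near_event b n (\<zeta> :: real ^ 'd::finite) \<epsilon>)"
  unfolding near_event_def Diff_eq
  by (intro local_event_Int local_nonneg local_event_INT finite local_crossing_bound local_event_Compl)

lemma near_event_iff:
  fixes t :: "(int ^ 'd::finite) set \<Rightarrow> real"
  assumes "\<forall>e\<in>edges_in (qbox 0 n :: (real ^ 'd) set). 0 \<le> t e" "0 \<le> b"
  shows "t \<in> near_event b n \<zeta> \<epsilon> \<longleftrightarrow>
    (\<forall>i. (\<zeta> $ i - \<epsilon>) * real n \<le> crossing_time b t n i \<and> crossing_time b t n i < (\<zeta> $ i + \<epsilon>) * real n)"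
  unfolding not_le[symmetric] crossing_time_ge_iff[where t = t, OF assms]
  using assms(1) by (auto simp: near_event_def)

text \<open>A discrete intermediate value argument: at the first index below c the predecessor was
  at least c, and one step loses at most b, so the value cannot have dropped below c - b.\<close>

lemma discrete_crossing:
  fixes g :: "nat \<Rightarrow> real"
  assumes "z \<le> g 0" "g n < c" "\<And>k. k < n \<Longrightarrow> g k - b \<le> g (Suc k)" "z \<le> c - b"
  obtains k where "k \<le> n" "z \<le> g k" "g k < c"
proof -
  define k where "k = (LEAST k. g k < c)"
  have k: "g k < c" "k \<le> n" unfolding k_def using assms(2) by (auto intro: LeastI Least_le)
  have "z \<le> g k"
  proof (cases k)
    case 0
    then show ?thesis using assms(1) by simp
  next
    case (Suc l)
    then have "\<not> g l < c" unfolding k_def by (metis lessI not_less_Least)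
    then show ?thesis using assms(3)[of l] assms(4) k(2) Suc by simp
  qed
  then show thesis using that k by blast
qed

context passage_percolation
begin

text \<open>The numbers \<open>\<kappa> i\<close> can be chosen separately, because direction i does
  not feel the weights on the other axes. With the whole axis refreshed the crossing time is at most
  (a + \<open>\<epsilon>\<close> / 2) n, below the upper end of the window since
  \<open>\<zeta> $ i\<close> is at least a. Somewhere between no and full replacement the window is
  hit.\<close>

lemma refresh_to_near:
  assumes t: "bounded_config b t" and n: "1 \<le> n" and \<zeta>: "\<And>i. a \<le> \<zeta> $ i"
    and cr: "t \<in> crossing_event b n \<zeta>" and \<epsilon>: "0 < \<epsilon>" "b \<le> 2 * \<epsilon> * real n"
    and fresh: "\<And>i k. k < n \<Longrightarrow> t (far_copy n (axis_edge i k)) \<le> a + \<epsilon> / 2"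
  obtains \<kappa> :: "'d \<Rightarrow> nat" where "\<And>i. \<kappa> i \<le> n" "(\<lambda>e. t (refresh n \<kappa> e)) \<in> near_event b n \<zeta> \<epsilon>"
proof -
  have b0: "0 \<le> b" using b_pos by simp
  have tb: "bounded_config b (\<lambda>e. t (refresh n \<kappa> e))" for \<kappa>
    using t refresh_lattice unfolding bounded_config_def by blast
  have nn: "\<forall>e\<in>edges_in (qbox 0 n :: (real ^ 'd) set). 0 \<le> t (refresh n \<kappa> e)" for \<kappa>
    using tb[of \<kappa>] by (auto simp: bounded_config_def edges_in_def)
  define \<mu> where "\<mu> i k = (\<lambda>j :: 'd. if j = i then k else 0 :: nat)" for i k
  define g where "g i k = crossing_time b (\<lambda>e. t (refresh n (\<mu> i k) e)) n i" for i k
  have ref: "refresh n (\<mu> i k) e = (if \<exists>l<k. e = axis_edge i l then far_copy n e else e)" for i k e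
    unfolding refresh_def \<mu>_def by (rule if_cong) (auto split: if_splits)
  have "\<exists>k\<le>n. (\<zeta> $ i - \<epsilon>) * real n \<le> g i k \<and> g i k < (\<zeta> $ i + \<epsilon>) * real n" for i
  proof -
    have nn0: "\<forall>e\<in>edges_in (qbox 0 n :: (real ^ 'd) set). 0 \<le> t e"
      using t by (auto simp: bounded_config_def edges_in_def)
    have "refresh n (\<mu> i 0) = (\<lambda>e. e)" by (rule ext) (simp add: ref)
    then have "g i 0 = crossing_time b t n i" by (simp add: g_def)
    moreover have "\<zeta> $ i * real n \<le> crossing_time b t n i"
      unfolding crossing_time_ge_iff[where t = t, OF nn0 b0] using cr by (auto simp: crossing_event_def)
    moreover have "0 \<le> \<epsilon> * real n" using \<epsilon> by simp
    ultimately have 1: "(\<zeta> $ i - \<epsilon>) * real n \<le> g i 0" by (simp add: left_diff_distrib)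
    have "g i n \<le> (\<Sum>k<n. t (refresh n (\<mu> i n) (unit_edge (0 + axis i (int k)) i)))"
      unfolding g_def by (rule crossing_time_le_line[OF tb b0]) auto
    also have "\<dots> \<le> (\<Sum>k<n. a + \<epsilon> / 2)"
    proof (rule sum_mono)
      fix k assume "k \<in> {..<n}"
      then have k: "k < n" by simp
      then have "refresh n (\<mu> i n) (axis_edge i k) = far_copy n (axis_edge i k)" unfolding ref by auto
      then show "t (refresh n (\<mu> i n) (unit_edge (0 + axis i (int k)) i)) \<le> a + \<epsilon> / 2"
        using fresh[OF k, of i] by (simp add: axis_edge_def)
    qed
    also have "\<dots> = (a + \<epsilon> / 2) * real n" by simp
    also have "\<dots> < (\<zeta> $ i + \<epsilon>) * real n" using \<zeta>[of i] \<epsilon> n by (intro mult_strict_right_mono) auto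
    finally have 2: "g i n < (\<zeta> $ i + \<epsilon>) * real n" .
    have 3: "g i k - b \<le> g i (Suc k)" for k
      unfolding g_def
    proof (rule crossing_time_single_edge[OF tb tb b0])
      show "axis_edge i k \<in> lattice_edges" by (simp add: axis_edge_def)
      fix e assume "e \<noteq> axis_edge i k"
      then have "(\<exists>l<Suc k. e = axis_edge i l) \<longleftrightarrow> (\<exists>l<k. e = axis_edge i l)" by (auto simp: less_Suc_eq)
      then show "t (refresh n (\<mu> i (Suc k)) e) = t (refresh n (\<mu> i k) e)" by (simp add: ref)
    qed
    \<comment> \<open>The window has width 2 \<open>\<epsilon>\<close> n, at least the maximal jump
      b, so it cannot be skipped.\<close>
    have 4: "(\<zeta> $ i - \<epsilon>) * real n \<le> (\<zeta> $ i + \<epsilon>) * real n - b"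
      using \<epsilon>(2) by (simp add: algebra_simps)
    show ?thesis by (rule discrete_crossing[of _ "g i", OF 1 2 3 4]) auto
  qed
  then obtain \<kappa> where \<kappa>: "\<And>i. \<kappa> i \<le> n" "\<And>i. (\<zeta> $ i - \<epsilon>) * real n \<le> g i (\<kappa> i)"
    "\<And>i. g i (\<kappa> i) < (\<zeta> $ i + \<epsilon>) * real n" by metis
  have "crossing_time b (\<lambda>e. t (refresh n \<kappa> e)) n i = g i (\<kappa> i)" for i
  proof -
    have same: "refresh n \<kappa> e = refresh n (\<mu> i (\<kappa> i)) e" if "\<not> (\<forall>v\<in>e. v $ i = 0)" for e
    proof -
      have "e \<noteq> axis_edge j k" if "j \<noteq> i" for j k
        using axis_edge_face[of _ j k i] that \<open>\<not> (\<forall>v\<in>e. v $ i = 0)\<close> by blast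
      then have "(\<exists>j k. k < \<kappa> j \<and> e = axis_edge j k) \<longleftrightarrow> (\<exists>l<\<kappa> i. e = axis_edge i l)" by metis
      then have "refresh n \<kappa> e = (if \<exists>l<\<kappa> i. e = axis_edge i l then far_copy n e else e)"
        unfolding refresh_def by simp
      then show ?thesis by (simp only: ref)
    qed
    show ?thesis unfolding g_def
      by (rule antisym; rule crossing_time_face_edges[OF tb tb b0]) (simp_all add: same)
  qed
  then have "(\<lambda>e. t (refresh n \<kappa> e)) \<in> near_event b n \<zeta> \<epsilon>"
    unfolding near_event_iff[where t = "\<lambda>e. t (refresh n \<kappa> e)", OF nn b0] using \<kappa>(2,3) by simp
  then show thesis using that \<kappa>(1) by blast
qed

text \<open>Coupling with fresh weights on the \<open>d\<close> axes: this costs a factor that is only exponential in \<open>n\<close>,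
  hence negligible at speed \<open>n\<^sup>d\<close> because \<open>d \<ge> 2\<close>.\<close>

lemma crossing_near_prob:
  assumes n: "1 \<le> n" and \<zeta>: "\<And>i. a \<le> \<zeta> $ i" and \<epsilon>: "0 < \<epsilon>" "b \<le> 2 * \<epsilon> * real n"
  shows "cprob (crossing_event b n \<zeta>) * measure \<nu> {..a + \<epsilon> / 2} ^ (CARD('d) * n)
    \<le> real ((n + 1) ^ CARD('d)) * cprob (near_event b n \<zeta> \<epsilon>)"
proof -
  interpret nu: prob_space \<nu> by (rule nu_prob)
  let ?E = "edges_in (qbox 0 n) :: (int ^ 'd) set set"
  let ?B = "{..a + \<epsilon> / 2}"
  let ?C = "crossing_event b n \<zeta>"
  define R :: "(int ^ 'd) set set" where "R = (\<lambda>(i, k). far_copy n (axis_edge i k)) ` (UNIV \<times> {..<n})"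
  define P :: "('d \<Rightarrow> nat) set" where "P = (\<Pi>\<^sub>E i\<in>UNIV. {..n})"
  have fR: "finite R" by (simp add: R_def)
  have RL: "R \<subseteq> lattice_edges" by (auto simp: R_def axis_edge_def intro!: far_copy_lattice)
  have "far_copy n (axis_edge i k) \<notin> ?E" if "k < n" for i k
    by (rule far_copy_outside[OF axis_edge_in_qbox[OF that]])
  then have RE: "R \<inter> ?E = {}" by (auto simp: R_def)
  have cR: "card R \<le> CARD('d) * n"
  proof -
    have "card R \<le> card ((UNIV :: 'd set) \<times> {..<n})" unfolding R_def by (rule card_image_le) simp
    then show ?thesis by (simp add: card_cartesian_product)
  qed
  have fP: "finite P" unfolding P_def by (rule finite_PiE) auto
  have cP: "card P = (n + 1) ^ CARD('d)" unfolding P_def by (simp add: card_PiE)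
  let ?A = "{\<omega> \<in> space M. (\<forall>k\<in>{()}. (\<lambda>e. \<tau> e \<omega>) \<in> ?C) \<and> (\<forall>e\<in>R. \<tau> e \<omega> \<in> ?B)}"
  let ?N = "\<lambda>\<kappa>. {\<omega> \<in> space M. (\<lambda>e. \<tau> (refresh n \<kappa> e) \<omega>) \<in> near_event b n \<zeta> \<epsilon>}"
  have "prob ?A = (\<Prod>k\<in>{()}. cprob ?C) * measure \<nu> ?B ^ card R"
    by (rule block_prob[where E = ?E and \<sigma> = "\<lambda>_ e. e" and C = "\<lambda>_. ?C"])
       (use local_crossing_event edges_in_lattice fR RL RE in auto)
  then have A: "prob ?A = cprob ?C * measure \<nu> ?B ^ card R" by simp
  have "measure \<nu> ?B ^ (CARD('d) * n) \<le> measure \<nu> ?B ^ card R"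
    by (intro power_decreasing cR) auto
  then have "cprob ?C * measure \<nu> ?B ^ (CARD('d) * n) \<le> prob ?A"
    unfolding A by (rule mult_left_mono) simp
  have rL: "refresh n \<kappa> ` ?E \<subseteq> lattice_edges" for \<kappa>
    using refresh_lattice edges_in_lattice by blast
  have NE: "?N \<kappa> \<in> events" for \<kappa>
    by (rule reindexed_event_measurable[OF local_near_event rL])
  \<comment> \<open>All refreshed configurations have the original law. Not knowing which
    \<open>\<kappa>\<close> works therefore costs only the number (n + 1)^d of candidates.\<close>
  have Np: "prob (?N \<kappa>) = cprob (near_event b n \<zeta> \<epsilon>)" for \<kappa>
    by (rule reindexed_prob[OF local_near_event refresh_inj rL edges_in_subset_lattice])
  note \<open>cprob ?C * measure \<nu> ?B ^ (CARD('d) * n) \<le> prob ?A\<close>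
  also have "prob ?A \<le> prob (\<Union>\<kappa>\<in>P. ?N \<kappa>)"
  proof (rule prob_mono_in_range)
    have 1: "{\<omega> \<in> space M. (\<lambda>e. \<tau> e \<omega>) \<in> ?C} \<in> events"
      by (rule local_event_measurable[OF local_crossing_event edges_in_subset_lattice])
    have 2: "{\<omega> \<in> space M. \<forall>e\<in>R. \<tau> e \<omega> \<in> ?B} \<in> events"
      by (rule sets.sets_Collect_finite_All) (use tau_event RL fR in \<open>auto simp del: atMost_iff\<close>)
    have eq: "?A = {\<omega> \<in> space M. (\<lambda>e. \<tau> e \<omega>) \<in> ?C} \<inter> {\<omega> \<in> space M. \<forall>e\<in>R. \<tau> e \<omega> \<in> ?B}" by auto
    show "?A \<in> events" unfolding eq by (rule sets.Int[OF 1 2])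
    show "(\<Union>\<kappa>\<in>P. ?N \<kappa>) \<in> events" using fP NE by blast
    fix \<omega> assume \<omega>: "\<omega> \<in> space M" "weights_in_range \<omega>" "\<omega> \<in> ?A"
    obtain \<kappa> where "\<And>i. \<kappa> i \<le> n" "(\<lambda>e. \<tau> (refresh n \<kappa> e) \<omega>) \<in> near_event b n \<zeta> \<epsilon>"
    proof (rule refresh_to_near[OF bounded_config_weights[OF \<omega>(2)] n \<zeta> _ \<epsilon>])
      show "(\<lambda>e. \<tau> e \<omega>) \<in> ?C" using \<omega>(3) by simp
      show "\<tau> (far_copy n (axis_edge i k)) \<omega> \<le> a + \<epsilon> / 2" if "k < n" for i k
      proof -
        have "far_copy n (axis_edge i k) \<in> R" unfolding R_def using that by force
        then show ?thesis using \<omega>(3) by simp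
      qed
    qed blast
    moreover have "\<kappa> \<in> P" using calculation(1) by (simp add: P_def PiE_iff)
    ultimately show "\<omega> \<in> (\<Union>\<kappa>\<in>P. ?N \<kappa>)" using \<omega>(1) by blast
  qed
  also have "\<dots> \<le> (\<Sum>\<kappa>\<in>P. prob (?N \<kappa>))"
    using NE by (intro finite_measure_subadditive_finite fP) auto
  also have "\<dots> = real ((n + 1) ^ CARD('d)) * cprob (near_event b n \<zeta> \<epsilon>)"
    unfolding Np by (simp add: cP)
  finally show ?thesis .
qed

end

section \<open>The rate function\<close>

lemma antimono_tendsto_SUP_at_right:
  fixes f :: "real \<Rightarrow> ennreal"
  assumes "\<And>x y. 0 < x \<Longrightarrow> x \<le> y \<Longrightarrow> f y \<le> f x"
  shows "(f \<longlongrightarrow> (SUP x\<in>{0<..}. f x)) (at_right 0)"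
proof (rule order_tendstoI)
  fix c assume "c < (SUP x\<in>{0<..}. f x)"
  then obtain z where z: "0 < z" "c < f z" by (auto simp: less_SUP_iff)
  have "eventually (\<lambda>x. x < z) (at_right (0::real))" using z(1) by (intro eventually_at_rightI[of 0 z]) auto
  then show "eventually (\<lambda>x. c < f x) (at_right 0)"
    using eventually_at_right_less[of "0::real"]
    by eventually_elim (use z assms in \<open>meson less_imp_le less_le_trans\<close>)
next
  fix c assume c: "(SUP x\<in>{0<..}. f x) < c"
  show "eventually (\<lambda>x. f x < c) (at_right 0)"
    using eventually_at_right_less[of "0::real"]
    by eventually_elim (meson SUP_upper c greaterThan_iff le_less_trans)
qed

lemma ennreal_le_all_above:
  fixes y :: ennreal
  assumes "\<And>\<beta>. 0 < \<beta> \<Longrightarrow> y \<le> ennreal (x + \<beta>)" "0 \<le> x"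
  shows "y \<le> ennreal x"
proof (rule ennreal_le_epsilon)
  fix e :: real assume "0 < e"
  then show "y \<le> ennreal x + ennreal e" using assms(1)[of e] assms(2) by (simp add: ennreal_plus)
qed

lemma ennreal_real_between:
  fixes y :: ennreal
  assumes "ennreal x < y" "0 \<le> x"
  obtains z where "x < z" "ennreal z < y"
proof -
  obtain w where w: "ennreal x < w" "w < y" using assms(1) dense by blast
  then obtain z where z: "w = ennreal z" "0 \<le> z" by (cases w) auto
  then have "x < z" using w(1) assms(2) by (simp add: ennreal_less_iff)
  then show thesis using that z w by blast
qed

lemma ennreal_below_real:
  fixes y :: ennreal
  assumes "y < z"
  obtains x where "0 \<le> x" "y < ennreal x" "ennreal x < z"
proof -
  obtain w where w: "y < w" "w < z" using assms dense by blast
  then obtain x where "w = ennreal x" "0 \<le> x" by (cases w) auto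
  then show thesis using that w by blast
qed

lemma box_ab_eq_cbox: "box_ab a b = cbox (\<chi> i. a) (\<chi> i. b)"
  by (auto simp: box_ab_def mem_box_cart)

context passage_percolation
begin

abbreviation crossing_prob :: "nat \<Rightarrow> real ^ 'd \<Rightarrow> real" where
  "crossing_prob n \<zeta> \<equiv> cprob (crossing_event b n \<zeta>)"

abbreviation profile_prob :: "nat \<Rightarrow> real ^ 'd \<Rightarrow> real \<Rightarrow> real" where
  "profile_prob n \<zeta> \<epsilon> \<equiv> cprob (profile_event b (qbox 0 n) (linear_profile \<zeta>) (\<epsilon> * real n))"

section \<open>From probabilities to decay rates\<close>

lemma rate_le:
  assumes "1 \<le> n" "exp (- x * real n ^ CARD('d)) \<le> prob E"
  shows "decay_rate M (real n ^ CARD('d)) E \<le> ennreal x"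
proof -
  have s: "0 < real n ^ CARD('d)" using assms(1) by simp
  have P: "0 < prob E" using assms(2) by (meson exp_gt_zero less_le_trans)
  then have "- x * real n ^ CARD('d) \<le> ln (prob E)" using assms(2) by (simp add: ln_ge_iff)
  then have "- (1 / real n ^ CARD('d)) * ln (prob E) \<le> x" using s by (simp add: field_simps)
  then show ?thesis using P by (simp add: decay_rate_def ennreal_leI)
qed

lemma le_rate:
  assumes "1 \<le> n" "prob E \<le> exp (- x * real n ^ CARD('d))"
  shows "ennreal x \<le> decay_rate M (real n ^ CARD('d)) E"
proof (cases "prob E = 0")
  case False
  have s: "0 < real n ^ CARD('d)" using assms(1) by simp
  have P: "0 < prob E" using False by (simp add: zero_less_measure_iff)
  then have "ln (prob E) \<le> - x * real n ^ CARD('d)" using assms(2) by (metis ln_exp ln_le_cancel_iff exp_gt_zero)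
  then have "x \<le> - (1 / real n ^ CARD('d)) * ln (prob E)" using s by (simp add: field_simps)
  then show ?thesis using False by (simp add: decay_rate_def ennreal_leI)
qed (simp add: decay_rate_def)

lemma rate_less_imp:
  assumes "1 \<le> n" "decay_rate M (real n ^ CARD('d)) E < ennreal x"
  shows "exp (- x * real n ^ CARD('d)) \<le> prob E"
  using le_rate[OF assms(1), of E x] assms(2) by (meson leD linorder_linear)

lemma rate_mono: "prob E \<le> prob F \<Longrightarrow> decay_rate M (real n ^ CARD('d)) F \<le> decay_rate M (real n ^ CARD('d)) E"
proof (cases "prob E = 0")
  case False
  assume le: "prob E \<le> prob F"
  have "0 < prob E" using False by (simp add: zero_less_measure_iff)
  then have "ln (prob E) \<le> ln (prob F)" "prob F \<noteq> 0" using le by auto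
  then have "- (1 / real n ^ CARD('d)) * ln (prob F) \<le> - (1 / real n ^ CARD('d)) * ln (prob E)"
    by (intro mult_left_mono_neg) auto
  then show ?thesis using False \<open>prob F \<noteq> 0\<close> by (simp add: decay_rate_def ennreal_leI)
qed (simp add: decay_rate_def)

lemma b_nonneg: "0 \<le> b" using b_pos by simp

lemma nonneg_weights:
  "weights_in_range \<omega> \<Longrightarrow> \<forall>e\<in>edges_in (qbox 0 n :: (real ^ 'd) set). 0 \<le> \<tau> e \<omega>"
  using bounded_config_weights by (auto simp: bounded_config_def edges_in_def)

text \<open>If some weight in the box is negative, all passage times equal one default value and
  membership reduces to the constant condition \<open>Q\<close>. This gives measurability on the
  whole space; almost surely the event coincides with the profile event.\<close>

lemma LD_plus_event:
  assumes n: "1 \<le> n" and \<zeta>: "\<And>i. 0 \<le> \<zeta> $ i"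
  shows "LD_plus M b \<tau> n (g_cross \<zeta>) \<epsilon> \<in> events"
    "prob (LD_plus M b \<tau> n (g_cross \<zeta>) \<epsilon>) = profile_prob n \<zeta> \<epsilon>"
proof -
  let ?E = "edges_in (qbox 0 n) :: (int ^ 'd) set set"
  let ?D = "profile_event b (qbox 0 n) (linear_profile \<zeta>) (\<epsilon> * real n)"
  let ?NN = "{t. \<forall>e\<in>?E. 0 \<le> t e}"
  define Q where "Q \<longleftrightarrow> (\<forall>x\<in>unit_cube. \<forall>y\<in>unit_cube. g_cross \<zeta> (x - y) - \<epsilon> \<le> Inf UNIV / real n)"
  have iff: "\<omega> \<in> LD_plus M b \<tau> n (g_cross \<zeta>) \<epsilon> \<longleftrightarrow>
      \<omega> \<in> space M \<and> (\<lambda>e. \<tau> e \<omega>) \<in> (?NN \<inter> ?D) \<union> (- ?NN \<inter> {t. Q})" for \<omega>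
  proof (cases "(\<lambda>e. \<tau> e \<omega>) \<in> ?NN")
    case True
    then have "\<forall>e\<in>?E. 0 \<le> \<tau> e \<omega>" by blast
    from rescaled_time_g_cross_iff[where t = "\<lambda>e. \<tau> e \<omega>", OF this b_nonneg n \<zeta>, of \<epsilon>] True show ?thesis
      by (auto simp: LD_plus_def)
  next
    case False
    then obtain e where e: "e \<in> ?E" "\<tau> e \<omega> < 0" by (auto simp: not_le)
    have "rescaled_time b (\<lambda>e. \<tau> e \<omega>) n unit_cube x y = Inf UNIV / real n"
      if "x \<in> unit_cube" "y \<in> unit_cube" for x y
      by (rule rescaled_time_negative[where t = "\<lambda>e. \<tau> e \<omega>" and e = e, OF e that])
    then show ?thesis using False unfolding LD_plus_def Q_def by auto
  qed
  have "local_event ?E ((?NN \<inter> ?D) \<union> (- ?NN \<inter> {t. Q}))"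
    by (intro local_event_Un local_event_Int local_event_Compl local_nonneg local_profile_event local_event_const)
  then show ev: "LD_plus M b \<tau> n (g_cross \<zeta>) \<epsilon> \<in> events"
  proof -
    assume loc: "local_event ?E ((?NN \<inter> ?D) \<union> (- ?NN \<inter> {t. Q}))"
    have "LD_plus M b \<tau> n (g_cross \<zeta>) \<epsilon> =
        {\<omega> \<in> space M. (\<lambda>e. \<tau> e \<omega>) \<in> (?NN \<inter> ?D) \<union> (- ?NN \<inter> {t. Q})}"
      using iff by blast
    then show ?thesis using local_event_measurable[OF loc edges_in_subset_lattice] by (simp only:)
  qed
  have D: "{\<omega> \<in> space M. (\<lambda>e. \<tau> e \<omega>) \<in> ?D} \<in> events"
    by (rule local_event_measurable[OF local_profile_event edges_in_subset_lattice])
  have same: "\<omega> \<in> LD_plus M b \<tau> n (g_cross \<zeta>) \<epsilon> \<longleftrightarrow> \<omega> \<in> {\<omega> \<in> space M. (\<lambda>e. \<tau> e \<omega>) \<in> ?D}"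
    if "weights_in_range \<omega>" for \<omega>
    using nonneg_weights[OF that, of n] unfolding iff by blast
  show "prob (LD_plus M b \<tau> n (g_cross \<zeta>) \<epsilon>) = profile_prob n \<zeta> \<epsilon>"
    by (rule antisym; rule prob_mono_in_range) (use ev D same in blast)+
qed

lemma rate_LD_plus:
  assumes "1 \<le> n" "\<And>i. 0 \<le> \<zeta> $ i"
  shows "decay_rate M (real n ^ CARD('d)) (LD_plus M b \<tau> n (g_cross \<zeta>) \<epsilon>) =
    decay_rate M (real n ^ CARD('d)) {\<omega> \<in> space M. (\<lambda>e. \<tau> e \<omega>) \<in> profile_event b (qbox 0 n) (linear_profile \<zeta>) (\<epsilon> * real n)}"
  unfolding decay_rate_def LD_plus_event(2)[OF assms] ..

definition J_plus :: "real ^ 'd \<Rightarrow> real \<Rightarrow> ennreal" where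
  "J_plus \<zeta> \<epsilon> = limsup (\<lambda>n. decay_rate M (real n ^ CARD('d)) (LD_plus M b \<tau> n (g_cross \<zeta>) \<epsilon>))"

text \<open>Coordinates vary by at most n in the box, so lowering a slope by
  \<open>\<epsilon>\<close> - \<open>\<delta>\<close> is paid by enlarging the additive error by as
  much, times n. Monotonicity in the error, monotonicity in the speeds and lower semicontinuity all
  come from this.\<close>

lemma profile_prob_mono:
  assumes "\<And>j. 0 \<le> \<zeta> $ j" "\<And>j. 0 \<le> \<xi> $ j" "\<And>j. \<zeta> $ j - (\<epsilon> - \<delta>) \<le> \<xi> $ j" "\<delta> \<le> \<epsilon>"
  shows "profile_prob n \<xi> \<delta> \<le> profile_prob n \<zeta> \<epsilon>"
proof (rule finite_measure_mono)
  show "{\<omega> \<in> space M. (\<lambda>e. \<tau> e \<omega>) \<in> profile_event b (qbox 0 n) (linear_profile \<zeta>) (\<epsilon> * real n)} \<in> events"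
    by (rule local_event_measurable[OF local_profile_event edges_in_subset_lattice])
  have "t \<in> profile_event b (qbox 0 n) (linear_profile \<zeta>) (\<epsilon> * real n)"
    if t: "t \<in> profile_event b (qbox 0 n) (linear_profile \<xi>) (\<delta> * real n)" for t
    unfolding profile_event_def
  proof (intro CollectI allI impI)
    fix j and p :: "(real ^ 'd) list" assume p: "path_in (qbox 0 n) p"
    let ?D = "last p $ j - hd p $ j"
    have "hd p \<in> qbox 0 n" "last p \<in> qbox 0 n" using p by (auto simp: path_in_def)
    then have "0 \<le> hd p $ j" "hd p $ j \<le> real n" "0 \<le> last p $ j" "last p $ j \<le> real n" by (auto simp: qbox_def)
    then have D: "\<bar>?D\<bar> \<le> real n" by linarith
    have lp: "\<bar>linear_profile z j (last p) - linear_profile z j (hd p)\<bar> = z $ j * \<bar>?D\<bar>" if "0 \<le> z $ j" for z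
      unfolding linear_profile_def right_diff_distrib[symmetric] abs_mult using that by simp
    have "(\<zeta> $ j - \<xi> $ j) * \<bar>?D\<bar> \<le> (\<epsilon> - \<delta>) * \<bar>?D\<bar>" using assms(3)[of j] by (intro mult_right_mono) auto
    also have "\<dots> \<le> (\<epsilon> - \<delta>) * real n" using D assms(4) by (intro mult_left_mono) auto
    finally have "\<zeta> $ j * \<bar>?D\<bar> - \<epsilon> * real n \<le> \<xi> $ j * \<bar>?D\<bar> - \<delta> * real n" by (simp add: algebra_simps)
    also have "\<dots> \<le> path_time b t p"
      using t p lp[OF assms(2)] unfolding profile_event_def by (metis (mono_tags, lifting) mem_Collect_eq)
    finally show "\<bar>linear_profile \<zeta> j (last p) - linear_profile \<zeta> j (hd p)\<bar> - \<epsilon> * real n \<le> path_time b t p"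
      unfolding lp[OF assms(1)] .
  qed
  then show "{\<omega> \<in> space M. (\<lambda>e. \<tau> e \<omega>) \<in> profile_event b (qbox 0 n) (linear_profile \<xi>) (\<delta> * real n)} \<subseteq>
    {\<omega> \<in> space M. (\<lambda>e. \<tau> e \<omega>) \<in> profile_event b (qbox 0 n) (linear_profile \<zeta>) (\<epsilon> * real n)}" by blast
qed

lemma J_plus_mono:
  assumes "\<And>j. 0 \<le> \<zeta> $ j" "\<And>j. 0 \<le> \<xi> $ j" "\<And>j. \<zeta> $ j - (\<epsilon> - \<delta>) \<le> \<xi> $ j" "\<delta> \<le> \<epsilon>"
  shows "J_plus \<zeta> \<epsilon> \<le> J_plus \<xi> \<delta>"
  unfolding J_plus_def
proof (rule Limsup_mono)
  show "\<forall>\<^sub>F n in sequentially. decay_rate M (real n ^ CARD('d)) (LD_plus M b \<tau> n (g_cross \<zeta>) \<epsilon>) \<le> decay_rate M (real n ^ CARD('d)) (LD_plus M b \<tau> n (g_cross \<xi>) \<delta>)"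
    using eventually_ge_at_top[of 1]
  proof eventually_elim
    case (elim n)
    show ?case unfolding rate_LD_plus[OF elim assms(1)] rate_LD_plus[OF elim assms(2)]
      by (rule rate_mono[OF profile_prob_mono[OF assms]])
  qed
qed

lemma I_cross_eq_SUP:
  assumes "\<And>j. 0 \<le> \<zeta> $ j"
  shows "I_cross M b \<tau> \<zeta> = (SUP \<epsilon>\<in>{0<..}. J_plus \<zeta> \<epsilon>)"
proof -
  have "(J_plus \<zeta> \<longlongrightarrow> (SUP \<epsilon>\<in>{0<..}. J_plus \<zeta> \<epsilon>)) (at_right 0)"
    by (rule antimono_tendsto_SUP_at_right) (use J_plus_mono[OF assms assms] in auto)
  then have "Lim (at_right 0) (J_plus \<zeta>) = (SUP \<epsilon>\<in>{0<..}. J_plus \<zeta> \<epsilon>)"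
    by (intro tendsto_Lim) auto
  moreover have "I_cross M b \<tau> \<zeta> = Lim (at_right 0) (J_plus \<zeta>)"
    unfolding I_cross_def I_plus_def J_plus_def[abs_def] ..
  ultimately show ?thesis by simp
qed

lemma J_plus_le_I_cross: "(\<And>j. 0 \<le> \<zeta> $ j) \<Longrightarrow> 0 < \<epsilon> \<Longrightarrow> J_plus \<zeta> \<epsilon> \<le> I_cross M b \<tau> \<zeta>"
  by (subst I_cross_eq_SUP) (auto intro: SUP_upper)

lemma I_cross_leI:
  assumes \<zeta>: "\<And>j. 0 \<le> \<zeta> $ j" and "0 \<le> x"
    and ev: "\<And>\<epsilon> \<beta>. 0 < \<epsilon> \<Longrightarrow> 0 < \<beta> \<Longrightarrow>
      \<forall>\<^sub>F n in sequentially. exp (- (x + \<beta>) * real n ^ CARD('d)) \<le> profile_prob n \<zeta> \<epsilon>"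
  shows "I_cross M b \<tau> \<zeta> \<le> ennreal x"
  unfolding I_cross_eq_SUP[OF \<zeta>]
proof (rule SUP_least)
  fix \<epsilon> :: real assume "\<epsilon> \<in> {0<..}"
  then have \<epsilon>: "0 < \<epsilon>" by simp
  show "J_plus \<zeta> \<epsilon> \<le> ennreal x"
  proof (rule ennreal_le_all_above[OF _ \<open>0 \<le> x\<close>])
    fix \<beta> :: real assume \<beta>: "0 < \<beta>"
    show "J_plus \<zeta> \<epsilon> \<le> ennreal (x + \<beta>)"
      unfolding J_plus_def
    proof (rule Limsup_bounded)
      show "\<forall>\<^sub>F n in sequentially. decay_rate M (real n ^ CARD('d)) (LD_plus M b \<tau> n (g_cross \<zeta>) \<epsilon>) \<le> ennreal (x + \<beta>)"
        using ev[OF \<epsilon> \<beta>] eventually_ge_at_top[of 1]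
        by eventually_elim (simp only: rate_LD_plus[OF _ \<zeta>] rate_le)
    qed
  qed
qed

lemma I_cross_le_of_crossing:
  assumes "\<And>j. 0 \<le> \<zeta> $ j" "\<And>j. \<zeta> $ j \<le> b" "0 \<le> x"
    and "\<exists>\<^sub>F n in sequentially. exp (- x * real n ^ CARD('d)) \<le> crossing_prob n \<zeta>"
  shows "I_cross M b \<tau> \<zeta> \<le> ennreal x"
  by (rule I_cross_leI[OF assms(1,3)]) (rule crossing_to_profile[OF assms(1,2) _ _ assms(3,4)])

text \<open>Contrapositive of the previous bound: infinitely many scales violating the estimate
  would already force a smaller rate. So the estimate holds for all large n, although
  \<open>I_plus\<close> is defined by a limsup.\<close>

lemma crossing_prob_less:
  assumes "\<And>j. 0 \<le> \<zeta> $ j" "\<And>j. \<zeta> $ j \<le> b" "0 \<le> x" "ennreal x < I_cross M b \<tau> \<zeta>"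
  shows "\<forall>\<^sub>F n in sequentially. crossing_prob n \<zeta> \<le> exp (- x * real n ^ CARD('d))"
proof (rule ccontr)
  assume "\<not> ?thesis"
  then have "\<exists>\<^sub>F n in sequentially. exp (- x * real n ^ CARD('d)) \<le> crossing_prob n \<zeta>"
    unfolding not_eventually by (rule frequently_elim1) simp
  from I_cross_le_of_crossing[OF assms(1,2,3) this] assms(4) show False by simp
qed

lemma profile_prob_ge:
  assumes "\<And>j. 0 \<le> \<zeta> $ j" "I_cross M b \<tau> \<zeta> < ennreal x" "0 < \<epsilon>"
  shows "\<forall>\<^sub>F n in sequentially. exp (- x * real n ^ CARD('d)) \<le> profile_prob n \<zeta> \<epsilon>"
proof -
  have "J_plus \<zeta> \<epsilon> < ennreal x" using J_plus_le_I_cross[OF assms(1,3)] assms(2) by (rule le_less_trans)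
  then have "\<forall>\<^sub>F n in sequentially. decay_rate M (real n ^ CARD('d)) (LD_plus M b \<tau> n (g_cross \<zeta>) \<epsilon>) < ennreal x"
    unfolding J_plus_def by (rule Limsup_lessD)
  then show ?thesis using eventually_ge_at_top[of 1]
    by eventually_elim (simp only: rate_LD_plus[OF _ assms(1)] rate_less_imp)
qed

lemma I_cross_mono:
  assumes "\<And>j. 0 \<le> \<zeta> $ j" "\<And>j. \<zeta> $ j \<le> \<xi> $ j"
  shows "I_cross M b \<tau> \<zeta> \<le> I_cross M b \<tau> \<xi>"
proof -
  have \<xi>: "\<And>j. 0 \<le> \<xi> $ j" using assms order_trans by blast
  show ?thesis unfolding I_cross_eq_SUP[OF assms(1)] I_cross_eq_SUP[OF \<xi>]
    by (rule SUP_mono') (use J_plus_mono[OF assms(1) \<xi>] assms(2) in simp)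
qed

text \<open>The rate is a supremum over the error, so one error already exceeds y; half of it is
  spent on lowering the speeds. The condition on \<open>\<xi>\<close> is one-sided, so the
  conclusion holds on a whole quadrant.\<close>

lemma I_cross_lsc:
  assumes \<zeta>: "\<And>j. 0 \<le> \<zeta> $ j" and "y < I_cross M b \<tau> \<zeta>"
  obtains \<epsilon> where "0 < \<epsilon>"
    "\<And>\<xi>. (\<And>j. 0 \<le> \<xi> $ j) \<Longrightarrow> (\<And>j. \<zeta> $ j - \<epsilon> \<le> \<xi> $ j) \<Longrightarrow> y < I_cross M b \<tau> \<xi>"
proof -
  obtain \<epsilon> where \<epsilon>: "0 < \<epsilon>" "y < J_plus \<zeta> \<epsilon>"
    using assms(2) unfolding I_cross_eq_SUP[OF \<zeta>] less_SUP_iff by auto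
  have "y < I_cross M b \<tau> \<xi>" if \<xi>: "\<And>j. 0 \<le> \<xi> $ j" "\<And>j. \<zeta> $ j - \<epsilon> / 2 \<le> \<xi> $ j" for \<xi>
  proof -
    have "J_plus \<zeta> \<epsilon> \<le> J_plus \<xi> (\<epsilon> / 2)" by (rule J_plus_mono[OF \<zeta> \<xi>(1)]) (use \<xi>(2) \<epsilon>(1) in simp_all)
    also have "\<dots> \<le> I_cross M b \<tau> \<xi>" by (rule J_plus_le_I_cross[OF \<xi>(1)]) (use \<epsilon>(1) in simp)
    finally show ?thesis using \<epsilon>(2) by simp
  qed
  then show thesis using that[of "\<epsilon> / 2"] \<epsilon>(1) by simp
qed

text \<open>Crossing speeds are almost surely at least a, so lower targets may be raised to a for
  free. This brings speeds such as \<open>\<zeta>\<close> - \<open>\<epsilon>\<close> back to at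
  least a, where the rate bounds and the refreshing argument apply.\<close>

lemma crossing_prob_clip:
  "crossing_prob n \<zeta> \<le> crossing_prob n (\<chi> i. max a (\<zeta> $ i))"
proof (rule prob_mono_in_range)
  fix \<omega> assume \<omega>: "\<omega> \<in> space M" "weights_in_range \<omega>" "\<omega> \<in> {\<omega> \<in> space M. (\<lambda>e. \<tau> e \<omega>) \<in> crossing_event b n \<zeta>}"
  let ?t = "\<lambda>e. \<tau> e \<omega>"
  have "(\<chi> i. max a (\<zeta> $ i)) $ i * real n \<le> path_time b ?t p" if p: "p \<in> crossing_paths n i" for i p
  proof -
    have "a * real n \<le> crossing_time b ?t n i"
      by (rule crossing_time_bounds(1)[OF bounded_config_weights[OF \<omega>(2)] a_nonneg less_imp_le[OF a_less_b]])
         (use \<omega>(2) in \<open>simp add: weights_in_range_def\<close>)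
    also have "\<dots> \<le> path_time b ?t p"
      by (rule crossing_time_le[OF bounded_config_weights[OF \<omega>(2)] b_nonneg p])
    finally have "a * real n \<le> path_time b ?t p" .
    moreover have "\<zeta> $ i * real n \<le> path_time b ?t p" using \<omega>(3) p by (auto simp: crossing_event_def)
    ultimately show ?thesis by (auto simp: max_def)
  qed
  then show "\<omega> \<in> {\<omega> \<in> space M. (\<lambda>e. \<tau> e \<omega>) \<in> crossing_event b n (\<chi> i. max a (\<zeta> $ i))}"
    using \<omega>(1) by (auto simp: crossing_event_def)
qed (rule local_event_measurable[OF local_crossing_event edges_in_subset_lattice])+

text \<open>Two layers only certify crossing speeds \<open>\<xi>\<close> -
  \<open>\<epsilon>\<close>, not a full profile. \<open>I_cross_le_of_crossing\<close> converts this
  into a bound on the rate, and lower semicontinuity removes \<open>\<epsilon>\<close>.\<close>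

lemma I_cross_separately_convex:
  assumes \<zeta>: "\<And>j. 0 \<le> \<zeta> $ j" "\<And>j. \<zeta> $ j \<le> b" "\<And>j. 0 \<le> \<zeta>' $ j" "\<And>j. \<zeta>' $ j \<le> b"
    and eq: "\<And>j. j \<noteq> i \<Longrightarrow> \<zeta>' $ j = \<zeta> $ j" and u: "0 < u" "u < 1"
    and \<xi>: "\<And>j. \<xi> $ j = u * \<zeta> $ j + (1 - u) * \<zeta>' $ j"
  shows "I_cross M b \<tau> \<xi> \<le> ennreal u * I_cross M b \<tau> \<zeta> + ennreal (1 - u) * I_cross M b \<tau> \<zeta>'"
proof (cases "I_cross M b \<tau> \<zeta> = \<infinity> \<or> I_cross M b \<tau> \<zeta>' = \<infinity>")
  case True
  then show ?thesis using u by (auto simp: ennreal_mult_top)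
next
  case False
  then obtain x1 x2 where x: "I_cross M b \<tau> \<zeta> = ennreal x1" "0 \<le> x1" "I_cross M b \<tau> \<zeta>' = ennreal x2" "0 \<le> x2"
    by (metis ennreal_cases infinity_ennreal_def)
  have \<xi>b: "0 \<le> \<xi> $ j" "\<xi> $ j \<le> b" for j
  proof -
    show "0 \<le> \<xi> $ j" unfolding \<xi> using \<zeta> u by simp
    have "u * \<zeta> $ j + (1 - u) * \<zeta>' $ j \<le> u * b + (1 - u) * b" using \<zeta> u by (intro add_mono mult_left_mono) auto
    then show "\<xi> $ j \<le> b" unfolding \<xi> by (simp add: algebra_simps)
  qed
  have "I_cross M b \<tau> \<xi> \<le> ennreal (u * x1 + (1 - u) * x2)"
  proof (rule ennreal_le_all_above)
    show "0 \<le> u * x1 + (1 - u) * x2" using x u by simp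
    fix \<beta> :: real assume \<beta>: "0 < \<beta>"
    define x' where "x' = u * (x1 + \<beta> / 2) + (1 - u) * (x2 + \<beta> / 2) + \<beta> / 2"
    have x': "x' = u * x1 + (1 - u) * x2 + \<beta>" by (simp add: x'_def field_simps)
    have x'0: "0 \<le> x'" using x u \<beta> by (simp add: x')
    have less: "I_cross M b \<tau> \<zeta> < ennreal (x1 + \<beta> / 2)" "I_cross M b \<tau> \<zeta>' < ennreal (x2 + \<beta> / 2)"
      using x \<beta> by (simp_all add: ennreal_less_iff)
    show "I_cross M b \<tau> \<xi> \<le> ennreal (u * x1 + (1 - u) * x2 + \<beta>)"
    proof (rule ccontr)
      assume "\<not> ?thesis"
      then have "ennreal x' < I_cross M b \<tau> \<xi>" by (simp add: x' not_le)
      then obtain \<epsilon> where \<epsilon>: "0 < \<epsilon>"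
        "\<And>z. (\<And>j. 0 \<le> z $ j) \<Longrightarrow> (\<And>j. \<xi> $ j - \<epsilon> \<le> z $ j) \<Longrightarrow> ennreal x' < I_cross M b \<tau> z"
        using I_cross_lsc[OF \<xi>b(1)] by metis
      define z where "z = (\<chi> j. max a ((\<chi> j. \<xi> $ j - \<epsilon>) $ j))"
      have "\<forall>\<^sub>F n in sequentially. exp (- x' * real n ^ CARD('d)) \<le> crossing_prob n (\<chi> j. \<xi> $ j - \<epsilon>)"
        unfolding x'_def
        by (rule layered_crossing[OF \<zeta> eq less_imp_le[OF u(1)] less_imp_le[OF u(2)], where \<epsilon> = \<epsilon>])
           (use \<xi> \<epsilon>(1) \<beta> x profile_prob_ge[OF \<zeta>(1) less(1)] profile_prob_ge[OF \<zeta>(3) less(2)] in auto)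
      then have ev: "\<forall>\<^sub>F n in sequentially. exp (- x' * real n ^ CARD('d)) \<le> crossing_prob n z"
        by eventually_elim (use crossing_prob_clip order_trans in \<open>unfold z_def, blast\<close>)
      have z: "0 \<le> z $ j" "\<xi> $ j - \<epsilon> \<le> z $ j" "z $ j \<le> max a b" for j
        using a_nonneg \<xi>b(2)[of j] \<epsilon>(1) by (auto simp: z_def)
      have "I_cross M b \<tau> z \<le> ennreal x'"
        by (rule I_cross_le_of_crossing[OF z(1) _ x'0])
           (use z(3) a_less_b eventually_frequently[OF sequentially_bot ev] in auto)
      then show False using \<epsilon>(2)[OF z(1,2)] by simp
    qed
  qed
  then show ?thesis using x u by (simp add: ennreal_mult' ennreal_plus)
qed

lemma I_cross_bounded:
  assumes c: "0 \<le> c" "c \<le> b" "0 < measure \<nu> {c..}"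
  obtains A where "0 \<le> A" "\<And>\<zeta>. (\<And>j. 0 \<le> \<zeta> $ j) \<Longrightarrow> (\<And>j. \<zeta> $ j \<le> c) \<Longrightarrow> I_cross M b \<tau> \<zeta> \<le> ennreal A"
proof -
  obtain A where A: "0 \<le> A" "\<And>n. 1 \<le> n \<Longrightarrow> exp (- A * real n ^ CARD('d)) \<le> profile_prob n (\<chi> j. c) 0"
    by (rule heavy_weights_bound[of "\<chi> j. c" c 0]) (use c in auto)
  have "I_cross M b \<tau> (\<chi> j. c) \<le> ennreal A"
  proof (rule I_cross_leI[OF _ A(1)])
    fix \<epsilon> \<beta> :: real assume \<epsilon>: "0 < \<epsilon>" "0 < \<beta>"
    show "\<forall>\<^sub>F n in sequentially. exp (- (A + \<beta>) * real n ^ CARD('d)) \<le> profile_prob n (\<chi> j. c) \<epsilon>"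
      using eventually_ge_at_top[of 1]
    proof eventually_elim
      case (elim n)
      have "exp (- (A + \<beta>) * real n ^ CARD('d)) \<le> exp (- A * real n ^ CARD('d))"
        unfolding exp_le_cancel_iff using \<epsilon>(2) by (intro mult_right_mono) auto
      also have "\<dots> \<le> profile_prob n (\<chi> j. c) 0" by (rule A(2)[OF elim])
      also have "\<dots> \<le> profile_prob n (\<chi> j. c) \<epsilon>" by (rule profile_prob_mono) (use c \<epsilon> in auto)
      finally show ?case .
    qed
  qed (use c in simp)
  moreover have "I_cross M b \<tau> \<zeta> \<le> I_cross M b \<tau> (\<chi> j. c)" if "\<And>j. 0 \<le> \<zeta> $ j" "\<And>j. \<zeta> $ j \<le> c" for \<zeta>
    by (rule I_cross_mono) (use that in auto)
  ultimately show thesis using that[OF A(1)] order_trans by blast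
qed

text \<open>A finite value x would give profiles with probability at least exp (-(x + 1) n^d). These
  force a crossing speed of at least b - \<open>\<epsilon>\<close>, whose probability is at most exp
  (-(x + 2) n^d) for small \<open>\<epsilon>\<close>.\<close>

lemma I_cross_infinite:
  assumes nb: "measure \<nu> {b} = 0" and \<zeta>: "\<And>j. 0 \<le> \<zeta> $ j" "\<zeta> $ i = b"
  shows "I_cross M b \<tau> \<zeta> = \<infinity>"
proof (rule ccontr)
  assume "I_cross M b \<tau> \<zeta> \<noteq> \<infinity>"
  then obtain x where x: "I_cross M b \<tau> \<zeta> = ennreal x" "0 \<le> x" by (metis ennreal_cases infinity_ennreal_def)
  obtain \<epsilon> where \<epsilon>: "0 < \<epsilon>" "\<And>n \<zeta> i. b - \<epsilon> \<le> \<zeta> $ i \<Longrightarrow> crossing_prob n \<zeta> \<le> exp (- (x + 2) * real n ^ CARD('d))"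
    by (rule near_maximal_crossing[OF nb, of "x + 2"]) (use x in auto)
  have "\<forall>\<^sub>F n in sequentially. exp (- (x + 1) * real n ^ CARD('d)) \<le> profile_prob n \<zeta> \<epsilon>"
    by (rule profile_prob_ge[OF \<zeta>(1) _ \<epsilon>(1)]) (use x in \<open>simp add: ennreal_less_iff\<close>)
  then have "\<forall>\<^sub>F n in sequentially. exp (- (x + 1) * real n ^ CARD('d)) \<le> profile_prob n \<zeta> \<epsilon> \<and> 1 \<le> n"
    using eventually_ge_at_top[of 1] by eventually_elim simp
  then obtain n where n: "exp (- (x + 1) * real n ^ CARD('d)) \<le> profile_prob n \<zeta> \<epsilon>" "1 \<le> n"
    using eventually_happens'[OF sequentially_bot] by blast
  note n(1)
  also have "profile_prob n \<zeta> \<epsilon> \<le> crossing_prob n (\<chi> j. \<zeta> $ j - \<epsilon>)"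
    by (rule profile_le_crossing) (use \<zeta> in auto)
  also have "\<dots> \<le> exp (- (x + 2) * real n ^ CARD('d))"
    by (rule \<epsilon>(2)[of _ i]) (simp add: \<zeta>(2))
  finally have "- (x + 1) * real n ^ CARD('d) \<le> - (x + 2) * real n ^ CARD('d)" by (simp only: exp_le_cancel_iff)
  moreover have "- (x + 2) * real n ^ CARD('d) = - (x + 1) * real n ^ CARD('d) - real n ^ CARD('d)"
    by (simp add: algebra_simps)
  moreover have "0 < real n ^ CARD('d)" using n(2) by simp
  ultimately show False by linarith
qed

end

section \<open>Continuity\<close>

lemma measurable_in_box:
  fixes X :: "'w \<Rightarrow> real ^ 'd::finite"
  assumes X: "\<And>i c. {\<omega> \<in> space M. c \<le> X \<omega> $ i} \<in> sets M"
    and A: "A \<in> borel_sets_of (top_of_set (box_ab a b))"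
  shows "{\<omega> \<in> space M. X \<omega> \<in> A} \<in> sets M"
proof -
  have "X \<in> borel_measurable M"
  proof (rule borel_measurable_euclidean_space[THEN iffD2], rule ballI)
    fix v :: "real ^ 'd" assume "v \<in> Basis"
    then obtain i where v: "v = axis i 1" by (auto simp: Basis_vec_def)
    have "(\<lambda>\<omega>. X \<omega> $ i) \<in> borel_measurable M" by (rule borel_measurable_iff_ge[THEN iffD2]) (use X in blast)
    then show "(\<lambda>\<omega>. X \<omega> \<bullet> v) \<in> borel_measurable M" by (simp add: v inner_axis)
  qed
  moreover have "A \<in> sets borel"
  proof -
    have box: "(box_ab a b :: (real ^ 'd) set) \<in> sets borel" unfolding box_ab_eq_cbox by simp
    have "{U. openin (top_of_set (box_ab a b :: (real ^ 'd) set)) U} \<subseteq> sets borel"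
      using box by (auto simp: openin_open)
    then have "sigma_sets (box_ab a b) {U. openin (top_of_set (box_ab a b :: (real ^ 'd) set)) U} \<subseteq> sets borel"
      by (rule sets.sigma_sets_subset'[OF _ box])
    then show ?thesis using A by (auto simp: borel_sets_of_def)
  qed
  ultimately have "X -` A \<inter> space M \<in> sets M" by (rule measurable_sets)
  then show ?thesis by (simp add: vimage_def Int_def conj_commute)
qed

context passage_percolation
begin

lemma box_ab_nonneg: "\<zeta> \<in> box_ab a b \<Longrightarrow> 0 \<le> \<zeta> $ j" "\<zeta> \<in> box_ab a b \<Longrightarrow> \<zeta> $ j \<le> b"
  using a_nonneg by (auto simp: box_ab_def intro: order_trans)

lemma compact_box_ab: "compact (box_ab a b :: (real ^ 'd) set)"
  unfolding box_ab_eq_cbox by (rule compact_cbox)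

text \<open>Measurability is required on all of \<open>M\<close>, hence the case of a negative
  weight in the box, where the crossing time is a constant default value.\<close>

lemma T_cross_measurable:
  assumes "1 \<le> n"
  shows "{\<omega> \<in> space M. c \<le> T_cross b (\<lambda>e. \<tau> e \<omega>) n $ i} \<in> events"
proof -
  let ?E = "edges_in (qbox 0 n) :: (int ^ 'd) set set"
  let ?NN = "{t. \<forall>e\<in>?E. 0 \<le> t e}"
  let ?D = "{t. \<forall>p\<in>crossing_paths n i. c * real n \<le> path_time b t p}"
  let ?W = "(?NN \<inter> ?D) \<union> (- ?NN \<inter> {t. c * real n \<le> Inf UNIV})"
  have iff: "c \<le> T_cross b t n $ i \<longleftrightarrow> t \<in> ?W" for t :: "(int ^ 'd) set \<Rightarrow> real"
  proof -
    have T: "c \<le> T_cross b t n $ i \<longleftrightarrow> c * real n \<le> crossing_time b t n i"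
      using assms by (simp add: T_cross_nth[OF assms b_nonneg] pos_le_divide_eq)
    show ?thesis
    proof (cases "t \<in> ?NN")
      case True
      then have "\<forall>e\<in>?E. 0 \<le> t e" by blast
      then show ?thesis unfolding T crossing_time_ge_iff[where t = t, OF \<open>\<forall>e\<in>?E. 0 \<le> t e\<close> b_nonneg]
        using True by blast
    next
      case False
      then obtain e where e: "e \<in> ?E" "t e < 0" by (auto simp: not_le)
      show ?thesis unfolding T crossing_time_negative[where t = t and e = e, OF e] using False by blast
    qed
  qed
  have "local_event ?E ?W"
    by (intro local_event_Un local_event_Int local_event_Compl local_nonneg local_crossing_bound local_event_const)
  from local_event_measurable[OF this edges_in_subset_lattice] show ?thesis unfolding iff .
qed

lemma T_cross_ge_iff:
  assumes "1 \<le> n" "weights_in_range \<omega>"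
  shows "(\<forall>i. \<zeta> $ i \<le> T_cross b (\<lambda>e. \<tau> e \<omega>) n $ i) \<longleftrightarrow> (\<lambda>e. \<tau> e \<omega>) \<in> crossing_event b n \<zeta>"
proof -
  have "\<zeta> $ i \<le> T_cross b (\<lambda>e. \<tau> e \<omega>) n $ i \<longleftrightarrow> \<zeta> $ i * real n \<le> crossing_time b (\<lambda>e. \<tau> e \<omega>) n i" for i
    using assms(1) by (simp add: T_cross_nth[OF assms(1) b_nonneg] pos_le_divide_eq)
  then show ?thesis
    unfolding crossing_event_def
    using crossing_time_ge_iff[where t = "\<lambda>e. \<tau> e \<omega>", OF nonneg_weights[OF assms(2)] b_nonneg] by auto
qed

lemma T_cross_in_box:
  assumes "1 \<le> n" "weights_in_range \<omega>"
  shows "T_cross b (\<lambda>e. \<tau> e \<omega>) n \<in> box_ab a b"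
proof -
  have "a * real n \<le> crossing_time b (\<lambda>e. \<tau> e \<omega>) n i \<and> crossing_time b (\<lambda>e. \<tau> e \<omega>) n i \<le> b * real n" for i
    using crossing_time_bounds[OF bounded_config_weights[OF assms(2)] a_nonneg less_imp_le[OF a_less_b]]
      assms(2) by (simp add: weights_in_range_def)
  then show ?thesis
    using assms(1) by (simp add: box_ab_def T_cross_nth[OF assms(1) b_nonneg] pos_le_divide_eq pos_divide_le_eq)
qed

lemma prob_T_cross_ge:
  assumes "1 \<le> n"
  shows "prob {\<omega> \<in> space M. \<forall>i. \<zeta> $ i \<le> rescaled_set_time b (\<lambda>e. \<tau> e \<omega>) n unit_cube (face0 i) (face1 i)}
    = crossing_prob n \<zeta>"
proof -
  have eq: "{\<omega> \<in> space M. \<forall>i. \<zeta> $ i \<le> rescaled_set_time b (\<lambda>e. \<tau> e \<omega>) n unit_cube (face0 i) (face1 i)} =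
      {\<omega> \<in> space M. \<forall>i. \<zeta> $ i \<le> T_cross b (\<lambda>e. \<tau> e \<omega>) n $ i}"
    by (simp add: T_cross_def)
  have "{\<omega> \<in> space M. \<forall>i\<in>UNIV. \<zeta> $ i \<le> T_cross b (\<lambda>e. \<tau> e \<omega>) n $ i} \<in> events"
    by (rule sets.sets_Collect_finite_All) (use T_cross_measurable[OF assms] in auto)
  then have 1: "{\<omega> \<in> space M. \<forall>i. \<zeta> $ i \<le> T_cross b (\<lambda>e. \<tau> e \<omega>) n $ i} \<in> events" by simp
  have 2: "{\<omega> \<in> space M. (\<lambda>e. \<tau> e \<omega>) \<in> crossing_event b n \<zeta>} \<in> events"
    by (rule local_event_measurable[OF local_crossing_event edges_in_subset_lattice])
  show ?thesis unfolding eq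
    by (rule antisym; rule prob_mono_in_range) (use 1 2 T_cross_ge_iff[OF assms] in blast)+
qed

text \<open>The coordinates are raised one at a time. The target \<open>\<xi> $ i\<close> lies
  between \<open>\<zeta> $ i\<close> and c at relative position \<open>\<theta> i\<close>, and by
  separate convexity the rate rises by at most \<open>\<theta> i\<close> times the bound
  \<open>A\<close> valid up to c. Separate convexity thus gives a quantitative upper bound.\<close>

lemma I_cross_raise:
  assumes c: "0 \<le> c" "c \<le> b"
    and A: "0 \<le> A" "\<And>\<zeta>. (\<And>j. 0 \<le> \<zeta> $ j) \<Longrightarrow> (\<And>j. \<zeta> $ j \<le> c) \<Longrightarrow> I_cross M b \<tau> \<zeta> \<le> ennreal A"
    and \<zeta>: "\<And>j. 0 \<le> \<zeta> $ j" "\<And>j. \<zeta> $ j \<le> \<xi> $ j" "\<And>j. \<xi> $ j \<le> c"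
  shows "I_cross M b \<tau> \<xi> \<le> I_cross M b \<tau> \<zeta> + ennreal (\<Sum>j\<in>UNIV. (\<xi> $ j - \<zeta> $ j) / (c - \<zeta> $ j) * A)"
proof -
  define z where "z S = (\<chi> j. if j \<in> S then \<xi> $ j else \<zeta> $ j)" for S
  define \<theta> where "\<theta> j = (\<xi> $ j - \<zeta> $ j) / (c - \<zeta> $ j)" for j
  have \<zeta>c: "\<zeta> $ j \<le> c" "0 \<le> \<xi> $ j" for j using \<zeta>(1,2,3)[of j] by linarith+
  have \<theta>: "0 \<le> \<theta> j" "\<theta> j \<le> 1" for j
    using \<zeta>(2,3)[of j] \<zeta>c[of j] by (auto simp: \<theta>_def divide_le_eq_1)
  have "I_cross M b \<tau> (z S) \<le> I_cross M b \<tau> \<zeta> + ennreal (\<Sum>j\<in>S. \<theta> j * A)" if "finite S" for S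
    using that
  proof (induction S rule: finite_induct)
    case empty
    then show ?case by (simp add: z_def)
  next
    case (insert i S)
    define y where "y = (\<chi> j. if j = i then c else z S $ j)"
    have zb: "0 \<le> z S $ j" "z S $ j \<le> c" for S j using \<zeta> \<zeta>c by (auto simp: z_def)
    have yb: "0 \<le> y $ j" "y $ j \<le> c" for j using zb c by (auto simp: y_def)
    have zi: "z S $ i = \<zeta> $ i" using insert.hyps by (simp add: z_def)
    have step: "I_cross M b \<tau> (z (insert i S)) \<le> I_cross M b \<tau> (z S) + ennreal (\<theta> i * A)"
    \<comment> \<open>The value 0 includes \<open>\<zeta> $ i = c\<close>, where the quotient is 0
      by convention. Excluding both ends leaves a weight strictly between 0 and 1, as separate
      convexity requires.\<close>
    proof (cases "\<theta> i = 0 \<or> \<theta> i = 1")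
      case True
      then show ?thesis
      proof
        assume "\<theta> i = 0"
        then have "\<xi> $ i = \<zeta> $ i" using \<zeta>(2,3)[of i] by (auto simp: \<theta>_def)
        then have "z (insert i S) = z S" by (auto simp: z_def vec_eq_iff)
        then show ?thesis by simp
      next
        assume "\<theta> i = 1"
        then have "I_cross M b \<tau> (z (insert i S)) \<le> ennreal (\<theta> i * A)" using A(2)[OF zb] by simp
        then show ?thesis by (simp add: add_increasing)
      qed
    next
      case False
      then have u: "0 < 1 - \<theta> i" "1 - \<theta> i < 1" using \<theta>[of i] by auto
      have "\<zeta> $ i \<noteq> c" using False by (auto simp: \<theta>_def)
      then have \<theta>i: "\<theta> i * (c - \<zeta> $ i) = \<xi> $ i - \<zeta> $ i" by (simp add: \<theta>_def)
      have "I_cross M b \<tau> (z (insert i S)) \<le>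
          ennreal (1 - \<theta> i) * I_cross M b \<tau> (z S) + ennreal (1 - (1 - \<theta> i)) * I_cross M b \<tau> y"
      proof (rule I_cross_separately_convex[OF zb(1) _ yb(1) _ _ u])
        show "z S $ j \<le> b" "y $ j \<le> b" for j using zb(2)[of S j] yb(2)[of j] c by linarith+
        show "y $ j = z S $ j" if "j \<noteq> i" for j using that by (simp add: y_def)
        show "z (insert i S) $ j = (1 - \<theta> i) * z S $ j + (1 - (1 - \<theta> i)) * y $ j" for j
        proof (cases "j = i")
          case True
          have "z (insert i S) $ i = \<xi> $ i" by (simp add: z_def)
          also have "\<dots> = (1 - \<theta> i) * \<zeta> $ i + \<theta> i * c" using \<theta>i by (simp add: algebra_simps)
          finally show ?thesis using True zi by (simp add: y_def)
        next
          case False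
          then show ?thesis by (simp add: z_def y_def algebra_simps)
        qed
      qed
      also have "\<dots> \<le> 1 * I_cross M b \<tau> (z S) + ennreal (\<theta> i) * ennreal A"
        using u \<theta> A(2)[OF yb] by (intro add_mono mult_mono) auto
      finally show ?thesis using \<theta> A(1) by (simp add: ennreal_mult)
    qed
    also have "\<dots> \<le> (I_cross M b \<tau> \<zeta> + ennreal (\<Sum>j\<in>S. \<theta> j * A)) + ennreal (\<theta> i * A)"
      by (rule add_right_mono[OF insert.IH])
    also have "\<dots> = I_cross M b \<tau> \<zeta> + ennreal (\<Sum>j\<in>insert i S. \<theta> j * A)"
    proof -
      have "0 \<le> (\<Sum>j\<in>S. \<theta> j * A)" using \<theta> A(1) by (intro sum_nonneg) simp
      then show ?thesis using insert.hyps \<theta>(1)[of i] A(1)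
        by (simp add: ennreal_plus add.assoc add.commute[of "\<theta> i * A"])
    qed
    finally show ?case .
  qed
  from this[of UNIV] show ?thesis by (simp add: z_def \<theta>_def)
qed

text \<open>By monotonicity it is enough to control the single point \<open>\<rho>\<close>, obtained
  by raising all coordinates by \<open>\<eta>\<close>, cut off at c.\<close>

lemma I_cross_usc:
  assumes \<zeta>: "\<And>j. 0 \<le> \<zeta> $ j" "\<And>j. \<zeta> $ j \<le> b" and y: "I_cross M b \<tau> \<zeta> < y"
  obtains \<eta> where "0 < \<eta>" "\<And>\<xi>. (\<And>j. 0 \<le> \<xi> $ j) \<Longrightarrow> (\<And>j. \<xi> $ j \<le> b) \<Longrightarrow>
    (\<And>j. \<xi> $ j \<le> \<zeta> $ j + \<eta>) \<Longrightarrow> I_cross M b \<tau> \<xi> < y"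
proof -
  interpret nu: prob_space \<nu> by (rule nu_prob)
  \<comment> \<open>A level above all coordinates of \<open>\<zeta>\<close> up to which the rate is
    bounded. With an atom at b this is b itself. Otherwise finiteness of the rate at
    \<open>\<zeta>\<close> keeps all coordinates strictly below b, and the midpoint between their
    maximum and b works.\<close>
  obtain c where c: "0 \<le> c" "c \<le> b" "0 < measure \<nu> {c..}" "\<And>j. \<zeta> $ j \<le> c" "c = b \<or> (\<forall>j. \<zeta> $ j < c)"
  proof (cases "measure \<nu> {b} = 0")
    case False
    then have "0 < measure \<nu> {b}" by (simp add: zero_less_measure_iff)
    also have "\<dots> \<le> measure \<nu> {b..}" using nu_sets by (intro nu.finite_measure_mono) auto
    finally show ?thesis using that[of b] b_nonneg \<zeta>(2) by simp
  next
    case True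
    have lt: "\<zeta> $ j < b" for j
      using I_cross_infinite[OF True \<zeta>(1), of j] y \<zeta>(2)[of j] by (cases "\<zeta> $ j = b") auto
    define m where "m = (MAX j. \<zeta> $ j)"
    have m: "m < b" "\<And>j. \<zeta> $ j \<le> m"
      unfolding m_def using lt by (subst Max_less_iff, auto)
    have "0 \<le> m" using \<zeta>(1) m(2) order_trans by blast
    moreover have "\<zeta> $ j < (m + b) / 2" for j using m(2)[of j] m(1) unfolding less_divide_eq_numeral1 by linarith
    ultimately show ?thesis
      using m(1) by (intro that[of "(m + b) / 2"] nu_upper_pos) (auto intro: less_imp_le)
  qed
  obtain A where A: "0 \<le> A" "\<And>\<zeta>. (\<And>j. 0 \<le> \<zeta> $ j) \<Longrightarrow> (\<And>j. \<zeta> $ j \<le> c) \<Longrightarrow> I_cross M b \<tau> \<zeta> \<le> ennreal A"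
    by (rule I_cross_bounded[OF c(1-3)]) blast
  obtain x where x: "I_cross M b \<tau> \<zeta> = ennreal x" "0 \<le> x"
    using y by (cases "I_cross M b \<tau> \<zeta>") auto
  obtain x' where x': "x < x'" "ennreal x' < y" using ennreal_real_between[of x y] y x by metis
  have "\<exists>\<gamma>>0. \<forall>j. \<zeta> $ j < c \<longrightarrow> \<gamma> \<le> c - \<zeta> $ j"
  proof -
    let ?G = "insert 1 ((\<lambda>j. c - \<zeta> $ j) ` {j. \<zeta> $ j < c})"
    have f: "finite ?G" by simp
    have "0 < Min ?G" by (subst Min_gr_iff[OF f]) auto
    moreover have "Min ?G \<le> c - \<zeta> $ j" if "\<zeta> $ j < c" for j by (rule Min_le[OF f]) (use that in auto)
    ultimately show ?thesis by blast
  qed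
  then obtain \<gamma> where \<gamma>: "0 < \<gamma>" "\<And>j. \<zeta> $ j < c \<Longrightarrow> \<gamma> \<le> c - \<zeta> $ j" by blast
  \<comment> \<open>Each of the d coordinates then contributes at most (x' - x) / (2 d), where
    \<open>\<gamma>\<close> bounds the positive gaps c - \<open>\<zeta> $ j\<close> from
    below.\<close>
  define \<eta> where "\<eta> = min \<gamma> (\<gamma> * (x' - x) / (2 * real CARD('d) * (A + 1)))"
  have \<eta>: "0 < \<eta>" "\<eta> \<le> \<gamma>" using \<gamma>(1) x'(1) A(1) by (auto simp: \<eta>_def)
  define \<rho> where "\<rho> = (\<chi> j. min c (\<zeta> $ j + \<eta>))"
  have \<rho>: "\<zeta> $ j \<le> \<rho> $ j" "\<rho> $ j \<le> c" for j using c(4) \<eta> by (auto simp: \<rho>_def)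
  have "(\<Sum>j\<in>UNIV. (\<rho> $ j - \<zeta> $ j) / (c - \<zeta> $ j) * A) \<le> (\<Sum>j\<in>(UNIV :: 'd set). (x' - x) / (2 * real CARD('d)))"
  proof (rule sum_mono)
    fix j
    show "(\<rho> $ j - \<zeta> $ j) / (c - \<zeta> $ j) * A \<le> (x' - x) / (2 * real CARD('d))"
    proof (cases "\<zeta> $ j < c")
      case True
      have "(\<rho> $ j - \<zeta> $ j) / (c - \<zeta> $ j) \<le> \<eta> / \<gamma>"
        using \<gamma>(2)[OF True] \<gamma>(1) \<eta> \<rho>(1)[of j] by (intro frac_le) (auto simp: \<rho>_def)
      then have "(\<rho> $ j - \<zeta> $ j) / (c - \<zeta> $ j) * A \<le> \<eta> / \<gamma> * (A + 1)"
        using A(1) \<eta>(1) \<gamma>(1) by (intro mult_mono) auto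
      also have "\<dots> \<le> (\<gamma> * (x' - x) / (2 * real CARD('d) * (A + 1))) / \<gamma> * (A + 1)"
        using A(1) \<gamma>(1) by (intro mult_right_mono divide_right_mono) (auto simp: \<eta>_def)
      also have "\<dots> = (x' - x) / (2 * real CARD('d))"
      proof -
        have "(r * q / (s * t)) / r * t = q / s" if "r \<noteq> 0" "t \<noteq> 0" for r q s t :: real using that by simp
        then show ?thesis using A(1) \<gamma>(1) by simp
      qed
      finally show ?thesis .
    next
      case False
      then have "\<zeta> $ j = c" using c(4)[of j] by simp
      then show ?thesis using x'(1) by simp
    qed
  qed
  also have "\<dots> = (x' - x) / 2" by simp
  finally have sum: "(\<Sum>j\<in>UNIV. (\<rho> $ j - \<zeta> $ j) / (c - \<zeta> $ j) * A) \<le> (x' - x) / 2" .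
  have "I_cross M b \<tau> \<rho> \<le> I_cross M b \<tau> \<zeta> + ennreal (\<Sum>j\<in>UNIV. (\<rho> $ j - \<zeta> $ j) / (c - \<zeta> $ j) * A)"
    by (rule I_cross_raise[OF c(1,2) A \<zeta>(1) \<rho>])
  also have "\<dots> \<le> ennreal x + ennreal ((x' - x) / 2)" unfolding x(1) by (intro add_left_mono ennreal_leI sum)
  also have "\<dots> = ennreal (x + (x' - x) / 2)" using x(2) x'(1) by (simp add: ennreal_plus)
  also have "\<dots> \<le> ennreal x'" using x'(1) by (intro ennreal_leI) (simp add: field_simps)
  finally have I\<rho>: "I_cross M b \<tau> \<rho> < y" using x'(2) by (rule le_less_trans)
  have "I_cross M b \<tau> \<xi> < y" if "\<And>j. 0 \<le> \<xi> $ j" "\<And>j. \<xi> $ j \<le> b" "\<And>j. \<xi> $ j \<le> \<zeta> $ j + \<eta>" for \<xi>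
  proof -
    have "\<xi> $ j \<le> \<rho> $ j" for j
    proof -
      have "\<xi> $ j \<le> c"
        using c(5)
      proof
        assume "\<forall>j. \<zeta> $ j < c"
        then show ?thesis using that(3)[of j] \<gamma>(2)[of j] \<eta>(2) by fastforce
      qed (use that(2)[of j] in simp)
      then show ?thesis using that(3)[of j] by (simp add: \<rho>_def)
    qed
    then have "I_cross M b \<tau> \<xi> \<le> I_cross M b \<tau> \<rho>" using that(1) by (intro I_cross_mono)
    then show ?thesis using I\<rho> by (rule le_less_trans)
  qed
  then show thesis using that \<eta>(1) by blast
qed

lemma continuous_on_I_cross: "continuous_on (box_ab a b) (I_cross M b \<tau>)"
  unfolding continuous_on_def
proof
  fix \<zeta> :: "real ^ 'd" assume z: "\<zeta> \<in> box_ab a b"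
  note \<zeta> = box_ab_nonneg[OF z]
  have near: "eventually (\<lambda>\<xi>. (\<forall>j. \<zeta> $ j - \<epsilon> \<le> \<xi> $ j \<and> \<xi> $ j \<le> \<zeta> $ j + \<epsilon>) \<and> \<xi> \<in> box_ab a b) (at \<zeta> within box_ab a b)"
    if "0 < \<epsilon>" for \<epsilon>
    unfolding eventually_at
  proof (intro exI[of _ \<epsilon>] conjI ballI impI allI that)
    fix \<xi> j assume "\<xi> \<noteq> \<zeta> \<and> dist \<xi> \<zeta> < \<epsilon>"
    then have "\<bar>(\<xi> - \<zeta>) $ j\<bar> < \<epsilon>" using component_le_norm_cart[of "\<xi> - \<zeta>" j] by (simp add: dist_norm)
    then show "\<zeta> $ j - \<epsilon> \<le> \<xi> $ j" "\<xi> $ j \<le> \<zeta> $ j + \<epsilon>" by auto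
  qed
  show "(I_cross M b \<tau> \<longlongrightarrow> I_cross M b \<tau> \<zeta>) (at \<zeta> within box_ab a b)"
  proof (rule order_tendstoI)
    fix y assume "y < I_cross M b \<tau> \<zeta>"
    then obtain \<epsilon> where \<epsilon>: "0 < \<epsilon>"
      "\<And>\<xi>. (\<And>j. 0 \<le> \<xi> $ j) \<Longrightarrow> (\<And>j. \<zeta> $ j - \<epsilon> \<le> \<xi> $ j) \<Longrightarrow> y < I_cross M b \<tau> \<xi>"
      using I_cross_lsc[OF \<zeta>(1)] by metis
    show "eventually (\<lambda>\<xi>. y < I_cross M b \<tau> \<xi>) (at \<zeta> within box_ab a b)"
      using near[OF \<epsilon>(1)] by eventually_elim (use \<epsilon>(2) box_ab_nonneg(1) in blast)
  next
    fix y assume "I_cross M b \<tau> \<zeta> < y"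
    then obtain \<eta> where \<eta>: "0 < \<eta>" "\<And>\<xi>. (\<And>j. 0 \<le> \<xi> $ j) \<Longrightarrow> (\<And>j. \<xi> $ j \<le> b) \<Longrightarrow>
      (\<And>j. \<xi> $ j \<le> \<zeta> $ j + \<eta>) \<Longrightarrow> I_cross M b \<tau> \<xi> < y"
      using I_cross_usc[OF \<zeta>] by metis
    show "eventually (\<lambda>\<xi>. I_cross M b \<tau> \<xi> < y) (at \<zeta> within box_ab a b)"
      using near[OF \<eta>(1)] by eventually_elim (use \<eta>(2) box_ab_nonneg in blast)
  qed
qed

lemma good_rate_function_I_cross: "good_rate_function (top_of_set (box_ab a b)) (I_cross M b \<tau>)"
  unfolding good_rate_function_def
proof (intro allI impI)
  fix r :: real assume "0 \<le> r"
  have "closed (box_ab a b \<inter> I_cross M b \<tau> -` {..ennreal r})"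
    by (rule continuous_closed_preimage[OF continuous_on_I_cross compact_imp_closed[OF compact_box_ab]]) simp
  then have "compact (box_ab a b \<inter> (box_ab a b \<inter> I_cross M b \<tau> -` {..ennreal r}))"
    by (rule compact_Int_closed[OF compact_box_ab])
  moreover have "{\<zeta> \<in> topspace (top_of_set (box_ab a b)). I_cross M b \<tau> \<zeta> \<le> ennreal r} =
      box_ab a b \<inter> (box_ab a b \<inter> I_cross M b \<tau> -` {..ennreal r})" by auto
  ultimately show "compactin (top_of_set (box_ab a b))
      {\<zeta> \<in> topspace (top_of_set (box_ab a b)). I_cross M b \<tau> \<zeta> \<le> ennreal r}"
    by (simp add: compactin_subtopology)
qed

end

section \<open>The large deviation principle\<close>

lemma exp_domination:
  fixes d :: nat
  assumes "x < x'" "1 \<le> d" "0 \<le> C"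
  shows "\<forall>\<^sub>F n in sequentially. C * exp (- x' * real n ^ d) \<le> exp (- x * real n ^ d)"
proof -
  have "\<forall>\<^sub>F n in sequentially. (C / (x' - x)) \<le> real n"
    by (intro eventually_at_top_linorderI[of "nat \<lceil>C / (x' - x)\<rceil>"]) linarith
  then show ?thesis using eventually_ge_at_top[of 1]
  proof eventually_elim
    case (elim n)
    have "C \<le> (x' - x) * real n" using elim(1) assms(1) by (simp add: field_simps)
    also have "\<dots> \<le> (x' - x) * real n ^ d"
      using assms elim(2) by (intro mult_left_mono self_le_power) auto
    also have "\<dots> \<le> exp ((x' - x) * real n ^ d)" using exp_ge_add_one_self[of "(x' - x) * real n ^ d"] by linarith
    finally have "C * exp (- x' * real n ^ d) \<le> exp ((x' - x) * real n ^ d) * exp (- x' * real n ^ d)"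
      by (intro mult_right_mono) auto
    also have "\<dots> = exp (- x * real n ^ d)" by (simp add: exp_add[symmetric] algebra_simps)
    finally show ?case .
  qed
qed

text \<open>The polynomial factor is at most exp (d n), so the total cost is linear in n, whereas
  the gain is \<open>\<beta>\<close> n^d. This is the point where dimension at least 2 is
  essential.\<close>

lemma linear_cost_negligible:
  fixes c :: real and d :: nat
  assumes "0 < c" "c \<le> 1" "2 \<le> d" "0 < \<beta>"
  shows "\<forall>\<^sub>F n in sequentially. real ((n + 1) ^ d) * exp (- \<beta> * real n ^ d) \<le> c ^ (d * n)"
proof -
  define L where "L = - ln c"
  have L: "0 \<le> L" "c = exp (- L)" using assms by (auto simp: L_def)
  have "\<forall>\<^sub>F n in sequentially. real d * (L + 1) / \<beta> \<le> real n"
    by (intro eventually_at_top_linorderI[of "nat \<lceil>real d * (L + 1) / \<beta>\<rceil>"]) linarith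
  then show ?thesis using eventually_ge_at_top[of 1]
  proof eventually_elim
    case (elim n)
    have n: "1 \<le> real n" using elim(2) by simp
    have "real ((n + 1) ^ d) = (real n + 1) ^ d" by (simp add: add.commute)
    also have "\<dots> \<le> exp (real n) ^ d"
      using exp_ge_add_one_self[of "real n"] by (intro power_mono) (auto simp: add.commute)
    also have "\<dots> = exp (real d * real n)" by (simp add: exp_of_nat_mult)
    finally have 1: "real ((n + 1) ^ d) \<le> exp (real d * real n)" .
    have "real d * (L + 1) * real n \<le> \<beta> * real n * real n"
      using elim(1) assms(4) by (intro mult_right_mono) (auto simp: field_simps)
    also have "\<dots> = \<beta> * real n ^ 2" by (simp add: power2_eq_square)
    also have "\<dots> \<le> \<beta> * real n ^ d" using n assms(3,4) by (intro mult_left_mono power_increasing) auto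
    finally have 2: "real d * real n - \<beta> * real n ^ d \<le> - (real (d * n) * L)" by (simp add: algebra_simps)
    have "real ((n + 1) ^ d) * exp (- \<beta> * real n ^ d) \<le> exp (real d * real n) * exp (- \<beta> * real n ^ d)"
      by (rule mult_right_mono[OF 1]) simp
    also have "\<dots> = exp (real d * real n - \<beta> * real n ^ d)" by (simp add: exp_add[symmetric])
    also have "\<dots> \<le> exp (- (real (d * n) * L))" using 2 by simp
    also have "\<dots> = c ^ (d * n)"
      unfolding L(2) exp_of_nat_mult[symmetric] by simp
    finally show ?case .
  qed
qed

context passage_percolation
begin

text \<open>Cover the compact closure by finitely many quadrants.\<close>

lemma ldp_upper_bound:
  assumes A: "A \<in> borel_sets_of (top_of_set (box_ab a b))"
  shows "(INF \<zeta>\<in>(top_of_set (box_ab a b)) closure_of A. I_cross M b \<tau> \<zeta>)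
    \<le> liminf (\<lambda>n. decay_rate M (real n ^ CARD('d)) {\<omega> \<in> space M. T_cross b (\<lambda>e. \<tau> e \<omega>) n \<in> A})"
    (is "?I \<le> ?R")
proof (rule ccontr)
  let ?S = "top_of_set (box_ab a b :: (real ^ 'd) set)"
  let ?X = "\<lambda>n \<omega>. T_cross b (\<lambda>e. \<tau> e \<omega>) n"
  assume "\<not> ?I \<le> ?R"
  then have "?R < ?I" by simp
  then obtain x where x: "0 \<le> x" "?R < ennreal x" "ennreal x < ?I" by (rule ennreal_below_real)
  obtain x' where x': "x < x'" "ennreal x' < ?I" by (rule ennreal_real_between[OF x(3,1)])
  define C where "C = ?S closure_of A"
  have Cbox: "C \<subseteq> box_ab a b" unfolding C_def using closure_of_subset_topspace[of ?S A] by simp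
  have Abox: "A \<subseteq> box_ab a b"
    using A sigma_sets_into_sp[of "{U. openin ?S U}" "box_ab a b" A] openin_subset[of ?S]
    by (auto simp: borel_sets_of_def)
  then have AC: "A \<subseteq> C" unfolding C_def by (intro closure_of_subset) simp
  have compC: "compact C"
  proof -
    have "closedin ?S C" unfolding C_def by (rule closedin_closure_of)
    then have "closed C" using closedin_closed_trans compact_imp_closed[OF compact_box_ab] by blast
    then have "compact (box_ab a b \<inter> C)" by (rule compact_Int_closed[OF compact_box_ab])
    then show ?thesis using Cbox by (simp add: Int_absorb1)
  qed
  have "\<exists>\<epsilon>>0. \<forall>\<xi>. (\<forall>j. 0 \<le> \<xi> $ j) \<longrightarrow> (\<forall>j. \<zeta> $ j - \<epsilon> \<le> \<xi> $ j) \<longrightarrow> ennreal x' < I_cross M b \<tau> \<xi>"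
    if \<zeta>: "\<zeta> \<in> C" for \<zeta>
  proof -
    have "?I \<le> I_cross M b \<tau> \<zeta>" using \<zeta> unfolding C_def by (rule INF_lower)
    then have "ennreal x' < I_cross M b \<tau> \<zeta>" using x'(2) by simp
    moreover have "\<And>j. 0 \<le> \<zeta> $ j" using box_ab_nonneg(1) Cbox \<zeta> by blast
    ultimately show ?thesis using I_cross_lsc[of \<zeta> "ennreal x'"] by metis
  qed
  then obtain \<epsilon> where \<epsilon>: "\<And>\<zeta>. \<zeta> \<in> C \<Longrightarrow> 0 < \<epsilon> \<zeta>"
    "\<And>\<zeta> \<xi>. \<zeta> \<in> C \<Longrightarrow> (\<And>j. 0 \<le> \<xi> $ j) \<Longrightarrow> (\<And>j. \<zeta> $ j - \<epsilon> \<zeta> \<le> \<xi> $ j) \<Longrightarrow> ennreal x' < I_cross M b \<tau> \<xi>"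
    by metis
  \<comment> \<open>Corner of the quadrant \<open>U \<zeta>\<close>, clipped at a. Speeds in the
    quadrant exceed this corner almost surely, and lower semicontinuity keeps the rate at the corner
    above x'.\<close>
  define z where "z \<zeta> = (\<chi> j. max a ((\<chi> j. \<zeta> $ j - \<epsilon> \<zeta>) $ j))" for \<zeta> :: "real ^ 'd"
  define U where "U \<zeta> = {\<xi> :: real ^ 'd. \<forall>j. \<zeta> $ j - \<epsilon> \<zeta> < \<xi> $ j}" for \<zeta>
  have "open (U \<zeta>)" for \<zeta>
  proof -
    have eq: "U \<zeta> = (\<Inter>j. {\<xi>. \<zeta> $ j - \<epsilon> \<zeta> < \<xi> $ j})" by (auto simp: U_def)
    show ?thesis unfolding eq
      by (intro open_INT ballI finite open_Collect_less continuous_intros)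
  qed
  moreover have "C \<subseteq> (\<Union>\<zeta>\<in>C. U \<zeta>)" using \<epsilon>(1) by (force simp: U_def)
  ultimately obtain Z where Z: "Z \<subseteq> C" "finite Z" "C \<subseteq> (\<Union>\<zeta>\<in>Z. U \<zeta>)"
    using compactE_image[OF compC, of C U] by metis
  have "\<forall>\<^sub>F n in sequentially. crossing_prob n (z \<zeta>) \<le> exp (- x' * real n ^ CARD('d))" if \<zeta>: "\<zeta> \<in> Z" for \<zeta>
  proof (rule crossing_prob_less)
    have \<zeta>C: "\<zeta> \<in> C" using \<zeta> Z(1) by blast
    have \<zeta>b: "\<zeta> $ j \<le> b" for j using box_ab_nonneg(2) Cbox \<zeta>C by blast
    show z0: "0 \<le> z \<zeta> $ j" for j using a_nonneg by (simp add: z_def)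
    show "z \<zeta> $ j \<le> b" for j using a_less_b \<zeta>b[of j] \<epsilon>(1)[OF \<zeta>C] by (simp add: z_def)
    show "0 \<le> x'" using x x' by simp
    show "ennreal x' < I_cross M b \<tau> (z \<zeta>)" by (rule \<epsilon>(2)[OF \<zeta>C z0]) (simp add: z_def)
  qed
  then have "\<forall>\<^sub>F n in sequentially. \<forall>\<zeta>\<in>Z. crossing_prob n (z \<zeta>) \<le> exp (- x' * real n ^ CARD('d))"
    using Z(2) by (intro eventually_ball_finite) auto
  moreover have "\<forall>\<^sub>F n in sequentially. real (card Z) * exp (- x' * real n ^ CARD('d)) \<le> exp (- x * real n ^ CARD('d))"
    using d_ge_2 by (intro exp_domination x') auto
  ultimately have "\<forall>\<^sub>F n in sequentially. ennreal x \<le> decay_rate M (real n ^ CARD('d)) {\<omega> \<in> space M. ?X n \<omega> \<in> A}"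
    using eventually_ge_at_top[of 1]
  proof eventually_elim
    case (elim n)
    let ?E = "\<lambda>\<zeta>. {\<omega> \<in> space M. (\<lambda>e. \<tau> e \<omega>) \<in> crossing_event b n (z \<zeta>)}"
    have ev: "?E \<zeta> \<in> events" for \<zeta>
      by (rule local_event_measurable[OF local_crossing_event edges_in_subset_lattice])
    have "prob {\<omega> \<in> space M. ?X n \<omega> \<in> A} \<le> prob (\<Union>\<zeta>\<in>Z. ?E \<zeta>)"
    proof (rule prob_mono_in_range)
      show "{\<omega> \<in> space M. ?X n \<omega> \<in> A} \<in> events"
        by (rule measurable_in_box[OF T_cross_measurable[OF elim(3)] A])
      show "(\<Union>\<zeta>\<in>Z. ?E \<zeta>) \<in> events" using Z(2) ev by blast
      fix \<omega> assume \<omega>: "\<omega> \<in> space M" "weights_in_range \<omega>" "\<omega> \<in> {\<omega> \<in> space M. ?X n \<omega> \<in> A}"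
      then obtain \<zeta> where \<zeta>: "\<zeta> \<in> Z" "?X n \<omega> \<in> U \<zeta>" using AC Z(3) by blast
      have "a \<le> ?X n \<omega> $ j" for j using T_cross_in_box[OF elim(3) \<omega>(2)] by (simp add: box_ab_def)
      moreover have "\<zeta> $ j - \<epsilon> \<zeta> < ?X n \<omega> $ j" for j using \<zeta>(2) by (simp add: U_def)
      ultimately have "\<forall>j. z \<zeta> $ j \<le> ?X n \<omega> $ j" by (simp add: z_def less_imp_le)
      then have "(\<lambda>e. \<tau> e \<omega>) \<in> crossing_event b n (z \<zeta>)" by (rule T_cross_ge_iff[OF elim(3) \<omega>(2), THEN iffD1])
      then show "\<omega> \<in> (\<Union>\<zeta>\<in>Z. ?E \<zeta>)" using \<zeta>(1) \<omega>(1) by blast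
    qed
    also have "\<dots> \<le> (\<Sum>\<zeta>\<in>Z. crossing_prob n (z \<zeta>))"
      using ev by (intro finite_measure_subadditive_finite Z) auto
    also have "\<dots> \<le> (\<Sum>\<zeta>\<in>Z. exp (- x' * real n ^ CARD('d)))" using elim(1) by (intro sum_mono) auto
    also have "\<dots> = real (card Z) * exp (- x' * real n ^ CARD('d))" by simp
    also have "\<dots> \<le> exp (- x * real n ^ CARD('d))" by (rule elim(2))
    finally show ?case by (rule le_rate[OF elim(3)])
  qed
  then have "ennreal x \<le> ?R" by (rule Liminf_bounded)
  then show False using x(2) by simp
qed

text \<open>The rate at \<open>\<zeta>\<close> provides profiles, hence crossing speeds of at least
  \<open>\<zeta>\<close> - \<open>\<epsilon>\<close> / 2, clipped at a to give \<open>\<xi>\<close>.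
  Refreshing the axes then pins the speeds within \<open>\<epsilon>\<close> / 2 of
  \<open>\<xi>\<close>, hence within \<open>\<epsilon>\<close> of \<open>\<zeta>\<close> and inside
  the open set.\<close>

lemma ldp_lower_bound:
  assumes A: "A \<in> borel_sets_of (top_of_set (box_ab a b))"
  shows "limsup (\<lambda>n. decay_rate M (real n ^ CARD('d)) {\<omega> \<in> space M. T_cross b (\<lambda>e. \<tau> e \<omega>) n \<in> A})
    \<le> (INF \<zeta>\<in>(top_of_set (box_ab a b)) interior_of A. I_cross M b \<tau> \<zeta>)"
    (is "?R \<le> _")
proof (rule INF_greatest)
  let ?S = "top_of_set (box_ab a b :: (real ^ 'd) set)"
  let ?X = "\<lambda>n \<omega>. T_cross b (\<lambda>e. \<tau> e \<omega>) n"
  interpret nu: prob_space \<nu> by (rule nu_prob)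
  fix \<zeta> assume z: "\<zeta> \<in> ?S interior_of A"
  show "?R \<le> I_cross M b \<tau> \<zeta>"
  proof (rule ccontr)
    assume "\<not> ?R \<le> I_cross M b \<tau> \<zeta>"
    then have "I_cross M b \<tau> \<zeta> < ?R" by simp
    then obtain x where x: "0 \<le> x" "I_cross M b \<tau> \<zeta> < ennreal x" "ennreal x < ?R" by (rule ennreal_below_real)
    obtain x' where x': "x < x'" "ennreal x' < ?R" by (rule ennreal_real_between[OF x(3,1)])
    have zbox: "\<zeta> \<in> box_ab a b" using interior_of_subset_topspace[of ?S A] z by auto
    note \<zeta> = box_ab_nonneg[OF zbox]
    have \<zeta>a: "a \<le> \<zeta> $ j" for j using zbox by (simp add: box_ab_def)
    obtain W where W: "open W" "?S interior_of A = box_ab a b \<inter> W"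
      using openin_interior_of[of ?S A, unfolded openin_open] by blast
    then obtain r where r: "0 < r" "ball \<zeta> r \<subseteq> W" using z open_contains_ball by blast
    define \<epsilon> where "\<epsilon> = r / (2 * real CARD('d))"
    have \<epsilon>: "0 < \<epsilon>" using r(1) by (simp add: \<epsilon>_def)
    have inA: "\<xi> \<in> A" if "\<xi> \<in> box_ab a b" "\<And>j. \<bar>\<xi> $ j - \<zeta> $ j\<bar> \<le> \<epsilon>" for \<xi>
    proof -
      have "norm (\<xi> - \<zeta>) \<le> (\<Sum>j\<in>UNIV. \<bar>(\<xi> - \<zeta>) $ j\<bar>)" by (rule norm_le_l1_cart)
      also have "\<dots> \<le> (\<Sum>j\<in>(UNIV :: 'd set). \<epsilon>)" using that(2) by (intro sum_mono) simp
      also have "\<dots> < r" using r(1) by (simp add: \<epsilon>_def)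
      finally have "\<xi> \<in> W" using r(2) by (auto simp: dist_norm norm_minus_commute)
      then show ?thesis using that(1) W(2) interior_of_subset[of ?S A] by blast
    qed
    define \<xi> where "\<xi> = (\<chi> j. max a ((\<chi> j. \<zeta> $ j - \<epsilon> / 2) $ j))"
    have \<xi>: "a \<le> \<xi> $ j" "\<bar>\<xi> $ j - \<zeta> $ j\<bar> \<le> \<epsilon> / 2" for j
      using \<zeta>a[of j] \<epsilon> by (auto simp: \<xi>_def max_def)
    let ?c = "measure \<nu> {..a + \<epsilon> / 2 / 2}"
    have c: "0 < ?c" "?c \<le> 1" using \<epsilon> by (auto intro!: nu_lower_pos)
    have "\<forall>\<^sub>F n in sequentially. b / \<epsilon> \<le> real n"
      by (intro eventually_at_top_linorderI[of "nat \<lceil>b / \<epsilon>\<rceil>"]) linarith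
    moreover have "\<forall>\<^sub>F n in sequentially. exp (- x * real n ^ CARD('d)) \<le> profile_prob n \<zeta> (\<epsilon> / 2)"
      by (rule profile_prob_ge[OF \<zeta>(1) x(2)]) (use \<epsilon> in simp)
    moreover have "\<forall>\<^sub>F n in sequentially.
        real ((n + 1) ^ CARD('d)) * exp (- (x' - x) * real n ^ CARD('d)) \<le> ?c ^ (CARD('d) * n)"
      by (rule linear_cost_negligible[OF c d_ge_2]) (use x' in simp)
    ultimately have "\<forall>\<^sub>F n in sequentially.
        decay_rate M (real n ^ CARD('d)) {\<omega> \<in> space M. ?X n \<omega> \<in> A} \<le> ennreal x'"
      using eventually_ge_at_top[of 1]
    proof eventually_elim
      case (elim n)
      note n = elim(4)
      have "exp (- x * real n ^ CARD('d)) \<le> crossing_prob n (\<chi> j. \<zeta> $ j - \<epsilon> / 2)"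
        using elim(2) profile_le_crossing[of \<zeta> "\<chi> j. \<zeta> $ j - \<epsilon> / 2" "\<epsilon> / 2" n] \<zeta>(1) by simp
      also have "\<dots> \<le> crossing_prob n \<xi>" unfolding \<xi>_def by (rule crossing_prob_clip)
      finally have p: "exp (- x * real n ^ CARD('d)) \<le> crossing_prob n \<xi>" .
      have "real ((n + 1) ^ CARD('d)) * exp (- x' * real n ^ CARD('d)) =
          exp (- x * real n ^ CARD('d)) * (real ((n + 1) ^ CARD('d)) * exp (- (x' - x) * real n ^ CARD('d)))"
        by (simp add: exp_add[symmetric] algebra_simps)
      also have "\<dots> \<le> crossing_prob n \<xi> * ?c ^ (CARD('d) * n)"
        using p elim(3) by (intro mult_mono) auto
      also have "\<dots> \<le> real ((n + 1) ^ CARD('d)) * cprob (near_event b n \<xi> (\<epsilon> / 2))"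
        by (rule crossing_near_prob[OF n \<xi>(1)]) (use \<epsilon> elim(1) in \<open>auto simp: field_simps\<close>)
      finally have "exp (- x' * real n ^ CARD('d)) \<le> cprob (near_event b n \<xi> (\<epsilon> / 2))"
        by (rule mult_left_le_imp_le) simp
      also have "\<dots> \<le> prob {\<omega> \<in> space M. ?X n \<omega> \<in> A}"
      proof (rule prob_mono_in_range)
        show "{\<omega> \<in> space M. (\<lambda>e. \<tau> e \<omega>) \<in> near_event b n \<xi> (\<epsilon> / 2)} \<in> events"
          by (rule local_event_measurable[OF local_near_event edges_in_subset_lattice])
        show "{\<omega> \<in> space M. ?X n \<omega> \<in> A} \<in> events"
          by (rule measurable_in_box[OF T_cross_measurable[OF n] A])
        fix \<omega> assume \<omega>: "\<omega> \<in> space M" "weights_in_range \<omega>"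
          "\<omega> \<in> {\<omega> \<in> space M. (\<lambda>e. \<tau> e \<omega>) \<in> near_event b n \<xi> (\<epsilon> / 2)}"
        have near: "(\<xi> $ j - \<epsilon> / 2) * real n \<le> crossing_time b (\<lambda>e. \<tau> e \<omega>) n j"
          "crossing_time b (\<lambda>e. \<tau> e \<omega>) n j < (\<xi> $ j + \<epsilon> / 2) * real n" for j
          using \<omega>(3) unfolding mem_Collect_eq
            near_event_iff[where t = "\<lambda>e. \<tau> e \<omega>", OF nonneg_weights[OF \<omega>(2)] b_nonneg] by blast+
        have "?X n \<omega> \<in> A"
        proof (rule inA[OF T_cross_in_box[OF n \<omega>(2)]])
          fix j
          have n0: "0 < real n" using n by simp
          have "\<xi> $ j - \<epsilon> / 2 \<le> ?X n \<omega> $ j"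
            unfolding T_cross_nth[OF n b_nonneg] pos_le_divide_eq[OF n0] by (rule near(1))
          moreover have "?X n \<omega> $ j < \<xi> $ j + \<epsilon> / 2"
            unfolding T_cross_nth[OF n b_nonneg] pos_divide_less_eq[OF n0] by (rule near(2))
          ultimately show "\<bar>?X n \<omega> $ j - \<zeta> $ j\<bar> \<le> \<epsilon>" using \<xi>(2)[of j] by linarith
        qed
        then show "\<omega> \<in> {\<omega> \<in> space M. ?X n \<omega> \<in> A}" using \<omega>(1) by simp
      qed
      finally show ?case by (rule rate_le[OF n])
    qed
    then have "?R \<le> ennreal x'" by (rule Limsup_bounded)
    then show False using x'(2) by simp
  qed
qed

lemma satisfies_LDP_T_cross:
  "satisfies_LDP M (top_of_set (box_ab a b)) (\<lambda>n. real n ^ CARD('d))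
     (\<lambda>n \<omega>. T_cross b (\<lambda>e. \<tau> e \<omega>) n) (I_cross M b \<tau>)"
  unfolding satisfies_LDP_def
proof (intro conjI allI impI ballI)
  fix n :: nat assume n: "1 \<le> n"
  show "AE \<omega> in M. T_cross b (\<lambda>e. \<tau> e \<omega>) n \<in> topspace (top_of_set (box_ab a b))"
    using AE_weights_in_range by eventually_elim (simp add: T_cross_in_box[OF n])
  fix A assume "A \<in> borel_sets_of (top_of_set (box_ab a b :: (real ^ 'd) set))"
  then show "{\<omega> \<in> space M. T_cross b (\<lambda>e. \<tau> e \<omega>) n \<in> A} \<in> events"
    by (rule measurable_in_box[OF T_cross_measurable[OF n]])
qed (rule ldp_upper_bound ldp_lower_bound, assumption)+

text \<open>Profiles at \<open>\<zeta>\<close> only give speeds \<open>\<zeta>\<close> -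
  \<open>\<epsilon>\<close>, so the lower bound on the probability uses profiles at the raised
  speeds \<open>\<zeta>\<close> + \<open>\<epsilon>\<close>. This needs room below b, and upper
  semicontinuity keeps the rate at the raised speeds below y.\<close>

lemma crossing_rate_tendsto:
  assumes \<zeta>: "\<And>i. a \<le> \<zeta> $ i" "\<And>i. \<zeta> $ i < b"
  shows "((\<lambda>n. decay_rate M (real n ^ CARD('d))
      {\<omega> \<in> space M. \<forall>i. rescaled_set_time b (\<lambda>e. \<tau> e \<omega>) n unit_cube (face0 i) (face1 i) \<ge> \<zeta> $ i})
    \<longlongrightarrow> I_cross M b \<tau> \<zeta>) sequentially"
proof (rule order_tendstoI)
  let ?E = "\<lambda>n. {\<omega> \<in> space M. \<forall>i. rescaled_set_time b (\<lambda>e. \<tau> e \<omega>) n unit_cube (face0 i) (face1 i) \<ge> \<zeta> $ i}"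
  have \<zeta>0: "0 \<le> \<zeta> $ i" "\<zeta> $ i \<le> b" for i using \<zeta>[of i] a_nonneg by linarith+
  {
    fix y assume "y < I_cross M b \<tau> \<zeta>"
    then obtain x where x: "0 \<le> x" "y < ennreal x" "ennreal x < I_cross M b \<tau> \<zeta>" by (rule ennreal_below_real)
    show "\<forall>\<^sub>F n in sequentially. y < decay_rate M (real n ^ CARD('d)) (?E n)"
      using crossing_prob_less[OF \<zeta>0 x(1,3)] eventually_ge_at_top[of 1]
    proof eventually_elim
      case (elim n)
      have "ennreal x \<le> decay_rate M (real n ^ CARD('d)) (?E n)"
        by (rule le_rate[OF elim(2)]) (simp only: prob_T_cross_ge[OF elim(2)] elim(1))
      then show ?case using x(2) by (rule less_le_trans[rotated])
    qed
  next
    fix y assume y: "I_cross M b \<tau> \<zeta> < y"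
    obtain \<eta> where \<eta>: "0 < \<eta>" "\<And>\<xi>. (\<And>j. 0 \<le> \<xi> $ j) \<Longrightarrow> (\<And>j. \<xi> $ j \<le> b) \<Longrightarrow>
      (\<And>j. \<xi> $ j \<le> \<zeta> $ j + \<eta>) \<Longrightarrow> I_cross M b \<tau> \<xi> < y"
      using I_cross_usc[OF \<zeta>0 y] by metis
    define \<epsilon> where "\<epsilon> = min \<eta> (MIN i. b - \<zeta> $ i)"
    have min: "(MIN i. b - \<zeta> $ i) \<le> b - \<zeta> $ i" for i by (rule Min_le) auto
    have "0 < (MIN i. b - \<zeta> $ i)" using \<zeta>(2) by (subst Min_gr_iff) auto
    then have \<epsilon>: "0 < \<epsilon>" "\<epsilon> \<le> \<eta>" "\<And>i. \<zeta> $ i + \<epsilon> \<le> b"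
      using \<eta>(1) min by (auto simp: \<epsilon>_def min_def) (smt (verit) min)+
    define \<xi> where "\<xi> = (\<chi> i. \<zeta> $ i + \<epsilon>)"
    have \<xi>: "0 \<le> \<xi> $ i" for i using \<zeta>0(1)[of i] \<epsilon>(1) by (simp add: \<xi>_def)
    have "I_cross M b \<tau> \<xi> < y" by (rule \<eta>(2)[OF \<xi>]) (use \<epsilon> in \<open>auto simp: \<xi>_def\<close>)
    then obtain x where x: "0 \<le> x" "I_cross M b \<tau> \<xi> < ennreal x" "ennreal x < y" by (rule ennreal_below_real)
    show "\<forall>\<^sub>F n in sequentially. decay_rate M (real n ^ CARD('d)) (?E n) < y"
      using profile_prob_ge[OF \<xi> x(2) \<epsilon>(1)] eventually_ge_at_top[of 1]
    proof eventually_elim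
      case (elim n)
      have "profile_prob n \<xi> \<epsilon> \<le> crossing_prob n \<zeta>"
        by (rule profile_le_crossing[OF \<xi>]) (simp add: \<xi>_def)
      then have "exp (- x * real n ^ CARD('d)) \<le> prob (?E n)"
        unfolding prob_T_cross_ge[OF elim(2)] using elim(1) by linarith
      then show ?case using rate_le[OF elim(2)] x(3) le_less_trans by blast
    qed
  }
qed

lemma I_cross_max_finite_iff: "I_cross M b \<tau> (\<chi> i. b) < \<infinity> \<longleftrightarrow> emeasure \<nu> {b} > 0"
proof -
  interpret nu: prob_space \<nu> by (rule nu_prob)
  have "I_cross M b \<tau> (\<chi> i. b) < \<infinity>" if "0 < measure \<nu> {b}"
  proof -
    have "measure \<nu> {b} \<le> measure \<nu> {b..}" using nu_sets by (intro nu.finite_measure_mono) auto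
    then have "0 < measure \<nu> {b..}" using that by linarith
    then obtain A where "I_cross M b \<tau> (\<chi> i. b) \<le> ennreal A"
      using I_cross_bounded[of b] b_nonneg by (metis order_refl vec_lambda_beta)
    then show ?thesis using ennreal_less_top le_less_trans by (metis infinity_ennreal_def)
  qed
  moreover have "I_cross M b \<tau> (\<chi> i. b) = \<infinity>" if "measure \<nu> {b} = 0"
    by (rule I_cross_infinite[OF that]) (use b_nonneg in auto)
  ultimately show ?thesis
    by (cases "measure \<nu> {b} = 0") (auto simp: nu.emeasure_eq_measure zero_less_measure_iff)
qed

lemma I_cross_ennreal_convex_on:
  assumes "\<zeta> \<in> box_ab a b"
  shows "ennreal_convex_on {a..b} (\<lambda>t. I_cross M b \<tau> (\<chi> j. if j = i then t else \<zeta> $ j))"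
  unfolding ennreal_convex_on_def
proof (intro conjI ballI allI impI)
  fix x y u v :: real assume xy: "x \<in> {a..b}" "y \<in> {a..b}" and uv: "0 \<le> u" "0 \<le> v" "u + v = 1"
  let ?z = "\<lambda>t. (\<chi> j. if j = i then t else \<zeta> $ j) :: real ^ 'd"
  show "I_cross M b \<tau> (?z (u * x + v * y)) \<le> ennreal u * I_cross M b \<tau> (?z x) + ennreal v * I_cross M b \<tau> (?z y)"
  \<comment> \<open>At the ends one rate may be infinite with coefficient 0; the product is then 0
    and the claim is an equality.\<close>
  proof (cases "u = 0 \<or> v = 0")
    case True
    then show ?thesis
    proof
      assume u: "u = 0"
      then have v: "v = 1" and e: "u * x + v * y = y" using uv by auto
      show ?thesis unfolding e unfolding u v by simp
    next
      assume v: "v = 0"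
      then have u: "u = 1" and e: "u * x + v * y = x" using uv by auto
      show ?thesis unfolding e unfolding u v by simp
    qed
  next
    case False
    then have u: "0 < u" "u < 1" and v: "v = 1 - u" using uv by auto
    have z: "0 \<le> ?z t $ j" "?z t $ j \<le> b" if "t \<in> {a..b}" for t j
      using that box_ab_nonneg[OF assms, of j] a_nonneg by auto
    have uu: "\<zeta> $ j = u * \<zeta> $ j + (1 - u) * \<zeta> $ j" for j by (simp add: algebra_simps)
    show ?thesis unfolding v
      by (rule I_cross_separately_convex[OF z[OF xy(1)] z[OF xy(2)] _ u, where i = i]) (simp_all add: uu[symmetric])
  qed
qed simp

end

theorem corollary1p7:
  fixes \<nu> :: "real measure"
    and a b :: real
    and M :: "'w measure"
    and \<tau> :: "(int ^ 'd::finite) set \<Rightarrow> 'w \<Rightarrow> real"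
  assumes d_ge_2: "CARD('d) \<ge> 2"
    and nu_prob: "prob_space \<nu>"
    and nu_sets: "sets \<nu> = sets borel"
    and nu_nonneg: "emeasure \<nu> {..<0} = 0"
    and a_def: "ereal a = Inf (ereal ` measure_support \<nu>)"
    and b_def: "ereal b = Sup (ereal ` measure_support \<nu>)"
    and a_nonneg: "0 \<le> a"
    and a_less_b: "a < b"
    and M_prob: "prob_space M"
    and tau_indep: "prob_space.indep_vars M (\<lambda>_. borel) \<tau> lattice_edges"
    and tau_distr: "\<And>e. e \<in> lattice_edges \<Longrightarrow> distr M borel (\<tau> e) = \<nu>"
  shows "good_rate_function (top_of_set (box_ab a b :: (real ^ 'd) set)) (I_cross M b \<tau>)
    \<and> satisfies_LDP M (top_of_set (box_ab a b :: (real ^ 'd) set)) (\<lambda>n. real n ^ CARD('d))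
        (\<lambda>n \<omega>. T_cross b (\<lambda>e. \<tau> e \<omega>) n) (I_cross M b \<tau>)
    \<and> continuous_on (box_ab a b) (I_cross M b \<tau>)
    \<and> (\<forall>\<zeta>\<in>box_ab a b. \<forall>\<zeta>'\<in>box_ab a b.
        (\<forall>i. \<zeta> $ i \<le> \<zeta>' $ i) \<longrightarrow> I_cross M b \<tau> \<zeta> \<le> I_cross M b \<tau> \<zeta>')
    \<and> (\<forall>i. \<forall>\<zeta>\<in>box_ab a b.
        ennreal_convex_on {a..b} (\<lambda>t. I_cross M b \<tau> (\<chi> j. if j = i then t else \<zeta> $ j)))
    \<and> (I_cross M b \<tau> (\<chi> i. b) < \<infinity> \<longleftrightarrow> emeasure \<nu> {b} > 0)
    \<and> (\<forall>\<zeta> :: real ^ 'd. (\<forall>i. a \<le> \<zeta> $ i \<and> \<zeta> $ i < b) \<longrightarrow>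
        ((\<lambda>n. decay_rate M (real n ^ CARD('d))
            {\<omega> \<in> space M. \<forall>i. rescaled_set_time b (\<lambda>e. \<tau> e \<omega>) n unit_cube (face0 i) (face1 i)
                              \<ge> \<zeta> $ i})
          \<longlongrightarrow> I_cross M b \<tau> \<zeta>) sequentially)"
proof -
  interpret prob_space M by (rule M_prob)
  interpret passage_percolation M \<nu> a b \<tau>
    by (intro passage_percolation.intro passage_percolation_axioms.intro) (fact assms)+
  show ?thesis
  proof (intro conjI ballI allI impI)
    fix \<zeta> \<zeta>' :: "real ^ 'd" assume "\<zeta> \<in> box_ab a b" "\<forall>i. \<zeta> $ i \<le> \<zeta>' $ i"
    then show "I_cross M b \<tau> \<zeta> \<le> I_cross M b \<tau> \<zeta>'" by (intro I_cross_mono box_ab_nonneg) auto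
  next
    fix \<zeta> :: "real ^ 'd" assume "\<forall>i. a \<le> \<zeta> $ i \<and> \<zeta> $ i < b"
    then show "((\<lambda>n. decay_rate M (real n ^ CARD('d))
        {\<omega> \<in> space M. \<forall>i. rescaled_set_time b (\<lambda>e. \<tau> e \<omega>) n unit_cube (face0 i) (face1 i) \<ge> \<zeta> $ i})
      \<longlongrightarrow> I_cross M b \<tau> \<zeta>) sequentially"
      by (intro crossing_rate_tendsto) auto
  qed (rule good_rate_function_I_cross satisfies_LDP_T_cross continuous_on_I_cross
      I_cross_ennreal_convex_on I_cross_max_finite_iff; assumption?)+
qed

end
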